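(* Suppose that $X$ is linearly ordered and $1<p<\infty$. If $\varphi\in L^\infty(G)$, then the Fredholm essential spectrum of $T_\varphi$ on $H^p(G)$ satisfies $\sigma_e(T_\varphi)\supseteq\sigma(\varphi)$, where $\sigma(\varphi)$ is the set of essential values (essential range) of $\varphi$. Moreover, if $G$ is not isomorphic to $\mathbb T$, then for $\varphi\in C(G)^{-1}\setminus\Phi(G)$ this inclusion is strict.
   Context: $G$ is a nontrivial connected compact abelian group with normalized Haar measure $m$; $X$ is its (discrete) character group, written multiplicatively, with unit character $\mathbf 1$. $T\subset X$ is a fixed subsemigroup (positive cone) with $\mathbf 1\in T$, $T\cap T^{-1}=\{\mathbf 1\}$, $X=T^{-1}T$; it defines an order on $X$ by $\xi\le\chi$ iff $\chi\xi^{-1}\in T$. $X$ is linearly ordered means $T\cup T^{-1}=X$. $\mathbb T$ is the unit circle group. Fourier transform: $\widehat f(\chi)=\int_G f\overline{\chi}\,dm$. $H^p(G)=\{f\in L^p(G):\widehat f(\chi)=0 \text{ for all }\chi\in X\setminus T\}$ with the $L^p$ norm. $Pol(G)$ and $Pol_T(G)$ are the linear spans of $X$ and of $T$. The Riesz projection $P_T:Pol(G)\to Pol_T(G)$ is $P_T(\sum_{\chi\in M}c_\chi\chi)=\sum_{\chi\in M\cap T}c_\chi\chi$; for linearly ordered $X$ and $1<p<\infty$ it extends to a bounded projection $P_T:L^p(G)\to H^p(G)$ (Bochner–Helson). For $\varphi\in L^\infty(G)$ the Toeplitz operator is $T_\varphi f=P_T(\varphi f)$, $f\in H^p(G)$.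 $X^i$ is the set of characters $\chi\in X$ of the form $\chi=\chi_1\chi_2^{-1}$ with $\chi_j\in T$ and both sets $T\setminus\chi_jT$ finite ($j=1,2$). $C(G)^{-1}$ is the group of invertible elements of $C(G)$, and $\Phi(G)=X^i\cdot\exp(C(G))\subset C(G)^{-1}$. $\sigma_e(A)$ is the set of $\lambda\in\mathbb C$ such that $A-\lambda I$ is not Fredholm. *)

theory Defs
  imports "HOL-Analysis.Analysis"
begin

text \<open>
  The compact group is the carrier of a type in class \<open>topological_ab_group_add\<close>, written
  additively; its characters are complex-valued functions, multiplied pointwise.
  Haar measure lives on the Borel sets. The group need not be metrizable, so outer
  regularity has to be demanded explicitly.
\<close>

definition normalized_haar :: "'a::topological_ab_group_add measure \<Rightarrow> bool" where
  "normalized_haar m \<longleftrightarrow>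
     sets m = sets borel \<and>
     emeasure m UNIV = 1 \<and>
     (\<forall>a. distr m m (\<lambda>x. a + x) = m) \<and>
     (\<forall>A\<in>sets borel. emeasure m A = (INF U\<in>{U. open U \<and> A \<subseteq> U}. emeasure m U))"

definition isomorphic_to_circle :: "'a::topological_ab_group_add itself \<Rightarrow> bool" where
  "isomorphic_to_circle _ \<longleftrightarrow>
     (\<exists>(h :: 'a \<Rightarrow> complex) k.
        homeomorphism UNIV (sphere 0 1) h k \<and> (\<forall>x y. h (x + y) = h x * h y))"


section \<open>Characters and the order\<close>

definition characters :: "('a::topological_ab_group_add \<Rightarrow> complex) set" where
  "characters =
     {\<gamma>. continuous_on UNIV \<gamma> \<and> (\<forall>x. norm (\<gamma> x) = 1) \<and> (\<forall>x y. \<gamma> (x + y) = \<gamma> x * \<gamma> y)}"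

definition char_mult :: "('a \<Rightarrow> complex) \<Rightarrow> ('a \<Rightarrow> complex) \<Rightarrow> 'a \<Rightarrow> complex" where
  "char_mult \<xi> \<gamma> = (\<lambda>x. \<xi> x * \<gamma> x)"

definition char_inv :: "('a \<Rightarrow> complex) \<Rightarrow> 'a \<Rightarrow> complex" where
  "char_inv \<gamma> = (\<lambda>x. inverse (\<gamma> x))"

definition positive_cone :: "('a::topological_ab_group_add \<Rightarrow> complex) set \<Rightarrow> bool" where
  "positive_cone T \<longleftrightarrow>
     T \<subseteq> characters \<and>
     (\<forall>\<xi>\<in>T. \<forall>\<gamma>\<in>T. char_mult \<xi> \<gamma> \<in> T) \<and>
     (\<lambda>_. 1) \<in> T \<and>
     T \<inter> char_inv ` T = {\<lambda>_. 1} \<and>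
     characters = {char_mult (char_inv \<xi>) \<gamma> | \<xi> \<gamma>. \<xi> \<in> T \<and> \<gamma> \<in> T}"

definition linearly_ordered :: "('a::topological_ab_group_add \<Rightarrow> complex) set \<Rightarrow> bool" where
  "linearly_ordered T \<longleftrightarrow> T \<union> char_inv ` T = characters"

definition Xi :: "('a::topological_ab_group_add \<Rightarrow> complex) set \<Rightarrow> ('a \<Rightarrow> complex) set" where
  "Xi T = {\<gamma> \<in> characters. \<exists>\<gamma>1\<in>T. \<exists>\<gamma>2\<in>T. \<gamma> = char_mult \<gamma>1 (char_inv \<gamma>2) \<and>
             finite (T - char_mult \<gamma>1 ` T) \<and> finite (T - char_mult \<gamma>2 ` T)}"

definition C_invertible :: "('a::topological_space \<Rightarrow> complex) set" where
  "C_invertible = {\<phi>. continuous_on UNIV \<phi> \<and>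
                      (\<exists>\<psi>. continuous_on UNIV \<psi> \<and> (\<forall>x. \<phi> x * \<psi> x = 1))}"

definition Phi :: "('a::topological_ab_group_add \<Rightarrow> complex) set \<Rightarrow> ('a \<Rightarrow> complex) set" where
  "Phi T = {\<lambda>x. \<gamma> x * exp (g x) | \<gamma> g. \<gamma> \<in> Xi T \<and> continuous_on UNIV g}"


section \<open>Lebesgue and Hardy spaces\<close>

text \<open>
  Elements of the function spaces are genuine functions; equality in the spaces is equality
  almost everywhere. All operator-theoretic notions below are therefore stated modulo
  null functions, i.e. they are the usual notions for the quotient Banach spaces.
\<close>

definition Lp :: "'a measure \<Rightarrow> real \<Rightarrow> ('a \<Rightarrow> complex) set" where
  "Lp m p = {f \<in> borel_measurable m. integrable m (\<lambda>x. norm (f x) powr p)}"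

definition lp_norm :: "'a measure \<Rightarrow> real \<Rightarrow> ('a \<Rightarrow> complex) \<Rightarrow> real" where
  "lp_norm m p f = (LINT x|m. norm (f x) powr p) powr (1 / p)"

definition Linf :: "'a measure \<Rightarrow> ('a \<Rightarrow> complex) set" where
  "Linf m = {f \<in> borel_measurable m. \<exists>C. AE x in m. norm (f x) \<le> C}"

definition essential_range :: "'a measure \<Rightarrow> ('a \<Rightarrow> complex) \<Rightarrow> complex set" where
  "essential_range m \<phi> = {z. \<forall>e>0. emeasure m {x \<in> space m. dist (\<phi> x) z < e} > 0}"

definition fourier :: "'a measure \<Rightarrow> ('a \<Rightarrow> complex) \<Rightarrow> ('a \<Rightarrow> complex) \<Rightarrow> complex" where
  "fourier m f \<gamma> = (LINT x|m. f x * cnj (\<gamma> x))"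

definition Hp :: "'a::topological_ab_group_add measure \<Rightarrow> ('a \<Rightarrow> complex) set \<Rightarrow> real \<Rightarrow>
    ('a \<Rightarrow> complex) set" where
  "Hp m T p = {f \<in> Lp m p. \<forall>\<gamma>\<in>characters - T. fourier m f \<gamma> = 0}"

definition lin_comb :: "('a \<Rightarrow> complex) set \<Rightarrow> (('a \<Rightarrow> complex) \<Rightarrow> complex) \<Rightarrow> 'a \<Rightarrow> complex" where
  "lin_comb B c = (\<lambda>x. \<Sum>b\<in>B. c b * b x)"


section \<open>Bounded and Fredholm operators\<close>

definition bounded_operator :: "'a measure \<Rightarrow> real \<Rightarrow> ('a \<Rightarrow> complex) set \<Rightarrow> ('a \<Rightarrow> complex) set \<Rightarrow>
    (('a \<Rightarrow> complex) \<Rightarrow> 'a \<Rightarrow> complex) \<Rightarrow> bool" where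
  "bounded_operator m p V W A \<longleftrightarrow>
     (\<forall>f\<in>V. A f \<in> W) \<and>
     (\<forall>f\<in>V. \<forall>g\<in>V. \<forall>a b. AE x in m. A (\<lambda>x. a * f x + b * g x) x = a * A f x + b * A g x) \<and>
     (\<exists>C. \<forall>f\<in>V. lp_norm m p (A f) \<le> C * lp_norm m p f)"

definition op_kernel :: "'a measure \<Rightarrow> ('a \<Rightarrow> complex) set \<Rightarrow>
    (('a \<Rightarrow> complex) \<Rightarrow> 'a \<Rightarrow> complex) \<Rightarrow> ('a \<Rightarrow> complex) set" where
  "op_kernel m V A = {f \<in> V. AE x in m. A f x = 0}"

text \<open>
  Bounded, finite-dimensional kernel, closed range, range of finite codimension.
\<close>

definition fredholm :: "'a measure \<Rightarrow> real \<Rightarrow> ('a \<Rightarrow> complex) set \<Rightarrow>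
    (('a \<Rightarrow> complex) \<Rightarrow> 'a \<Rightarrow> complex) \<Rightarrow> bool" where
  "fredholm m p V A \<longleftrightarrow>
     bounded_operator m p V V A \<and>
     (\<exists>B. finite B \<and> B \<subseteq> op_kernel m V A \<and>
        (\<forall>f\<in>op_kernel m V A. \<exists>c. AE x in m. f x = lin_comb B c x)) \<and>
     (\<forall>F. \<forall>g\<in>V. range F \<subseteq> V \<and> (\<lambda>n. lp_norm m p (\<lambda>x. A (F n) x - g x)) \<longlonglongrightarrow> 0 \<longrightarrow>
        (\<exists>f\<in>V. AE x in m. A f x = g x)) \<and>
     (\<exists>B. finite B \<and> B \<subseteq> V \<and>
        (\<forall>g\<in>V. \<exists>f\<in>V. \<exists>c. AE x in m. g x = A f x + lin_comb B c x))"

definition essential_spectrum :: "'a measure \<Rightarrow> real \<Rightarrow> ('a \<Rightarrow> complex) set \<Rightarrow>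
    (('a \<Rightarrow> complex) \<Rightarrow> 'a \<Rightarrow> complex) \<Rightarrow> complex set" where
  "essential_spectrum m p V A = {z. \<not> fredholm m p V (\<lambda>f x. A f x - z * f x)}"


section \<open>Riesz projection and Toeplitz operators\<close>

definition extends_riesz :: "'a::topological_ab_group_add measure \<Rightarrow> ('a \<Rightarrow> complex) set \<Rightarrow> real \<Rightarrow>
    (('a \<Rightarrow> complex) \<Rightarrow> 'a \<Rightarrow> complex) \<Rightarrow> bool" where
  "extends_riesz m T p P \<longleftrightarrow>
     bounded_operator m p (Lp m p) (Hp m T p) P \<and>
     (\<forall>M c. finite M \<and> M \<subseteq> characters \<longrightarrow>
        (AE x in m. P (lin_comb M c) x = lin_comb (M \<inter> T) c x))"

text \<open>
  By density of the trigonometric polynomials such an extension is unique up to null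
  functions, so the choice below is immaterial; its existence for linear orders and
  \<open>1 < p < \<infinity>\<close> is the Bochner-Helson theorem.
\<close>

definition riesz_projection :: "'a::topological_ab_group_add measure \<Rightarrow> ('a \<Rightarrow> complex) set \<Rightarrow> real \<Rightarrow>
    ('a \<Rightarrow> complex) \<Rightarrow> 'a \<Rightarrow> complex" where
  "riesz_projection m T p = (SOME P. extends_riesz m T p P)"

definition toeplitz :: "'a::topological_ab_group_add measure \<Rightarrow> ('a \<Rightarrow> complex) set \<Rightarrow> real \<Rightarrow>
    ('a \<Rightarrow> complex) \<Rightarrow> ('a \<Rightarrow> complex) \<Rightarrow> 'a \<Rightarrow> complex" where
  "toeplitz m T p \<phi> f = riesz_projection m T p (\<lambda>x. \<phi> x * f x)"

end

theory Submission
  imports Defs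
begin

text \<open>
  Suppose \<open>T\<^sub>\<psi>\<close> is Fredholm. It is bounded below on a subspace cut out by finitely many Fourier
  coefficients. Multiplying a trigonometric polynomial \<open>q\<close> by a large positive character moves it into
  that subspace and preserves the norms of \<open>q\<close> and \<open>\<psi> q\<close>, so \<open>\<psi>\<close> is bounded away from zero; this gives
  the inclusion. For the strictness, write \<open>\<phi> = \<gamma> exp g\<close> with a character \<open>\<gamma>\<close> (Bohr and van Kampen) and
  approximate \<open>g\<close> by a trigonometric polynomial: up to a factor near \<open>1\<close>, \<open>exp g\<close> is the product of an
  analytic and an antianalytic function, both invertible. Hence if \<open>T\<^sub>\<phi>\<close> is Fredholm then the kernel and
  cokernel of \<open>T\<^sub>\<gamma>\<close> are finite-dimensional, which means \<open>\<gamma> \<in> X\<^sup>i\<close>. So \<open>0\<close> lies in the essential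
  spectrum of \<open>T\<^sub>\<phi>\<close> for \<open>\<phi> \<notin> \<Phi>(G)\<close>, but not in the essential range of the invertible function \<open>\<phi>\<close>.

  The Riesz projection has to exist and be determined by Fourier coefficients for this to make sense.
  Existence is M. Riesz' inequality: for an analytic polynomial \<open>F\<close> with positive real part,
  \<open>\<integral> F\<^sup>p = (\<integral> F)\<^sup>p\<close>, and \<open>\<bar>F\<bar>\<^sup>p \<le> A (Re F)\<^sup>p - B Re F\<^sup>p\<close> pointwise if \<open>1 < p \<le> 2\<close>; duality gives \<open>p > 2\<close>.
  Uniqueness is the Peter--Weyl theorem, obtained by power iteration of convolution operators.
\<close>

section \<open>Lebesgue spaces\<close>

text \<open>Elements of the spaces are functions up to null sets, and the projection inside
  \<open>toeplitz\<close> is an arbitrary choice. Operator equations are therefore turned into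
  Fourier coefficients: on \<open>H\<close>, an equation for T_\<phi> - z says that two functions
  have the same coefficients over T. In this form a function may be altered by any element of the
  annihilator \<open>nul\<close> of T, and the factors of \<phi> can be treated one at a time
  without naming inverse operators.

  Finite dimension is used through matrices of coefficients. If \<gamma> lies in T, the characters
  in T - \<gamma>T represent the cokernel of T_\<gamma>; if not, those in T - \<gamma>^(-1)T lie in
  its kernel. The Fredholm property of T_\<phi> factors the identity matrix on this set through a
  finite index set, so the set is finite, and \<gamma> satisfies the definition of \<open>Xi\<close>
  with the trivial character as other factor.

  Since the group need not be metrizable, uniform estimates, Fubini's theorem and approximation rest
  on finite covers of the compact group and on Urysohn functions.\<close>

lemma powr_convex_nonneg:
  fixes a b t p :: real
  assumes p: "1 \<le> p" and "0 \<le> a" "0 \<le> b" "0 \<le> t" "t \<le> 1"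
  shows "(t * a + (1 - t) * b) powr p \<le> t * a powr p + (1 - t) * b powr p"
proof -
  \<comment> \<open>If \<open>a\<close> or \<open>b\<close> vanishes, the claim reduces to this; on
    positive arguments it is convexity of the power function.\<close>
  have *: "(s * c) powr p \<le> s * c powr p" if "0 \<le> s" "s \<le> 1" "0 \<le> c" for s c :: real
  proof -
    have "s powr p \<le> s powr 1" if "s > 0"
      using p \<open>s \<le> 1\<close> that by (intro powr_mono') auto
    then have "s powr p \<le> s"
      using \<open>0 \<le> s\<close> p by (cases "s = 0") auto
    then show ?thesis
      using that by (simp add: powr_mult mult_right_mono)
  qed
  show ?thesis
  proof (cases "a = 0 \<or> b = 0")
    case True
    then show ?thesis using *[of t a] *[of "1 - t" b] assms by auto
  next
    case False
    then show ?thesis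
      using convex_onD[OF powr_convex[OF p], of "1 - t" a b] assms by (simp add: algebra_simps)
  qed
qed

lemma Lp_measurable [measurable_dest]: "f \<in> Lp m p \<Longrightarrow> f \<in> borel_measurable m"
  by (simp add: Lp_def)

lemma Lp_integrable: "f \<in> Lp m p \<Longrightarrow> integrable m (\<lambda>x. norm (f x) powr p)"
  by (simp add: Lp_def)

lemma lp_norm_nonneg [simp]: "0 \<le> lp_norm m p f"
  by (simp add: lp_norm_def)

lemma lp_norm_powr:
  assumes "p > 0"
  shows "lp_norm m p f powr p = (LINT x|m. norm (f x) powr p)"
  using assms by (simp add: lp_norm_def powr_powr)

lemma lp_norm_cong_AE:
  assumes "AE x in m. f x = g x" "f \<in> borel_measurable m" "g \<in> borel_measurable m"
  shows "lp_norm m p f = lp_norm m p g"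
  unfolding lp_norm_def using assms by (intro arg_cong2[where f = "(powr)"] integral_cong_AE) auto

lemma Lp_bounded:
  assumes f: "f \<in> Lp m p" and [measurable]: "g \<in> borel_measurable m"
    and bound: "AE x in m. norm (g x) \<le> C * norm (f x)" and "0 \<le> C" "0 < p"
  shows "g \<in> Lp m p" "lp_norm m p g \<le> C * lp_norm m p f"
proof -
  have [measurable]: "f \<in> borel_measurable m" using f by measurable
  have b: "AE x in m. norm (g x) powr p \<le> C powr p * norm (f x) powr p"
    using bound by eventually_elim
      (use assms in \<open>auto simp: powr_mult[symmetric] intro!: powr_mono2\<close>)
  have i: "integrable m (\<lambda>x. C powr p * norm (f x) powr p)"
    using Lp_integrable[OF f] by auto
  have ig: "integrable m (\<lambda>x. norm (g x) powr p)"
    using i by (rule Bochner_Integration.integrable_bound) (use b in auto)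
  then show "g \<in> Lp m p" by (simp add: Lp_def)
  have "(LINT x|m. norm (g x) powr p) \<le> (LINT x|m. C powr p * norm (f x) powr p)"
    by (rule integral_mono_AE[OF ig i b])
  then have "lp_norm m p g \<le> (C powr p * (LINT x|m. norm (f x) powr p)) powr (1 / p)"
    unfolding lp_norm_def using assms by (intro powr_mono2) auto
  also have "\<dots> = C * lp_norm m p f"
    unfolding lp_norm_def using assms by (simp add: powr_mult powr_powr)
  finally show "lp_norm m p g \<le> C * lp_norm m p f" .
qed

lemma Lp_scale:
  assumes "f \<in> Lp m p"
  shows "(\<lambda>x. c * f x) \<in> Lp m p"
  using assms by (auto simp: Lp_def norm_mult powr_mult)

lemma lp_norm_scale:
  assumes "p > 0"
  shows "lp_norm m p (\<lambda>x. c * f x) = norm c * lp_norm m p f"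
  using assms by (simp add: lp_norm_def norm_mult powr_mult powr_powr)

lemma lp_norm_minus_commute: "lp_norm m p (\<lambda>x. f x - g x) = lp_norm m p (\<lambda>x. g x - f x)"
  by (simp add: lp_norm_def norm_minus_commute)

lemma lp_norm_zero [simp]: "p > 0 \<Longrightarrow> lp_norm m p (\<lambda>x. 0) = 0"
  by (simp add: lp_norm_def)

lemma Lp_zero [simp]: "(\<lambda>x. 0) \<in> Lp m p"
  by (simp add: Lp_def)

lemma lp_norm_norm [simp]: "lp_norm m p (\<lambda>x. complex_of_real (norm (f x))) = lp_norm m p f"
  by (simp add: lp_norm_def)

lemma lp_norm_cnj [simp]: "lp_norm m p (\<lambda>x. cnj (f x)) = lp_norm m p f"
  by (simp add: lp_norm_def)

lemma Lp_add:
  assumes f: "f \<in> Lp m p" and g: "g \<in> Lp m p" and p: "1 \<le> p"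
  shows "(\<lambda>x. f x + g x) \<in> Lp m p"
proof -
  note [measurable] = Lp_measurable[OF f] Lp_measurable[OF g]
  have b: "norm (f x + g x) powr p \<le> 2 powr p * (norm (f x) powr p + norm (g x) powr p)" for x
  proof -
    have "norm (f x + g x) powr p \<le> (2 * ((1/2) * norm (f x) + (1 - 1/2) * norm (g x))) powr p"
      using norm_triangle_ineq[of "f x" "g x"] p by (intro powr_mono2) (auto simp: algebra_simps)
    also have "\<dots> = 2 powr p * ((1/2) * norm (f x) + (1 - 1/2) * norm (g x)) powr p"
      by (rule powr_mult)
    also have "\<dots> \<le> 2 powr p * ((1/2) * norm (f x) powr p + (1 - 1/2) * norm (g x) powr p)"
      using p by (intro mult_left_mono powr_convex_nonneg) auto
    also have "\<dots> \<le> 2 powr p * (norm (f x) powr p + norm (g x) powr p)"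
    proof (rule mult_left_mono)
      have "(1/2) * a + (1 - 1/2) * b \<le> a + b" if "0 \<le> a" "0 \<le> b" for a b :: real
        using that by simp
      then show "(1/2) * norm (f x) powr p + (1 - 1/2) * norm (g x) powr p \<le> norm (f x) powr p + norm (g x) powr p"
        by (meson powr_ge_zero)
    qed auto
    finally show ?thesis .
  qed
  have "integrable m (\<lambda>x. 2 powr p * (norm (f x) powr p + norm (g x) powr p))"
    using Lp_integrable[OF f] Lp_integrable[OF g] by auto
  then have "integrable m (\<lambda>x. norm (f x + g x) powr p)"
    by (rule Bochner_Integration.integrable_bound) (use b in auto)
  then show ?thesis by (simp add: Lp_def)
qed

lemma Lp_diff:
  assumes "f \<in> Lp m p" "g \<in> Lp m p" "1 \<le> p"
  shows "(\<lambda>x. f x - g x) \<in> Lp m p"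
  using Lp_add[OF assms(1) Lp_scale[OF assms(2), of "-1"] assms(3)] by simp

lemma Lp_lincomb:
  assumes "f \<in> Lp m p" "g \<in> Lp m p" "1 \<le> p"
  shows "(\<lambda>x. a * f x + b * g x) \<in> Lp m p"
  by (intro Lp_add Lp_scale assms)

lemma Lp_sum:
  assumes "\<And>i. i \<in> I \<Longrightarrow> f i \<in> Lp m p" "1 \<le> p"
  shows "(\<lambda>x. \<Sum>i\<in>I. f i x) \<in> Lp m p"
  using assms by (induction I rule: infinite_finite_induct) (auto intro: Lp_add)

text \<open>Minkowski's inequality directly from convexity: with upper bounds a and b of the two
  norms, f + g is a + b times a convex combination of f / a and g / b with weight t = a / (a + b).
  The summand e / 2 keeps both bounds positive when a norm vanishes.\<close>

lemma lp_norm_triangle: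
  assumes f: "f \<in> Lp m p" and g: "g \<in> Lp m p" and p: "1 \<le> p"
  shows "lp_norm m p (\<lambda>x. f x + g x) \<le> lp_norm m p f + lp_norm m p g"
proof (rule field_le_epsilon)
  fix e :: real assume e: "0 < e"
  define a where "a = lp_norm m p f + e / 2"
  define b where "b = lp_norm m p g + e / 2"
  have ab: "0 < a" "0 < b" "lp_norm m p f \<le> a" "lp_norm m p g \<le> b"
    using e by (auto simp: a_def b_def intro!: add_nonneg_pos)
  define t where "t = a / (a + b)"
  have t: "0 \<le> t" "t \<le> 1" "1 - t = b / (a + b)"
    using ab by (auto simp: t_def field_simps)
  note [measurable] = Lp_measurable[OF f] Lp_measurable[OF g]
  have pt: "norm (f x + g x) powr p \<le>
      (a + b) powr p * (t * (norm (f x) powr p / a powr p) + (1 - t) * (norm (g x) powr p / b powr p))" for x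
  proof -
    have "norm (f x + g x) powr p \<le> (norm (f x) + norm (g x)) powr p"
      using p by (intro powr_mono2 norm_triangle_ineq) auto
    also have "norm (f x) + norm (g x) = (a + b) * (t * (norm (f x) / a) + (1 - t) * (norm (g x) / b))"
    proof -
      have "(a + b) * t = a" "(a + b) * (1 - t) = b" using ab by (simp_all add: t(3), simp add: t_def)
      moreover have "(a + b) * (t * (norm (f x) / a) + (1 - t) * (norm (g x) / b)) =
          ((a + b) * t) * (norm (f x) / a) + ((a + b) * (1 - t)) * (norm (g x) / b)" by algebra
      ultimately show ?thesis using ab by simp
    qed
    also have "\<dots> powr p = (a + b) powr p * (t * (norm (f x) / a) + (1 - t) * (norm (g x) / b)) powr p"
      using ab t by (simp add: powr_mult)
    also have "\<dots> \<le> (a + b) powr p * (t * (norm (f x) / a) powr p + (1 - t) * (norm (g x) / b) powr p)"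
      using ab t p by (intro mult_left_mono powr_convex_nonneg) auto
    finally show ?thesis using ab by (simp add: powr_divide)
  qed
  have i: "integrable m (\<lambda>x. norm (f x) powr p)" "integrable m (\<lambda>x. norm (g x) powr p)"
    using f g by (auto simp: Lp_def)
  have "(LINT x|m. norm (f x + g x) powr p) \<le> (LINT x|m. (a + b) powr p *
      (t * (norm (f x) powr p / a powr p) + (1 - t) * (norm (g x) powr p / b powr p)))"
    using i Lp_integrable[OF Lp_add[OF f g p]] by (intro integral_mono pt) auto
  also have "\<dots> = (a + b) powr p * (t * (lp_norm m p f powr p / a powr p) +
      (1 - t) * (lp_norm m p g powr p / b powr p))"
    using i p by (simp add: lp_norm_powr)
  also have "\<dots> \<le> (a + b) powr p * (t * 1 + (1 - t) * 1)"
    using ab t p by (intro mult_left_mono add_mono) (auto intro!: powr_mono2)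
  finally have "(LINT x|m. norm (f x + g x) powr p) \<le> (a + b) powr p" by simp
  then have "lp_norm m p (\<lambda>x. f x + g x) \<le> ((a + b) powr p) powr (1 / p)"
    unfolding lp_norm_def using p by (intro powr_mono2) auto
  also have "\<dots> = a + b" using ab p by (simp add: powr_powr)
  finally show "lp_norm m p (\<lambda>x. f x + g x) \<le> lp_norm m p f + lp_norm m p g + e"
    by (simp add: a_def b_def)
qed

lemma lp_norm_triangle_diff:
  assumes "f \<in> Lp m p" "g \<in> Lp m p" "1 \<le> p"
  shows "lp_norm m p (\<lambda>x. f x - g x) \<le> lp_norm m p f + lp_norm m p g"
  using lp_norm_triangle[OF assms(1) Lp_scale[OF assms(2), of "-1"] assms(3)] assms(3)
    lp_norm_scale[of p m "-1" g] by simp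

lemma lp_norm_triangle_sub:
  assumes "f \<in> Lp m p" "g \<in> Lp m p" "1 \<le> p"
  shows "lp_norm m p f \<le> lp_norm m p g + lp_norm m p (\<lambda>x. f x - g x)"
  using lp_norm_triangle[OF assms(2) Lp_diff[OF assms(1,2,3)] assms(3)] by simp

lemma lp_norm_triangle3:
  assumes "f \<in> Lp m p" "g \<in> Lp m p" "h \<in> Lp m p" "1 \<le> p"
  shows "lp_norm m p (\<lambda>x. f x - h x) \<le> lp_norm m p (\<lambda>x. f x - g x) + lp_norm m p (\<lambda>x. g x - h x)"
  using lp_norm_triangle[OF Lp_diff[OF assms(1,2,4)] Lp_diff[OF assms(2,3,4)] assms(4)] by simp

lemma lp_norm_sum_le:
  assumes "\<And>i. i \<in> I \<Longrightarrow> f i \<in> Lp m p" "1 \<le> p"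
  shows "lp_norm m p (\<lambda>x. \<Sum>i\<in>I. f i x) \<le> (\<Sum>i\<in>I. lp_norm m p (f i))"
  using assms
proof (induction I rule: infinite_finite_induct)
  case (insert i I)
  then show ?case
    using lp_norm_triangle[of "f i" m p "\<lambda>x. \<Sum>i\<in>I. f i x"] Lp_sum[of I f m p] by fastforce
qed auto

lemma lp_norm_eq_0_iff:
  assumes f: "f \<in> Lp m p" and p: "0 < p"
  shows "lp_norm m p f = 0 \<longleftrightarrow> (AE x in m. f x = 0)"
proof -
  note [measurable] = Lp_measurable[OF f]
  have "lp_norm m p f = 0 \<longleftrightarrow> (LINT x|m. norm (f x) powr p) = 0"
    using p by (simp add: lp_norm_def)
  also have "\<dots> \<longleftrightarrow> (AE x in m. norm (f x) powr p = 0)"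
    using Lp_integrable[OF f] by (intro integral_nonneg_eq_0_iff_AE) auto
  finally show ?thesis by simp
qed

text \<open>Young's inequality for f / a and g / b, integrated, where a and b exceed the norms by e;
  letting e tend to 0 avoids a separate treatment of vanishing norms. With a = b = 1 the same
  pointwise bound gives integrability.\<close>

lemma Hoelder:
  assumes f: "f \<in> Lp m p" and g: "g \<in> Lp m q" and pq: "1 < p" "1 < q" "1 / p + 1 / q = 1"
  shows "integrable m (\<lambda>x. f x * g x)"
    "(LINT x|m. norm (f x * g x)) \<le> lp_norm m p f * lp_norm m q g"
proof -
  note [measurable] = Lp_measurable[OF f] Lp_measurable[OF g]
  have i: "integrable m (\<lambda>x. norm (f x) powr p)" "integrable m (\<lambda>x. norm (g x) powr q)"
    using f g by (auto simp: Lp_def)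
  have pt: "norm (f x * g x) \<le> a * b * ((norm (f x) powr p / a powr p) / p + (norm (g x) powr q / b powr q) / q)"
    if "0 < a" "0 < b" for a b x
  proof -
    have "(norm (f x) / a) * (norm (g x) / b) \<le> (norm (f x) / a) powr p / p + (norm (g x) / b) powr q / q"
      using pq that by (intro Youngs_inequality) auto
    then have "a * b * ((norm (f x) / a) * (norm (g x) / b)) \<le>
        a * b * ((norm (f x) powr p / a powr p) / p + (norm (g x) powr q / b powr q) / q)"
      using that by (intro mult_left_mono) (auto simp: powr_divide)
    then show ?thesis using that by (simp add: norm_mult)
  qed
  have "integrable m (\<lambda>x. 1 * 1 * ((norm (f x) powr p / 1 powr p) / p + (norm (g x) powr q / 1 powr q) / q))"
    using i by auto
  then show int: "integrable m (\<lambda>x. f x * g x)"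
    by (rule Bochner_Integration.integrable_bound) (use pt[of 1 1] pq in \<open>auto intro!: add_nonneg_nonneg\<close>)
  have le: "(LINT x|m. norm (f x * g x)) \<le> (lp_norm m p f + e) * (lp_norm m q g + e)" if e: "0 < e" for e
  proof -
    define a where "a = lp_norm m p f + e"
    define b where "b = lp_norm m q g + e"
    have ab: "0 < a" "0 < b" "lp_norm m p f \<le> a" "lp_norm m q g \<le> b"
      using e by (auto simp: a_def b_def intro!: add_nonneg_pos)
    have "(LINT x|m. norm (f x * g x)) \<le>
        (LINT x|m. a * b * ((norm (f x) powr p / a powr p) / p + (norm (g x) powr q / b powr q) / q))"
      using i int ab by (intro integral_mono pt) auto
    also have "\<dots> = a * b * ((lp_norm m p f powr p / a powr p) / p + (lp_norm m q g powr q / b powr q) / q)"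
      using i pq by (simp add: lp_norm_powr)
    also have "\<dots> \<le> a * b * (1 / p + 1 / q)"
      using ab pq by (intro mult_left_mono add_mono divide_right_mono) (auto intro!: powr_mono2)
    finally show ?thesis using pq by (simp add: a_def b_def)
  qed
  have "((\<lambda>e. (lp_norm m p f + e) * (lp_norm m q g + e)) \<longlongrightarrow> (lp_norm m p f + 0) * (lp_norm m q g + 0)) (at_right 0)"
    by (intro tendsto_intros)
  then have "(LINT x|m. norm (f x * g x)) \<le> (lp_norm m p f + 0) * (lp_norm m q g + 0)"
    by (rule tendsto_lowerbound) (use le in \<open>auto simp: eventually_at_filter\<close>)
  then show "(LINT x|m. norm (f x * g x)) \<le> lp_norm m p f * lp_norm m q g" by simp
qed

lemma Hoelder_integral:
  assumes "f \<in> Lp m p" "g \<in> Lp m q" "1 < p" "1 < q" "1 / p + 1 / q = 1"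
  shows "norm (LINT x|m. f x * g x) \<le> lp_norm m p f * lp_norm m q g"
  using integral_norm_bound[of m "\<lambda>x. f x * g x"] Hoelder(2)[OF assms] by linarith

lemma nn_integral_Lp:
  assumes "f \<in> Lp m p" "0 < p"
  shows "(\<integral>\<^sup>+x. ennreal (norm (f x) powr p) \<partial>m) = ennreal (lp_norm m p f powr p)"
  using assms by (simp add: lp_norm_powr nn_integral_eq_integral Lp_integrable)

lemma Lp_nn_integralI:
  assumes [measurable]: "f \<in> borel_measurable m" and "0 < p" "0 \<le> C"
    and le: "(\<integral>\<^sup>+x. ennreal (norm (f x) powr p) \<partial>m) \<le> ennreal (C powr p)"
  shows "f \<in> Lp m p" "lp_norm m p f \<le> C"
proof -
  have "integrable m (\<lambda>x. norm (f x) powr p)"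
    using le by (intro integrableI_bounded) (auto simp: order_le_less_trans)
  then show f: "f \<in> Lp m p" by (simp add: Lp_def)
  have "ennreal (lp_norm m p f powr p) \<le> ennreal (C powr p)"
    using le nn_integral_Lp[OF f] assms by simp
  then have "lp_norm m p f powr p \<le> C powr p" by (simp add: ennreal_le_iff)
  then show "lp_norm m p f \<le> C"
    using powr_less_mono2[of p C "lp_norm m p f"] assms by linarith
qed

text \<open>Riesz--Fischer. The partial sums \<open>S\<close> of the absolute increments stay
  bounded in norm, so by monotone convergence they are bounded at almost every point and the
  sequence converges there; Fatou's lemma transfers the bound on differences to the limit.\<close>

lemma Lp_complete_fast:
  fixes F :: "nat \<Rightarrow> 'a \<Rightarrow> complex"
  assumes F: "\<And>n. F n \<in> Lp m p" and p: "1 \<le> p"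
    and fast: "\<And>n. lp_norm m p (\<lambda>x. F (Suc n) x - F n x) \<le> (1/2) ^ n"
  shows "\<exists>f\<in>Lp m p. \<forall>n. lp_norm m p (\<lambda>x. F n x - f x) \<le> 2 * (1/2) ^ n"
proof -
  note [measurable] = Lp_measurable[OF F]
  define d where "d k x = norm (F (Suc k) x - F k x)" for k x
  define S where "S n x = (\<Sum>k<n. d k x)" for n x
  have dL: "(\<lambda>x. complex_of_real (d k x)) \<in> Lp m p" for k
  proof (rule Lp_bounded(1)[where C = 1])
    show "(\<lambda>x. F (Suc k) x - F k x) \<in> Lp m p" by (intro Lp_diff F p)
  qed (use p in \<open>auto simp: d_def[abs_def]\<close>)
  have SL: "(\<lambda>x. complex_of_real (S n x)) \<in> Lp m p" for n
    using Lp_sum[of "{..<n}" "\<lambda>k x. complex_of_real (d k x)", OF dL p] by (simp add: S_def)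
  have Sn: "lp_norm m p (\<lambda>x. complex_of_real (S n x)) \<le> 2" for n
  proof -
    have "lp_norm m p (\<lambda>x. complex_of_real (S n x)) \<le> (\<Sum>k<n. lp_norm m p (\<lambda>x. complex_of_real (d k x)))"
      using lp_norm_sum_le[of "{..<n}" "\<lambda>k x. complex_of_real (d k x)", OF dL p] by (simp add: S_def)
    also have "\<dots> \<le> (\<Sum>k<n. (1/2) ^ k)"
      using fast by (intro sum_mono) (simp add: d_def)
    also have "\<dots> \<le> 2" by (simp add: sum_gp_strict)
    finally show ?thesis .
  qed
  have dnn: "0 \<le> d k x" for k x by (simp add: d_def)
  have Snn: "0 \<le> S n x" for n x by (simp add: S_def dnn sum_nonneg)
  have Sinc: "S n x \<le> S (Suc n) x" for n x by (simp add: S_def dnn)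
  have mS [measurable]: "S n \<in> borel_measurable m" for n
    unfolding S_def d_def by measurable
  have "(\<integral>\<^sup>+x. (SUP n. ennreal (S n x powr p)) \<partial>m) = (SUP n. \<integral>\<^sup>+x. ennreal (S n x powr p) \<partial>m)"
  proof (rule nn_integral_monotone_convergence_SUP)
    show "incseq (\<lambda>n x. ennreal (S n x powr p))"
      using Sinc Snn p by (intro incseq_SucI le_funI ennreal_leI powr_mono2) auto
  qed measurable
  also have "\<dots> \<le> ennreal (2 powr p)"
  proof (rule SUP_least)
    fix n
    have "(\<integral>\<^sup>+x. ennreal (S n x powr p) \<partial>m) = ennreal (lp_norm m p (\<lambda>x. complex_of_real (S n x)) powr p)"
      using nn_integral_Lp[OF SL[of n]] p Snn by simp
    also have "\<dots> \<le> ennreal (2 powr p)"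
      using Sn p by (intro ennreal_leI powr_mono2) auto
    finally show "(\<integral>\<^sup>+x. ennreal (S n x powr p) \<partial>m) \<le> ennreal (2 powr p)" .
  qed
  finally have "(\<integral>\<^sup>+x. (SUP n. ennreal (S n x powr p)) \<partial>m) \<noteq> \<infinity>"
    by (auto simp: top_unique)
  then have "AE x in m. (SUP n. ennreal (S n x powr p)) \<noteq> \<infinity>"
    by (intro nn_integral_PInf_AE) auto
  then have ae: "AE x in m. convergent (\<lambda>n. F n x)"
  proof eventually_elim
    case (elim x)
    then obtain C where C: "C \<ge> 0" "(SUP n. ennreal (S n x powr p)) = ennreal C"
      by (cases "(SUP n. ennreal (S n x powr p))" rule: ennreal_cases) auto
    have "S n x powr p \<le> C" for n
    proof -
      have "ennreal (S n x powr p) \<le> ennreal C" unfolding C(2)[symmetric] by (rule SUP_upper) auto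
      then show ?thesis using C(1) by (simp add: ennreal_le_iff)
    qed
    then have "(S n x powr p) powr (1 / p) \<le> C powr (1 / p)" for n
      using p by (intro powr_mono2) auto
    then have "S n x \<le> C powr (1 / p)" for n
      using p Snn by (simp add: powr_powr)
    then have "summable (\<lambda>k. d k x)"
      by (intro bounded_imp_summable[where B = "C powr (1/p)"] dnn)
         (metis S_def lessThan_Suc_atMost)
    then have "summable (\<lambda>k. F (Suc k) x - F k x)"
      unfolding d_def by (rule summable_norm_cancel)
    then have "(\<lambda>n. (\<Sum>k<n. F (Suc k) x - F k x)) \<longlonglongrightarrow> (\<Sum>k. F (Suc k) x - F k x)"
      by (simp add: summable_LIMSEQ)
    then have "(\<lambda>n. F n x - F 0 x) \<longlonglongrightarrow> (\<Sum>k. F (Suc k) x - F k x)"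
      by (simp add: sum_lessThan_telescope[of "\<lambda>n. F n x"])
    then have "(\<lambda>n. (F n x - F 0 x) + F 0 x) \<longlonglongrightarrow> (\<Sum>k. F (Suc k) x - F k x) + F 0 x"
      by (intro tendsto_add tendsto_const)
    then show ?case by (auto simp: convergent_def)
  qed
  define f where "f x = lim (\<lambda>n. F n x)" for x
  have [measurable]: "f \<in> borel_measurable m" unfolding f_def by measurable
  have bd: "lp_norm m p (\<lambda>x. F (n + k) x - F n x) \<le> 2 * (1/2) ^ n" for n k
  proof -
    have "(\<lambda>x. F (n + k) x - F n x) = (\<lambda>x. \<Sum>j<k. F (Suc (n + j)) x - F (n + j) x)"
    proof
      fix x show "F (n + k) x - F n x = (\<Sum>j<k. F (Suc (n + j)) x - F (n + j) x)"
        using sum_lessThan_telescope[of "\<lambda>j. F (n + j) x" k] by simp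
    qed
    then have "lp_norm m p (\<lambda>x. F (n + k) x - F n x) \<le> (\<Sum>j<k. lp_norm m p (\<lambda>x. F (Suc (n + j)) x - F (n + j) x))"
      using lp_norm_sum_le[of "{..<k}" "\<lambda>j x. F (Suc (n + j)) x - F (n + j) x" m p] Lp_diff[OF F F p] p by simp
    also have "\<dots> \<le> (\<Sum>j<k. (1/2) ^ (n + j))" by (intro sum_mono fast)
    also have "\<dots> = (1/2) ^ n * (\<Sum>j<k. (1/2) ^ j)" by (simp add: power_add sum_distrib_left)
    also have "\<dots> \<le> (1/2) ^ n * 2" by (intro mult_left_mono) (auto simp: sum_gp_strict)
    finally show ?thesis by simp
  qed
  have main: "(\<lambda>x. f x - F n x) \<in> Lp m p \<and> lp_norm m p (\<lambda>x. f x - F n x) \<le> 2 * (1/2) ^ n" for n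
  proof -
    have "(\<integral>\<^sup>+x. ennreal (norm (f x - F n x) powr p) \<partial>m) \<le>
        (\<integral>\<^sup>+x. liminf (\<lambda>k. ennreal (norm (F (n + k) x - F n x) powr p)) \<partial>m)"
    proof (rule nn_integral_mono_AE)
      show "AE x in m. ennreal (norm (f x - F n x) powr p) \<le>
          liminf (\<lambda>k. ennreal (norm (F (n + k) x - F n x) powr p))"
        using ae
      proof eventually_elim
        case (elim x)
        then have "(\<lambda>k. F k x) \<longlonglongrightarrow> f x" by (simp add: f_def convergent_LIMSEQ_iff)
        then have "(\<lambda>k. F (k + n) x) \<longlonglongrightarrow> f x" by (rule LIMSEQ_ignore_initial_segment)
        then have "(\<lambda>k. ennreal (norm (F (n + k) x - F n x) powr p)) \<longlonglongrightarrow> ennreal (norm (f x - F n x) powr p)"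
          using p by (intro tendsto_intros) (auto simp: add.commute)
then show ?case by (subst lim_imp_Liminf) auto
      qed
    qed
    also have "\<dots> \<le> liminf (\<lambda>k. \<integral>\<^sup>+x. ennreal (norm (F (n + k) x - F n x) powr p) \<partial>m)"
      by (rule nn_integral_liminf) measurable
    also have "\<dots> \<le> liminf (\<lambda>k. ennreal ((2 * (1/2) ^ n) powr p))"
    proof (intro Liminf_mono always_eventually allI)
      fix k
      have "(\<integral>\<^sup>+x. ennreal (norm (F (n + k) x - F n x) powr p) \<partial>m) =
          ennreal (lp_norm m p (\<lambda>x. F (n + k) x - F n x) powr p)"
        using p by (intro nn_integral_Lp Lp_diff F) auto
      also have "\<dots> \<le> ennreal ((2 * (1/2) ^ n) powr p)"
        using p bd by (intro ennreal_leI powr_mono2) auto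
      finally show "(\<integral>\<^sup>+x. ennreal (norm (F (n + k) x - F n x) powr p) \<partial>m) \<le> ennreal ((2 * (1/2) ^ n) powr p)" .
    qed
    also have "\<dots> = ennreal ((2 * (1/2) ^ n) powr p)" by (simp add: Liminf_const)
    finally show ?thesis
      using Lp_nn_integralI[of "\<lambda>x. f x - F n x" m p "2 * (1/2) ^ n"] p by simp
  qed
  have "f \<in> Lp m p" using Lp_add[OF conjunct1[OF main[of 0]] F[of 0] p] by simp
  then show ?thesis using main lp_norm_minus_commute[of m p f] by auto
qed

lemma Lp_complete:
  fixes F :: "nat \<Rightarrow> 'a \<Rightarrow> complex"
  assumes F: "\<And>n. F n \<in> Lp m p" and p: "1 \<le> p"
    and cauchy: "\<And>e. 0 < e \<Longrightarrow> \<exists>N. \<forall>k\<ge>N. \<forall>n\<ge>N. lp_norm m p (\<lambda>x. F k x - F n x) < e"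
  shows "\<exists>f\<in>Lp m p. (\<lambda>n. lp_norm m p (\<lambda>x. F n x - f x)) \<longlonglongrightarrow> 0"
proof -
  obtain N where N: "\<And>j k n. k \<ge> N j \<Longrightarrow> n \<ge> N j \<Longrightarrow> lp_norm m p (\<lambda>x. F k x - F n x) < (1/2) ^ j"
    using cauchy[of "(1/2) ^ _"] by (metis half_gt_zero_iff zero_less_one zero_less_power)
  \<comment> \<open>Partial sums rather than \<open>N j\<close> itself, because \<open>r\<close>
    must be monotone: then \<open>r j\<close> and \<open>r (Suc j)\<close> are both at least
    \<open>N j\<close>.\<close>
  define r where "r j = (\<Sum>i\<le>j. N i)" for j
  have r: "N j \<le> r j" "r j \<le> r (Suc j)" for j
    by (auto simp: r_def intro: member_le_sum)
  have fast: "lp_norm m p (\<lambda>x. F (r (Suc j)) x - F (r j) x) \<le> (1/2) ^ j" for j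
    using N[of j "r (Suc j)" "r j"] r[of j] by auto
  obtain f where f: "f \<in> Lp m p" "\<And>n. lp_norm m p (\<lambda>x. F (r n) x - f x) \<le> 2 * (1/2) ^ n"
    using Lp_complete_fast[of "\<lambda>j. F (r j)", OF F p fast] by auto
  have "lp_norm m p (\<lambda>x. F n x - f x) \<le> 3 * (1/2) ^ j" if "n \<ge> N j" for n j
    using lp_norm_triangle3[OF F[of n] F[of "r j"] f(1) p] N[OF that r(1)] f(2)[of j] by linarith
  moreover have "\<exists>j. 3 * (1/2) ^ j < e" if "0 < e" for e :: real
  proof -
    have "\<exists>j. (1/2) ^ j < e / 3" using that by (intro real_arch_pow_inv) auto
    then obtain j where "(1/2) ^ j < e / 3" by blast
    then show ?thesis by (intro exI[of _ j]) simp
  qed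
  ultimately have "(\<lambda>n. lp_norm m p (\<lambda>x. F n x - f x)) \<longlonglongrightarrow> 0"
    unfolding LIMSEQ_iff by (metis abs_of_nonneg diff_zero lp_norm_nonneg order_le_less_trans real_norm_def)
  then show ?thesis using f by blast
qed

lemma (in finite_measure) Lp_boundedI:
  assumes "f \<in> borel_measurable M" "AE x in M. norm (f x) \<le> C" "0 < p"
  shows "f \<in> Lp M p"
proof -
  have "integrable M (\<lambda>x. norm (f x) powr p)"
    using assms by (intro integrable_const_bound[where B = "C powr p"]) (auto intro!: powr_mono2)
  then show ?thesis using assms by (simp add: Lp_def)
qed

lemma (in finite_measure) Lp_simple_approx:
  assumes f: "f \<in> Lp M p" and p: "1 \<le> p" and e: "0 < e"
  shows "\<exists>s. simple_function M s \<and> lp_norm M p (\<lambda>x. f x - s x) < e"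
proof -
  note [measurable] = Lp_measurable[OF f]
  obtain s where s: "\<And>i. simple_function M (s i)"
    "\<And>x. x \<in> space M \<Longrightarrow> (\<lambda>i. s i x) \<longlonglongrightarrow> f x"
    "\<And>i x. x \<in> space M \<Longrightarrow> norm (s i x) \<le> 2 * norm (f x)"
    using borel_measurable_implies_sequence_metric[of f M 0] by simp metis
  have [measurable]: "s i \<in> borel_measurable M" for i using s(1) by (rule borel_measurable_simple_function)
  have "(\<lambda>i. LINT x|M. norm (f x - s i x) powr p) \<longlonglongrightarrow> (LINT x|M. 0)"
  proof (rule integral_dominated_convergence)
    \<comment> \<open>The approximating functions satisfy
      \<open>norm (s i x) \<le> 2 * norm (f x)\<close>, whence the factor 3 in the majorant.\<close>
    show "integrable M (\<lambda>x. 3 powr p * norm (f x) powr p)" using Lp_integrable[OF f] by simp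
    show "AE x in M. (\<lambda>i. norm (f x - s i x) powr p) \<longlonglongrightarrow> 0"
    proof (rule AE_I2)
      fix x assume "x \<in> space M"
      then have "(\<lambda>i. norm (f x - s i x) powr p) \<longlonglongrightarrow> norm (f x - f x) powr p"
        using p s(2) by (intro tendsto_intros) auto
      then show "(\<lambda>i. norm (f x - s i x) powr p) \<longlonglongrightarrow> 0" by simp
    qed
    show "AE x in M. norm (norm (f x - s i x) powr p) \<le> 3 powr p * norm (f x) powr p" for i
    proof (rule AE_I2)
      fix x assume "x \<in> space M"
      then have "norm (f x - s i x) \<le> 3 * norm (f x)"
        using s(3)[of x i] norm_triangle_ineq4[of "f x" "s i x"] by linarith
      then show "norm (norm (f x - s i x) powr p) \<le> 3 powr p * norm (f x) powr p"
        using p by (simp add: powr_mult[symmetric] powr_mono2)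
    qed
  qed measurable
  then have "(\<lambda>i. lp_norm M p (\<lambda>x. f x - s i x)) \<longlonglongrightarrow> 0 powr (1 / p)"
    unfolding lp_norm_def using p by (intro tendsto_powr2) auto
  then have "\<forall>\<^sub>F i in sequentially. lp_norm M p (\<lambda>x. f x - s i x) < e"
    using e by (intro order_tendstoD) auto
  then show ?thesis using s(1) by (auto simp: eventually_sequentially)
qed

section \<open>Haar integration on a compact group\<close>

locale compact_group_haar =
  fixes m :: "'a::{topological_ab_group_add, t2_space} measure"
  assumes compact_UNIV: "compact (UNIV :: 'a set)"
    and haar: "normalized_haar m"
begin

lemma sets_m [measurable_cong, simp]: "sets m = sets borel"
  using haar by (simp add: normalized_haar_def)

lemma space_m [simp]: "space m = UNIV"
  using sets_eq_imp_space_eq[OF sets_m] by simp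

lemma emeasure_UNIV [simp]: "emeasure m UNIV = 1"
  using haar by (simp add: normalized_haar_def)

sublocale finite_measure m
  by (rule finite_measureI) simp

lemma measure_UNIV [simp]: "measure m UNIV = 1"
  by (simp add: measure_def)

lemma measurable_continuous:
  fixes f :: "'a \<Rightarrow> 'b::topological_space"
  assumes "continuous_on UNIV f"
  shows "f \<in> borel_measurable m"
  using borel_measurable_continuous_onI[OF assms] by (simp cong: measurable_cong_sets)

lemma finite_subcover:
  fixes U :: "'b \<Rightarrow> 'a set"
  assumes "\<And>x. open (U x)" "\<And>y. \<exists>x. y \<in> U x"
  obtains D where "finite D" "UNIV \<subseteq> (\<Union>x\<in>D. U x)"
proof -
  have "UNIV \<subseteq> (\<Union>x\<in>UNIV. U x)" using assms(2) by blast
  then show thesis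
    using compactE_image[OF compact_UNIV, of UNIV U] assms(1) that by metis
qed

lemma continuous_norm_bound:
  fixes f :: "'a \<Rightarrow> 'b::real_normed_vector"
  assumes "continuous_on UNIV f"
  obtains B where "0 < B" "\<And>x. norm (f x) \<le> B"
proof -
  have "bounded (f ` UNIV)"
    using compact_imp_bounded compact_continuous_image[OF assms compact_UNIV] by blast
  then show thesis using that by (auto simp: bounded_pos)
qed

lemma integrable_continuous:
  fixes f :: "'a \<Rightarrow> 'b::{banach, second_countable_topology}"
  assumes "continuous_on UNIV f"
  shows "integrable m f"
  using continuous_norm_bound[OF assms] measurable_continuous[OF assms]
  by (metis AE_I2 integrable_const_bound)

lemma Lp_continuous:
  assumes "continuous_on UNIV f" "0 < p"
  shows "f \<in> Lp m p"
  using continuous_norm_bound[OF assms(1)] measurable_continuous[OF assms(1)] assms(2)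
  by (metis AE_I2 Lp_boundedI)

lemma lp_norm_le_const:
  assumes "f \<in> borel_measurable m" "\<And>x. norm (f x) \<le> C" "0 < p"
  shows "lp_norm m p f \<le> C"
proof -
  have C: "0 \<le> C" using assms(2)[of 0] norm_ge_zero order_trans by blast
  have "lp_norm m p f \<le> C * lp_norm m p (\<lambda>x. 1)"
    using assms C by (intro Lp_bounded(2) Lp_boundedI[where C = 1]) auto
  then show ?thesis by (simp add: lp_norm_def)
qed

section \<open>Invariance and support of Haar measure\<close>

lemma integral_translation:
  fixes f :: "'a \<Rightarrow> 'b::{banach, second_countable_topology}"
  assumes [measurable]: "f \<in> borel_measurable m"
  shows "(LINT x|m. f (a + x)) = (LINT x|m. f x)"
proof -
  have [measurable]: "(\<lambda>x. a + x) \<in> measurable m m"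
  proof -
    have "(\<lambda>x. a + x) \<in> measurable borel borel"
      by (intro borel_measurable_continuous_onI continuous_intros)
    then show ?thesis by (simp cong: measurable_cong_sets)
  qed
  have "(LINT x|m. f x) = (LINT x|distr m m (\<lambda>x. a + x). f x)"
    using haar by (simp add: normalized_haar_def)
  also have "\<dots> = (LINT x|m. f (a + x))"
    by (rule integral_distr) measurable
  finally show ?thesis by simp
qed

lemma emeasure_translation:
  assumes [measurable]: "A \<in> sets m"
  shows "emeasure m ((\<lambda>x. a + x) -` A) = emeasure m A"
proof -
  have [measurable]: "(\<lambda>x. a + x) \<in> measurable m m"
  proof -
    have "(\<lambda>x. a + x) \<in> measurable borel borel"
      by (intro borel_measurable_continuous_onI continuous_intros)
    then show ?thesis by (simp cong: measurable_cong_sets)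
  qed
  have "emeasure m A = emeasure (distr m m (\<lambda>x. a + x)) A"
    using haar by (simp add: normalized_haar_def)
  also have "\<dots> = emeasure m ((\<lambda>x. a + x) -` A)"
    using assms by (subst emeasure_distr) auto
  finally show ?thesis by simp
qed

text \<open>If U were null, so would be its translates, and by compactness finitely many of them
  cover the group.\<close>

lemma emeasure_open_pos:
  assumes U: "open U" "z \<in> U"
  shows "0 < emeasure m U"
proof (rule ccontr)
  assume "\<not> 0 < emeasure m U"
  then have U0: "emeasure m U = 0" by simp
  define V where "V a = (\<lambda>x. a + x) -` U" for a
  have V: "open (V a)" for a
    unfolding V_def using U(1) by (intro open_vimage continuous_intros)
  have "\<exists>a. x \<in> V a" for x
    using U(2) by (intro exI[of _ "z - x"]) (simp add: V_def)
  then obtain D where D: "finite D" "UNIV \<subseteq> (\<Union>a\<in>D. V a)"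
    using finite_subcover[of V] V by metis
  have "(\<Union>a\<in>D. V a) \<in> null_sets m"
  proof (intro null_sets_UN' countable_finite D(1))
    fix a assume "a \<in> D"
    show "V a \<in> null_sets m"
      using emeasure_translation[of U a] U U0 V by (auto simp: null_sets_def V_def)
  qed
  then have "UNIV \<in> null_sets m" using D(2) by (metis top.extremum_unique)
  then show False by (auto simp: null_sets_def)
qed

lemma continuous_integral_zero:
  fixes f :: "'a \<Rightarrow> real"
  assumes f: "continuous_on UNIV f" "\<And>x. 0 \<le> f x" and "(LINT x|m. f x) = 0"
  shows "f x = 0"
proof (rule ccontr)
  assume "f x \<noteq> 0"
  define U where "U = f -` {0<..}"
  have "open U" unfolding U_def using f(1) by (intro open_vimage) auto
  moreover have "x \<in> U" using \<open>f x \<noteq> 0\<close> f(2)[of x] by (simp add: U_def)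
  ultimately have "0 < emeasure m U" by (rule emeasure_open_pos)
  moreover have "AE x in m. f x = 0"
    using assms integrable_continuous[OF f(1)] by (subst integral_nonneg_eq_0_iff_AE[symmetric]) auto
  then have "emeasure m U = 0"
  proof -
    have "U \<in> sets m" using \<open>open U\<close> by simp
    moreover have "AE x in m. x \<notin> U" using \<open>AE x in m. f x = 0\<close> by eventually_elim (simp add: U_def)
    ultimately show ?thesis using AE_iff_measurable[of U m "\<lambda>x. x \<notin> U"] by auto
  qed
  ultimately show False by simp
qed

text \<open>Tube lemma: finitely many product neighbourhoods cover the slice over \<open>x0\<close>,
  and the intersection of their first factors is the required neighbourhood. It takes the place of
  uniform continuity, for which a general compact group offers no metric.\<close>

lemma uniform_in_parameter:
  fixes F :: "'b::topological_space \<Rightarrow> 'a \<Rightarrow> 'c::metric_space"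
  assumes F: "continuous_on UNIV (\<lambda>(x, y). F x y)" and e: "0 < e"
  shows "\<exists>U. open U \<and> x0 \<in> U \<and> (\<forall>x\<in>U. \<forall>y. dist (F x y) (F x0 y) < e)"
proof -
  define P where "P y0 U V \<longleftrightarrow> open U \<and> open V \<and> x0 \<in> U \<and> y0 \<in> V \<and>
      (\<forall>x\<in>U. \<forall>y\<in>V. dist (F x y) (F x0 y) < e)" for y0 U V
  have "\<exists>U V. P y0 U V" for y0
  proof -
    have "open ((\<lambda>(x, y). F x y) -` ball (F x0 y0) (e / 2))"
      using F by (intro open_vimage) auto
    moreover have "(x0, y0) \<in> (\<lambda>(x, y). F x y) -` ball (F x0 y0) (e / 2)" using e by simp
    ultimately obtain U V where UV: "open U" "open V" "x0 \<in> U" "y0 \<in> V"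
      "U \<times> V \<subseteq> (\<lambda>(x, y). F x y) -` ball (F x0 y0) (e / 2)"
      by (rule open_prod_elim) auto
    have "dist (F x y) (F x0 y) < e" if "x \<in> U" "y \<in> V" for x y
    proof -
      have "(x, y) \<in> U \<times> V" "(x0, y) \<in> U \<times> V" using that UV by auto
      then have "dist (F x0 y0) (F x y) < e / 2" "dist (F x0 y0) (F x0 y) < e / 2" using UV(5) by auto
      then show ?thesis using dist_triangle3[of "F x y" "F x0 y" "F x0 y0"] by linarith
    qed
    then show ?thesis unfolding P_def using UV by blast
  qed
  then obtain U V where "\<And>y. P y (U y) (V y)" by metis
  then have UV: "\<And>y. open (U y)" "\<And>y. open (V y)" "\<And>y. x0 \<in> U y" "\<And>y. y \<in> V y"
    "\<And>y0 x y. x \<in> U y0 \<Longrightarrow> y \<in> V y0 \<Longrightarrow> dist (F x y) (F x0 y) < e"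
    by (auto simp: P_def)
  obtain D where D: "finite D" "UNIV \<subseteq> (\<Union>y\<in>D. V y)"
    using finite_subcover[of V] UV(2,4) by metis
  show ?thesis
  proof (intro exI[of _ "\<Inter>y\<in>D. U y"] conjI ballI allI)
    show "open (\<Inter>y\<in>D. U y)" using D(1) UV(1) by (intro open_INT) auto
    show "x0 \<in> (\<Inter>y\<in>D. U y)" using UV(3) by auto
    fix x y assume "x \<in> (\<Inter>y\<in>D. U y)"
    moreover obtain y0 where "y0 \<in> D" "y \<in> V y0" using D(2) by blast
    ultimately show "dist (F x y) (F x0 y) < e" using UV(5) by blast
  qed
qed

lemma continuous_section:
  assumes "continuous_on UNIV (\<lambda>(x, y). F x y)"
  shows "continuous_on UNIV (\<lambda>y. F x y)" "continuous_on UNIV (\<lambda>x. F x y)"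
proof -
  have "continuous_on UNIV (\<lambda>y. (\<lambda>(x, y). F x y) (x, y))"
    by (rule continuous_on_compose2[OF assms]) (auto intro!: continuous_intros)
  then show "continuous_on UNIV (\<lambda>y. F x y)" by simp
  have "continuous_on UNIV (\<lambda>x. (\<lambda>(x, y). F x y) (x, y))"
    by (rule continuous_on_compose2[OF assms]) (auto intro!: continuous_intros)
  then show "continuous_on UNIV (\<lambda>x. F x y)" by simp
qed

lemma norm_integral_diff_le:
  fixes f g :: "'a \<Rightarrow> complex"
  assumes "integrable m f" "integrable m g" "\<And>x. norm (f x - g x) \<le> e"
  shows "norm ((LINT x|m. f x) - (LINT x|m. g x)) \<le> e"
proof -
  have "norm ((LINT x|m. f x) - (LINT x|m. g x)) = norm (LINT x|m. f x - g x)"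
    using assms by simp
  also have "\<dots> \<le> (LINT x|m. norm (f x - g x))" by (rule integral_norm_bound)
  also have "\<dots> \<le> (LINT x|m. e)" using assms by (intro integral_mono) auto
  finally show ?thesis by simp
qed

lemma continuous_parameter_integral:
  fixes F :: "'b::topological_space \<Rightarrow> 'a \<Rightarrow> complex"
  assumes F: "continuous_on UNIV (\<lambda>(x, y). F x y)"
  shows "continuous_on UNIV (\<lambda>x. LINT y|m. F x y)"
proof -
  have i: "integrable m (F x)" for x
    using integrable_continuous[OF continuous_section(1)[OF F]] by simp
  have "((\<lambda>x. LINT y|m. F x y) \<longlongrightarrow> (LINT y|m. F x0 y)) (at x0)" for x0
  proof (rule tendstoI)
    fix e :: real assume e: "0 < e"
    obtain U where U: "open U" "x0 \<in> U" "\<forall>x\<in>U. \<forall>y. dist (F x y) (F x0 y) < e / 2"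
      using uniform_in_parameter[OF F half_gt_zero[OF e], of x0] by blast
    have "dist (LINT y|m. F x y) (LINT y|m. F x0 y) < e" if "x \<in> U" for x
    proof -
      have "norm ((LINT y|m. F x y) - (LINT y|m. F x0 y)) \<le> e / 2"
        using U(3) that by (intro norm_integral_diff_le i) (auto simp: dist_norm less_imp_le)
      then show ?thesis using e by (simp add: dist_norm)
    qed
    then show "\<forall>\<^sub>F x in at x0. dist (LINT y|m. F x y) (LINT y|m. F x0 y) < e"
      using U(1,2) by (auto simp: eventually_at_topological)
  qed
  then show ?thesis by (simp add: continuous_on_def)
qed

text \<open>The product \<open>\<sigma>\<close>-algebra need not contain the Borel sets of the product, so Fubini's theorem
  is proved by approximating with functions that are simple in the first variable.\<close>

lemma Fubini_continuous:
  fixes F :: "'a \<Rightarrow> 'a \<Rightarrow> complex"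
  assumes F: "continuous_on UNIV (\<lambda>(x, y). F x y)"
  shows "(LINT x|m. LINT y|m. F x y) = (LINT y|m. LINT x|m. F x y)"
proof -
  have F': "continuous_on UNIV (\<lambda>(y, x). F x y)"
  proof -
    have "continuous_on UNIV (\<lambda>z. (\<lambda>(x, y). F x y) (snd z, fst z))"
      by (rule continuous_on_compose2[OF F]) (auto intro!: continuous_intros)
    then show ?thesis by (simp add: case_prod_unfold)
  qed
  have iy: "integrable m (\<lambda>y. F x y)" for x
    by (rule integrable_continuous[OF continuous_section(1)[OF F]])
  have ix: "integrable m (\<lambda>x. F x y)" for y
    by (rule integrable_continuous[OF continuous_section(2)[OF F]])
  have c1: "continuous_on UNIV (\<lambda>x. LINT y|m. F x y)" by (rule continuous_parameter_integral[OF F])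
  have c2: "continuous_on UNIV (\<lambda>y. LINT x|m. F x y)"
    using continuous_parameter_integral[OF F'] by simp
  have bnd: "norm ((LINT x|m. LINT y|m. F x y) - (LINT y|m. LINT x|m. F x y)) \<le> e" if e: "0 < e" for e
  proof -
    have "\<exists>U. open U \<and> x0 \<in> U \<and> (\<forall>x\<in>U. \<forall>y. dist (F x y) (F x0 y) < e / 2)" for x0
      by (rule uniform_in_parameter[OF F half_gt_zero[OF e]])
    then obtain U where "\<forall>x0. open (U x0) \<and> x0 \<in> U x0 \<and> (\<forall>x\<in>U x0. \<forall>y. dist (F x y) (F x0 y) < e / 2)"
      using choice[of "\<lambda>x0 U. open U \<and> x0 \<in> U \<and> (\<forall>x\<in>U. \<forall>y. dist (F x y) (F x0 y) < e / 2)"] by blast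
    then have U: "\<And>x. open (U x)" "\<And>x. x \<in> U x"
      "\<And>x0 x y. x \<in> U x0 \<Longrightarrow> dist (F x y) (F x0 y) < e / 2" by blast+
    obtain D where D: "finite D" "UNIV \<subseteq> (\<Union>y\<in>D. U y)"
      using finite_subcover[of U] U(1,2) by metis
    obtain X n where X: "D = X ` {i::nat. i < n}"
      using finite_imp_nat_seg_image_inj_on[OF D(1)] by auto
    \<comment> \<open>Making the finite cover disjoint gives a Borel partition, so the section of
      \<open>G\<close> at any x is the section of F at one of finitely many points.\<close>
    define A where "A i = U (X i) - (\<Union>j<i. U (X j))" for i
    have A [measurable]: "A i \<in> sets m" for i
      unfolding A_def using U(1) by (auto intro!: sets.Diff borel_open)
    have Aone: "\<exists>i<n. x \<in> A i \<and> (\<forall>j<n. x \<in> A j \<longrightarrow> j = i)" for x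
    proof -
      define P where "P i \<longleftrightarrow> i < n \<and> x \<in> U (X i)" for i
      have "\<exists>i. P i" using D(2) unfolding X P_def by blast
      then obtain k where k: "P k" "\<And>j. j < k \<Longrightarrow> \<not> P j"
        using exists_least_iff[of P] by blast
      have "x \<in> A k"
      proof -
        have "x \<notin> U (X j)" if "j < k" for j
          using k(2)[OF that] k(1) that by (simp add: P_def)
        then show ?thesis using k(1) by (simp add: A_def P_def)
      qed
      moreover have "j = k" if j: "j < n" "x \<in> A j" for j
      proof -
        have "P j" using j by (simp add: P_def A_def)
        then have "\<not> j < k" using k(2) by blast
        moreover have "\<not> k < j" using j(2) k(1) by (auto simp: A_def P_def)
        ultimately show ?thesis by simp
      qed
      ultimately show ?thesis using k(1) by (auto simp: P_def)
    qed
    define G where "G x y = (\<Sum>i<n. indicator (A i) x * F (X i) y)" for x y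
    have Geq: "\<exists>i. x \<in> U (X i) \<and> (\<forall>y. G x y = F (X i) y)" for x
    proof -
      obtain i where i: "i < n" "x \<in> A i" "\<forall>j<n. x \<in> A j \<longrightarrow> j = i"
        using Aone[of x] by blast
      have "G x y = F (X i) y" for y
      proof -
        have "G x y = (\<Sum>j<n. if j = i then F (X i) y else 0)"
          unfolding G_def
        proof (rule sum.cong[OF refl])
          fix j assume "j \<in> {..<n}"
          then have "indicator (A j) x = (if j = i then 1 else 0 :: complex)"
            using i by (metis indicator_simps lessThan_iff)
          then show "indicator (A j) x * F (X j) y = (if j = i then F (X i) y else 0)" by simp
        qed
        then show ?thesis using i(1) by simp
      qed
      then show ?thesis using i(2) by (auto simp: A_def)
    qed
    have FG: "norm (F x y - G x y) \<le> e / 2" for x y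
      using Geq[of x] U(3) by (metis dist_norm less_imp_le)
    have iind: "integrable m (\<lambda>x. indicator (A i) x :: complex)" for i
      using A by (intro integrable_const_bound[where B = 1]) (auto simp: indicator_def)
    have iGy: "integrable m (\<lambda>y. G x y)" for x
      unfolding G_def using iy by (intro Bochner_Integration.integrable_sum integrable_mult_right)
    have iGx: "integrable m (\<lambda>x. G x y)" for y
      unfolding G_def using iind by (intro Bochner_Integration.integrable_sum integrable_mult_left)
    have Gy: "(LINT y|m. G x y) = (\<Sum>i<n. indicator (A i) x * (LINT y|m. F (X i) y))" for x
      unfolding G_def using iy by (subst Bochner_Integration.integral_sum) auto
    have Gx: "(LINT x|m. G x y) = (\<Sum>i<n. (LINT x|m. indicator (A i) x) * F (X i) y)" for y
      unfolding G_def using iind by (subst Bochner_Integration.integral_sum) auto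
    have swap: "(LINT x|m. LINT y|m. G x y) = (LINT y|m. LINT x|m. G x y)"
      unfolding Gx Gy using iy iind by (subst (1 2) Bochner_Integration.integral_sum) auto
    have "norm ((LINT x|m. LINT y|m. F x y) - (LINT x|m. LINT y|m. G x y)) \<le> e / 2"
    proof (rule norm_integral_diff_le)
      show "integrable m (\<lambda>x. LINT y|m. G x y)" unfolding Gy by (intro Bochner_Integration.integrable_sum integrable_mult_left iind)
      show "norm ((LINT y|m. F x y) - (LINT y|m. G x y)) \<le> e / 2" for x
        by (intro norm_integral_diff_le iy iGy FG)
    qed (rule integrable_continuous[OF c1])
    moreover have "norm ((LINT y|m. LINT x|m. F x y) - (LINT y|m. LINT x|m. G x y)) \<le> e / 2"
    proof (rule norm_integral_diff_le)
      show "integrable m (\<lambda>y. LINT x|m. G x y)" unfolding Gx by (intro Bochner_Integration.integrable_sum integrable_mult_right iy)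
      show "norm ((LINT x|m. F x y) - (LINT x|m. G x y)) \<le> e / 2" for y
        by (intro norm_integral_diff_le ix iGx FG)
    qed (rule integrable_continuous[OF c2])
    ultimately show ?thesis
      unfolding swap using norm_triangle_ineq4[of "(LINT x|m. LINT y|m. F x y) - (LINT y|m. LINT x|m. G x y)"
        "(LINT y|m. LINT x|m. F x y) - (LINT y|m. LINT x|m. G x y)"] by simp
  qed
  have "norm ((LINT x|m. LINT y|m. F x y) - (LINT y|m. LINT x|m. F x y)) \<le> 0"
  proof (rule field_le_epsilon)
    fix e :: real assume "0 < e"
    then show "norm ((LINT x|m. LINT y|m. F x y) - (LINT y|m. LINT x|m. F x y)) \<le> 0 + e"
      using bnd[of e] by linarith
  qed
  then show ?thesis by simp
qed

lemma continuous_on_compose_UNIV: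
  assumes "continuous_on UNIV f" "continuous_on UNIV g"
  shows "continuous_on UNIV (\<lambda>x. f (g x))"
  using continuous_on_compose2[OF assms] by simp

text \<open>Integrate f(x - y) in both orders: by translation invariance the inner integral over x
  is the mean of f, the one over y the mean of f(-y).\<close>

lemma integral_uminus:
  fixes f :: "'a \<Rightarrow> complex"
  assumes f: "continuous_on UNIV f"
  shows "(LINT x|m. f (- x)) = (LINT x|m. f x)"
proof -
  have "(LINT y|m. f (x - y)) = (LINT y|m. f (- y))" for x
    using integral_translation[of "\<lambda>y. f (x - y)" x] f
    by (simp add: measurable_continuous continuous_on_compose_UNIV continuous_intros)
  moreover have "(LINT x|m. f (x - y)) = (LINT x|m. f x)" for y
    using integral_translation[of f "- y"] f by (simp add: measurable_continuous)
  moreover have "continuous_on UNIV (\<lambda>(x, y). f (x - y))"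
    unfolding case_prod_unfold by (intro continuous_on_compose_UNIV[OF f] continuous_intros)
  ultimately show ?thesis using Fubini_continuous[of "\<lambda>x y. f (x - y)"] by simp
qed

lemma integral_reflect:
  fixes f :: "'a \<Rightarrow> complex"
  assumes f: "continuous_on UNIV f"
  shows "(LINT y|m. f (x - y)) = (LINT y|m. f y)"
proof -
  have "(LINT y|m. f (x - y)) = (LINT y|m. f (x + - y))" by simp
  also have "\<dots> = (LINT y|m. f (x + y))"
    by (rule integral_uminus[of "\<lambda>y. f (x + y)"]) (intro continuous_on_compose_UNIV[OF f] continuous_intros)
  also have "\<dots> = (LINT y|m. f y)" by (rule integral_translation[OF measurable_continuous[OF f]])
  finally show ?thesis .
qed

section \<open>Regularity of the measure and density of continuous functions\<close>

lemma Urysohn_compact: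
  fixes K U :: "'a set"
  assumes "closed K" "open U" "K \<subseteq> U"
  obtains g :: "'a \<Rightarrow> real" where "continuous_on UNIV g" "\<And>x. 0 \<le> g x" "\<And>x. g x \<le> 1"
    "\<And>x. x \<in> K \<Longrightarrow> g x = 1" "\<And>x. x \<notin> U \<Longrightarrow> g x = 0"
proof -
  have "Hausdorff_space (euclidean :: 'a topology)"
    unfolding Hausdorff_space_def by (simp add: disjnt_def) (meson hausdorff)
  then have "normal_space (euclidean :: 'a topology)"
    using compact_UNIV by (intro compact_Hausdorff_or_regular_imp_normal_space) (auto simp: compact_space_def)
  then obtain g :: "'a \<Rightarrow> real" where g: "continuous_map euclidean (top_of_set {0..1}) g"
    "g ` (- U) \<subseteq> {0}" "g ` K \<subseteq> {1}"
    using Urysohn_lemma[of euclidean "- U" K 0 1] assms by (auto simp: disjnt_def)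
  show thesis
  proof
    show "continuous_on UNIV g" using g(1) by (simp add: continuous_map_in_subtopology)
    show "0 \<le> g x" "g x \<le> 1" for x using g(1) by (auto simp: continuous_map_in_subtopology image_subset_iff)
  qed (use g in auto)
qed

text \<open>Outer regularity is what \<open>normalized_haar\<close> provides; the closed set K is
  the complement of an open set that approximates the complement of A from outside.\<close>

lemma regular_approx:
  assumes A: "A \<in> sets m" and e: "0 < e"
  obtains K U where "closed K" "open U" "K \<subseteq> A" "A \<subseteq> U" "measure m (U - K) < e"
proof -
  have out: "\<exists>U. open U \<and> A \<subseteq> U \<and> measure m (U - A) < e / 2" if A: "A \<in> sets m" for A
  proof -
    have "emeasure m A = (INF U\<in>{U. open U \<and> A \<subseteq> U}. emeasure m U)"
      using haar A by (simp add: normalized_haar_def)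
    moreover have "emeasure m A < emeasure m A + ennreal (e / 2)"
      using e by (simp add: emeasure_eq_measure ennreal_plus[symmetric] ennreal_less_iff del: ennreal_plus)
    ultimately have "(INF U\<in>{U. open U \<and> A \<subseteq> U}. emeasure m U) < emeasure m A + ennreal (e / 2)" by simp
    then obtain U where U: "open U" "A \<subseteq> U" "emeasure m U < emeasure m A + ennreal (e / 2)"
      unfolding INF_less_iff by auto
    then have "measure m U < measure m A + e / 2"
      using e by (simp add: emeasure_eq_measure ennreal_plus[symmetric] ennreal_less_iff del: ennreal_plus)
    then have "measure m (U - A) < e / 2"
      using U A by (subst finite_measure_Diff) auto
    then show ?thesis using U by blast
  qed
  obtain U where U: "open U" "A \<subseteq> U" "measure m (U - A) < e / 2" using out[OF A] by blast
  have "- A \<in> sets m" using A by simp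
  then obtain V where V: "open V" "- A \<subseteq> V" "measure m (V - - A) < e / 2" using out by blast
  have "measure m (U - - V) \<le> measure m ((U - A) \<union> (V - - A))"
    using A U V by (intro finite_measure_mono) auto
  also have "\<dots> \<le> measure m (U - A) + measure m (V - - A)"
    using A U V by (intro measure_Un_le) auto
  also have "\<dots> < e" using U V by simp
  finally show thesis using that[of "- V" U] U V by auto
qed

lemma Lp_indicator:
  assumes "A \<in> sets m" "0 < p"
  shows "(\<lambda>x. indicator A x :: complex) \<in> Lp m p"
proof (rule Lp_boundedI[where C = 1])
  show "(\<lambda>x. indicator A x :: complex) \<in> borel_measurable m" using assms(1) by measurable
qed (use assms(2) in \<open>auto simp: indicator_def\<close>)

lemma continuous_dense_indicator:
  assumes A: "A \<in> sets m" and p: "1 \<le> p" and e: "0 < e"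
  shows "\<exists>g. continuous_on UNIV g \<and> lp_norm m p (\<lambda>x. indicator A x - g x) < e"
proof -
  \<comment> \<open>The Urysohn function differs from the indicator by at most 1 and only on U - K,
    so a measure below \<open>e powr p\<close> makes the norm of the difference less than e.\<close>
  obtain K U where KU: "closed K" "open U" "K \<subseteq> A" "A \<subseteq> U" "measure m (U - K) < e powr p"
    using regular_approx[OF A, of "e powr p"] e by auto
  obtain g :: "'a \<Rightarrow> real" where g: "continuous_on UNIV g" "\<And>x. 0 \<le> g x" "\<And>x. g x \<le> 1"
    "\<And>x. x \<in> K \<Longrightarrow> g x = 1" "\<And>x. x \<notin> U \<Longrightarrow> g x = 0"
    using Urysohn_compact[of K U] KU by blast
  note [measurable] = A measurable_continuous[OF g(1)]
  have UK: "U - K \<in> sets m" using KU by auto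
  have L: "(\<lambda>x. indicator (U - K) x :: complex) \<in> Lp m p"
    using UK p by (intro Lp_indicator) auto
  have "lp_norm m p (\<lambda>x. indicator A x - complex_of_real (g x)) \<le> 1 * lp_norm m p (indicator (U - K))"
  proof (rule Lp_bounded(2)[OF L])
    show "AE x in m. norm (indicator A x - complex_of_real (g x)) \<le> 1 * norm (indicator (U - K) x :: complex)"
    proof (rule AE_I2)
      fix x
      have "norm (1 - complex_of_real (g x)) = 1 - g x"
        using g(3)[of x] by (metis abs_of_nonneg diff_ge_0_iff_ge norm_of_real of_real_1 of_real_diff)
      then show "norm (indicator A x - complex_of_real (g x)) \<le> 1 * norm (indicator (U - K) x :: complex)"
        using KU(3,4) g(2-5)[of x] by (auto simp: indicator_def)
    qed
  qed (use p in auto)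
  also have "\<dots> = measure m (U - K) powr (1 / p)"
  proof -
    have "(LINT x|m. norm (indicator (U - K) x :: complex) powr p) = (LINT x|m. indicator (U - K) x)"
      by (intro Bochner_Integration.integral_cong) (auto simp: indicator_def)
    then show ?thesis using UK by (simp add: lp_norm_def)
  qed
  also have "\<dots> < (e powr p) powr (1 / p)" using KU p by (intro powr_less_mono2) auto
  also have "\<dots> = e" using p e by (simp add: powr_powr)
  finally show ?thesis using g(1)
    by (intro exI[of _ "\<lambda>x. complex_of_real (g x)"]) (auto intro!: continuous_intros)
qed

lemma continuous_dense_Lp:
  assumes f: "f \<in> Lp m p" and p: "1 \<le> p" and e: "0 < e"
  shows "\<exists>g. continuous_on UNIV g \<and> lp_norm m p (\<lambda>x. f x - g x) < e"
proof -
  obtain s where s: "simple_function m s" "lp_norm m p (\<lambda>x. f x - s x) < e / 2"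
    using Lp_simple_approx[OF f p, of "e / 2"] e by auto
  have fin: "finite (range s)" using s(1) by (simp add: simple_function_def)
  have meas: "s -` {y} \<in> sets m" for y
    using simple_functionD(2)[OF s(1), of "{y}"] by simp
  \<comment> \<open>The summand 1 keeps N positive when s vanishes, and makes the total error (N -
    1) e / (2 N) strictly smaller than e / 2.\<close>
  define N where "N = (\<Sum>y\<in>range s. norm y) + 1"
  have N: "0 < N" unfolding N_def by (intro add_nonneg_pos sum_nonneg) auto
  have "\<exists>g. continuous_on UNIV g \<and> lp_norm m p (\<lambda>x. indicator (s -` {y}) x - g x) < e / (2 * N)" for y
    using e N p by (intro continuous_dense_indicator meas) auto
  then obtain g where "\<forall>y. continuous_on UNIV (g y) \<and>
      lp_norm m p (\<lambda>x. indicator (s -` {y}) x - g y x) < e / (2 * N)"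
    using choice[of "\<lambda>y g. continuous_on UNIV g \<and> lp_norm m p (\<lambda>x. indicator (s -` {y}) x - g x) < e / (2 * N)"]
    by blast
  then have g: "\<And>y. continuous_on UNIV (g y)"
    "\<And>y. lp_norm m p (\<lambda>x. indicator (s -` {y}) x - g y x) < e / (2 * N)" by blast+
  define G where "G x = (\<Sum>y\<in>range s. y * g y x)" for x
  have cG: "continuous_on UNIV G" unfolding G_def by (intro continuous_intros g)
  have seq: "s x = (\<Sum>y\<in>range s. y * indicator (s -` {y}) x)" for x
  proof -
    have "(\<Sum>y\<in>range s. y * indicator (s -` {y}) x) = (\<Sum>y\<in>range s. if y = s x then s x else 0)"
      by (intro sum.cong) (auto simp: indicator_def)
    then show ?thesis using fin by simp
  qed
  have Li: "(\<lambda>x. indicator (s -` {y}) x :: complex) \<in> Lp m p" for y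
    using meas p by (intro Lp_indicator) auto
  have Ld: "(\<lambda>x. indicator (s -` {y}) x - g y x) \<in> Lp m p" for y
    using p by (intro Lp_diff Li Lp_continuous g) auto
  have "lp_norm m p (\<lambda>x. s x - G x) = lp_norm m p (\<lambda>x. \<Sum>y\<in>range s. y * (indicator (s -` {y}) x - g y x))"
  proof (rule arg_cong[where f = "lp_norm m p"], rule ext)
    fix x
    show "s x - G x = (\<Sum>y\<in>range s. y * (indicator (s -` {y}) x - g y x))"
      unfolding right_diff_distrib sum_subtractf seq[of x, symmetric] G_def ..
  qed
  also have "\<dots> \<le> (\<Sum>y\<in>range s. lp_norm m p (\<lambda>x. y * (indicator (s -` {y}) x - g y x)))"
    by (intro lp_norm_sum_le Lp_scale Ld p)
  also have "\<dots> = (\<Sum>y\<in>range s. norm y * lp_norm m p (\<lambda>x. indicator (s -` {y}) x - g y x))"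
    using p by (simp add: lp_norm_scale)
  also have "\<dots> \<le> (\<Sum>y\<in>range s. norm y * (e / (2 * N)))"
    using g(2) by (intro sum_mono mult_left_mono) (auto simp: less_imp_le)
  also have "\<dots> = (N - 1) * (e / (2 * N))" by (simp only: N_def sum_distrib_right add_diff_cancel_right')
  also have "\<dots> < e / 2" using e N by (simp add: field_simps)
  finally have "lp_norm m p (\<lambda>x. s x - G x) < e / 2" .
  moreover have "s \<in> Lp m p"
    using Lp_sum[of "range s" "\<lambda>y x. y * indicator (s -` {y}) x", OF Lp_scale[OF Li] p]
    unfolding seq[symmetric] .
  ultimately have "lp_norm m p (\<lambda>x. f x - G x) < e"
    using lp_norm_triangle3[OF f _ Lp_continuous[OF cG, of p] p, of s] s(2) p by auto
  then show ?thesis using cG by blast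
qed

lemma exponent_conjugate:
  fixes p :: real
  assumes "1 < p"
  obtains q where "1 < q" "1 / p + 1 / q = 1"
proof
  show "1 < p / (p - 1)" "1 / p + 1 / (p / (p - 1)) = 1" using assms by (auto simp: field_simps)
qed

lemma Lp_integrable_fn:
  assumes f: "f \<in> Lp m p" and p: "1 < p"
  shows "integrable m f" "norm (LINT x|m. f x) \<le> lp_norm m p f"
proof -
  obtain q where q: "1 < q" "1 / p + 1 / q = 1" using exponent_conjugate[OF p] .
  have 1: "(\<lambda>x. 1) \<in> Lp m q" using q by (intro Lp_continuous) auto
  show "integrable m f" using Hoelder(1)[OF f 1 p q] by simp
  show "norm (LINT x|m. f x) \<le> lp_norm m p f"
    using Hoelder_integral[OF f 1 p q] by (simp add: lp_norm_def[of m q])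
qed

end

section \<open>Characters and trigonometric polynomials\<close>

lemma charactersD:
  assumes "\<gamma> \<in> characters"
  shows "continuous_on UNIV \<gamma>" "norm (\<gamma> x) = 1" "\<gamma> (x + y) = \<gamma> x * \<gamma> y"
    "\<gamma> 0 = 1" "\<gamma> (- x) = cnj (\<gamma> x)" "\<gamma> (x - y) = \<gamma> x * cnj (\<gamma> y)" "\<gamma> x * cnj (\<gamma> x) = 1"
    "inverse (\<gamma> x) = cnj (\<gamma> x)" "\<gamma> x \<noteq> 0"
proof -
  show c: "continuous_on UNIV \<gamma>" "norm (\<gamma> x) = 1" "\<gamma> (x + y) = \<gamma> x * \<gamma> y" for x y
    using assms by (auto simp: characters_def)
  show nz: "\<gamma> x \<noteq> 0" for x using c(2)[of x] by auto
  have "\<gamma> 0 * \<gamma> 0 = \<gamma> 0 * 1" using c(3)[of 0 0] by simp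
  then show one: "\<gamma> 0 = 1" using nz[of 0] by (metis mult_cancel_left)
  show cc: "\<gamma> x * cnj (\<gamma> x) = 1" for x
    using complex_norm_square[of "\<gamma> x"] c(2)[of x] by simp
  show "inverse (\<gamma> x) = cnj (\<gamma> x)"
    using cc[of x] nz[of x] by (simp add: field_simps)
  have "\<gamma> x * \<gamma> (- x) = \<gamma> x * cnj (\<gamma> x)" for x
    using c(3)[of x "- x"] one cc[of x] by simp
  then show inv: "\<gamma> (- x) = cnj (\<gamma> x)" for x
    using nz[of x] by (metis mult_cancel_left)
  show "\<gamma> (x - y) = \<gamma> x * cnj (\<gamma> y)"
    using c(3)[of x "- y"] inv[of y] by simp
qed

lemma char_inv_eq: "\<gamma> \<in> characters \<Longrightarrow> char_inv \<gamma> = (\<lambda>x. cnj (\<gamma> x))"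
  by (simp add: char_inv_def charactersD(8))

lemma characters_one [simp]: "(\<lambda>_. 1) \<in> characters"
  by (simp add: characters_def)

lemma characters_mult: "\<gamma> \<in> characters \<Longrightarrow> \<xi> \<in> characters \<Longrightarrow> char_mult \<gamma> \<xi> \<in> characters"
  by (auto simp: characters_def char_mult_def norm_mult intro!: continuous_intros)

lemma characters_inv:
  assumes "\<gamma> \<in> characters"
  shows "char_inv \<gamma> \<in> characters"
  unfolding char_inv_eq[OF assms] using assms
  by (auto simp: characters_def intro!: continuous_intros)

lemma char_mult_commute: "char_mult \<gamma> \<xi> = char_mult \<xi> \<gamma>"
  by (auto simp: char_mult_def)

lemma char_mult_assoc: "char_mult (char_mult \<gamma> \<xi>) \<zeta> = char_mult \<gamma> (char_mult \<xi> \<zeta>)"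
  by (auto simp: char_mult_def)

lemma char_mult_one [simp]: "char_mult (\<lambda>_. 1) \<gamma> = \<gamma>" "char_mult \<gamma> (\<lambda>_. 1) = \<gamma>"
  by (auto simp: char_mult_def)

lemma char_mult_inv [simp]:
  assumes "\<gamma> \<in> characters"
  shows "char_mult \<gamma> (char_inv \<gamma>) = (\<lambda>_. 1)" "char_mult (char_inv \<gamma>) \<gamma> = (\<lambda>_. 1)"
  using charactersD(9)[OF assms] by (auto simp: char_mult_def char_inv_def)

lemma char_mult_inv_cancel [simp]:
  assumes "\<gamma> \<in> characters"
  shows "char_mult \<gamma> (char_mult (char_inv \<gamma>) \<xi>) = \<xi>" "char_mult (char_inv \<gamma>) (char_mult \<gamma> \<xi>) = \<xi>"
  using charactersD(9)[OF assms] by (auto simp: char_mult_def char_inv_def)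

lemma char_inv_inv [simp]: "char_inv (char_inv \<gamma>) = \<gamma>"
  by (auto simp: char_inv_def)

lemma char_inv_one [simp]: "char_inv (\<lambda>_. 1) = (\<lambda>_. 1)"
  by (auto simp: char_inv_def)

lemma inj_char_mult: "\<gamma> \<in> characters \<Longrightarrow> inj (char_mult \<gamma>)"
  by (rule inj_on_inverseI[of _ "char_mult (char_inv \<gamma>)"]) simp

text \<open>Trigonometric polynomials with frequencies in S: the space Pol(G) for
  \<open>characters\<close>, the analytic polynomials for \<open>T\<close>.\<close>

definition tpoly :: "('a \<Rightarrow> complex) set \<Rightarrow> ('a \<Rightarrow> complex) set" where
  "tpoly S = {lin_comb M c | M c. finite M \<and> M \<subseteq> S}"

lemma tpolyI: "finite M \<Longrightarrow> M \<subseteq> S \<Longrightarrow> lin_comb M c \<in> tpoly S"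
  by (auto simp: tpoly_def)

lemma tpoly_mono: "S \<subseteq> S' \<Longrightarrow> tpoly S \<subseteq> tpoly S'"
  by (auto simp: tpoly_def)

lemma tpoly_zero [simp]: "(\<lambda>x. 0) \<in> tpoly S"
  using tpolyI[of "{}" S undefined] by (simp add: lin_comb_def)

lemma tpoly_scale: "f \<in> tpoly S \<Longrightarrow> (\<lambda>x. a * f x) \<in> tpoly S"
proof -
  assume "f \<in> tpoly S"
  then obtain M c where M: "finite M" "M \<subseteq> S" "f = lin_comb M c" by (auto simp: tpoly_def)
  have "(\<lambda>x. a * f x) = lin_comb M (\<lambda>\<gamma>. a * c \<gamma>)"
    by (auto simp: M(3) lin_comb_def sum_distrib_left mult.assoc)
  then show ?thesis using tpolyI[OF M(1,2)] by simp
qed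

lemma tpoly_base: "\<gamma> \<in> S \<Longrightarrow> \<gamma> \<in> tpoly S"
  using tpolyI[of "{\<gamma>}" S "\<lambda>_. 1"] by (simp add: lin_comb_def)

lemma lin_comb_extend:
  assumes "finite N" "M \<subseteq> N"
  shows "lin_comb M c = lin_comb N (\<lambda>\<gamma>. if \<gamma> \<in> M then c \<gamma> else 0)"
proof
  fix x
  show "lin_comb M c x = lin_comb N (\<lambda>\<gamma>. if \<gamma> \<in> M then c \<gamma> else 0) x"
    unfolding lin_comb_def using assms by (intro sum.mono_neutral_cong_left) auto
qed

lemma tpoly_add:
  assumes "f \<in> tpoly S" "g \<in> tpoly S"
  shows "(\<lambda>x. f x + g x) \<in> tpoly S"
proof -
  obtain M c where M: "finite M" "M \<subseteq> S" "f = lin_comb M c" using assms(1) by (auto simp: tpoly_def)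
  obtain N d where N: "finite N" "N \<subseteq> S" "g = lin_comb N d" using assms(2) by (auto simp: tpoly_def)
  have "f = lin_comb (M \<union> N) (\<lambda>\<gamma>. if \<gamma> \<in> M then c \<gamma> else 0)"
    "g = lin_comb (M \<union> N) (\<lambda>\<gamma>. if \<gamma> \<in> N then d \<gamma> else 0)"
    using M N by (auto intro!: lin_comb_extend)
  then have "(\<lambda>x. f x + g x) =
      lin_comb (M \<union> N) (\<lambda>\<gamma>. (if \<gamma> \<in> M then c \<gamma> else 0) + (if \<gamma> \<in> N then d \<gamma> else 0))"
    by (simp add: lin_comb_def sum.distrib distrib_right)
  then show ?thesis using tpolyI[of "M \<union> N" S] M N by simp
qed

lemma tpoly_induct [consumes 1, case_names zero add]:
  assumes "f \<in> tpoly S" and "P (\<lambda>x. 0)"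
    and step: "\<And>c \<gamma> g. \<gamma> \<in> S \<Longrightarrow> g \<in> tpoly S \<Longrightarrow> P g \<Longrightarrow> P (\<lambda>x. c * \<gamma> x + g x)"
  shows "P f"
proof -
  obtain M c where M: "finite M" "M \<subseteq> S" "f = lin_comb M c" using assms(1) by (auto simp: tpoly_def)
  have "P (lin_comb M c)"
    using M(1,2)
  proof (induction M)
    case empty
    then show ?case using assms(2) by (simp add: lin_comb_def)
  next
    case (insert \<gamma> M)
    then have "P (\<lambda>x. c \<gamma> * \<gamma> x + lin_comb M c x)" by (intro step tpolyI) auto
    then show ?case using insert by (simp add: lin_comb_def)
  qed
  then show ?thesis using M(3) by simp
qed

lemma tpoly_mult:
  assumes "f \<in> tpoly S" "g \<in> tpoly S" and S: "\<And>\<gamma> \<xi>. \<gamma> \<in> S \<Longrightarrow> \<xi> \<in> S \<Longrightarrow> char_mult \<gamma> \<xi> \<in> S"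
  shows "(\<lambda>x. f x * g x) \<in> tpoly S"
proof -
  have 1: "(\<lambda>x. \<gamma> x * h x) \<in> tpoly S" if "\<gamma> \<in> S" "h \<in> tpoly S" for \<gamma> h
    using that(2)
  proof (induction rule: tpoly_induct)
    case (add c \<xi> g)
    have "(\<lambda>x. c * char_mult \<gamma> \<xi> x + \<gamma> x * g x) \<in> tpoly S"
      by (intro tpoly_add tpoly_scale tpoly_base S that add)
    then show ?case by (simp add: char_mult_def algebra_simps)
  qed simp
  show ?thesis using assms(1)
  proof (induction rule: tpoly_induct)
    case (add c \<xi> h)
    have "(\<lambda>x. c * (\<xi> x * g x) + h x * g x) \<in> tpoly S"
      by (intro tpoly_add tpoly_scale 1 add assms(2))
    then show ?case by (simp add: algebra_simps)
  qed simp
qed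

lemma tpoly_continuous:
  assumes "f \<in> tpoly S" "S \<subseteq> characters"
  shows "continuous_on UNIV f"
  using assms(1)
proof (induction rule: tpoly_induct)
  case (add c \<gamma> g)
  then show ?case using charactersD(1)[of \<gamma>] assms(2) by (intro continuous_intros) auto
qed (rule continuous_on_const)

lemma tpoly_cnj:
  assumes "f \<in> tpoly characters"
  shows "(\<lambda>x. cnj (f x)) \<in> tpoly characters"
  using assms
proof (induction rule: tpoly_induct)
  case (add c \<gamma> g)
  have "(\<lambda>x. cnj c * char_inv \<gamma> x + cnj (g x)) \<in> tpoly characters"
    by (intro tpoly_add tpoly_scale tpoly_base characters_inv add)
  then show ?case using add by (simp add: char_inv_eq)
qed simp

section \<open>Convolution and the Peter--Weyl theorem\<close>

text \<open>The involution of the convolution algebra; \<open>star f = f\<close> means that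
  convolution by f is self-adjoint on the square-integrable functions.\<close>

definition star :: "('a::group_add \<Rightarrow> complex) \<Rightarrow> 'a \<Rightarrow> complex" where
  "star f x = cnj (f (- x))"

context compact_group_haar
begin

abbreviation cts :: "('a \<Rightarrow> complex) \<Rightarrow> bool" where
  "cts f \<equiv> continuous_on UNIV f"

abbreviation l2 :: "('a \<Rightarrow> complex) \<Rightarrow> real" where
  "l2 f \<equiv> lp_norm m 2 f"

section \<open>The convolution algebra of continuous functions\<close>

definition conv :: "('a \<Rightarrow> complex) \<Rightarrow> ('a \<Rightarrow> complex) \<Rightarrow> 'a \<Rightarrow> complex" where
  "conv f g x = (LINT y|m. f (x - y) * g y)"

lemma conv_kernel:
  assumes "cts f" "cts g"
  shows "continuous_on UNIV (\<lambda>(x, y). f (x - y) * g y)"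
  unfolding case_prod_unfold
  by (intro continuous_on_mult continuous_on_compose_UNIV[OF assms(1)] continuous_on_compose_UNIV[OF assms(2)]
      continuous_intros)

lemma conv_cts: "cts f \<Longrightarrow> cts g \<Longrightarrow> cts (conv f g)"
  unfolding conv_def using continuous_parameter_integral[OF conv_kernel] by simp

lemma conv_integrable: "cts f \<Longrightarrow> cts g \<Longrightarrow> integrable m (\<lambda>y. f (x - y) * g y)"
  using integrable_continuous[OF continuous_section(1)[OF conv_kernel]] by simp

lemma conv_commute:
  assumes "cts f" "cts g"
  shows "conv f g = conv g f"
proof
  fix x
  have "(LINT y|m. (\<lambda>y. f (x - y) * g y) (x - y)) = (LINT y|m. f (x - y) * g y)"
    by (rule integral_reflect[OF continuous_section(1)[OF conv_kernel[OF assms]]])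
  then show "conv f g x = conv g f x" by (simp add: conv_def mult.commute)
qed

lemma conv_assoc:
  assumes f: "cts f" and g: "cts g" and h: "cts h"
  shows "conv (conv f g) h = conv f (conv g h)"
proof
  fix x
  have c: "cts (\<lambda>z. f (x - z) * g (z - y))" for y
    by (intro continuous_on_mult continuous_on_compose_UNIV[OF f] continuous_on_compose_UNIV[OF g] continuous_intros)
  have 1: "conv f g (x - y) = (LINT z|m. f (x - z) * g (z - y))" for y
  proof -
    have "(LINT z|m. f (x - (y + z)) * g (y + z - y)) = (LINT z|m. f (x - z) * g (z - y))"
      using integral_translation[OF measurable_continuous[OF c[of y]], of y] by simp
    then show ?thesis by (simp add: conv_def diff_diff_eq)
  qed
  have k: "continuous_on UNIV (\<lambda>(y, z). f (x - z) * g (z - y) * h y)"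
    unfolding case_prod_unfold
    by (intro continuous_on_mult continuous_on_compose_UNIV[OF f] continuous_on_compose_UNIV[OF g]
        continuous_on_compose_UNIV[OF h] continuous_intros)
  have "conv (conv f g) h x = (LINT y|m. LINT z|m. f (x - z) * g (z - y) * h y)"
    unfolding conv_def[of "conv f g"] 1 using integrable_continuous[OF c] by simp
  also have "\<dots> = (LINT z|m. LINT y|m. f (x - z) * g (z - y) * h y)"
    by (rule Fubini_continuous[OF k])
  also have "\<dots> = conv f (conv g h) x"
    unfolding conv_def using conv_integrable[OF g h] by (simp add: mult.assoc)
  finally show "conv (conv f g) h x = conv f (conv g h) x" .
qed

lemma conv_lincomb:
  assumes "cts f" "cts g" "cts h"
  shows "conv (\<lambda>x. a * f x + b * g x) h = (\<lambda>x. a * conv f h x + b * conv g h x)"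
proof
  fix x
  have "conv (\<lambda>x. a * f x + b * g x) h x = (LINT y|m. a * (f (x - y) * h y) + b * (g (x - y) * h y))"
    unfolding conv_def by (intro Bochner_Integration.integral_cong) (auto simp: algebra_simps)
  also have "\<dots> = a * conv f h x + b * conv g h x"
    unfolding conv_def using conv_integrable[OF assms(1,3)] conv_integrable[OF assms(2,3)] by simp
  finally show "conv (\<lambda>x. a * f x + b * g x) h x = a * conv f h x + b * conv g h x" .
qed

lemma conv_lincomb_right:
  assumes f: "cts f" and g: "cts g" and h: "cts h"
  shows "conv h (\<lambda>x. a * f x + b * g x) = (\<lambda>x. a * conv h f x + b * conv h g x)"
proof -
  have c: "cts (\<lambda>x. a * f x + b * g x)" by (intro continuous_intros f g)
  show ?thesis
    unfolding conv_commute[OF h c] conv_lincomb[OF f g h] conv_commute[OF h f] conv_commute[OF h g] ..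
qed

lemma conv_scale: "conv (\<lambda>x. a * f x) h = (\<lambda>x. a * conv f h x)"
  by (rule ext) (simp add: conv_def mult.assoc)

lemma conv_scale_right: "conv h (\<lambda>x. a * f x) = (\<lambda>x. a * conv h f x)"
  by (rule ext) (simp add: conv_def mult.left_commute)

lemma conv_zero [simp]: "conv (\<lambda>x. 0) h = (\<lambda>x. 0)" "conv h (\<lambda>x. 0) = (\<lambda>x. 0)"
  by (auto simp: conv_def)

lemma star_cts:
  assumes "cts f"
  shows "cts (star f)"
proof -
  have "cts (\<lambda>x. cnj (f (- x)))"
    by (intro continuous_on_cnj continuous_on_compose_UNIV[OF assms] continuous_intros)
  then show ?thesis unfolding star_def .
qed

lemma star_conv:
  assumes f: "cts f" and g: "cts g"
  shows "star (conv f g) = conv (star f) (star g)"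
proof
  fix x
  have c: "cts (\<lambda>y. cnj (f (- x - y)) * cnj (g y))"
    by (intro continuous_intros continuous_on_compose_UNIV[OF f] g)
  have "star (conv f g) x = (LINT y|m. cnj (f (- x - y)) * cnj (g y))"
    using Bochner_Integration.integral_cnj[of m "\<lambda>y. f (- x - y) * g y"] by (simp add: star_def conv_def del: Bochner_Integration.integral_cnj)
  also have "\<dots> = (LINT y|m. cnj (f (- x - - y)) * cnj (g (- y)))"
    using integral_uminus[OF c] by simp
  also have "\<dots> = conv (star f) (star g) x"
    by (simp add: star_def conv_def algebra_simps)
  finally show "star (conv f g) x = conv (star f) (star g) x" .
qed

lemma star_lincomb: "star (\<lambda>x. a * f x + b * g x) = (\<lambda>x. cnj a * star f x + cnj b * star g x)"
  by (auto simp: star_def)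

lemma lp_norm_reflect:
  assumes f: "cts f" and p: "0 < p"
  shows "lp_norm m p (\<lambda>y. f (x - y)) = lp_norm m p f"
proof -
  have c: "cts (\<lambda>y. complex_of_real (norm (f y) powr p))"
    using p by (intro continuous_intros f continuous_on_powr') auto
  have "complex_of_real (LINT y|m. norm (f (x - y)) powr p) = complex_of_real (LINT y|m. norm (f y) powr p)"
    using integral_reflect[OF c, of x] by (simp only: integral_complex_of_real)
  then show ?thesis unfolding lp_norm_def by (simp only: of_real_eq_iff)
qed

text \<open>Cauchy--Schwarz with the supremum on the left: one further convolution turns convergence
  in \<open>l2\<close> into uniform convergence.\<close>

lemma conv_bound:
  assumes f: "cts f" and g: "cts g"
  shows "norm (conv f g x) \<le> l2 f * l2 g"
proof -
  have c: "cts (\<lambda>y. f (x - y))" by (intro continuous_on_compose_UNIV[OF f] continuous_intros)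
  have "norm (LINT y|m. f (x - y) * g y) \<le> l2 (\<lambda>y. f (x - y)) * l2 g"
    using c g by (intro Hoelder_integral Lp_continuous) auto
  then show ?thesis using lp_norm_reflect[OF f] by (simp add: conv_def)
qed

lemma l2_square:
  shows "(l2 f)\<^sup>2 = (LINT x|m. (norm (f x))\<^sup>2)"
proof -
  have "(LINT x|m. norm (f x) powr 2) = (LINT x|m. (norm (f x))\<^sup>2)"
    by (intro Bochner_Integration.integral_cong) auto
  moreover have "0 \<le> (LINT x|m. (norm (f x))\<^sup>2)" by simp
  ultimately show ?thesis by (simp add: lp_norm_def powr_half_sqrt)
qed

lemma l2_le_bound: "cts f \<Longrightarrow> (\<And>x. norm (f x) \<le> C) \<Longrightarrow> l2 f \<le> C"
  by (rule lp_norm_le_const) (auto intro: measurable_continuous)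

lemma l2_zero:
  assumes f: "cts f" and "l2 f = 0"
  shows "f x = 0"
proof -
  have c: "continuous_on UNIV (\<lambda>x. (norm (f x))\<^sup>2)" by (intro continuous_intros f)
  have "(LINT x|m. (norm (f x))\<^sup>2) = 0" using assms(2) l2_square[of f] by simp
  then have "(norm (f x))\<^sup>2 = 0" by (intro continuous_integral_zero[OF c]) auto
  then show ?thesis by simp
qed

lemma l2_pos:
  assumes f: "cts f" and "f x \<noteq> 0"
  shows "0 < l2 f"
  using l2_zero[OF f, of x] assms(2) lp_norm_nonneg[of m 2 f] by linarith

text \<open>Evaluation at 0 plays the role of a trace, so that squared norms of convolution powers
  become values at 0.\<close>

lemma conv_star_0:
  assumes f: "cts f"
  shows "conv f (star f) 0 = complex_of_real ((l2 f)\<^sup>2)"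
proof -
  have c: "cts (\<lambda>y. complex_of_real ((norm (f y))\<^sup>2))" by (intro continuous_intros f)
  have "conv f (star f) 0 = (LINT y|m. complex_of_real ((norm (f (- y)))\<^sup>2))"
    by (simp only: conv_def star_def complex_norm_square diff_0)
  also have "\<dots> = (LINT y|m. complex_of_real ((norm (f y))\<^sup>2))" by (rule integral_uminus[OF c])
  finally show ?thesis by (simp only: l2_square integral_complex_of_real)
qed

lemma conv_self_0: "cts f \<Longrightarrow> star f = f \<Longrightarrow> conv f f 0 = complex_of_real ((l2 f)\<^sup>2)"
  using conv_star_0[of f] by simp

text \<open>Power iteration: the normalized even convolution powers of \<open>h\<close> converge to the kernel of the
  spectral projection for the largest eigenvalue of convolution by \<open>h * h\<close>.\<close>

lemma power_iteration:
  assumes h: "cts h" "star h = h" "h x0 \<noteq> 0"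
  shows "\<exists>e R. cts e \<and> star e = e \<and> conv e e = e \<and> (\<exists>x. e x \<noteq> 0) \<and> 0 < (R::real) \<and>
    conv e (conv h h) = (\<lambda>x. R * e x)"
proof -
  \<comment> \<open>\<open>H n\<close> is the convolution power of exponent n + 1; hence the shift
    in \<open>Hadd\<close>.\<close>
  define H where "H n = ((conv h) ^^ n) h" for n
  have H0: "H 0 = h" and HS: "H (Suc n) = conv h (H n)" for n by (auto simp: H_def)
  have Hc: "cts (H n)" for n by (induction n) (auto simp: H0 HS intro: h conv_cts)
  have Hs: "star (H n) = H n" for n
    by (induction n) (auto simp: H0 HS h star_conv Hc)
  have Hadd: "conv (H a) (H b) = H (a + b + 1)" for a b
    by (induction a) (auto simp: H0 HS conv_assoc h Hc)
  define s where "s n = (l2 (H n))\<^sup>2" for n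
  have s0: "H (2 * n + 1) 0 = complex_of_real (s n)" for n
    using conv_self_0[OF Hc Hs, of n] Hadd[of n n] by (simp add: s_def mult_2)
  have snn: "0 \<le> s n" for n by (simp add: s_def)
  \<comment> \<open>Log-convexity of the moments \<open>s\<close>. Together with the
    submultiplicativity \<open>sub\<close> it makes the quotients \<open>r\<close> increase to a
    finite limit \<open>R\<close>.\<close>
  have CS: "(s (n + 1))\<^sup>2 \<le> s n * s (n + 2)" for n
  proof -
    have "complex_of_real (s (n + 1)) = conv (H n) (H (n + 2)) 0"
      using s0[of "n + 1"] Hadd[of n "n + 2"] by (simp add: mult_2)
    then have "norm (complex_of_real (s (n + 1))) \<le> l2 (H n) * l2 (H (n + 2))"
      using conv_bound[OF Hc Hc] by metis
    then have "s (n + 1) \<le> l2 (H n) * l2 (H (n + 2))" using snn[of "n + 1"] by simp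
    then have "(s (n + 1))\<^sup>2 \<le> (l2 (H n) * l2 (H (n + 2)))\<^sup>2"
      using snn by (intro power_mono) auto
    then show ?thesis by (simp add: s_def power_mult_distrib)
  qed
  have sub: "s (a + b + 1) \<le> s a * s b" for a b
  proof -
    have "l2 (H (a + b + 1)) \<le> l2 (H a) * l2 (H b)"
      unfolding Hadd[symmetric] by (intro l2_le_bound conv_cts Hc conv_bound)
    then have "(l2 (H (a + b + 1)))\<^sup>2 \<le> (l2 (H a) * l2 (H b))\<^sup>2" by (intro power_mono) auto
    then show ?thesis by (simp add: s_def power_mult_distrib)
  qed
  have spos2: "0 < s n \<and> 0 < s (n + 1)" for n
  proof (induction n)
    case 0
    have "0 < s 0" using l2_pos[OF h(1,3)] by (simp add: s_def H0)
    then have "H 1 0 \<noteq> 0" using s0[of 0] by simp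
    then have "0 < s 1" using l2_pos[OF Hc, of 1 0] by (simp add: s_def)
    then show ?case using \<open>0 < s 0\<close> by simp
  next
    case (Suc n)
    have "s (n + 2) \<noteq> 0"
    proof
      assume "s (n + 2) = 0"
      then have "(s (n + 1))\<^sup>2 \<le> 0" using CS[of n] by simp
      then show False using Suc by simp
    qed
    then show ?case using Suc snn[of "n + 2"] by simp
  qed
  then have spos: "0 < s n" for n by blast
  define r where "r n = s (n + 1) / s n" for n
  have r_inc: "incseq r"
  proof (rule incseq_SucI)
    fix n
    have "s (n + 1) * s (n + 1) \<le> s (n + 2) * s n"
      using CS[of n] by (simp add: power2_eq_square mult.commute)
    then have "s (n + 1) / s n \<le> s (n + 2) / s (n + 1)"
      using spos[of n] spos[of "n + 1"] by (simp add: divide_le_eq le_divide_eq mult.commute)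
    then show "r n \<le> r (Suc n)" by (simp add: r_def)
  qed
  have r_bd: "r n \<le> s 0" for n
    using sub[of n 0] spos[of n] by (simp add: r_def divide_le_eq mult.commute)
  obtain R where R: "r \<longlonglongrightarrow> R" "\<forall>i. r i \<le> R"
    using incseq_convergent[OF r_inc, of "s 0"] r_bd by blast
  have Rpos: "0 < R"
  proof -
    have "0 < r 0" using spos by (simp add: r_def)
    then show ?thesis using R(2) by (meson order_less_le_trans)
  qed
  \<comment> \<open>The rescaled sequence decreases, since r n \<le> R. What remains is to exclude
    the limit 0.\<close>
  define a where "a n = s n / R ^ (n + 1)" for n
  have apos: "0 < a n" for n using spos Rpos by (simp add: a_def)
  have a_step: "a (n + 1) = r n / R * a n" for n
    using spos[of n] Rpos by (simp add: a_def r_def)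
  have a_dec: "decseq a"
  proof (rule decseq_SucI)
    fix n
    have "r n / R \<le> 1" using R(2) Rpos by simp
    then have "r n / R * a n \<le> 1 * a n" using apos[of n] by (intro mult_right_mono) auto
    then show "a (Suc n) \<le> a n" using a_step[of n] by simp
  qed
  have a_sub: "a (k + n + 1) \<le> a k * a n" for k n
  proof -
    have "a (k + n + 1) = s (k + n + 1) / (R ^ (k + 1) * R ^ (n + 1))"
      by (simp add: a_def power_add[symmetric] algebra_simps)
    also have "\<dots> \<le> (s k * s n) / (R ^ (k + 1) * R ^ (n + 1))"
      using Rpos by (intro divide_right_mono sub) auto
    finally show ?thesis by (simp add: a_def)
  qed
  have ratio: "(\<lambda>k. a (k + j) / a k) \<longlonglongrightarrow> 1" for j
  proof (induction j)
    case 0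
    have "(\<lambda>k. a (k + 0) / a k) = (\<lambda>k. 1)"
    proof
      fix k show "a (k + 0) / a k = 1" using apos[of k] by simp
    qed
    then show ?case by simp
  next
    case (Suc j)
    have "(\<lambda>k. r (k + j) / R * (a (k + j) / a k)) \<longlonglongrightarrow> R / R * 1"
      using Rpos by (intro tendsto_intros Suc LIMSEQ_ignore_initial_segment R) auto
    then show ?case using Rpos a_step[of "_ + j"] by simp
  qed
  \<comment> \<open>Submultiplicativity bounds a (k + n + 1) / a k by a n, and these quotients tend
    to 1 as k grows. This is why the limit idempotent does not vanish at 0.\<close>
  have a_ge1: "1 \<le> a n" for n
  proof (rule LIMSEQ_le_const2[OF ratio[of "n + 1"]], intro exI allI impI)
    fix k :: nat
    show "a (k + (n + 1)) / a k \<le> a n"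
      using a_sub[of k n] apos[of k] by (simp add: divide_le_eq mult.commute add.assoc)
  qed
  obtain L where L: "a \<longlonglongrightarrow> L" "\<forall>i. L \<le> a i"
    using decseq_convergent[OF a_dec, of 1] a_ge1 by blast
  have L1: "1 \<le> L" using LIMSEQ_le_const[OF L(1)] a_ge1 by blast
  \<comment> \<open>Even powers of the self-adjoint h, normalized to have the value
    \<open>a n\<close> at 0. By \<open>econv\<close> the inner products of the \<open>e n\<close>
    are again values of \<open>a\<close>, so convergence of \<open>a\<close> makes the sequence
    Cauchy in \<open>l2\<close>.\<close>
  define e where "e n x = (1 / R ^ (n + 1)) * H (2 * n + 1) x" for n x
  have ec: "cts (e n)" for n unfolding e_def by (intro continuous_intros Hc)
  have es: "star (e n) = e n" for n
    using Hs[of "2 * n + 1"] by (auto simp: e_def star_def fun_eq_iff)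
  have econv: "conv (e n) (e k) = e (n + k + 1)" for n k
  proof -
    have "conv (e n) (e k) = (\<lambda>x. (1 / R ^ (n + 1)) * ((1 / R ^ (k + 1)) * conv (H (2 * n + 1)) (H (2 * k + 1)) x))"
      unfolding e_def by (simp only: conv_scale conv_scale_right)
    also have "\<dots> = e (n + k + 1)"
      unfolding Hadd e_def by (auto simp: power_add fun_eq_iff algebra_simps)
    finally show ?thesis .
  qed
  have e0: "e n 0 = complex_of_real (a n)" for n
    unfolding e_def s0 by (simp add: a_def)
  have dist_e: "(l2 (\<lambda>x. e n x - e k x))\<^sup>2 = a (2 * n + 1) - 2 * a (n + k + 1) + a (2 * k + 1)" for n k
  proof -
    let ?d = "\<lambda>x. 1 * e n x + (-1) * e k x"
    have dc: "cts ?d" by (intro continuous_intros ec)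
    have "star ?d = ?d" unfolding star_lincomb es by simp
    then have "complex_of_real ((l2 ?d)\<^sup>2) = conv ?d ?d 0" using conv_self_0[OF dc] by simp
    also have "\<dots> = (e (n + n + 1) 0 - e (n + k + 1) 0) - (e (k + n + 1) 0 - e (k + k + 1) 0)"
      unfolding conv_lincomb[OF ec ec dc] conv_lincomb_right[OF ec ec ec] econv by simp
    also have "\<dots> = complex_of_real (a (2 * n + 1) - 2 * a (n + k + 1) + a (2 * k + 1))"
    proof -
      have "n + n + 1 = 2 * n + 1" "k + k + 1 = 2 * k + 1" "k + n + 1 = n + k + 1" by simp_all
      then show ?thesis by (simp only: e0) simp
    qed
    finally show ?thesis by (simp only: of_real_eq_iff) simp
  qed
  have e_cauchy: "\<exists>N. \<forall>n\<ge>N. \<forall>k\<ge>N. l2 (\<lambda>x. e n x - e k x) < \<epsilon>" if \<epsilon>: "0 < \<epsilon>" for \<epsilon>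
  proof -
    obtain N where N: "\<forall>j\<ge>N. norm (a j - L) < \<epsilon>\<^sup>2 / 4"
      using LIMSEQ_D[OF L(1), of "\<epsilon>\<^sup>2 / 4"] \<epsilon> by auto
    have "l2 (\<lambda>x. e n x - e k x) < \<epsilon>" if nk: "n \<ge> N" "k \<ge> N" for n k
    proof -
      have "\<bar>a (2 * n + 1) - L\<bar> < \<epsilon>\<^sup>2 / 4" "\<bar>a (n + k + 1) - L\<bar> < \<epsilon>\<^sup>2 / 4" "\<bar>a (2 * k + 1) - L\<bar> < \<epsilon>\<^sup>2 / 4"
        using N nk by (auto simp: real_norm_def)
      then have "(l2 (\<lambda>x. e n x - e k x))\<^sup>2 < \<epsilon>\<^sup>2" unfolding dist_e abs_less_iff by linarith
      then show ?thesis using \<epsilon> by (meson power_less_imp_less_base less_imp_le)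
    qed
    then show ?thesis by blast
  qed
  have eSuc: "conv (e n) (H 1) x = R * e (n + 1) x" for n x
  proof -
    have "conv (e n) (H 1) x = (1 / R ^ (n + 1)) * conv (H (2 * n + 1)) (H 1) x"
      unfolding e_def by (simp only: conv_scale)
    also have "\<dots> = R * e (n + 1) x" unfolding Hadd e_def using Rpos by simp
    finally show ?thesis .
  qed
  \<comment> \<open>Since R e (n + 1) is the convolution of e n with h * h, the estimate
    \<open>conv_bound\<close> upgrades \<open>l2\<close>-convergence to uniform convergence.\<close>
  have "uniformly_Cauchy_on UNIV (\<lambda>n. e (n + 1))"
  proof (rule uniformly_Cauchy_onI)
    fix \<epsilon> :: real assume \<epsilon>: "0 < \<epsilon>"
    define K where "K = l2 (H 1) + 1"
    have K: "0 < K" "l2 (H 1) \<le> K" by (auto simp: K_def add_nonneg_pos)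
    obtain N where N: "\<forall>n\<ge>N. \<forall>k\<ge>N. l2 (\<lambda>x. e n x - e k x) < \<epsilon> * R / K"
      using e_cauchy[of "\<epsilon> * R / K"] \<epsilon> Rpos K by auto
    have "dist (e (n + 1) x) (e (k + 1) x) < \<epsilon>" if nk: "n \<ge> N" "k \<ge> N" for n k x
    proof -
      have dc: "cts (\<lambda>x. e n x - e k x)" by (intro continuous_intros ec)
      have "R * (e (n + 1) x - e (k + 1) x) = conv (\<lambda>x. 1 * e n x + (-1) * e k x) (H 1) x"
        unfolding conv_lincomb[OF ec ec Hc] eSuc by (simp add: algebra_simps)
      then have "norm (R * (e (n + 1) x - e (k + 1) x)) \<le> l2 (\<lambda>x. e n x - e k x) * l2 (H 1)"
        using conv_bound[OF dc Hc, of 1 x] by simp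
      also have "\<dots> \<le> l2 (\<lambda>x. e n x - e k x) * K" using K by (intro mult_left_mono) auto
      also have "\<dots> < \<epsilon> * R / K * K" using N nk K by (intro mult_strict_right_mono) auto
      finally have "R * norm (e (n + 1) x - e (k + 1) x) < R * \<epsilon>"
        using K Rpos by (simp add: norm_mult mult.commute)
      then show ?thesis using Rpos by (simp add: dist_norm)
    qed
    then show "\<exists>M. \<forall>x\<in>UNIV. \<forall>n\<ge>M. \<forall>k\<ge>M. dist (e (n + 1) x) (e (k + 1) x) < \<epsilon>" by blast
  qed
  then obtain E where E: "uniform_limit UNIV (\<lambda>n. e (n + 1)) E sequentially"
    using Cauchy_uniformly_convergent by (auto simp: uniformly_convergent_on_def)
  have Ec: "cts E"
    by (rule uniform_limit_theorem[OF _ E]) (auto intro!: always_eventually ec)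
  have Ept: "(\<lambda>n. e n x) \<longlonglongrightarrow> E x" for x
  proof -
    have "(\<lambda>n. e (n + 1) x) \<longlonglongrightarrow> E x" by (rule tendsto_uniform_limitI[OF E]) simp
    then show ?thesis by (rule LIMSEQ_offset)
  qed
  have conv_lim: "(\<lambda>n. conv (e (n + 1)) g x) \<longlonglongrightarrow> conv E g x" if g: "cts g" for g x
  proof (rule LIMSEQ_I)
    fix \<epsilon> :: real assume \<epsilon>: "0 < \<epsilon>"
    define K where "K = l2 g + 1"
    have K: "0 < K" "l2 g \<le> K" by (auto simp: K_def add_nonneg_pos)
    have "0 < \<epsilon> / (2 * K)" using \<epsilon> K by simp
    then have "\<forall>\<^sub>F n in sequentially. \<forall>x\<in>UNIV. dist (e (n + 1) x) (E x) < \<epsilon> / (2 * K)"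
      using E unfolding uniform_limit_iff by blast
    then obtain N where N: "\<forall>n\<ge>N. \<forall>x. dist (e (n + 1) x) (E x) < \<epsilon> / (2 * K)"
      by (auto simp: eventually_sequentially)
    have "norm (conv (e (n + 1)) g x - conv E g x) < \<epsilon>" if n: "n \<ge> N" for n
    proof -
      have dc: "cts (\<lambda>x. e (n + 1) x - E x)" by (intro continuous_intros ec Ec)
      have "conv (e (n + 1)) g x - conv E g x = conv (\<lambda>x. 1 * e (n + 1) x + (-1) * E x) g x"
        unfolding conv_lincomb[OF ec Ec g] by simp
      then have "norm (conv (e (n + 1)) g x - conv E g x) \<le> l2 (\<lambda>x. e (n + 1) x - E x) * l2 g"
        using conv_bound[OF dc g, of x] by simp
      also have "\<dots> \<le> (\<epsilon> / (2 * K)) * K"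
      proof (rule mult_mono)
        show "l2 (\<lambda>x. e (n + 1) x - E x) \<le> \<epsilon> / (2 * K)"
          using N n by (intro l2_le_bound dc) (auto simp: dist_norm less_imp_le)
      qed (use K \<epsilon> in auto)
      also have "\<dots> < \<epsilon>" using \<epsilon> K by simp
      finally show ?thesis .
    qed
    then show "\<exists>no. \<forall>n\<ge>no. norm (conv (e (n + 1)) g x - conv E g x) < \<epsilon>" by blast
  qed
  have Ee: "conv E (e k) = E" for k
  proof
    fix x
    have "(\<lambda>n. e (n + (k + 2)) x) \<longlonglongrightarrow> E x" by (rule LIMSEQ_ignore_initial_segment[OF Ept])
    then have "(\<lambda>n. conv (e (n + 1)) (e k) x) \<longlonglongrightarrow> E x" unfolding econv by (simp add: add.assoc add.commute)
    then show "conv E (e k) x = E x" using conv_lim[OF ec] LIMSEQ_unique by blast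
  qed
  have EE: "conv E E = E"
  proof
    fix x
    have "(\<lambda>n. conv (e (n + 1)) E x) \<longlonglongrightarrow> conv E E x" by (rule conv_lim[OF Ec])
    moreover have "conv (e (n + 1)) E = E" for n using Ee[of "n + 1"] conv_commute[OF ec Ec] by simp
    ultimately have "(\<lambda>n. E x) \<longlonglongrightarrow> conv E E x" by simp
    then show "conv E E x = E x" using LIMSEQ_const_iff by metis
  qed
  have ER: "conv E (conv h h) = (\<lambda>x. R * E x)"
  proof
    fix x
    have H1: "H 1 = conv h h" using HS[of 0] H0 by simp
    have "(\<lambda>n. R * e (n + 2) x) \<longlonglongrightarrow> R * E x"
      by (intro tendsto_mult tendsto_const LIMSEQ_ignore_initial_segment[OF Ept])
    then have "(\<lambda>n. conv (e (n + 1)) (H 1) x) \<longlonglongrightarrow> R * E x" unfolding eSuc by (simp add: add.assoc)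
    then show "conv E (conv h h) x = R * E x"
      using conv_lim[OF Hc, of 1 x] LIMSEQ_unique unfolding H1 by blast
  qed
  have Es: "star E = E"
  proof
    fix x
    have "(\<lambda>n. star (e n) x) \<longlonglongrightarrow> star E x"
      unfolding star_def by (intro tendsto_cnj Ept)
    then show "star E x = E x" unfolding es using Ept LIMSEQ_unique by blast
  qed
  have "(\<lambda>n. e n 0) \<longlonglongrightarrow> complex_of_real L" unfolding e0 by (intro tendsto_of_real L(1))
  then have "E 0 = complex_of_real L" using Ept LIMSEQ_unique by blast
  then have "E 0 \<noteq> 0" using L1 by auto
  then show ?thesis using Ec Es EE ER Rpos by blast
qed

text \<open>The convolution kernel of a nonzero orthogonal projection that annihilates every
  character: the object whose existence would contradict the Peter--Weyl theorem.\<close>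

definition null_idempotent :: "('a \<Rightarrow> complex) \<Rightarrow> bool" where
  "null_idempotent e \<longleftrightarrow> cts e \<and> star e = e \<and> conv e e = e \<and> (\<exists>x. e x \<noteq> 0) \<and>
     (\<forall>\<gamma>\<in>characters. conv e \<gamma> = (\<lambda>_. 0))"

text \<open>Because e = e * e, the supremum of e is at most the squared \<open>l2\<close> norm, and
  it is at least \<open>l2 e\<close>; hence a nonzero idempotent has norm at least 1. This gap is
  what makes approximate minimality enough below.\<close>

lemma null_idempotent_norm:
  assumes "cts e" "star e = e" "conv e e = e" "e z \<noteq> 0"
  shows "e 0 = complex_of_real ((l2 e)\<^sup>2)" "norm (e x) \<le> (l2 e)\<^sup>2" "1 \<le> (l2 e)\<^sup>2"
proof -
  show "e 0 = complex_of_real ((l2 e)\<^sup>2)" using conv_self_0[of e] assms by simp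
  show b: "norm (e x) \<le> (l2 e)\<^sup>2" for x
    using conv_bound[OF assms(1,1), of x] assms(3) by (simp add: power2_eq_square)
  have "l2 e \<le> (l2 e)\<^sup>2" by (rule l2_le_bound[OF assms(1) b])
  moreover have "0 < l2 e" by (rule l2_pos[OF assms(1,4)])
  ultimately have "1 \<le> l2 e" by (simp add: power2_eq_square)
  then show "1 \<le> (l2 e)\<^sup>2" by simp
qed

text \<open>An idempotent of nearly minimal norm spans its ideal, so its translates are proportional
  to it and it is a multiple of a character.\<close>

lemma no_null_idempotent: "\<not> null_idempotent e"
proof
  assume "null_idempotent e"
  define I where "I = {(l2 e)\<^sup>2 | e. null_idempotent e}"
  have Ine: "I \<noteq> {}" using \<open>null_idempotent e\<close> by (auto simp: I_def)
  have bdd: "bdd_below I" by (rule bdd_belowI[of _ 0]) (auto simp: I_def)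
  \<comment> \<open>A minimum need not be attained. A proper splitting of e into f and e - f would
    force a squared norm of at least Inf I + 1, so it suffices to come within 1 of the
    infimum.\<close>
  obtain v where "v \<in> I" "v < Inf I + 1"
    using cInf_lessD[OF Ine, of "Inf I + 1"] by auto
  then obtain e where ne: "null_idempotent e" and emin: "(l2 e)\<^sup>2 < Inf I + 1" by (auto simp: I_def)
  have minimal: "Inf I \<le> (l2 f)\<^sup>2" if "null_idempotent f" for f
    by (rule cInf_lower[OF _ bdd]) (use that in \<open>auto simp: I_def\<close>)
  obtain z where e: "cts e" "star e = e" "conv e e = e" "e z \<noteq> 0" "\<forall>\<gamma>\<in>characters. conv e \<gamma> = (\<lambda>_. 0)"
    using ne by (auto simp: null_idempotent_def)
  \<comment> \<open>Power iteration on k yields an idempotent f below e. It annihilates all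
    characters as well, so near-minimality forces f = e, and k * k is a multiple of e.\<close>
  have square: "\<exists>R::complex. conv k k = (\<lambda>x. R * e x)" if k: "cts k" "star k = k" "conv k e = k" for k
  proof (cases "\<exists>x. k x \<noteq> 0")
    case False
    then have "k = (\<lambda>x. 0)" by auto
    then show ?thesis by (intro exI[of _ 0]) simp
  next
    case True
    then obtain x0 where x0: "k x0 \<noteq> 0" by blast
    obtain f R where f: "cts f" "star f = f" "conv f f = f" "\<exists>x. f x \<noteq> 0" "0 < (R::real)"
      "conv f (conv k k) = (\<lambda>x. R * f x)"
      using power_iteration[OF k(1,2) x0] by blast
    have kkc: "cts (conv k k)" by (intro conv_cts k)
    have scale: "u = v" if "(\<lambda>x. complex_of_real R * u x) = (\<lambda>x. R * v x)" for u v :: "'a \<Rightarrow> complex"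
      using that f(5) by (auto simp: fun_eq_iff)
    have f\<gamma>: "conv f \<gamma> = (\<lambda>_. 0)" if \<gamma>: "\<gamma> \<in> characters" for \<gamma>
    proof (rule scale)
      note \<gamma>c = charactersD(1)[OF \<gamma>]
      have "conv k \<gamma> = conv k (conv e \<gamma>)" using conv_assoc[OF k(1) e(1) \<gamma>c] k(3) by simp
      then have k\<gamma>: "conv k \<gamma> = (\<lambda>_. 0)" using e(5) \<gamma> by simp
      have "(\<lambda>x. complex_of_real R * conv f \<gamma> x) = conv (conv f (conv k k)) \<gamma>"
        unfolding f(6) conv_scale ..
      also have "\<dots> = (\<lambda>_. 0)"
        unfolding conv_assoc[OF f(1) kkc \<gamma>c] conv_assoc[OF k(1) k(1) \<gamma>c] k\<gamma> by simp
      finally show "(\<lambda>x. complex_of_real R * conv f \<gamma> x) = (\<lambda>x. complex_of_real R * 0)" by simp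
    qed
    have fe: "conv f e = f"
    proof (rule scale)
      have "(\<lambda>x. complex_of_real R * conv f e x) = conv (conv f (conv k k)) e"
        unfolding f(6) conv_scale ..
      also have "\<dots> = (\<lambda>x. R * f x)"
        unfolding conv_assoc[OF f(1) kkc e(1)] conv_assoc[OF k(1) k(1) e(1)] k(3) unfolding f(6) ..
      finally show "(\<lambda>x. complex_of_real R * conv f e x) = (\<lambda>x. R * f x)" .
    qed
    have nf: "null_idempotent f" using f f\<gamma> by (auto simp: null_idempotent_def)
    let ?d = "\<lambda>x. 1 * e x + (-1) * f x"
    have dc: "cts ?d" by (intro continuous_intros e f)
    have ds: "star ?d = ?d" unfolding star_lincomb e(2) f(2) by simp
    have ef: "conv e f = f" using fe conv_commute[OF e(1) f(1)] by simp
    have dd: "conv ?d ?d = ?d"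
      unfolding conv_lincomb[OF e(1) f(1) dc] conv_lincomb_right[OF e(1) f(1) e(1)]
        conv_lincomb_right[OF e(1) f(1) f(1)] ef fe e(3) f(3) by simp
    have "\<not> (\<exists>x. ?d x \<noteq> 0)"
    proof
      assume ex: "\<exists>x. ?d x \<noteq> 0"
      then obtain y where y: "?d y \<noteq> 0" by blast
      have "complex_of_real ((l2 ?d)\<^sup>2) = complex_of_real ((l2 e)\<^sup>2) - complex_of_real ((l2 f)\<^sup>2)"
        using null_idempotent_norm(1)[OF dc ds dd y] null_idempotent_norm(1)[OF e(1-4)]
          conv_self_0[OF f(1,2)] f(3) by simp
      then have "(l2 ?d)\<^sup>2 = (l2 e)\<^sup>2 - (l2 f)\<^sup>2"
        by (simp only: of_real_diff[symmetric] of_real_eq_iff)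
      then show False
        using null_idempotent_norm(3)[OF dc ds dd y] minimal[OF nf] emin by linarith
    qed
    then have "f = e" by (auto simp: fun_eq_iff)
    then have "conv e (conv k k) = (\<lambda>x. R * e x)" using f(6) by simp
    moreover have "conv e (conv k k) = conv k k"
      using conv_assoc[OF k(1) k(1) e(1)] conv_commute[OF e(1) kkc] k(3) by simp
    ultimately show ?thesis by metis
  qed
  \<comment> \<open>The square of k + e is again a multiple of e; expanding it isolates 2 k.\<close>
  have scalar: "\<exists>c. k = (\<lambda>x. c * e x)" if k: "cts k" "star k = k" "conv k e = k" for k
  proof -
    obtain R1 :: complex where R1: "conv k k = (\<lambda>x. R1 * e x)" using square[OF k] by blast
    let ?l = "\<lambda>x. 1 * k x + 1 * e x"
    have lc: "cts ?l" by (intro continuous_intros e k)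
    have "\<exists>R::complex. conv ?l ?l = (\<lambda>x. R * e x)"
    proof (rule square[OF lc])
      show "star ?l = ?l" unfolding star_lincomb e(2) k(2) by simp
      show "conv ?l e = ?l" unfolding conv_lincomb[OF k(1) e(1) e(1)] k(3) e(3) ..
    qed
    then obtain R2 :: complex where R2: "conv ?l ?l = (\<lambda>x. R2 * e x)" by blast
    have "conv e k = k" using conv_commute[OF e(1) k(1)] k(3) by simp
    then have "conv ?l ?l = (\<lambda>x. (R1 * e x + k x) + (k x + e x))"
      unfolding conv_lincomb[OF k(1) e(1) lc] conv_lincomb_right[OF k(1) e(1) e(1)]
        conv_lincomb_right[OF k(1) e(1) k(1)] R1 k(3) e(3) by (simp add: fun_eq_iff)
    then have "2 * k x = (R2 - R1 - 1) * e x" for x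
      using fun_cong[OF R2, of x] by (simp add: algebra_simps)
    then have "k x = (R2 - R1 - 1) / 2 * e x" for x
      by (metis (no_types, lifting) nonzero_mult_div_cancel_left times_divide_eq_left zero_neq_numeral)
    then show ?thesis by blast
  qed
  have translate: "\<exists>\<nu>. \<forall>x. e (x - a) = \<nu> * e x" for a
  proof -
    have tc: "cts (\<lambda>x. e (x - b))" for b by (intro continuous_on_compose_UNIV[OF e(1)] continuous_intros)
    have te: "conv (\<lambda>x. e (x - b)) e = (\<lambda>x. e (x - b))" for b
    proof
      fix x
      have "conv (\<lambda>x. e (x - b)) e x = conv e e (x - b)"
        unfolding conv_def by (simp add: algebra_simps)
      then show "conv (\<lambda>x. e (x - b)) e x = e (x - b)" using e(3) by simp
    qed
    have ts: "star (\<lambda>x. e (x - b)) = (\<lambda>x. e (x - - b))" for b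
    proof
      fix x
      have "- (x - - b) = - x - b" by simp
      then have "star (\<lambda>x. e (x - b)) x = star e (x - - b)" by (simp only: star_def)
      then show "star (\<lambda>x. e (x - b)) x = e (x - - b)" using e(2) by simp
    qed
    \<comment> \<open>A translate of e need not be self-adjoint, but its combination with the
      opposite translate and conjugate coefficient is; the coefficients u = 1 and u = i then
      separate the two translates.\<close>
    let ?k = "\<lambda>u v x. u * e (x - a) + v * e (x - - a)"
    have kk: "\<exists>c. ?k u (cnj u) = (\<lambda>x. c * e x)" for u
    proof (rule scalar)
      show "cts (?k u (cnj u))" by (intro continuous_intros tc)
      show "star (?k u (cnj u)) = ?k u (cnj u)"
        unfolding star_lincomb ts by (auto simp: add.commute)
      show "conv (?k u (cnj u)) e = ?k u (cnj u)"
        unfolding conv_lincomb[OF tc tc e(1)] te ..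
    qed
    obtain c1 where c1: "?k 1 (cnj 1) = (\<lambda>x. c1 * e x)" using kk[of 1] by blast
    obtain c2 where c2: "?k \<i> (cnj \<i>) = (\<lambda>x. c2 * e x)" using kk[of \<i>] by blast
    have "e (x - a) = (c1 - \<i> * c2) / 2 * e x" for x
    proof -
      have 1: "e (x - a) + e (x - - a) = c1 * e x" using fun_cong[OF c1, of x] by simp
      have 2: "\<i> * e (x - a) - \<i> * e (x - - a) = c2 * e x" using fun_cong[OF c2, of x] by simp
      have "(c1 - \<i> * c2) * e x = c1 * e x - \<i> * (c2 * e x)" by (simp add: algebra_simps)
      also have "\<dots> = 2 * e (x - a)" unfolding 1[symmetric] 2[symmetric] by (simp add: algebra_simps)
      finally show ?thesis by simp
    qed
    then show ?thesis by blast
  qed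
  define E where "E = (l2 e)\<^sup>2"
  have E: "e 0 = complex_of_real E" "\<And>x. norm (e x) \<le> E" "1 \<le> E"
    using null_idempotent_norm[OF e(1-4)] by (auto simp: E_def)
  have e0: "e 0 \<noteq> 0" using E(1,3) by auto
  have hom: "e (x + b) = e x * e b / e 0" for x b
  proof -
    obtain \<nu> where \<nu>: "\<forall>x. e (x - - b) = \<nu> * e x" using translate by blast
    have "e (x + b) = \<nu> * e x" "e b = \<nu> * e 0" using spec[OF \<nu>, of x] spec[OF \<nu>, of 0] by simp_all
    then show ?thesis using e0 by simp
  qed
  \<comment> \<open>Proportional translates make e / e 0 multiplicative, and |e| \<le> e 0 forces
    modulus 1. Convolution by e fixes this character, although e annihilates all of them.\<close>
  define \<gamma> where "\<gamma> x = (1 / e 0) * e x" for x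
  have "\<gamma> \<in> characters"
  proof -
    have c: "cts \<gamma>" unfolding \<gamma>_def by (intro continuous_intros e)
    have mult: "\<gamma> (x + y) = \<gamma> x * \<gamma> y" for x y unfolding \<gamma>_def using hom[of x y] by simp
    have le: "norm (\<gamma> x) \<le> 1" for x
      using E(2)[of x] E(1,3) by (simp add: \<gamma>_def norm_divide divide_le_eq)
    have "norm (\<gamma> x) = 1" for x
    proof (rule antisym[OF le])
      have "\<gamma> x * \<gamma> (- x) = 1" using mult[of x "- x"] e0 by (simp add: \<gamma>_def)
      then have "norm (\<gamma> x) * norm (\<gamma> (- x)) = 1" by (metis norm_mult norm_one)
      moreover have "norm (\<gamma> x) * norm (\<gamma> (- x)) \<le> norm (\<gamma> x) * 1"
        using le by (intro mult_left_mono) auto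
      ultimately show "1 \<le> norm (\<gamma> x)" by simp
    qed
    then show ?thesis using c mult by (auto simp: characters_def)
  qed
  then have "conv e \<gamma> = (\<lambda>_. 0)" using e(5) by blast
  moreover have "conv e \<gamma> = (\<lambda>x. (1 / e 0) * e x)"
    unfolding \<gamma>_def conv_scale_right e(3) ..
  ultimately have "(1 / e 0) * e z = 0" by (metis (no_types, lifting))
  then show False using e0 e(4) by simp
qed

text \<open>If h is orthogonal to all characters, so is the self-adjoint function k = h * star h.
  Were k nonzero, power iteration would produce a forbidden idempotent; and k = 0 gives h = 0
  because k(0) is the squared norm of h.\<close>

lemma fourier_zero_continuous:
  assumes h: "cts h" and zero: "\<And>\<gamma>. \<gamma> \<in> characters \<Longrightarrow> fourier m h \<gamma> = 0"
  shows "h x = 0"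
proof -
  have h\<gamma>: "conv h \<gamma> = (\<lambda>_. 0)" if \<gamma>: "\<gamma> \<in> characters" for \<gamma>
  proof
    fix x
    have "conv h \<gamma> x = conv \<gamma> h x" using conv_commute[OF h charactersD(1)[OF \<gamma>]] by simp
    also have "\<dots> = \<gamma> x * fourier m h \<gamma>"
    proof -
      have "conv \<gamma> h x = (LINT y|m. \<gamma> x * (h y * cnj (\<gamma> y)))"
        unfolding conv_def charactersD(6)[OF \<gamma>]
        by (intro Bochner_Integration.integral_cong) auto
      then show ?thesis by (simp add: fourier_def)
    qed
    finally show "conv h \<gamma> x = 0" using zero[OF \<gamma>] by simp
  qed
  define k where "k = conv h (star h)"
  have sc: "cts (star h)" by (rule star_cts[OF h])
  have kc: "cts k" unfolding k_def by (intro conv_cts h sc)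
  have "star (star h) = h" by (auto simp: star_def)
  then have ks: "star k = k"
    unfolding k_def star_conv[OF h sc] using conv_commute[OF sc h] by simp
  have k\<gamma>: "conv k \<gamma> = (\<lambda>_. 0)" if \<gamma>: "\<gamma> \<in> characters" for \<gamma>
  proof -
    note \<gamma>c = charactersD(1)[OF \<gamma>]
    have "conv k \<gamma> = conv (star h) (conv h \<gamma>)"
      unfolding k_def conv_commute[OF h sc] conv_assoc[OF sc h \<gamma>c] ..
    then show ?thesis using h\<gamma>[OF \<gamma>] by simp
  qed
  have "k y = 0" for y
  proof (rule ccontr)
    assume "k y \<noteq> 0"
    then obtain e R where e: "cts e" "star e = e" "conv e e = e" "\<exists>x. e x \<noteq> 0" "0 < (R::real)"
      "conv e (conv k k) = (\<lambda>x. R * e x)"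
      using power_iteration[OF kc ks] by blast
    have "conv e \<gamma> = (\<lambda>_. 0)" if \<gamma>: "\<gamma> \<in> characters" for \<gamma>
    proof -
      note \<gamma>c = charactersD(1)[OF \<gamma>]
      have "(\<lambda>x. complex_of_real R * conv e \<gamma> x) = conv (conv e (conv k k)) \<gamma>"
        unfolding e(6) conv_scale ..
      also have "\<dots> = (\<lambda>_. 0)"
        unfolding conv_assoc[OF e(1) conv_cts[OF kc kc] \<gamma>c] conv_assoc[OF kc kc \<gamma>c] k\<gamma>[OF \<gamma>] by simp
      finally show ?thesis using e(5) by (auto simp: fun_eq_iff)
    qed
    then have "null_idempotent e" using e by (auto simp: null_idempotent_def)
    then show False using no_null_idempotent by blast
  qed
  then have "(l2 h)\<^sup>2 = 0" using conv_star_0[OF h] by (simp add: k_def)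
  then show ?thesis using l2_zero[OF h] by simp
qed

text \<open>If no character separates x and y, all of them are 1 at a = y - x, so every continuous
  function has the same Fourier coefficients as its translate by a. A Urysohn function with
  different values at 0 and a contradicts uniqueness.\<close>

lemma characters_separate:
  fixes x y :: 'a
  assumes "x \<noteq> y"
  shows "\<exists>\<gamma>\<in>characters. \<gamma> x \<noteq> \<gamma> y"
proof (rule ccontr)
  assume "\<not> ?thesis"
  then have eq: "\<gamma> x = \<gamma> y" if "\<gamma> \<in> characters" for \<gamma> using that by blast
  define a where "a = y - x"
  have a: "\<gamma> a = 1" if "\<gamma> \<in> characters" for \<gamma>
    using charactersD(6)[OF that, of y x] charactersD(7)[OF that, of y] eq[OF that] by (simp add: a_def)
  have "a \<noteq> 0" using assms by (simp add: a_def)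
  then obtain g :: "'a \<Rightarrow> real" where g: "continuous_on UNIV g" "g 0 = 1" "g a = 0"
    using Urysohn_compact[of "{0}" "- {a}"] by (metis ComplD Compl_iff closed_singleton open_Compl
      singletonD singletonI subsetI)
  define f where "f x = complex_of_real (g x)" for x
  have f: "cts f" unfolding f_def by (intro continuous_intros g)
  have ft: "cts (\<lambda>z. f (a + z))" by (intro continuous_on_compose_UNIV[OF f] continuous_intros)
  have "f (a + z) - f z = 0" for z
  proof (rule fourier_zero_continuous)
    show "cts (\<lambda>z. f (a + z) - f z)" by (intro continuous_intros f ft)
    fix \<gamma> :: "'a \<Rightarrow> complex" assume \<gamma>: "\<gamma> \<in> characters"
    note \<gamma>c = charactersD(1)[OF \<gamma>]
    have i1: "integrable m (\<lambda>z. f (a + z) * cnj (\<gamma> z))" and i2: "integrable m (\<lambda>z. f z * cnj (\<gamma> z))"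
      by (intro integrable_continuous continuous_intros ft f \<gamma>c)+
    have "(LINT z|m. f (a + z) * cnj (\<gamma> (a + z))) = (LINT z|m. f z * cnj (\<gamma> z))"
      by (rule integral_translation) (intro measurable_continuous continuous_intros f \<gamma>c)
    then have "(LINT z|m. f (a + z) * cnj (\<gamma> z)) = (LINT z|m. f z * cnj (\<gamma> z))"
      by (simp add: charactersD(3)[OF \<gamma>] a[OF \<gamma>])
    then show "fourier m (\<lambda>z. f (a + z) - f z) \<gamma> = 0"
      using i1 i2 by (simp add: fourier_def left_diff_distrib)
  qed
  from this[of 0] show False using g by (simp add: f_def)
qed

text \<open>Stone--Weierstrass for the algebra of real-valued trigonometric polynomials; the real
  and imaginary parts of characters separate points.\<close>

lemma tpoly_dense_real:
  fixes f :: "'a \<Rightarrow> real"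
  assumes f: "continuous_on UNIV f" and e: "0 < e"
  shows "\<exists>q. (\<lambda>x. complex_of_real (q x)) \<in> tpoly characters \<and> (\<forall>x. \<bar>f x - q x\<bar> < e)"
proof -
  let ?P = "\<lambda>r. (\<lambda>x. complex_of_real (r x)) \<in> tpoly (characters :: ('a \<Rightarrow> complex) set)"
  have "\<exists>g. ?P g \<and> (\<forall>x\<in>UNIV. \<bar>f x - g x\<bar> < e)"
  proof (rule Stone_Weierstrass_HOL[OF compact_UNIV, where P = ?P])
    show "?P (\<lambda>x. c)" for c
      using tpoly_scale[OF tpoly_base[OF characters_one], of "complex_of_real c"] by simp
    show "continuous_on UNIV r" if "?P r" for r
      using continuous_on_Re[OF tpoly_continuous[OF that]] by simp
    show "?P (\<lambda>x. r x + s x)" if "?P r \<and> ?P s" for r s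
      using tpoly_add[of "\<lambda>x. complex_of_real (r x)" _ "\<lambda>x. complex_of_real (s x)"] that by simp
    show "?P (\<lambda>x. r x * s x)" if "?P r \<and> ?P s" for r s
      using tpoly_mult[OF conjunct1[OF that] conjunct2[OF that] characters_mult] by simp
    show "\<exists>r. ?P r \<and> r x \<noteq> r y" if "x \<in> UNIV \<and> y \<in> UNIV \<and> x \<noteq> y" for x y :: 'a
    proof -
      have "x \<noteq> y" using that by simp
      from characters_separate[OF this] obtain \<gamma> where \<gamma>: "\<gamma> \<in> characters" "\<gamma> x \<noteq> \<gamma> y" by blast
      have "(\<lambda>x. (1/2) * \<gamma> x + (1/2) * cnj (\<gamma> x)) \<in> tpoly characters"
        "(\<lambda>x. (- \<i>/2) * \<gamma> x + (\<i>/2) * cnj (\<gamma> x)) \<in> tpoly characters"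
        by (intro tpoly_add tpoly_scale tpoly_base \<gamma> tpoly_cnj)+
      moreover have "(\<lambda>x. (1/2) * \<gamma> x + (1/2) * cnj (\<gamma> x)) = (\<lambda>x. complex_of_real (Re (\<gamma> x)))"
        "(\<lambda>x. (- \<i>/2) * \<gamma> x + (\<i>/2) * cnj (\<gamma> x)) = (\<lambda>x. complex_of_real (Im (\<gamma> x)))"
        by (auto simp: complex_eq_iff)
      ultimately have "?P (\<lambda>x. Re (\<gamma> x))" "?P (\<lambda>x. Im (\<gamma> x))" by simp_all
      moreover have "Re (\<gamma> x) \<noteq> Re (\<gamma> y) \<or> Im (\<gamma> x) \<noteq> Im (\<gamma> y)" using \<gamma>(2) by (auto simp: complex_eq_iff)
      ultimately show ?thesis
        using exI[of "\<lambda>r. ?P r \<and> r x \<noteq> r y" "\<lambda>x. Re (\<gamma> x)"]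
          exI[of "\<lambda>r. ?P r \<and> r x \<noteq> r y" "\<lambda>x. Im (\<gamma> x)"] by satx
    qed
  qed (use f e in auto)
  then show ?thesis by simp
qed

lemma tpoly_dense:
  assumes f: "cts f" and e: "0 < e"
  shows "\<exists>q\<in>tpoly characters. \<forall>x. norm (f x - q x) < e"
proof -
  obtain u where u: "(\<lambda>x. complex_of_real (u x)) \<in> tpoly characters" "\<forall>x. \<bar>Re (f x) - u x\<bar> < e / 2"
    using tpoly_dense_real[of "\<lambda>x. Re (f x)" "e / 2"] e continuous_on_Re[OF f] by auto
  obtain v where v: "(\<lambda>x. complex_of_real (v x)) \<in> tpoly characters" "\<forall>x. \<bar>Im (f x) - v x\<bar> < e / 2"
    using tpoly_dense_real[of "\<lambda>x. Im (f x)" "e / 2"] e continuous_on_Im[OF f] by auto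
  have "(\<lambda>x. complex_of_real (u x) + \<i> * complex_of_real (v x)) \<in> tpoly characters"
    by (intro tpoly_add tpoly_scale u v)
  moreover have "norm (f x - (complex_of_real (u x) + \<i> * complex_of_real (v x))) < e" for x
  proof -
    have "norm (f x - (complex_of_real (u x) + \<i> * complex_of_real (v x))) \<le> \<bar>Re (f x) - u x\<bar> + \<bar>Im (f x) - v x\<bar>"
      using cmod_le[of "f x - (complex_of_real (u x) + \<i> * complex_of_real (v x))"] by simp
    then show ?thesis using spec[OF u(2), of x] spec[OF v(2), of x] by linarith
  qed
  ultimately show ?thesis
    by (intro bexI[of _ "\<lambda>x. complex_of_real (u x) + \<i> * complex_of_real (v x)"] allI)
qed

end

section \<open>Fourier coefficients\<close>

lemma Lp_mult_bounded:
  assumes f: "f \<in> Lp m p" and [measurable]: "g \<in> borel_measurable m"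
    and "AE x in m. norm (g x) \<le> C" "0 \<le> C" "0 < p"
  shows "(\<lambda>x. g x * f x) \<in> Lp m p" "lp_norm m p (\<lambda>x. g x * f x) \<le> C * lp_norm m p f"
proof -
  note [measurable] = Lp_measurable[OF f]
  have "AE x in m. norm (g x * f x) \<le> C * norm (f x)"
    using assms(3) by eventually_elim (simp add: norm_mult mult_right_mono)
  then show "(\<lambda>x. g x * f x) \<in> Lp m p" "lp_norm m p (\<lambda>x. g x * f x) \<le> C * lp_norm m p f"
    using Lp_bounded[OF f, of "\<lambda>x. g x * f x" C] assms by auto
qed

lemma borel_measurable_cnj [measurable]:
  assumes "f \<in> borel_measurable M"
  shows "(\<lambda>x. cnj (f x)) \<in> borel_measurable M"
  by (rule measurable_compose[OF assms borel_measurable_continuous_onI]) (intro continuous_intros)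

lemma Lp_cnj:
  assumes "f \<in> Lp m p"
  shows "(\<lambda>x. cnj (f x)) \<in> Lp m p"
proof -
  note [measurable] = Lp_measurable[OF assms]
  have "(\<lambda>x. cnj (f x)) \<in> borel_measurable m" by measurable
  then show ?thesis using assms by (simp add: Lp_def)
qed

lemma fourier_cong_AE:
  assumes "AE x in m. f x = g x" "f \<in> borel_measurable m" "g \<in> borel_measurable m" "\<gamma> \<in> borel_measurable m"
  shows "fourier m f \<gamma> = fourier m g \<gamma>"
proof -
  note [measurable] = assms(2-4)
  have "AE x in m. f x * cnj (\<gamma> x) = g x * cnj (\<gamma> x)" using assms(1) by eventually_elim simp
  then show ?thesis unfolding fourier_def by (intro integral_cong_AE) measurable
qed

context compact_group_haar
begin

lemma integral_character:
  assumes "\<gamma> \<in> characters"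
  shows "(LINT x|m. \<gamma> x) = (if \<gamma> = (\<lambda>_. 1) then 1 else 0)"
proof (cases "\<gamma> = (\<lambda>_. 1)")
  case True
  then show ?thesis by simp
next
  case False
  then obtain a where a: "\<gamma> a \<noteq> 1" by auto
  have "(LINT x|m. \<gamma> (a + x)) = (LINT x|m. \<gamma> x)"
    by (rule integral_translation[OF measurable_continuous[OF charactersD(1)[OF assms]]])
  then have "\<gamma> a * (LINT x|m. \<gamma> x) = (LINT x|m. \<gamma> x)"
    by (simp add: charactersD(3)[OF assms])
  then show ?thesis using a False by auto
qed

lemma fourier_character:
  assumes "\<gamma> \<in> characters" "\<xi> \<in> characters"
  shows "fourier m \<gamma> \<xi> = (if \<gamma> = \<xi> then 1 else 0)"
proof -
  have "fourier m \<gamma> \<xi> = (LINT x|m. char_mult \<gamma> (char_inv \<xi>) x)"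
    by (simp add: fourier_def char_mult_def char_inv_eq[OF assms(2)])
  also have "\<dots> = (if char_mult \<gamma> (char_inv \<xi>) = (\<lambda>_. 1) then 1 else 0)"
    by (intro integral_character characters_mult characters_inv assms)
  also have "char_mult \<gamma> (char_inv \<xi>) = (\<lambda>_. 1) \<longleftrightarrow> \<gamma> = \<xi>"
  proof
    assume "char_mult \<gamma> (char_inv \<xi>) = (\<lambda>_. 1)"
    then have "char_mult (char_mult \<gamma> (char_inv \<xi>)) \<xi> = \<xi>" by simp
    then show "\<gamma> = \<xi>" using assms by (simp add: char_mult_assoc)
  qed (use assms in simp)
  finally show ?thesis .
qed

lemma Lp_character_mult:
  assumes f: "f \<in> Lp m p" and \<gamma>: "\<gamma> \<in> characters" and p: "0 < p"
  shows "(\<lambda>x. \<gamma> x * f x) \<in> Lp m p" "lp_norm m p (\<lambda>x. \<gamma> x * f x) = lp_norm m p f"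
proof -
  show "(\<lambda>x. \<gamma> x * f x) \<in> Lp m p"
    by (rule Lp_mult_bounded(1)[OF f measurable_continuous[OF charactersD(1)[OF \<gamma>]], of 1])
      (use p charactersD(2)[OF \<gamma>] in auto)
  show "lp_norm m p (\<lambda>x. \<gamma> x * f x) = lp_norm m p f"
    by (simp add: lp_norm_def norm_mult charactersD(2)[OF \<gamma>])
qed

lemma Lp_fourier_integrable:
  assumes f: "f \<in> Lp m p" and \<gamma>: "\<gamma> \<in> characters" and p: "1 < p"
  shows "integrable m (\<lambda>x. f x * cnj (\<gamma> x))" "norm (fourier m f \<gamma>) \<le> lp_norm m p f"
proof -
  have "(\<lambda>x. char_inv \<gamma> x * f x) \<in> Lp m p" "lp_norm m p (\<lambda>x. char_inv \<gamma> x * f x) = lp_norm m p f"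
    using Lp_character_mult[OF f characters_inv[OF \<gamma>]] p by auto
  then have *: "(\<lambda>x. f x * cnj (\<gamma> x)) \<in> Lp m p" "lp_norm m p (\<lambda>x. f x * cnj (\<gamma> x)) = lp_norm m p f"
    by (simp_all add: char_inv_eq[OF \<gamma>] mult.commute)
  show "integrable m (\<lambda>x. f x * cnj (\<gamma> x))" by (rule Lp_integrable_fn(1)[OF *(1) p])
  show "norm (fourier m f \<gamma>) \<le> lp_norm m p f"
    using Lp_integrable_fn(2)[OF *(1) p] *(2) by (simp add: fourier_def)
qed

lemma fourier_lincomb:
  assumes f: "f \<in> Lp m p" and g: "g \<in> Lp m p" and \<gamma>: "\<gamma> \<in> characters" and p: "1 < p"
  shows "fourier m (\<lambda>x. a * f x + b * g x) \<gamma> = a * fourier m f \<gamma> + b * fourier m g \<gamma>"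
proof -
  have "fourier m (\<lambda>x. a * f x + b * g x) \<gamma> = (LINT x|m. a * (f x * cnj (\<gamma> x)) + b * (g x * cnj (\<gamma> x)))"
    unfolding fourier_def by (intro Bochner_Integration.integral_cong) (auto simp: algebra_simps)
  then show ?thesis
    using Lp_fourier_integrable(1)[OF f \<gamma> p] Lp_fourier_integrable(1)[OF g \<gamma> p] by (simp add: fourier_def)
qed

lemma fourier_diff:
  assumes "f \<in> Lp m p" "g \<in> Lp m p" "\<gamma> \<in> characters" "1 < p"
  shows "fourier m (\<lambda>x. f x - g x) \<gamma> = fourier m f \<gamma> - fourier m g \<gamma>"
  using fourier_lincomb[OF assms, of 1 "-1"] by simp

lemma fourier_scale: "fourier m (\<lambda>x. a * f x) \<gamma> = a * fourier m f \<gamma>"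
  by (simp add: fourier_def mult.assoc)

lemma fourier_sum:
  assumes f: "\<And>i. i \<in> I \<Longrightarrow> f i \<in> Lp m p" and \<gamma>: "\<gamma> \<in> characters" and p: "1 < p"
  shows "fourier m (\<lambda>x. \<Sum>i\<in>I. f i x) \<gamma> = (\<Sum>i\<in>I. fourier m (f i) \<gamma>)"
  unfolding fourier_def sum_distrib_right
  by (intro Bochner_Integration.integral_sum Lp_fourier_integrable(1)[OF f \<gamma> p])

lemma fourier_lin_comb:
  assumes M: "finite M" "M \<subseteq> characters" and \<gamma>: "\<gamma> \<in> characters"
  shows "fourier m (lin_comb M c) \<gamma> = (if \<gamma> \<in> M then c \<gamma> else 0)"
proof -
  have "fourier m (lin_comb M c) \<gamma> = (\<Sum>\<xi>\<in>M. fourier m (\<lambda>x. c \<xi> * \<xi> x) \<gamma>)"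
    unfolding lin_comb_def
    by (rule fourier_sum[where p = 2])
      (use M charactersD(1) \<gamma> in \<open>auto intro!: Lp_scale Lp_continuous\<close>)
  also have "\<dots> = (\<Sum>\<xi>\<in>M. if \<xi> = \<gamma> then c \<gamma> else 0)"
  proof (rule sum.cong[OF refl])
    fix \<xi> assume "\<xi> \<in> M"
    then have "\<xi> \<in> characters" using M by auto
    then show "fourier m (\<lambda>x. c \<xi> * \<xi> x) \<gamma> = (if \<xi> = \<gamma> then c \<gamma> else 0)"
      unfolding fourier_scale using fourier_character \<gamma> by auto
  qed
  also have "\<dots> = (if \<gamma> \<in> M then c \<gamma> else 0)" using M(1) by simp
  finally show ?thesis .
qed

lemma fourier_char_mult:
  assumes \<gamma>: "\<gamma> \<in> characters" and \<xi>: "\<xi> \<in> characters"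
  shows "fourier m (\<lambda>x. \<xi> x * f x) \<gamma> = fourier m f (char_mult \<gamma> (char_inv \<xi>))"
  unfolding fourier_def
  by (intro Bochner_Integration.integral_cong) (auto simp: char_mult_def char_inv_eq[OF \<xi>])

lemma tpoly_Lp: "f \<in> tpoly S \<Longrightarrow> S \<subseteq> characters \<Longrightarrow> 0 < p \<Longrightarrow> f \<in> Lp m p"
  by (intro Lp_continuous tpoly_continuous)

lemma tpoly_dense_Lp:
  assumes f: "f \<in> Lp m p" and p: "1 \<le> p" and e: "0 < e"
  shows "\<exists>q\<in>tpoly characters. lp_norm m p (\<lambda>x. f x - q x) < e"
proof -
  obtain g where g: "cts g" "lp_norm m p (\<lambda>x. f x - g x) < e / 2"
    using continuous_dense_Lp[OF f p, of "e / 2"] e by auto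
  obtain q where q: "q \<in> tpoly characters" "\<forall>x. norm (g x - q x) < e / 2"
    using tpoly_dense[OF g(1), of "e / 2"] e by auto
  have qc: "cts q" by (rule tpoly_continuous[OF q(1)]) simp
  have "cts (\<lambda>x. g x - q x)" by (intro continuous_intros g qc)
  then have "lp_norm m p (\<lambda>x. g x - q x) \<le> e / 2"
    using q(2) p by (intro lp_norm_le_const measurable_continuous) (auto simp: less_imp_le)
  moreover have "g \<in> Lp m p" "q \<in> Lp m p" using g qc p by (auto intro: Lp_continuous)
  ultimately have "lp_norm m p (\<lambda>x. f x - q x) < e"
    using lp_norm_triangle3[OF f _ _ p, of g q] g(2) by linarith
  then show ?thesis using q(1) by blast
qed

text \<open>f annihilates all polynomials. They approximate the bounded function \<open>h\<close>,
  the conjugate phase of f, in the dual exponent, and the integral of f h is the integral of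
  |f|.\<close>

lemma fourier_unique_zero:
  assumes f: "f \<in> Lp m p" and p: "1 < p" and zero: "\<And>\<gamma>. \<gamma> \<in> characters \<Longrightarrow> fourier m f \<gamma> = 0"
  shows "AE x in m. f x = 0"
proof -
  obtain q where q: "1 < q" "1 / p + 1 / q = 1" using exponent_conjugate[OF p] .
  note [measurable] = Lp_measurable[OF f]
  have prod: "integrable m (\<lambda>x. f x * h x)" if "h \<in> Lp m q" for h
    by (rule Hoelder(1)[OF f that p q])
  have poly: "(LINT x|m. f x * h x) = 0" if "h \<in> tpoly characters" for h
    using that
  proof (induction rule: tpoly_induct)
    case (add c \<gamma> g)
    have 1: "integrable m (\<lambda>x. f x * \<gamma> x)" "integrable m (\<lambda>x. f x * g x)"
      using prod[OF Lp_continuous[OF charactersD(1)[OF add(1)]]] prod[OF tpoly_Lp[OF add(2)]] q by auto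
    have "fourier m f (char_inv \<gamma>) = (LINT x|m. f x * \<gamma> x)"
      by (simp add: fourier_def char_inv_eq[OF add(1)])
    then have 2: "(LINT x|m. f x * \<gamma> x) = 0" using zero[OF characters_inv[OF add(1)]] by simp
    have "(LINT x|m. f x * (c * \<gamma> x + g x)) = (LINT x|m. c * (f x * \<gamma> x) + f x * g x)"
      by (intro Bochner_Integration.integral_cong) (auto simp: algebra_simps)
    then show ?case using 1 2 add.IH by simp
  qed simp
  define h where "h x = cnj (f x) / complex_of_real (norm (f x))" for x
  have hm [measurable]: "h \<in> borel_measurable m" unfolding h_def by measurable
  have hL: "h \<in> Lp m q"
    by (rule Lp_boundedI[OF hm, of 1]) (use q in \<open>auto simp: h_def norm_divide\<close>)
  have fh: "f x * h x = complex_of_real (norm (f x))" for x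
    by (cases "f x = 0") (auto simp: h_def complex_norm_square[symmetric] power2_eq_square)
  have "norm (LINT x|m. f x * h x) \<le> e" if e: "0 < e" for e
  proof -
    define K where "K = lp_norm m p f + 1"
    have K: "0 < K" "lp_norm m p f \<le> K" by (auto simp: K_def add_nonneg_pos)
    obtain w where w: "w \<in> tpoly characters" "lp_norm m q (\<lambda>x. h x - w x) < e / K"
      using tpoly_dense_Lp[OF hL, of "e / K"] q e K by auto
    have wL: "w \<in> Lp m q" using tpoly_Lp[OF w(1)] q by simp
    have "(LINT x|m. f x * h x) = (LINT x|m. f x * h x) - (LINT x|m. f x * w x)" using poly[OF w(1)] by simp
    also have "\<dots> = (LINT x|m. f x * (h x - w x))"
      using prod[OF hL] prod[OF wL] by (simp add: right_diff_distrib)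
    finally have "norm (LINT x|m. f x * h x) \<le> lp_norm m p f * lp_norm m q (\<lambda>x. h x - w x)"
      using Hoelder_integral[OF f Lp_diff[OF hL wL] p q] q by simp
    also have "\<dots> \<le> K * (e / K)" using K w(2) by (intro mult_mono) auto
    finally show ?thesis using K by simp
  qed
  then have "norm (LINT x|m. f x * h x) \<le> 0" by (metis field_le_epsilon add_0)
  then have "(LINT x|m. f x * h x) = 0" by simp
  then have "(LINT x|m. complex_of_real (norm (f x))) = 0" unfolding fh .
  then have "(LINT x|m. norm (f x)) = 0" by (simp only: integral_complex_of_real of_real_eq_0_iff)
  then have "AE x in m. norm (f x) = 0"
    using Lp_integrable_fn(1)[OF f p] by (subst (asm) integral_nonneg_eq_0_iff_AE) auto
  then show ?thesis by simp
qed

lemma fourier_unique: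
  assumes f: "f \<in> Lp m p" and g: "g \<in> Lp m p" and p: "1 < p"
    and eq: "\<And>\<gamma>. \<gamma> \<in> characters \<Longrightarrow> fourier m f \<gamma> = fourier m g \<gamma>"
  shows "AE x in m. f x = g x"
proof -
  have "AE x in m. f x - g x = 0"
    using p fourier_diff[OF f g _ p] eq by (intro fourier_unique_zero[OF Lp_diff[OF f g] p]) auto
  then show ?thesis by simp
qed

lemma fourier_tendsto:
  assumes F: "\<And>n. F n \<in> Lp m p" and f: "f \<in> Lp m p" and p: "1 < p" and \<gamma>: "\<gamma> \<in> characters"
    and lim: "(\<lambda>n. lp_norm m p (\<lambda>x. F n x - f x)) \<longlonglongrightarrow> 0"
  shows "(\<lambda>n. fourier m (F n) \<gamma>) \<longlonglongrightarrow> fourier m f \<gamma>"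
proof -
  have "(\<lambda>n. fourier m (F n) \<gamma> - fourier m f \<gamma>) \<longlonglongrightarrow> 0"
  proof (rule Lim_null_comparison[OF _ lim], intro always_eventually allI)
    fix n
    show "norm (fourier m (F n) \<gamma> - fourier m f \<gamma>) \<le> lp_norm m p (\<lambda>x. F n x - f x)"
      using Lp_fourier_integrable(2)[OF Lp_diff[OF F f] \<gamma> p] fourier_diff[OF F f \<gamma> p] p by simp
  qed
  then show ?thesis by (simp add: LIM_zero_iff)
qed

lemma lp_norm_tendsto:
  assumes F: "\<And>n. F n \<in> Lp m p" and f: "f \<in> Lp m p" and p: "1 \<le> p"
    and lim: "(\<lambda>n. lp_norm m p (\<lambda>x. F n x - f x)) \<longlonglongrightarrow> 0"
  shows "(\<lambda>n. lp_norm m p (F n)) \<longlonglongrightarrow> lp_norm m p f"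
proof -
  have "(\<lambda>n. lp_norm m p (F n) - lp_norm m p f) \<longlonglongrightarrow> 0"
  proof (rule Lim_null_comparison[OF _ lim], intro always_eventually allI)
    fix n
    show "norm (lp_norm m p (F n) - lp_norm m p f) \<le> lp_norm m p (\<lambda>x. F n x - f x)"
      using lp_norm_triangle_sub[OF F f p, of n] lp_norm_triangle_sub[OF f F p, of n]
        lp_norm_minus_commute[of m p f "F n"] by (simp add: abs_le_iff)
  qed
  then show ?thesis by (simp add: LIM_zero_iff)
qed

section \<open>Hardy spaces\<close>

lemma Hp_Lp: "f \<in> Hp m T p \<Longrightarrow> f \<in> Lp m p"
  by (simp add: Hp_def)

lemma Hp_fourier: "f \<in> Hp m T p \<Longrightarrow> \<gamma> \<in> characters \<Longrightarrow> \<gamma> \<notin> T \<Longrightarrow> fourier m f \<gamma> = 0"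
  by (simp add: Hp_def)

lemma Hp_zero [simp]: "(\<lambda>x. 0) \<in> Hp m T p"
  by (simp add: Hp_def fourier_def)

lemma Hp_lincomb:
  assumes "f \<in> Hp m T p" "g \<in> Hp m T p" "1 < p"
  shows "(\<lambda>x. a * f x + b * g x) \<in> Hp m T p"
  using assms fourier_lincomb[of f p g _ a b] by (auto simp: Hp_def Lp_lincomb)

lemma Hp_scale: "f \<in> Hp m T p \<Longrightarrow> (\<lambda>x. a * f x) \<in> Hp m T p"
  by (auto simp: Hp_def Lp_scale fourier_scale)

lemma Hp_add: "f \<in> Hp m T p \<Longrightarrow> g \<in> Hp m T p \<Longrightarrow> 1 < p \<Longrightarrow> (\<lambda>x. f x + g x) \<in> Hp m T p"
  using Hp_lincomb[of f T p g 1 1] by simp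

lemma Hp_diff: "f \<in> Hp m T p \<Longrightarrow> g \<in> Hp m T p \<Longrightarrow> 1 < p \<Longrightarrow> (\<lambda>x. f x - g x) \<in> Hp m T p"
  using Hp_lincomb[of f T p g 1 "-1"] by simp

lemma Hp_sum:
  assumes "\<And>i. i \<in> I \<Longrightarrow> f i \<in> Hp m T p" "1 < p"
  shows "(\<lambda>x. \<Sum>i\<in>I. f i x) \<in> Hp m T p"
  using assms by (induction I rule: infinite_finite_induct) (auto intro: Hp_add)

lemma Hp_closed:
  assumes F: "\<And>n. F n \<in> Hp m T p" and f: "f \<in> Lp m p" and p: "1 < p"
    and lim: "(\<lambda>n. lp_norm m p (\<lambda>x. F n x - f x)) \<longlonglongrightarrow> 0"
  shows "f \<in> Hp m T p"
proof -
  have "fourier m f \<gamma> = 0" if \<gamma>: "\<gamma> \<in> characters - T" for \<gamma>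
  proof -
    have "(\<lambda>n. fourier m (F n) \<gamma>) \<longlonglongrightarrow> fourier m f \<gamma>"
      using \<gamma> by (intro fourier_tendsto[OF Hp_Lp[OF F] f p _ lim]) auto
    moreover have "fourier m (F n) \<gamma> = 0" for n using Hp_fourier[OF F] \<gamma> by auto
    ultimately show ?thesis using LIMSEQ_unique[OF _ tendsto_const] by simp
  qed
  then show ?thesis using f by (simp add: Hp_def)
qed

lemma tpoly_Hp:
  assumes "f \<in> tpoly T" "T \<subseteq> characters" "0 < p"
  shows "f \<in> Hp m T p"
proof -
  obtain M c where M: "finite M" "M \<subseteq> T" "f = lin_comb M c" using assms(1) by (auto simp: tpoly_def)
  then have "fourier m f \<gamma> = 0" if "\<gamma> \<in> characters - T" for \<gamma>
    using fourier_lin_comb[of M \<gamma> c] that assms(2) by auto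
  then show ?thesis using tpoly_Lp[OF assms] by (simp add: Hp_def)
qed

lemma parallelogram_orthogonal:
  assumes f: "cts f" and g: "cts g" and orth: "(LINT x|m. f x * cnj (g x)) = 0"
  shows "(l2 (\<lambda>x. f x + g x))\<^sup>2 = (l2 f)\<^sup>2 + (l2 g)\<^sup>2"
proof -
  have i: "integrable m (\<lambda>x. (norm (f x))\<^sup>2)" "integrable m (\<lambda>x. (norm (g x))\<^sup>2)"
    "integrable m (\<lambda>x. f x * cnj (g x))"
    by (intro integrable_continuous continuous_intros f g)+
  define r where "r = (\<lambda>x. Re (f x * cnj (g x)))"
  have pt: "(norm (f x + g x))\<^sup>2 = (norm (f x))\<^sup>2 + (norm (g x))\<^sup>2 + 2 * r x" for x
    unfolding cmod_power2 r_def by (simp add: power2_eq_square algebra_simps)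
  have "(LINT x|m. Re (f x * cnj (g x))) = Re (LINT x|m. f x * cnj (g x))"
    by (rule integral_Re[OF i(3)])
  then have r0: "(LINT x|m. r x) = 0" unfolding r_def orth by simp
  have ri: "integrable m r" unfolding r_def using i(3) by (rule integrable_Re)
  show ?thesis unfolding l2_square pt using i ri r0 by simp
qed

lemma integral_tpoly_fourier_zero:
  assumes f: "f \<in> Lp m p" and p: "1 < p" and S: "S \<subseteq> characters" and g: "g \<in> tpoly S"
    and zero: "\<And>\<gamma>. \<gamma> \<in> S \<Longrightarrow> fourier m f \<gamma> = 0"
  shows "(LINT x|m. f x * cnj (g x)) = 0"
  using g
proof (induction rule: tpoly_induct)
  case (add c \<gamma> g)
  have \<gamma>: "\<gamma> \<in> characters" using add(1) S by auto
  obtain q where q: "1 < q" "1 / p + 1 / q = 1" using exponent_conjugate[OF p] .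
  have 1: "integrable m (\<lambda>x. f x * cnj (\<gamma> x))" by (rule Lp_fourier_integrable(1)[OF f \<gamma> p])
  have "(\<lambda>x. cnj (g x)) \<in> Lp m q" using tpoly_Lp[OF add(2) S] q by (intro Lp_cnj) auto
  then have 2: "integrable m (\<lambda>x. f x * cnj (g x))" using Hoelder(1)[OF f _ p q] by auto
  have "(LINT x|m. f x * cnj (c * \<gamma> x + g x)) = (LINT x|m. cnj c * (f x * cnj (\<gamma> x)) + f x * cnj (g x))"
    by (intro Bochner_Integration.integral_cong) (auto simp: algebra_simps)
  then show ?case using 1 2 add.IH zero[OF add(1)] by (simp add: fourier_def)
qed simp

end

section \<open>Riesz projection of trigonometric polynomials\<close>

locale ordered_dual = compact_group_haar m
  for m :: "'a::{topological_ab_group_add, t2_space} measure" +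
  fixes T :: "('a \<Rightarrow> complex) set"
  assumes cone: "positive_cone T" and linear: "linearly_ordered T"
begin

lemma T_sub: "T \<subseteq> characters"
  using cone by (simp add: positive_cone_def)

lemma T_char: "\<gamma> \<in> T \<Longrightarrow> \<gamma> \<in> characters"
  using T_sub by blast

lemma T_mult: "\<gamma> \<in> T \<Longrightarrow> \<xi> \<in> T \<Longrightarrow> char_mult \<gamma> \<xi> \<in> T"
  using cone by (simp add: positive_cone_def)

lemma T_one [simp]: "(\<lambda>_. 1) \<in> T"
  using cone by (simp add: positive_cone_def)

lemma T_antisym:
  assumes "\<gamma> \<in> T" "char_inv \<gamma> \<in> T"
  shows "\<gamma> = (\<lambda>_. 1)"
proof -
  have "\<gamma> \<in> T \<inter> char_inv ` T"
    using assms image_eqI[of \<gamma> char_inv "char_inv \<gamma>" T] by simp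
  moreover have "T \<inter> char_inv ` T = {\<lambda>_. 1}" using cone by (simp add: positive_cone_def)
  ultimately show ?thesis by simp
qed

lemma T_total:
  assumes "\<gamma> \<in> characters" "\<gamma> \<notin> T"
  shows "char_inv \<gamma> \<in> T"
proof -
  have "\<gamma> \<in> T \<union> char_inv ` T" using linear assms(1) by (simp add: linearly_ordered_def)
  then show ?thesis using assms(2) by auto
qed

lemma T_mult_eq_one:
  assumes "\<gamma> \<in> T" "\<xi> \<in> T" "char_mult \<gamma> \<xi> = (\<lambda>_. 1)"
  shows "\<gamma> = (\<lambda>_. 1)" "\<xi> = (\<lambda>_. 1)"
proof -
  have "char_mult (char_inv \<gamma>) (char_mult \<gamma> \<xi>) = char_inv \<gamma>" unfolding assms(3) by simp
  then have "\<xi> = char_inv \<gamma>" using T_char[OF assms(1)] by simp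
  then show "\<gamma> = (\<lambda>_. 1)" using T_antisym assms by simp
  then show "\<xi> = (\<lambda>_. 1)" using assms(3) by simp
qed

text \<open>A product of two characters in T is trivial only if both are, so on such characters, and
  then on their linear span, the mean is multiplicative.\<close>

lemma integral_tpoly_mult:
  assumes f: "f \<in> tpoly T" and g: "g \<in> tpoly T"
  shows "(LINT x|m. f x * g x) = (LINT x|m. f x) * (LINT x|m. g x)"
proof -
  have int: "integrable m h" if "h \<in> tpoly T" for h
    by (intro integrable_continuous tpoly_continuous[OF that T_sub])
  have intT: "integrable m h" if "h \<in> T" for h
    using int[OF tpoly_base[OF that]] .
  have int2: "integrable m (\<lambda>x. h x * k x)" if "h \<in> tpoly T" "k \<in> tpoly T" for h k
    using int[OF tpoly_mult[OF that T_mult]] .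
  have 1: "(LINT x|m. \<gamma> x * h x) = (LINT x|m. \<gamma> x) * (LINT x|m. h x)" if \<gamma>: "\<gamma> \<in> T" and h: "h \<in> tpoly T" for \<gamma> h
    using h
  proof (induction rule: tpoly_induct)
    case (add c \<xi> k)
    have "(LINT x|m. char_mult \<gamma> \<xi> x) = (LINT x|m. \<gamma> x) * (LINT x|m. \<xi> x)"
      using T_mult_eq_one[OF \<gamma> add(1)] T_mult[OF \<gamma> add(1)] \<gamma> add(1) by (auto simp: integral_character T_char)
    then have e: "(LINT x|m. \<gamma> x * \<xi> x) = (LINT x|m. \<gamma> x) * (LINT x|m. \<xi> x)" by (simp add: char_mult_def)
    have "(LINT x|m. \<gamma> x * (c * \<xi> x + k x)) = (LINT x|m. c * (\<gamma> x * \<xi> x) + \<gamma> x * k x)"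
      by (intro Bochner_Integration.integral_cong) (auto simp: algebra_simps)
    also have "\<dots> = c * (LINT x|m. \<gamma> x * \<xi> x) + (LINT x|m. \<gamma> x * k x)"
      using int2[OF tpoly_base[OF \<gamma>] tpoly_base[OF add(1)]] int2[OF tpoly_base[OF \<gamma>] add(2)] by simp
    also have "\<dots> = (LINT x|m. \<gamma> x) * (LINT x|m. c * \<xi> x + k x)"
      using intT[OF add(1)] int[OF add(2)] by (simp add: e add.IH algebra_simps)
    finally show ?case .
  qed simp
  show ?thesis using f
  proof (induction rule: tpoly_induct)
    case (add c \<xi> k)
    have "(LINT x|m. (c * \<xi> x + k x) * g x) = (LINT x|m. c * (\<xi> x * g x) + k x * g x)"
      by (intro Bochner_Integration.integral_cong) (auto simp: algebra_simps)
    also have "\<dots> = c * (LINT x|m. \<xi> x * g x) + (LINT x|m. k x * g x)"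
      using int2[OF tpoly_base[OF add(1)] g] int2[OF add(2) g] by simp
    also have "\<dots> = (LINT x|m. c * \<xi> x + k x) * (LINT x|m. g x)"
      using intT[OF add(1)] int[OF add(2)] by (simp add: 1[OF add(1) g] add.IH distrib_right mult.assoc)
    finally show ?case .
  qed simp
qed

lemma tpoly_power: "f \<in> tpoly T \<Longrightarrow> (\<lambda>x. f x ^ n) \<in> tpoly T"
proof (induction n)
  case 0
  then show ?case using tpoly_base[OF T_one] by simp
next
  case (Suc n)
  then show ?case using tpoly_mult[of f T "\<lambda>x. f x ^ n"] T_mult by simp
qed

lemma integral_tpoly_power: "f \<in> tpoly T \<Longrightarrow> (LINT x|m. f x ^ n) = (LINT x|m. f x) ^ n"
  by (induction n) (auto simp: integral_tpoly_mult tpoly_power)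

text \<open>The real power of an analytic polynomial with values in a disc around \<open>1\<close> is a uniform limit
  of analytic polynomials, on which the mean is multiplicative.\<close>

lemma integral_tpoly_powr:
  fixes p :: real
  assumes g: "g \<in> tpoly T" and \<rho>: "\<rho> < 1" and gb: "\<And>x. norm (g x) \<le> \<rho>"
  shows "(LINT x|m. (1 + g x) powr (of_real p)) = (1 + (LINT x|m. g x)) powr (of_real p)"
    "integrable m (\<lambda>x. (1 + g x) powr (of_real p))"
proof -
  have gc: "cts g" by (rule tpoly_continuous[OF g T_sub])
  have \<rho>0: "0 \<le> \<rho>" using gb[of 0] norm_ge_zero order_trans by blast
  define a where "a n = (complex_of_real p gchoose n)" for n
  \<comment> \<open>A point strictly between \<rho> and 1: convergence of the binomial series there
    gives its absolute convergence at \<rho>.\<close>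
  define t where "t = (\<rho> + 1) / 2"
  have t: "\<rho> < t" "t < 1" "0 < t" using \<rho> \<rho>0 by (auto simp: t_def)
  have "summable (\<lambda>n. a n * complex_of_real t ^ n)"
    using gen_binomial_complex[of "complex_of_real t" "complex_of_real p"] t
    by (auto simp: a_def sums_iff)
  then have sm: "summable (\<lambda>n. norm (a n * complex_of_real \<rho> ^ n))"
    by (rule powser_insidea) (use t \<rho>0 in auto)
  have gn: "norm (g x) < 1" for x using gb[of x] \<rho> by simp
  have pt: "(\<lambda>n. a n * g x ^ n) sums (1 + g x) powr (of_real p)" for x
    unfolding a_def by (rule gen_binomial_complex[OF gn])
  have bnd: "norm (a n * g x ^ n) \<le> norm (a n * complex_of_real \<rho> ^ n)" for n x
    using gb[of x] \<rho>0 by (auto simp: norm_mult norm_power intro!: mult_left_mono power_mono)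
  have int: "integrable m (\<lambda>x. a n * g x ^ n)" for n
    by (intro integrable_continuous continuous_intros gc)
  have s1: "AE x in m. summable (\<lambda>n. norm (a n * g x ^ n))"
    by (intro AE_I2 summable_comparison_test[OF _ sm]) (use bnd in auto)
  have s2: "summable (\<lambda>n. LINT x|m. norm (a n * g x ^ n))"
  proof (rule summable_comparison_test[OF _ sm], intro exI allI impI)
    fix n :: nat
    have "(LINT x|m. norm (a n * g x ^ n)) \<le> (LINT x|m. norm (a n * complex_of_real \<rho> ^ n))"
      using int[of n] bnd by (intro integral_mono) auto
    then show "norm (LINT x|m. norm (a n * g x ^ n)) \<le> norm (a n * complex_of_real \<rho> ^ n)" by simp
  qed
  have eq: "(\<Sum>n. a n * g x ^ n) = (1 + g x) powr (of_real p)" for x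
    using pt[of x] by (simp add: sums_iff)
  have "(\<lambda>n. LINT x|m. a n * g x ^ n) sums (LINT x|m. (\<Sum>n. a n * g x ^ n))"
    by (rule sums_integral[OF int s1 s2])
  then have "(\<lambda>n. a n * (LINT x|m. g x) ^ n) sums (LINT x|m. (1 + g x) powr (of_real p))"
    unfolding eq using integral_tpoly_power[OF g] by simp
  moreover have "(\<lambda>n. a n * (LINT x|m. g x) ^ n) sums (1 + (LINT x|m. g x)) powr (of_real p)"
    unfolding a_def
  proof (rule gen_binomial_complex)
    have "norm (LINT x|m. g x) \<le> (LINT x|m. norm (g x))" by (rule integral_norm_bound)
    also have "\<dots> \<le> (LINT x|m. \<rho>)"
      using gb by (intro integral_mono integrable_continuous continuous_intros gc) auto
    finally show "norm (LINT x|m. g x) < 1" using \<rho> by simp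
  qed
  ultimately show "(LINT x|m. (1 + g x) powr (of_real p)) = (1 + (LINT x|m. g x)) powr (of_real p)"
    by (rule sums_unique2)
  show "integrable m (\<lambda>x. (1 + g x) powr (of_real p))"
    using integrable_suminf[OF int s1 s2] unfolding eq .
qed

text \<open>The projection is kept as a relation given by Fourier coefficients, so that it does not
  depend on a representation \<open>lin_comb M c\<close> of the polynomial.\<close>

definition riesz_pair :: "('a \<Rightarrow> complex) \<Rightarrow> ('a \<Rightarrow> complex) \<Rightarrow> bool" where
  "riesz_pair f g \<longleftrightarrow> f \<in> tpoly characters \<and> g \<in> tpoly T \<and> (\<forall>\<gamma>\<in>T. fourier m g \<gamma> = fourier m f \<gamma>)"

lemma riesz_pair_lin_comb:
  assumes "finite M" "M \<subseteq> characters"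
  shows "riesz_pair (lin_comb M c) (lin_comb (M \<inter> T) c)"
  unfolding riesz_pair_def
proof (intro conjI ballI)
  fix \<gamma> assume "\<gamma> \<in> T"
  then show "fourier m (lin_comb (M \<inter> T) c) \<gamma> = fourier m (lin_comb M c) \<gamma>"
    using fourier_lin_comb[of "M \<inter> T" \<gamma> c] fourier_lin_comb[of M \<gamma> c] assms T_char[of \<gamma>]
      le_infI1[OF assms(2), of T] by simp
qed (use assms in \<open>auto intro!: tpolyI\<close>)

lemma riesz_pair_exists:
  assumes "f \<in> tpoly characters"
  shows "\<exists>g. riesz_pair f g"
proof -
  obtain M c where "finite M" "M \<subseteq> characters" "f = lin_comb M c"
    using assms by (auto simp: tpoly_def)
  then show ?thesis using riesz_pair_lin_comb by blast
qed

lemma riesz_pair_lincomb: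
  assumes "riesz_pair f g" "riesz_pair f' g'"
  shows "riesz_pair (\<lambda>x. a * f x + b * f' x) (\<lambda>x. a * g x + b * g' x)"
proof -
  have L: "f \<in> Lp m 2" "f' \<in> Lp m 2" "g \<in> Lp m 2" "g' \<in> Lp m 2"
    using assms T_sub by (auto simp: riesz_pair_def intro!: tpoly_Lp)
  show ?thesis
    unfolding riesz_pair_def
  proof (intro conjI ballI)
    show "(\<lambda>x. a * f x + b * f' x) \<in> tpoly characters" "(\<lambda>x. a * g x + b * g' x) \<in> tpoly T"
      using assms by (auto simp: riesz_pair_def intro!: tpoly_add tpoly_scale)
    fix \<gamma> assume \<gamma>: "\<gamma> \<in> T"
    show "fourier m (\<lambda>x. a * g x + b * g' x) \<gamma> = fourier m (\<lambda>x. a * f x + b * f' x) \<gamma>"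
      using fourier_lincomb[OF L(1,2) T_char[OF \<gamma>]] fourier_lincomb[OF L(3,4) T_char[OF \<gamma>]] assms \<gamma>
      by (simp add: riesz_pair_def)
  qed
qed

lemma riesz_pair_fourier_off:
  assumes "riesz_pair f g" "\<gamma> \<in> characters" "\<gamma> \<notin> T"
  shows "fourier m g \<gamma> = 0"
  using assms Hp_fourier[OF tpoly_Hp[OF _ T_sub, of g 2]] by (auto simp: riesz_pair_def)

lemma riesz_pair_unique:
  assumes "riesz_pair f g" "riesz_pair f h"
  shows "g = h"
proof
  fix x
  have gh: "g \<in> tpoly T" "h \<in> tpoly T" using assms by (auto simp: riesz_pair_def)
  have c: "cts (\<lambda>x. g x - h x)" by (intro continuous_intros tpoly_continuous[OF _ T_sub] gh)
  have L: "g \<in> Lp m 2" "h \<in> Lp m 2" using gh T_sub by (auto intro!: tpoly_Lp)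
  have "g x - h x = 0"
  proof (rule fourier_zero_continuous[OF c])
    fix \<gamma> :: "'a \<Rightarrow> complex" assume \<gamma>: "\<gamma> \<in> characters"
    show "fourier m (\<lambda>x. g x - h x) \<gamma> = 0"
    proof (cases "\<gamma> \<in> T")
      case True
      then show ?thesis using fourier_diff[OF L \<gamma>] assms by (simp add: riesz_pair_def)
    next
      case False
      then show ?thesis using fourier_diff[OF L \<gamma>] riesz_pair_fourier_off assms \<gamma> by simp
    qed
  qed
  then show "g x = h x" by simp
qed

text \<open>f - g is orthogonal to g. The bound later absorbs a uniformly small approximation error
  in the inequality for p \<le> 2.\<close>

lemma riesz_pair_l2:
  assumes "riesz_pair f g"
  shows "l2 g \<le> l2 f"
proof -
  have fg: "f \<in> tpoly characters" "g \<in> tpoly T" using assms by (auto simp: riesz_pair_def)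
  have c: "cts f" "cts g" using tpoly_continuous[OF fg(1)] tpoly_continuous[OF fg(2) T_sub] by auto
  have dc: "cts (\<lambda>x. f x - g x)" by (intro continuous_intros c)
  have L: "f \<in> Lp m 2" "g \<in> Lp m 2" using c by (auto intro: Lp_continuous)
  have "(LINT x|m. (f x - g x) * cnj (g x)) = 0"
  proof (rule integral_tpoly_fourier_zero[OF Lp_diff[OF L] _ T_sub fg(2)])
    fix \<gamma> assume \<gamma>: "\<gamma> \<in> T"
    show "fourier m (\<lambda>x. f x - g x) \<gamma> = 0"
      using fourier_diff[OF L T_char[OF \<gamma>]] assms \<gamma> by (simp add: riesz_pair_def)
  qed auto
  then have "(l2 (\<lambda>x. (f x - g x) + g x))\<^sup>2 = (l2 (\<lambda>x. f x - g x))\<^sup>2 + (l2 g)\<^sup>2"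
    by (rule parallelogram_orthogonal[OF dc c(2)])
  then have "(l2 g)\<^sup>2 \<le> (l2 f)\<^sup>2" by simp
  then show ?thesis by (rule power2_le_imp_le) simp
qed

end

section \<open>The M. Riesz inequality\<close>

text \<open>Near the ends of the interval cos \<theta> is too small to help, but there cos (p
  \<theta>) is negative because p > 1; away from the ends cos \<theta> is bounded below and a large
  A also pays for the term with B.\<close>

lemma cos_powr_bound:
  fixes p :: real
  assumes p: "1 < p" "p \<le> 2"
  shows "\<exists>A B. 0 \<le> A \<and> 0 \<le> B \<and> (\<forall>\<theta>. \<bar>\<theta>\<bar> < pi / 2 \<longrightarrow> 1 \<le> A * cos \<theta> powr p - B * cos (p * \<theta>))"
proof -
  \<comment> \<open>The midpoint of pi / (2 p), where cos (p \<theta>) changes sign, and pi / 2.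
    Since p \<le> 2, the argument p \<bar>\<theta>\<bar> does not exceed pi, so the cosine is still
    decreasing there.\<close>
  define s where "s = (pi / 2 + pi / (2 * p)) / 2"
  have ps: "p * s = (p + 1) * pi / 4" using p by (simp add: s_def field_simps)
  have "0 < s" unfolding s_def using p by (intro divide_pos_pos add_pos_pos) auto
  moreover have "s < pi / 2" using p by (simp add: s_def field_simps)
  ultimately have s: "0 < s" "s < pi / 2" by simp_all
  have ps1: "pi / 2 < p * s" "p * s \<le> pi"
    using p pi_gt_zero unfolding ps by (auto simp: field_simps)
  define b where "b = - cos (p * s)"
  have b: "0 < b"
    using cos_monotone_0_pi[of "pi / 2" "p * s"] ps1 by (simp add: b_def)
  define B where "B = 1 / b"
  have cs: "0 < cos s" using s by (intro cos_gt_zero) auto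
  define A where "A = (1 + B) / cos s powr p"
  have AB: "0 \<le> A" "0 \<le> B" using b by (auto simp: A_def B_def)
  have "1 \<le> A * cos \<theta> powr p - B * cos (p * \<theta>)" if \<theta>: "\<bar>\<theta>\<bar> < pi / 2" for \<theta>
  proof (cases "s \<le> \<bar>\<theta>\<bar>")
    case True
    have "p * \<bar>\<theta>\<bar> \<le> 2 * (pi / 2)" using p \<theta> by (intro mult_mono) auto
    then have "cos (p * \<bar>\<theta>\<bar>) \<le> cos (p * s)"
      using True p ps1 pi_gt_zero s by (intro cos_monotone_0_pi_le mult_left_mono) auto
    moreover have "cos (p * \<bar>\<theta>\<bar>) = cos (p * \<theta>)" by (cases "0 \<le> \<theta>") auto
    ultimately have "b \<le> - cos (p * \<theta>)" by (simp add: b_def)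
    then have "B * b \<le> B * (- cos (p * \<theta>))" using AB by (intro mult_left_mono) auto
    then have "1 \<le> - B * cos (p * \<theta>)" using b by (simp add: B_def)
    moreover have "0 \<le> A * cos \<theta> powr p" using AB by simp
    ultimately show ?thesis by simp
  next
    case False
    have "cos s \<le> cos \<bar>\<theta>\<bar>" using False s by (intro cos_monotone_0_pi_le) auto
    then have "cos s \<le> cos \<theta>" by simp
    then have "A * cos s powr p \<le> A * cos \<theta> powr p"
      using AB cs p by (intro mult_left_mono powr_mono2) auto
    moreover have "A * cos s powr p = 1 + B" using cs by (simp add: A_def)
    moreover have "B * cos (p * \<theta>) \<le> B * 1" using AB by (intro mult_left_mono) auto
    ultimately show ?thesis by simp
  qed
  then show ?thesis using AB by blast
qed

text \<open>Polar form: both sides are homogeneous of degree p, so only the argument of z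
  matters.\<close>

lemma norm_powr_le_Re:
  fixes p :: real
  assumes p: "1 < p" "p \<le> 2"
  shows "\<exists>A B. 0 \<le> A \<and> 0 \<le> B \<and>
    (\<forall>z. 0 < Re z \<longrightarrow> norm z powr p \<le> A * Re z powr p - B * Re (z powr (of_real p)))"
proof -
  obtain A B where AB: "0 \<le> A" "0 \<le> B"
    and bd: "\<forall>\<theta>. \<bar>\<theta>\<bar> < pi / 2 \<longrightarrow> 1 \<le> A * cos \<theta> powr p - B * cos (p * \<theta>)"
    using cos_powr_bound[OF p] by blast
  have "norm z powr p \<le> A * Re z powr p - B * Re (z powr (of_real p))" if z: "0 < Re z" for z
  proof -
    have z0: "z \<noteq> 0" using z by auto
    define \<theta> where "\<theta> = Im (Ln z)"
    have \<theta>: "\<bar>\<theta>\<bar> < pi / 2" using Re_Ln_pos_lt[OF z0] z by (simp add: \<theta>_def)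
    have cpos: "0 < cos \<theta>" using \<theta> by (intro cos_gt_zero_pi) auto
    have "Re (exp (Ln z)) = exp (Re (Ln z)) * cos \<theta>" by (simp only: Re_exp \<theta>_def)
    then have Rez: "Re z = norm z * cos \<theta>" using z0 by simp
    have "z powr (of_real p) = exp (of_real p * Ln z)" using z0 by (simp add: powr_def)
    then have "Re (z powr (of_real p)) = exp (p * ln (norm z)) * cos (p * \<theta>)"
      using z0 by (simp add: Re_exp \<theta>_def)
    then have Rep: "Re (z powr (of_real p)) = norm z powr p * cos (p * \<theta>)"
      using z0 by (simp add: powr_def)
    have "norm z powr p * 1 \<le> norm z powr p * (A * cos \<theta> powr p - B * cos (p * \<theta>))"
      using bd \<theta> by (intro mult_left_mono) auto
    then show ?thesis
      unfolding Rep Rez using cpos by (simp add: powr_mult algebra_simps)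
  qed
  then show ?thesis using AB by blast
qed

context compact_group_haar
begin

lemma fourier_cnj:
  assumes "\<gamma> \<in> characters"
  shows "fourier m (\<lambda>x. cnj (f x)) \<gamma> = cnj (fourier m f (char_inv \<gamma>))"
proof -
  have "(LINT x|m. cnj (f x) * cnj (\<gamma> x)) = (LINT x|m. cnj (f x * \<gamma> x))" by simp
  also have "\<dots> = cnj (LINT x|m. f x * \<gamma> x)" by (rule Bochner_Integration.integral_cnj)
  finally show ?thesis by (simp add: fourier_def char_inv_eq[OF assms])
qed

lemma fourier_const:
  assumes "\<gamma> \<in> characters"
  shows "fourier m (\<lambda>x. c) \<gamma> = (if \<gamma> = (\<lambda>_. 1) then c else 0)"
  using fourier_scale[of c "\<lambda>_. 1" \<gamma>] fourier_character[OF characters_one assms] by auto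

text \<open>On a probability space the norm grows with the exponent; here by the inequality t^p
  \<le> (1 - p/2) + (p/2) t^2. A positive bound a in place of the norm itself allows h = 0.\<close>

lemma lp_norm_le_l2:
  assumes h: "cts h" and p: "1 < p" "p \<le> 2" and a: "l2 h \<le> a" "0 < a"
  shows "lp_norm m p h \<le> a"
proof -
  have pt: "norm (h x) powr p \<le> a powr p * ((1 - p / 2) + (p / 2) * ((norm (h x))\<^sup>2 / a\<^sup>2))" for x
  proof (cases "h x = 0")
    case True
    then show ?thesis using p by simp
  next
    case False
    define t where "t = norm (h x) / a"
    have t: "0 < t" using False a by (simp add: t_def)
    have "1 powr (1 - p / 2) * (t\<^sup>2) powr (p / 2) \<le> (1 - p / 2) * 1 + (p / 2) * t\<^sup>2"
      using p t by (intro Youngs_inequality_0) auto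
    moreover have "(t\<^sup>2) powr (p / 2) = t powr p"
      using t by (simp add: powr_powr flip: powr_numeral)
    ultimately have "t powr p \<le> (1 - p / 2) + (p / 2) * t\<^sup>2" by simp
    then have "a powr p * t powr p \<le> a powr p * ((1 - p / 2) + (p / 2) * t\<^sup>2)"
      by (intro mult_left_mono) auto
    moreover have "a powr p * t powr p = norm (h x) powr p"
      using a by (simp add: t_def powr_divide)
    ultimately show ?thesis by (simp add: t_def power_divide)
  qed
  have i2: "integrable m (\<lambda>x. (norm (h x))\<^sup>2)" by (intro integrable_continuous continuous_intros h)
  have "(LINT x|m. norm (h x) powr p) \<le>
      (LINT x|m. a powr p * ((1 - p / 2) + (p / 2) * ((norm (h x))\<^sup>2 / a\<^sup>2)))"
    using i2 Lp_integrable[OF Lp_continuous[OF h]] p by (intro integral_mono pt) auto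
  also have "\<dots> = a powr p * ((1 - p / 2) + (p / 2) * ((l2 h)\<^sup>2 / a\<^sup>2))"
    using i2 by (simp add: l2_square)
  also have "\<dots> \<le> a powr p * ((1 - p / 2) + (p / 2) * 1)"
    using p a by (intro mult_left_mono add_left_mono) (auto intro!: power_mono)
  finally have "lp_norm m p h powr p \<le> a powr p"
    using p by (simp add: lp_norm_powr)
  then show ?thesis using powr_less_mono2[of p a "lp_norm m p h"] a p by linarith
qed

end

context ordered_dual
begin

lemma tpoly_T_const: "(\<lambda>x. c) \<in> tpoly T"
  using tpoly_scale[OF tpoly_base[OF T_one], of c] by simp

text \<open>In a linear order a nontrivial character or its inverse lies in T, but not both. So g +
  cnj g has the coefficients of u, except that the trivial character is counted twice.\<close>

lemma analytic_completion:
  fixes u :: "'a \<Rightarrow> real"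
  assumes pair: "riesz_pair (\<lambda>x. complex_of_real (u x)) g"
  shows "2 * Re (g x) = u x + (LINT x|m. u x)"
    "(LINT x|m. g x) = complex_of_real (LINT x|m. u x)"
proof -
  let ?u = "\<lambda>x. complex_of_real (u x)"
  define c where "c = complex_of_real (LINT x|m. u x)"
  have up: "?u \<in> tpoly characters" and gp: "g \<in> tpoly T"
    using pair by (auto simp: riesz_pair_def)
  note uc = tpoly_continuous[OF up subset_refl] and gc = tpoly_continuous[OF gp T_sub]
  have c1: "fourier m ?u (\<lambda>_. 1) = c"
    by (simp add: fourier_def c_def)
  have g1: "fourier m g (\<lambda>_. 1) = c" using pair c1 by (simp add: riesz_pair_def)
  then show "(LINT x|m. g x) = complex_of_real (LINT x|m. u x)" by (simp add: fourier_def c_def)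
  have cc: "cnj c = c" by (simp add: c_def)
  have usym: "fourier m ?u (char_inv \<gamma>) = cnj (fourier m ?u \<gamma>)" if "\<gamma> \<in> characters" for \<gamma>
    using fourier_cnj[OF characters_inv[OF that], of ?u] by simp
  let ?D = "\<lambda>x. 1 * (1 * g x + 1 * cnj (g x)) + (-1) * (1 * ?u x + 1 * c)"
  have "?D x = 0"
  proof (rule fourier_zero_continuous)
    show "cts ?D" by (intro continuous_intros uc gc)
    fix \<gamma> :: "'a \<Rightarrow> complex" assume \<gamma>: "\<gamma> \<in> characters"
    have L: "g \<in> Lp m 2" "?u \<in> Lp m 2" "(\<lambda>x. cnj (g x)) \<in> Lp m 2" "(\<lambda>x. c) \<in> Lp m 2"
      by (intro Lp_continuous continuous_intros gc uc; simp)+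
    have D: "fourier m ?D \<gamma> = (fourier m g \<gamma> + cnj (fourier m g (char_inv \<gamma>))) -
        (fourier m ?u \<gamma> + (if \<gamma> = (\<lambda>_. 1) then c else 0))"
    proof -
      have "fourier m ?D \<gamma> = 1 * fourier m (\<lambda>x. 1 * g x + 1 * cnj (g x)) \<gamma> +
          (-1) * fourier m (\<lambda>x. 1 * ?u x + 1 * c) \<gamma>"
        by (rule fourier_lincomb[OF Lp_lincomb[OF L(1,3)] Lp_lincomb[OF L(2,4)] \<gamma>]) auto
      also have "fourier m (\<lambda>x. 1 * g x + 1 * cnj (g x)) \<gamma> = 1 * fourier m g \<gamma> + 1 * fourier m (\<lambda>x. cnj (g x)) \<gamma>"
        by (rule fourier_lincomb[OF L(1,3) \<gamma>]) auto
      also have "fourier m (\<lambda>x. 1 * ?u x + 1 * c) \<gamma> = 1 * fourier m ?u \<gamma> + 1 * fourier m (\<lambda>x. c) \<gamma>"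
        by (rule fourier_lincomb[OF L(2,4) \<gamma>]) auto
      finally show ?thesis unfolding fourier_cnj[OF \<gamma>] fourier_const[OF \<gamma>] by simp
    qed
    show "fourier m ?D \<gamma> = 0"
    proof (cases "\<gamma> = (\<lambda>_. 1)")
      case True
      show ?thesis unfolding D unfolding True by (simp add: g1 c1 cc)
    next
      case False
      show ?thesis
      proof (cases "\<gamma> \<in> T")
        case True
        then have "char_inv \<gamma> \<notin> T" using T_antisym False by blast
        then have "fourier m g (char_inv \<gamma>) = 0"
          by (intro riesz_pair_fourier_off[OF pair] characters_inv \<gamma>)
        then show ?thesis unfolding D using True False pair by (simp add: riesz_pair_def)
      next
        case nT: False
        then have "char_inv \<gamma> \<in> T" by (rule T_total[OF \<gamma>])
        then have "fourier m g (char_inv \<gamma>) = cnj (fourier m ?u \<gamma>)"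
          using pair usym[OF \<gamma>] by (simp add: riesz_pair_def)
        then show ?thesis unfolding D using False riesz_pair_fourier_off[OF pair \<gamma> nT] by simp
      qed
    qed
  qed
  then have "g x + cnj (g x) = ?u x + c" by (simp add: algebra_simps)
  then have "Re (g x + cnj (g x)) = Re (?u x + c)" by simp
  then show "2 * Re (g x) = u x + (LINT x|m. u x)" by (simp add: c_def)
qed

lemma riesz_bound_positive:
  assumes p: "1 < p" "p \<le> 2"
  shows "\<exists>K\<ge>0. \<forall>u g. (\<forall>x. 0 < u x) \<longrightarrow> riesz_pair (\<lambda>x. complex_of_real (u x)) g \<longrightarrow>
    lp_norm m p g \<le> K * lp_norm m p (\<lambda>x. complex_of_real (u x))"
proof -
  obtain A B where AB: "0 \<le> A" "0 \<le> B"
    and bd: "\<forall>z. 0 < Re z \<longrightarrow> norm z powr p \<le> A * Re z powr p - B * Re (z powr (of_real p))"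
    using norm_powr_le_Re[OF p] by blast
  have "lp_norm m p g \<le> (A powr (1 / p) + 1) / 2 * lp_norm m p (\<lambda>x. complex_of_real (u x))"
    if u: "\<forall>x. 0 < u x" and pair: "riesz_pair (\<lambda>x. complex_of_real (u x)) g" for u g
  proof -
    let ?u = "\<lambda>x. complex_of_real (u x)"
    define c where "c = (LINT x|m. u x)"
    \<comment> \<open>An analytic polynomial with real part u and mean c.\<close>
    define F where "F x = 2 * g x + (-1) * complex_of_real c" for x
    have up: "?u \<in> tpoly characters" and gp: "g \<in> tpoly T"
      using pair by (auto simp: riesz_pair_def)
    note uc = tpoly_continuous[OF up subset_refl]
    have urc: "continuous_on UNIV u" using continuous_on_Re[OF uc] by simp
    have Fp: "F \<in> tpoly T" unfolding F_def by (intro tpoly_add tpoly_scale gp tpoly_T_const)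
    have Fc: "cts F" by (rule tpoly_continuous[OF Fp T_sub])
    have ReF: "Re (F x) = u x" for x
      using analytic_completion(1)[OF pair, of x] by (simp add: F_def c_def)
    have gi: "integrable m g" by (intro integrable_continuous tpoly_continuous[OF gp T_sub])
    have intF: "(LINT x|m. F x) = complex_of_real c"
      unfolding F_def using gi analytic_completion(2)[OF pair] by (simp add: c_def)
    have c0: "0 \<le> c" unfolding c_def using u by (intro integral_nonneg_AE AE_I2) (simp add: less_imp_le)
    obtain x0 where x0: "\<forall>x. u x0 \<le> u x"
      using continuous_attains_inf[OF compact_UNIV _ urc] by auto
    define \<delta> where "\<delta> = u x0"
    have \<delta>: "0 < \<delta>" "\<And>x. \<delta> \<le> u x" using u x0 by (auto simp: \<delta>_def)
    obtain M where M: "0 < M" "\<And>x. norm (F x) \<le> M" using continuous_norm_bound[OF Fc] by blast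
    \<comment> \<open>With this scale |F - R|^2 \<le> M^2 - 2 R \<delta> + R^2 = R^2 - M^2, so F / R
      lies in a disc around 1 of radius less than 1 and its real power has a binomial
      expansion.\<close>
    define R where "R = M\<^sup>2 / \<delta>"
    have R: "0 < R" "R * \<delta> = M\<^sup>2" using M \<delta> by (auto simp: R_def)
    define h where "h x = (1 / complex_of_real R) * F x + (-1)" for x
    have hp: "h \<in> tpoly T" unfolding h_def by (intro tpoly_add tpoly_scale Fp tpoly_T_const)
    define \<rho> where "\<rho> = sqrt (1 - (M / R)\<^sup>2)"
    have \<rho>: "\<rho> < 1" using M R by (simp add: \<rho>_def)
    have hb: "norm (h x) \<le> \<rho>" for x
    proof -
      have "(norm (F x - complex_of_real R))\<^sup>2 = (norm (F x))\<^sup>2 - 2 * R * Re (F x) + R\<^sup>2"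
        unfolding cmod_power2 by (simp add: power2_eq_square algebra_simps)
      also have "\<dots> \<le> M\<^sup>2 - 2 * R * \<delta> + R\<^sup>2"
        using M(2)[of x] \<delta>(2)[of x] R(1) by (intro add_mono diff_mono power_mono mult_left_mono) (auto simp: ReF)
      also have "\<dots> = R\<^sup>2 * (1 - (M / R)\<^sup>2)"
        using R by (simp add: power_divide right_diff_distrib)
      finally have "(norm (F x - complex_of_real R))\<^sup>2 / R\<^sup>2 \<le> 1 - (M / R)\<^sup>2"
        using R by (simp add: divide_le_eq mult.commute)
      moreover have "norm (h x) = norm (F x - complex_of_real R) / R"
      proof -
        have "h x = (F x - complex_of_real R) / complex_of_real R" using R by (simp add: h_def diff_divide_distrib)
        then show ?thesis using R by (simp add: norm_divide)
      qed
      ultimately have "(norm (h x))\<^sup>2 \<le> 1 - (M / R)\<^sup>2" by (simp add: power_divide)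
      then show ?thesis unfolding \<rho>_def by (rule real_le_rsqrt)
    qed
    have h1: "1 + h x = F x / complex_of_real R" for x by (simp add: h_def)
    have int_h: "1 + (LINT x|m. h x) = complex_of_real (c / R)"
    proof -
      have "(LINT x|m. h x) = (1 / complex_of_real R) * (LINT x|m. F x) + (-1)"
        unfolding h_def using integrable_continuous[OF Fc] by simp
      then show ?thesis by (simp add: intF)
    qed
    have powc: "(LINT x|m. (1 + h x) powr (of_real p)) = complex_of_real ((c / R) powr p)"
      unfolding integral_tpoly_powr(1)[OF hp \<rho> hb] int_h using c0 R by (intro powr_of_real) auto
    have powi: "integrable m (\<lambda>x. (1 + h x) powr (of_real p))"
      by (rule integral_tpoly_powr(2)[OF hp \<rho> hb])
    have pt: "norm (1 + h x) powr p \<le> A * Re (1 + h x) powr p - B * Re ((1 + h x) powr (of_real p))" for x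
    proof -
      have "0 < Re (1 + h x)" unfolding h1 using u R by (simp add: Re_divide_of_real ReF)
      then show ?thesis using bd by blast
    qed
    have i1: "integrable m (\<lambda>x. norm (F x) powr p)" "integrable m (\<lambda>x. u x powr p)"
      using Lp_integrable[OF Lp_continuous[OF Fc, of p]] Lp_integrable[OF Lp_continuous[OF uc, of p]] p u
      by (auto simp: less_imp_le)
    have e1: "norm (1 + h x) powr p = norm (F x) powr p / R powr p" for x
      unfolding h1 using R by (simp add: norm_divide powr_divide)
    have e2: "Re (1 + h x) powr p = u x powr p / R powr p" for x
      unfolding h1 using R u by (simp add: Re_divide_of_real ReF powr_divide less_imp_le)
    have "(LINT x|m. norm (1 + h x) powr p) \<le>
        (LINT x|m. A * Re (1 + h x) powr p - B * Re ((1 + h x) powr (of_real p)))"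
      unfolding e1 e2 using i1 powi pt[unfolded e1 e2] by (intro integral_mono) auto
    also have "\<dots> = A * (LINT x|m. Re (1 + h x) powr p) - B * ((c / R) powr p)"
      unfolding e2 using i1 powi powc by simp
    \<comment> \<open>The discarded term is B (c / R)^p, which is nonnegative: the mean of the power
      is the power of the nonnegative mean c / R.\<close>
    also have "\<dots> \<le> A * (LINT x|m. Re (1 + h x) powr p)" using AB by simp
    finally have "(LINT x|m. norm (F x) powr p) / R powr p \<le> A * (LINT x|m. u x powr p) / R powr p"
      unfolding e1 e2 using i1 by simp
    then have le: "(LINT x|m. norm (F x) powr p) \<le> A * (LINT x|m. u x powr p)"
      using R by (simp add: divide_le_cancel)
    have "lp_norm m p F \<le> (A * (LINT x|m. u x powr p)) powr (1 / p)"
      unfolding lp_norm_def using le p by (intro powr_mono2) auto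
    also have "\<dots> = A powr (1 / p) * lp_norm m p ?u"
      unfolding lp_norm_def using AB u by (simp add: powr_mult less_imp_le abs_of_pos)
    finally have FN: "lp_norm m p F \<le> A powr (1 / p) * lp_norm m p ?u" .
    have cN: "c \<le> lp_norm m p ?u"
    proof -
      have "norm (LINT x|m. ?u x) \<le> lp_norm m p ?u"
        using p by (intro Lp_integrable_fn(2) Lp_continuous uc) auto
      then show ?thesis using c0 by (simp add: c_def)
    qed
    have LF: "(\<lambda>x. (1/2) * F x) \<in> Lp m p" "(\<lambda>x. (1/2) * complex_of_real c) \<in> Lp m p"
      using p by (intro Lp_continuous continuous_intros Fc; simp)+
    have "g = (\<lambda>x. (1/2) * F x + (1/2) * complex_of_real c)"
      by (auto simp: F_def algebra_simps)
    then have "lp_norm m p g \<le> lp_norm m p (\<lambda>x. (1/2) * F x) + lp_norm m p (\<lambda>x. (1/2) * complex_of_real c)"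
      using lp_norm_triangle[OF LF] p by simp
    also have "lp_norm m p (\<lambda>x. (1/2) * F x) = (1/2) * lp_norm m p F"
      using p lp_norm_scale[of p m "1/2" F] by simp
    also have "lp_norm m p (\<lambda>x. (1/2) * complex_of_real c) \<le> c / 2"
      using p c0 by (intro lp_norm_le_const) auto
    finally have "lp_norm m p g \<le> (1/2) * lp_norm m p F + c / 2" by simp
    also have "\<dots> \<le> (1/2) * (A powr (1 / p) * lp_norm m p ?u) + lp_norm m p ?u / 2"
      using FN cN by (intro add_mono) auto
    also have "\<dots> = (A powr (1 / p) + 1) / 2 * lp_norm m p ?u" by (simp add: field_simps)
    finally show ?thesis .
  qed
  moreover have "0 \<le> (A powr (1 / p) + 1) / 2" by simp
  ultimately show ?thesis by blast
qed

text \<open>The positive and negative parts of r need not be polynomials. Shifted up by d and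
  approximated within d they become positive polynomials u and v, and the rest s = r - (u - v) is
  uniformly small; its projection is estimated in \<open>l2\<close>, which dominates the norm for p
  \<le> 2.\<close>

lemma riesz_bound_real:
  assumes p: "1 < p" "p \<le> 2"
  shows "\<exists>K\<ge>0. \<forall>r g. riesz_pair (\<lambda>x. complex_of_real (r x)) g \<longrightarrow>
    lp_norm m p g \<le> K * lp_norm m p (\<lambda>x. complex_of_real (r x))"
proof -
  obtain K where K: "0 \<le> K" and bd: "\<forall>u g. (\<forall>x. 0 < u x) \<longrightarrow> riesz_pair (\<lambda>x. complex_of_real (u x)) g \<longrightarrow>
    lp_norm m p g \<le> K * lp_norm m p (\<lambda>x. complex_of_real (u x))"
    using riesz_bound_positive[OF p] by blast
  have "lp_norm m p g \<le> 2 * K * lp_norm m p (\<lambda>x. complex_of_real (r x))"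
    if pair: "riesz_pair (\<lambda>x. complex_of_real (r x)) g" for r g
  proof (rule field_le_epsilon)
    fix e :: real assume e: "0 < e"
    \<comment> \<open>The total error is 2 K d for each of u and v, plus 2 d for s.\<close>
    define d where "d = e / (4 * K + 2)"
    have d: "0 < d" "(4 * K + 2) * d = e" using e K by (auto simp: d_def)
    let ?c = "\<lambda>(v::'a \<Rightarrow> real) x. complex_of_real (v x)"
    have rp: "?c r \<in> tpoly characters" using pair by (simp add: riesz_pair_def)
    have rcc: "cts (?c r)" by (rule tpoly_continuous[OF rp]) simp
    have rc: "continuous_on UNIV r" using continuous_on_Re[OF rcc] by simp
    have cp: "continuous_on UNIV (\<lambda>x. max (r x) 0 + d)" "continuous_on UNIV (\<lambda>x. max (- r x) 0 + d)"
      by (intro continuous_intros rc)+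
    obtain u where u: "?c u \<in> tpoly characters" "\<forall>x. \<bar>(max (r x) 0 + d) - u x\<bar> < d"
      using tpoly_dense_real[OF cp(1) d(1)] by blast
    obtain v where v: "?c v \<in> tpoly characters" "\<forall>x. \<bar>(max (- r x) 0 + d) - v x\<bar> < d"
      using tpoly_dense_real[OF cp(2) d(1)] by blast
    have upos: "0 < u x" for x using spec[OF u(2), of x] by (auto simp: abs_less_iff max_def split: if_splits)
    have vpos: "0 < v x" for x using spec[OF v(2), of x] by (auto simp: abs_less_iff max_def split: if_splits)
    have uub: "\<bar>u x\<bar> \<le> \<bar>r x\<bar> + 2 * d" for x using spec[OF u(2), of x] upos[of x] d(1)
      by (auto simp: abs_less_iff max_def split: if_splits)
    have vub: "\<bar>v x\<bar> \<le> \<bar>r x\<bar> + 2 * d" for x using spec[OF v(2), of x] vpos[of x] d(1)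
      by (auto simp: abs_less_iff max_def split: if_splits)
    define s where "s x = 1 * ?c r x + (-1) * (1 * ?c u x + (-1) * ?c v x)" for x
    have sp: "s \<in> tpoly characters"
      unfolding s_def by (intro tpoly_add tpoly_scale rp u v)
    have sc: "cts s" by (rule tpoly_continuous[OF sp]) simp
    have sb: "norm (s x) \<le> 2 * d" for x
    proof -
      have "s x = complex_of_real (r x - (u x - v x))" by (simp add: s_def)
      moreover have "\<bar>r x - (u x - v x)\<bar> \<le> 2 * d"
        using spec[OF u(2), of x] spec[OF v(2), of x] by (auto simp: abs_le_iff abs_less_iff max_def split: if_splits)
      ultimately show ?thesis by (simp only: norm_of_real)
    qed
    obtain gu gv gs where prs: "riesz_pair (?c u) gu" "riesz_pair (?c v) gv" "riesz_pair s gs"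
      using riesz_pair_exists u(1) v(1) sp by meson
    have "riesz_pair (\<lambda>x. 1 * (1 * ?c u x + (-1) * ?c v x) + 1 * s x) (\<lambda>x. 1 * (1 * gu x + (-1) * gv x) + 1 * gs x)"
      by (intro riesz_pair_lincomb prs)
    moreover have "(\<lambda>x. 1 * (1 * ?c u x + (-1) * ?c v x) + 1 * s x) = ?c r"
      by (auto simp: s_def)
    ultimately have gdec: "g = (\<lambda>x. (gu x - gv x) + gs x)"
      using riesz_pair_unique[OF pair] by fastforce
    have gL: "gu \<in> Lp m p" "gv \<in> Lp m p" "gs \<in> Lp m p"
      using prs p T_sub by (auto simp: riesz_pair_def intro!: tpoly_Lp)
    have "l2 gs \<le> 2 * d"
      using riesz_pair_l2[OF prs(3)] l2_le_bound[OF sc sb] by simp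
    moreover have "gs \<in> tpoly T" using prs(3) by (simp add: riesz_pair_def)
    ultimately have gsn: "lp_norm m p gs \<le> 2 * d"
      using lp_norm_le_l2[OF tpoly_continuous[OF _ T_sub] p] d by simp
    have wn: "lp_norm m p (?c w) \<le> lp_norm m p (?c r) + 2 * d"
      if w: "cts (?c w)" "\<And>x. \<bar>w x\<bar> \<le> \<bar>r x\<bar> + 2 * d" for w
    proof -
      have c1: "cts (\<lambda>x. complex_of_real \<bar>r x\<bar>)" by (intro continuous_intros rc)
      have L: "(\<lambda>x. complex_of_real \<bar>r x\<bar>) \<in> Lp m p" "(\<lambda>x. complex_of_real (2 * d)) \<in> Lp m p"
        using p c1 by (auto intro!: Lp_continuous)
      have "lp_norm m p (?c w) \<le> 1 * lp_norm m p (\<lambda>x. complex_of_real \<bar>r x\<bar> + complex_of_real (2 * d))"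
      proof (rule Lp_bounded(2)[OF Lp_add[OF L] measurable_continuous[OF w(1)]])
        have "norm (?c w x) \<le> 1 * norm (complex_of_real \<bar>r x\<bar> + complex_of_real (2 * d))" for x
        proof -
          have "norm (complex_of_real \<bar>r x\<bar> + complex_of_real (2 * d)) = \<bar>\<bar>r x\<bar> + 2 * d\<bar>"
            by (simp only: of_real_add[symmetric] norm_of_real)
          then show ?thesis using w(2)[of x] d(1) by simp
        qed
        then show "AE x in m. norm (?c w x) \<le> 1 * norm (complex_of_real \<bar>r x\<bar> + complex_of_real (2 * d))" by simp
      qed (use p in auto)
      also have "\<dots> \<le> lp_norm m p (\<lambda>x. complex_of_real \<bar>r x\<bar>) + lp_norm m p (\<lambda>x. complex_of_real (2 * d))"
        using lp_norm_triangle[OF L] p by simp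
      also have "lp_norm m p (\<lambda>x. complex_of_real \<bar>r x\<bar>) = lp_norm m p (?c r)"
        by (simp add: lp_norm_def)
      also have "lp_norm m p (\<lambda>x. complex_of_real (2 * d)) \<le> 2 * d"
        using p d by (intro lp_norm_le_const) auto
      finally show ?thesis by simp
    qed
    have un: "lp_norm m p gu \<le> K * (lp_norm m p (?c r) + 2 * d)"
    proof -
      have "lp_norm m p gu \<le> K * lp_norm m p (?c u)" using bd upos prs(1) by blast
      also have "\<dots> \<le> K * (lp_norm m p (?c r) + 2 * d)"
        using K uub tpoly_continuous[OF u(1)] by (intro mult_left_mono wn) auto
      finally show ?thesis .
    qed
    have vn: "lp_norm m p gv \<le> K * (lp_norm m p (?c r) + 2 * d)"
    proof -
      have "lp_norm m p gv \<le> K * lp_norm m p (?c v)" using bd vpos prs(2) by blast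
      also have "\<dots> \<le> K * (lp_norm m p (?c r) + 2 * d)"
        using K vub tpoly_continuous[OF v(1)] by (intro mult_left_mono wn) auto
      finally show ?thesis .
    qed
    have "lp_norm m p g \<le> (lp_norm m p gu + lp_norm m p gv) + lp_norm m p gs"
      using lp_norm_triangle[OF Lp_diff[OF gL(1,2)] gL(3)] lp_norm_triangle_diff[OF gL(1,2)] p
      unfolding gdec by simp
    also have "\<dots> \<le> 2 * K * lp_norm m p (?c r) + (4 * K + 2) * d"
      using un vn gsn by (simp add: algebra_simps)
    finally show "lp_norm m p g \<le> 2 * K * lp_norm m p (?c r) + e" unfolding d(2) .
  qed
  moreover have "0 \<le> 2 * K" using K by simp
  ultimately show ?thesis by blast
qed

lemma riesz_bound_le_2:
  assumes p: "1 < p" "p \<le> 2"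
  shows "\<exists>K\<ge>0. \<forall>f g. riesz_pair f g \<longrightarrow> lp_norm m p g \<le> K * lp_norm m p f"
proof -
  obtain K where K: "0 \<le> K" and bd: "\<forall>r g. riesz_pair (\<lambda>x. complex_of_real (r x)) g \<longrightarrow>
    lp_norm m p g \<le> K * lp_norm m p (\<lambda>x. complex_of_real (r x))"
    using riesz_bound_real[OF p] by blast
  have "lp_norm m p g \<le> 2 * K * lp_norm m p f" if pair: "riesz_pair f g" for f g
  proof -
    have fp: "f \<in> tpoly characters" using pair by (simp add: riesz_pair_def)
    have fc: "cts f" by (rule tpoly_continuous[OF fp]) simp
    have "(\<lambda>x. (1/2) * f x + (1/2) * cnj (f x)) \<in> tpoly characters"
      "(\<lambda>x. (- \<i>/2) * f x + (\<i>/2) * cnj (f x)) \<in> tpoly characters"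
      by (intro tpoly_add tpoly_scale fp tpoly_cnj)+
    moreover have "(\<lambda>x. (1/2) * f x + (1/2) * cnj (f x)) = (\<lambda>x. complex_of_real (Re (f x)))"
      "(\<lambda>x. (- \<i>/2) * f x + (\<i>/2) * cnj (f x)) = (\<lambda>x. complex_of_real (Im (f x)))"
      by (auto simp: complex_eq_iff)
    ultimately have "(\<lambda>x. complex_of_real (Re (f x))) \<in> tpoly characters"
      "(\<lambda>x. complex_of_real (Im (f x))) \<in> tpoly characters" by simp_all
    then obtain g1 g2 where prs: "riesz_pair (\<lambda>x. complex_of_real (Re (f x))) g1"
      "riesz_pair (\<lambda>x. complex_of_real (Im (f x))) g2"
      using riesz_pair_exists by meson
    have "riesz_pair (\<lambda>x. 1 * complex_of_real (Re (f x)) + \<i> * complex_of_real (Im (f x))) (\<lambda>x. 1 * g1 x + \<i> * g2 x)"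
      by (intro riesz_pair_lincomb prs)
    moreover have "(\<lambda>x. 1 * complex_of_real (Re (f x)) + \<i> * complex_of_real (Im (f x))) = f"
      by (auto simp: complex_eq_iff)
    ultimately have gdec: "g = (\<lambda>x. g1 x + \<i> * g2 x)"
      using riesz_pair_unique[OF pair] by fastforce
    have gL: "g1 \<in> Lp m p" "g2 \<in> Lp m p"
      using prs p T_sub by (auto simp: riesz_pair_def intro!: tpoly_Lp)
    have fL: "f \<in> Lp m p" using fc p by (auto intro: Lp_continuous)
    have c: "cts (\<lambda>x. complex_of_real (Re (f x)))" "cts (\<lambda>x. complex_of_real (Im (f x)))"
      by (intro continuous_intros fc)+
    have "lp_norm m p (\<lambda>x. complex_of_real (Re (f x))) \<le> 1 * lp_norm m p f"
      by (rule Lp_bounded(2)[OF fL measurable_continuous[OF c(1)]]) (use p abs_Re_le_cmod in auto)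
    then have 1: "lp_norm m p g1 \<le> K * lp_norm m p f"
      using bd prs(1) mult_left_mono[OF _ K] by fastforce
    have "lp_norm m p (\<lambda>x. complex_of_real (Im (f x))) \<le> 1 * lp_norm m p f"
      by (rule Lp_bounded(2)[OF fL measurable_continuous[OF c(2)]]) (use p abs_Im_le_cmod in auto)
    then have 2: "lp_norm m p g2 \<le> K * lp_norm m p f"
      using bd prs(2) mult_left_mono[OF _ K] by fastforce
    have "lp_norm m p g \<le> lp_norm m p g1 + lp_norm m p (\<lambda>x. \<i> * g2 x)"
      unfolding gdec using p by (intro lp_norm_triangle gL Lp_scale) auto
    also have "lp_norm m p (\<lambda>x. \<i> * g2 x) = lp_norm m p g2"
      using lp_norm_scale[of p m \<i> g2] p by simp
    finally show ?thesis using 1 2 by linarith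
  qed
  moreover have "0 \<le> 2 * K" using K by simp
  ultimately show ?thesis by blast
qed

text \<open>Self-adjointness of the projection: both sides equal the integral of
  \<open>g x * cnj (z x)\<close>.\<close>

lemma riesz_pair_duality:
  assumes "riesz_pair f g" "riesz_pair v z"
  shows "(LINT x|m. g x * cnj (v x)) = (LINT x|m. f x * cnj (z x))"
proof -
  have P: "f \<in> tpoly characters" "g \<in> tpoly T" "v \<in> tpoly characters" "z \<in> tpoly T"
    using assms by (auto simp: riesz_pair_def)
  have L: "f \<in> Lp m 2" "g \<in> Lp m 2" "v \<in> Lp m 2" "z \<in> Lp m 2"
    using P T_sub by (auto intro!: tpoly_Lp)
  have c: "cts f" "cts g" "cts v" "cts z"
    using P T_sub by (auto intro!: tpoly_continuous)
  have i: "integrable m (\<lambda>x. h x * cnj (k x))" if "cts h" "cts k" for h k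
    using that by (intro integrable_continuous continuous_intros)
  have "(LINT x|m. (v x - z x) * cnj (g x)) = 0"
  proof (rule integral_tpoly_fourier_zero[OF Lp_diff[OF L(3,4)] _ T_sub P(2)])
    fix \<gamma> assume \<gamma>: "\<gamma> \<in> T"
    show "fourier m (\<lambda>x. v x - z x) \<gamma> = 0"
      using fourier_diff[OF L(3,4) T_char[OF \<gamma>]] assms \<gamma> by (simp add: riesz_pair_def)
  qed auto
  then have "(LINT x|m. v x * cnj (g x)) - (LINT x|m. z x * cnj (g x)) = 0"
    using i[OF c(3,2)] i[OF c(4,2)] by (simp add: left_diff_distrib)
  then have eq: "(LINT x|m. v x * cnj (g x)) = (LINT x|m. z x * cnj (g x))" by simp
  have swap: "(LINT x|m. g x * cnj (h x)) = cnj (LINT x|m. h x * cnj (g x))" for h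
  proof -
    have "(LINT x|m. g x * cnj (h x)) = (LINT x|m. cnj (h x * cnj (g x)))" by (simp add: mult.commute)
    also have "\<dots> = cnj (LINT x|m. h x * cnj (g x))" by (rule Bochner_Integration.integral_cnj)
    finally show ?thesis .
  qed
  have 1: "(LINT x|m. g x * cnj (v x)) = (LINT x|m. g x * cnj (z x))"
    unfolding swap eq ..
  have "(LINT x|m. (f x - g x) * cnj (z x)) = 0"
  proof (rule integral_tpoly_fourier_zero[OF Lp_diff[OF L(1,2)] _ T_sub P(4)])
    fix \<gamma> assume \<gamma>: "\<gamma> \<in> T"
    show "fourier m (\<lambda>x. f x - g x) \<gamma> = 0"
      using fourier_diff[OF L(1,2) T_char[OF \<gamma>]] assms \<gamma> by (simp add: riesz_pair_def)
  qed auto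
  then have "(LINT x|m. f x * cnj (z x)) = (LINT x|m. g x * cnj (z x))"
    using i[OF c(1,4)] i[OF c(2,4)] by (simp add: left_diff_distrib)
  then show ?thesis using 1 by simp
qed

text \<open>Duality with w = g |g|^(p-2), for which Hoelder's inequality against g is an equality.
  Since w need not be a polynomial, it is replaced by a uniform approximation v, whose projection z
  obeys the bound for the exponent q.\<close>

lemma riesz_bound_dual:
  assumes p: "2 < p" and q: "1 < q" "1 / p + 1 / q = 1"
    and K: "0 \<le> K" "\<forall>f g. riesz_pair f g \<longrightarrow> lp_norm m q g \<le> K * lp_norm m q f"
    and pair: "riesz_pair f g"
  shows "lp_norm m p g \<le> K * lp_norm m p f"
proof (cases "lp_norm m p g = 0")
  case True
  then show ?thesis using K(1) by simp
next
  case False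
  define N where "N = lp_norm m p g"
  have N: "0 < N" using False lp_norm_nonneg[of m p g] by (simp add: N_def order.strict_iff_order)
  have fg: "f \<in> tpoly characters" "g \<in> tpoly T" using pair by (auto simp: riesz_pair_def)
  have gc: "cts g" by (rule tpoly_continuous[OF fg(2) T_sub])
  have fL: "f \<in> Lp m p" and gL: "g \<in> Lp m p" using fg p T_sub by (auto intro!: tpoly_Lp)
  define w where "w x = g x * complex_of_real (norm (g x) powr (p - 2))" for x
  have wc: "cts w" unfolding w_def
    using p by (intro continuous_intros gc continuous_on_powr') auto
  have wn: "norm (w x) = norm (g x) powr (p - 1)" for x
  proof (cases "g x = 0")
    case False
    then have "norm (g x) powr 1 * norm (g x) powr (p - 2) = norm (g x) powr (p - 1)"
      by (subst powr_add[symmetric]) simp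
    then show ?thesis by (simp add: w_def norm_mult)
  qed (simp add: w_def)
  have gw: "g x * cnj (w x) = complex_of_real (norm (g x) powr p)" for x
  proof (cases "g x = 0")
    case False
    have "g x * cnj (w x) = (g x * cnj (g x)) * complex_of_real (norm (g x) powr (p - 2))"
      by (simp add: w_def)
    also have "\<dots> = complex_of_real ((norm (g x))\<^sup>2 * norm (g x) powr (p - 2))"
      by (simp only: complex_norm_square[symmetric] of_real_mult)
    also have "(norm (g x))\<^sup>2 * norm (g x) powr (p - 2) = norm (g x) powr 2 * norm (g x) powr (p - 2)"
      using False by simp
    also have "\<dots> = norm (g x) powr p" by (subst powr_add[symmetric]) simp
    finally show ?thesis .
  qed (simp add: w_def)
  have Np: "(LINT x|m. g x * cnj (w x)) = complex_of_real (N powr p)"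
    unfolding gw N_def using p by (simp add: lp_norm_powr)
  have pq: "(p - 1) * q = p" "p / q = p - 1" using p q by (auto simp: field_simps)
  have wq: "lp_norm m q w = N powr (p - 1)"
  proof -
    have "lp_norm m q w = (LINT x|m. norm (g x) powr p) powr (1 / q)"
      unfolding lp_norm_def wn by (simp add: powr_powr pq)
    also have "\<dots> = (N powr p) powr (1 / q)" using p by (simp add: N_def lp_norm_powr)
    also have "\<dots> = N powr (p - 1)" using pq(2) by (simp add: powr_powr)
    finally show ?thesis .
  qed
  let ?f = "lp_norm m p f"
  have "N powr p \<le> ?f * (K * (N powr (p - 1) + e)) + N * e" if e: "0 < e" for e
  proof -
    obtain v where v: "v \<in> tpoly characters" "\<forall>x. norm (w x - v x) < e" using tpoly_dense[OF wc e] by blast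
    obtain z where z: "riesz_pair v z" using riesz_pair_exists[OF v(1)] by blast
    have vc: "cts v" by (rule tpoly_continuous[OF v(1)]) simp
    have "z \<in> tpoly T" using z by (simp add: riesz_pair_def)
    then have zL: "z \<in> Lp m q" "v \<in> Lp m q" "w \<in> Lp m q"
      using tpoly_Lp[OF _ T_sub, of z q] Lp_continuous[OF vc, of q] Lp_continuous[OF wc, of q] q by auto
    have dc: "cts (\<lambda>x. w x - v x)" by (intro continuous_intros wc vc)
    have dn: "lp_norm m q (\<lambda>x. w x - v x) \<le> e"
      using v(2) q by (intro lp_norm_le_const measurable_continuous dc) (auto simp: less_imp_le)
    have dL: "(\<lambda>x. cnj (w x - v x)) \<in> Lp m q" using dc q by (intro Lp_cnj Lp_continuous) auto
    have "(LINT x|m. g x * cnj (w x)) = (LINT x|m. g x * cnj (v x)) + (LINT x|m. g x * cnj (w x - v x))"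
    proof -
      have "integrable m (\<lambda>x. g x * cnj (v x))" "integrable m (\<lambda>x. g x * cnj (w x - v x))"
        by (intro integrable_continuous continuous_intros gc vc wc)+
      then have "(LINT x|m. g x * cnj (v x)) + (LINT x|m. g x * cnj (w x - v x)) =
          (LINT x|m. g x * cnj (v x) + g x * cnj (w x - v x))" by simp
      also have "\<dots> = (LINT x|m. g x * cnj (w x))"
        by (intro Bochner_Integration.integral_cong) (auto simp: algebra_simps)
      finally show ?thesis ..
    qed
    then have eq: "complex_of_real (N powr p) = (LINT x|m. f x * cnj (z x)) + (LINT x|m. g x * cnj (w x - v x))"
      unfolding Np riesz_pair_duality[OF pair z] .
    have "N powr p = norm (complex_of_real (N powr p))" by simp
    also have "\<dots> \<le> norm (LINT x|m. f x * cnj (z x)) + norm (LINT x|m. g x * cnj (w x - v x))"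
      unfolding eq by (rule norm_triangle_ineq)
    also have "\<dots> \<le> ?f * lp_norm m q (\<lambda>x. cnj (z x)) + lp_norm m p g * lp_norm m q (\<lambda>x. cnj (w x - v x))"
      using p q by (intro add_mono Hoelder_integral fL gL dL Lp_cnj[OF zL(1)]) auto
    also have "\<dots> = ?f * lp_norm m q z + N * lp_norm m q (\<lambda>x. w x - v x)"
      unfolding lp_norm_cnj by (simp add: N_def)
    also have "\<dots> \<le> ?f * (K * (N powr (p - 1) + e)) + N * e"
    proof (intro add_mono mult_left_mono dn)
      have "lp_norm m q v \<le> lp_norm m q w + lp_norm m q (\<lambda>x. v x - w x)"
        using q by (intro lp_norm_triangle_sub zL) auto
      also have "\<dots> \<le> N powr (p - 1) + e" using dn wq lp_norm_minus_commute[of m q v w] by simp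
      finally have "K * lp_norm m q v \<le> K * (N powr (p - 1) + e)" using K by (intro mult_left_mono) auto
      then show "lp_norm m q z \<le> K * (N powr (p - 1) + e)" using K(2) z by fastforce
    qed (use N in auto)
    finally show ?thesis .
  qed
  then have le: "N powr p \<le> ?f * (K * (N powr (p - 1) + e)) + N * e" if "0 < e" for e using that .
  have "((\<lambda>e. ?f * (K * (N powr (p - 1) + e)) + N * e) \<longlongrightarrow> ?f * (K * (N powr (p - 1) + 0)) + N * 0) (at_right 0)"
    by (intro tendsto_intros)
  then have "N powr p \<le> ?f * (K * (N powr (p - 1) + 0)) + N * 0"
    by (rule tendsto_lowerbound) (use le in \<open>auto simp: eventually_at_filter\<close>)
  then have "N powr p \<le> (K * ?f) * N powr (p - 1)" by (simp add: algebra_simps)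
  moreover have "N powr p = N * N powr (p - 1)"
  proof -
    have "N powr 1 * N powr (p - 1) = N powr p" by (subst powr_add[symmetric]) simp
    then show ?thesis using N by simp
  qed
  ultimately have "N * N powr (p - 1) \<le> (K * ?f) * N powr (p - 1)" by simp
  then show ?thesis using N by (simp add: N_def)
qed

lemma riesz_bound:
  assumes p: "1 < p"
  shows "\<exists>K\<ge>0. \<forall>f g. riesz_pair f g \<longrightarrow> lp_norm m p g \<le> K * lp_norm m p f"
proof (cases "p \<le> 2")
  case True
  then show ?thesis using riesz_bound_le_2[OF p] by simp
next
  case False
  obtain q where q: "1 < q" "1 / p + 1 / q = 1" using exponent_conjugate[OF p] .
  have "q \<le> 2"
  proof (rule ccontr)
    assume "\<not> q \<le> 2"
    then have "1 / p < 1 / 2" "1 / q < 1 / 2" using False by (auto simp: field_simps)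
    then show False using q(2) by simp
  qed
  then obtain K where K: "0 \<le> K" "\<forall>f g. riesz_pair f g \<longrightarrow> lp_norm m q g \<le> K * lp_norm m q f"
    using riesz_bound_le_2[OF q(1)] by blast
  then show ?thesis using riesz_bound_dual[OF _ q K] False by auto
qed

end

section \<open>Bounded inverses\<close>

lemma Lp_complete_geometric:
  fixes F :: "nat \<Rightarrow> 'a \<Rightarrow> complex"
  assumes F: "\<And>n. F n \<in> Lp m p" and p: "1 \<le> p" and D: "0 < D"
    and fast: "\<And>n. lp_norm m p (\<lambda>x. F (Suc n) x - F n x) \<le> D * (1/2) ^ n"
  shows "\<exists>f\<in>Lp m p. \<forall>n. lp_norm m p (\<lambda>x. F n x - f x) \<le> 2 * D * (1/2) ^ n"
proof -
  have scale: "lp_norm m p (\<lambda>x. complex_of_real (1 / D) * h x) = lp_norm m p h / D" for h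
    using lp_norm_scale[of p m "complex_of_real (1 / D)" h] p D by (simp add: norm_divide)
  have "\<exists>f\<in>Lp m p. \<forall>n. lp_norm m p (\<lambda>x. complex_of_real (1 / D) * F n x - f x) \<le> 2 * (1/2) ^ n"
  proof (rule Lp_complete_fast[OF _ p])
    show "(\<lambda>x. complex_of_real (1 / D) * F n x) \<in> Lp m p" for n by (intro Lp_scale F)
    show "lp_norm m p (\<lambda>x. complex_of_real (1 / D) * F (Suc n) x - complex_of_real (1 / D) * F n x) \<le> (1/2) ^ n" for n
    proof -
      have "lp_norm m p (\<lambda>x. complex_of_real (1 / D) * (F (Suc n) x - F n x)) \<le> (D * (1/2) ^ n) / D"
        unfolding scale using D by (intro divide_right_mono fast) auto
      then show ?thesis using D by (simp add: right_diff_distrib)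
    qed
  qed
  then obtain f where f: "f \<in> Lp m p"
    "\<forall>n. lp_norm m p (\<lambda>x. complex_of_real (1 / D) * F n x - f x) \<le> 2 * (1/2) ^ n" by blast
  have "lp_norm m p (\<lambda>x. F n x - complex_of_real D * f x) \<le> 2 * D * (1/2) ^ n" for n
  proof -
    have "(\<lambda>x. F n x - complex_of_real D * f x) =
        (\<lambda>x. complex_of_real D * (complex_of_real (1 / D) * F n x - f x))"
      using D by (auto simp: right_diff_distrib)
    then have "lp_norm m p (\<lambda>x. F n x - complex_of_real D * f x) =
        D * lp_norm m p (\<lambda>x. complex_of_real (1 / D) * F n x - f x)"
      using lp_norm_scale[of p m "complex_of_real D"] p D by simp
    also have "\<dots> \<le> D * (2 * (1/2) ^ n)" using D f(2) by (intro mult_left_mono) auto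
    finally show ?thesis by simp
  qed
  then show ?thesis by (intro bexI[of _ "\<lambda>x. complex_of_real D * f x"] allI Lp_scale f(1))
qed

lemma geometric_null: "(\<lambda>n. c * (1/2) ^ n) \<longlonglongrightarrow> (0::real)"
  by (rule tendsto_mult_right_zero) (rule LIMSEQ_power_zero, simp)

text \<open>The inverse mapping theorem modulo null functions, for which there is no Banach space type:
  by Baire's theorem some sublevel set of the norm of the inverse is dense in a ball of the range,
  and a geometric series removes the closure.\<close>

locale inverse_mapping =
  fixes m :: "'a measure" and p :: real and Z :: "('a \<Rightarrow> complex) set"
    and A :: "('a \<Rightarrow> complex) \<Rightarrow> 'a \<Rightarrow> complex" and C :: real
  assumes p: "1 \<le> p"
    and Z_Lp: "\<And>f. f \<in> Z \<Longrightarrow> f \<in> Lp m p"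
    and Z_lincomb: "\<And>f g a b. f \<in> Z \<Longrightarrow> g \<in> Z \<Longrightarrow> (\<lambda>x. a * f x + b * g x) \<in> Z"
    and Z_zero: "(\<lambda>x. 0) \<in> Z"
    and Z_closed: "\<And>F f. (\<And>n. F n \<in> Z) \<Longrightarrow> f \<in> Lp m p \<Longrightarrow>
      (\<lambda>n. lp_norm m p (\<lambda>x. F n x - f x)) \<longlonglongrightarrow> 0 \<Longrightarrow> f \<in> Z"
    and A_Lp: "\<And>f. f \<in> Z \<Longrightarrow> A f \<in> Lp m p"
    and A_lin: "\<And>f g a b. f \<in> Z \<Longrightarrow> g \<in> Z \<Longrightarrow>
      AE x in m. A (\<lambda>x. a * f x + b * g x) x = a * A f x + b * A g x"
    and A_bound: "\<And>f. f \<in> Z \<Longrightarrow> lp_norm m p (A f) \<le> C * lp_norm m p f"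
    and A_inj: "\<And>f. f \<in> Z \<Longrightarrow> AE x in m. A f x = 0 \<Longrightarrow> AE x in m. f x = 0"
    and A_closed: "\<And>F g. (\<And>n. F n \<in> Z) \<Longrightarrow> g \<in> Lp m p \<Longrightarrow>
      (\<lambda>n. lp_norm m p (\<lambda>x. A (F n) x - g x)) \<longlonglongrightarrow> 0 \<Longrightarrow> \<exists>f\<in>Z. AE x in m. A f x = g x"
begin

abbreviation "N \<equiv> lp_norm m p"

text \<open>The metric of the range pulled back to \<open>Z\<close>. The category argument runs in
  \<open>Z\<close> with this pseudometric, in which fast Cauchy sequences converge because the range
  is closed (\<open>A_limit\<close>).\<close>

definition d :: "('a \<Rightarrow> complex) \<Rightarrow> ('a \<Rightarrow> complex) \<Rightarrow> real" where
  "d f g = N (\<lambda>x. A f x - A g x)"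

lemma Z_diff: "f \<in> Z \<Longrightarrow> g \<in> Z \<Longrightarrow> (\<lambda>x. f x - g x) \<in> Z"
  using Z_lincomb[of f g 1 "-1"] by simp

lemma Z_add: "f \<in> Z \<Longrightarrow> g \<in> Z \<Longrightarrow> (\<lambda>x. f x + g x) \<in> Z"
  using Z_lincomb[of f g 1 1] by simp

lemma Z_scale: "f \<in> Z \<Longrightarrow> (\<lambda>x. a * f x) \<in> Z"
  using Z_lincomb[OF _ Z_zero, of f a 0] by simp

lemma A_meas: "f \<in> Z \<Longrightarrow> A f \<in> borel_measurable m"
  using A_Lp Lp_measurable by blast

lemma N_A_lincomb:
  assumes "f \<in> Z" "g \<in> Z"
  shows "N (A (\<lambda>x. a * f x + b * g x)) = N (\<lambda>x. a * A f x + b * A g x)"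
  using A_meas[OF assms(1)] A_meas[OF assms(2)]
  by (intro lp_norm_cong_AE A_lin A_meas Z_lincomb assms) auto

lemma d_eq: "f \<in> Z \<Longrightarrow> g \<in> Z \<Longrightarrow> d f g = N (A (\<lambda>x. f x - g x))"
  using N_A_lincomb[of f g 1 "-1"] by (simp add: d_def)

lemma N_A_scale: "f \<in> Z \<Longrightarrow> N (A (\<lambda>x. a * f x)) = norm a * N (A f)"
  using N_A_lincomb[OF _ Z_zero, of f a 0] lp_norm_scale[of p m a "A f"] p by simp

lemma d_triangle: "f \<in> Z \<Longrightarrow> g \<in> Z \<Longrightarrow> h \<in> Z \<Longrightarrow> d f h \<le> d f g + d g h"
  unfolding d_def by (intro lp_norm_triangle3 A_Lp p)

lemma d_commute: "d f g = d g f"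
  unfolding d_def by (rule lp_norm_minus_commute)

lemma d_self [simp]: "d f f = 0"
  using p by (simp add: d_def)

lemma d_nonneg [simp]: "0 \<le> d f g"
  by (simp add: d_def)

lemma A_limit:
  assumes F: "\<And>n. F n \<in> Z" and D: "0 < D" and fast: "\<And>n. d (F (Suc n)) (F n) \<le> D * (1/2) ^ n"
  shows "\<exists>f\<in>Z. (\<lambda>n. d (F n) f) \<longlonglongrightarrow> 0"
proof -
  obtain g where g: "g \<in> Lp m p" "\<forall>n. N (\<lambda>x. A (F n) x - g x) \<le> 2 * D * (1/2) ^ n"
    using Lp_complete_geometric[OF A_Lp[OF F] p D, of "\<lambda>n. n"] fast[unfolded d_def] by auto
  have lim: "(\<lambda>n. N (\<lambda>x. A (F n) x - g x)) \<longlonglongrightarrow> 0"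
    by (rule Lim_null_comparison[OF _ geometric_null[of "2 * D"]]) (use g(2) in auto)
  obtain f where f: "f \<in> Z" "AE x in m. A f x = g x" using A_closed[OF F g(1) lim] by blast
  have "d (F n) f = N (\<lambda>x. A (F n) x - g x)" for n
    unfolding d_def
  proof (rule lp_norm_cong_AE)
    show "AE x in m. A (F n) x - A f x = A (F n) x - g x" using f(2) by eventually_elim simp
  qed (use A_meas[OF F] A_meas[OF f(1)] Lp_measurable[OF g(1)] in auto)
  then have "(\<lambda>n. d (F n) f) = (\<lambda>n. N (\<lambda>x. A (F n) x - g x))" by (rule ext)
  then show ?thesis using lim f(1) by (intro bexI[of _ f]) simp_all
qed

text \<open>Otherwise nested balls can be chosen, the n-th step leaving the sublevel set of norm n
  at a positive distance; their common point would belong to no sublevel set.\<close>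

lemma baire_ball:
  "\<exists>n z0 r. z0 \<in> Z \<and> 0 < r \<and> (\<forall>z\<in>Z. d z z0 < r \<longrightarrow> (\<forall>e>0. \<exists>w\<in>Z. N w \<le> real n \<and> d z w < e))"
proof (rule ccontr)
  assume neg: "\<not> ?thesis"
  have step: "\<exists>z\<in>Z. d z z0 < r \<and> (\<exists>e>0. \<forall>w\<in>Z. N w \<le> real n \<longrightarrow> e \<le> d z w)"
    if zr: "z0 \<in> Z" "0 < r" for n z0 r
  proof -
    have "\<not> (\<forall>z\<in>Z. d z z0 < r \<longrightarrow> (\<forall>e>0. \<exists>w\<in>Z. N w \<le> real n \<and> d z w < e))"
      using neg zr by blast
    then show ?thesis by (meson not_le_imp_less)
  qed
  define Q where "Q n s \<longleftrightarrow> fst s \<in> Z \<and> 0 < snd s" for n :: nat and s :: "('a \<Rightarrow> complex) \<times> real"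
  \<comment> \<open>States are pairs of centre and radius. The centre moves by less than half the
    radius and the new radius is at most half the old one, so the balls are nested and the centres
    form a fast Cauchy sequence.\<close>
  define R where "R n s t \<longleftrightarrow> d (fst t) (fst s) < snd s / 2 \<and> snd t \<le> snd s / 2 \<and>
    (\<forall>w\<in>Z. N w \<le> real n \<longrightarrow> snd t < d (fst t) w)" for n :: nat and s t :: "('a \<Rightarrow> complex) \<times> real"
  have "\<exists>s. \<forall>n. Q n (s n) \<and> R n (s n) (s (Suc n))"
  proof (rule dependent_nat_choice)
    show "\<exists>s. Q 0 s" by (intro exI[of _ "(\<lambda>x. 0, 1)"]) (simp add: Q_def Z_zero)
    fix s n assume "Q n s"
    then have s: "fst s \<in> Z" "0 < snd s / 2" by (auto simp: Q_def)
    obtain z e where z: "z \<in> Z" "d z (fst s) < snd s / 2" "0 < e" "\<forall>w\<in>Z. N w \<le> real n \<longrightarrow> e \<le> d z w"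
      using step[OF s, of n] by blast
    define \<rho> where "\<rho> = min (e / 2) (snd s / 2)"
    have \<rho>: "0 < \<rho>" "\<rho> < e" "\<rho> \<le> snd s / 2" using z(3) s by (auto simp: \<rho>_def)
    show "\<exists>t. Q (Suc n) t \<and> R n s t"
      by (intro exI[of _ "(z, \<rho>)"]) (use z \<rho> in \<open>auto simp: Q_def R_def intro: less_le_trans\<close>)
  qed
  then obtain s where s: "\<And>n. Q n (s n)" "\<And>n. R n (s n) (s (Suc n))" by blast
  define z where "z n = fst (s n)" for n
  define r where "r n = snd (s n)" for n
  have zr: "z n \<in> Z" "0 < r n" "d (z (Suc n)) (z n) < r n / 2" "r (Suc n) \<le> r n / 2" for n
    using s(1)[of n] s(2)[of n] by (auto simp: Q_def R_def z_def r_def)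
  have far: "r (Suc n) < d (z (Suc n)) w" if "w \<in> Z" "N w \<le> real n" for n w
    using s(2)[of n] that by (auto simp: R_def z_def r_def)
  have rn: "r n \<le> r 0 * (1/2) ^ n" for n
  proof (induction n)
    case (Suc n)
    then show ?case using zr(4)[of n] by simp
  qed simp
  have near: "d (z (n + k)) (z n) + r (n + k) \<le> r n" for n k
  proof (induction k)
    case (Suc k)
    have "d (z (n + Suc k)) (z n) \<le> d (z (n + Suc k)) (z (n + k)) + d (z (n + k)) (z n)"
      by (intro d_triangle zr)
    then show ?case using zr(3,4)[of "n + k"] Suc by simp
  qed simp
  have fast: "d (z (Suc n)) (z n) \<le> r 0 * (1/2) ^ n" for n
    using zr(3)[of n] zr(2)[of n] rn[of n] by linarith
  obtain w where w: "w \<in> Z" "(\<lambda>n. d (z n) w) \<longlonglongrightarrow> 0" using A_limit[OF zr(1,2) fast] by blast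
  have close: "d (z n) w \<le> r n" for n
  proof (rule LIMSEQ_le_const)
    have "(\<lambda>k. d (z (k + n)) w) \<longlonglongrightarrow> 0" by (rule LIMSEQ_ignore_initial_segment[OF w(2)])
    then have "(\<lambda>k. r n + d (z (k + n)) w) \<longlonglongrightarrow> r n + 0" by (intro tendsto_add tendsto_const)
    then show "(\<lambda>k. r n + d (z (k + n)) w) \<longlonglongrightarrow> r n" by simp
    show "\<exists>K. \<forall>k\<ge>K. d (z n) w \<le> r n + d (z (k + n)) w"
    proof (intro exI allI impI)
      fix k :: nat
      show "d (z n) w \<le> r n + d (z (k + n)) w"
        using d_triangle[OF zr(1)[of n] zr(1)[of "k + n"] w(1)] near[of n k] zr(2)[of "n + k"]
          d_commute[of "z n" "z (k + n)"] by (simp add: add.commute)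
    qed
  qed
  obtain n where "N w \<le> real n" using real_arch_simple by blast
  then show False using far[OF w(1), of n] close[of "Suc n"] by simp
qed

theorem bounded_inverse: "\<exists>K\<ge>0. \<forall>f\<in>Z. N f \<le> K * N (A f)"
proof -
  obtain n z0 r where z0: "z0 \<in> Z" "0 < r"
    and ball: "\<forall>z\<in>Z. d z z0 < r \<longrightarrow> (\<forall>e>0. \<exists>w\<in>Z. N w \<le> real n \<and> d z w < e)"
    using baire_ball by blast
  \<comment> \<open>A point z with small image is the difference of z + z0 and z0, both in the ball,
    so two norms of at most n add up to 2 n; the summand 1 makes D positive.\<close>
  define D where "D = 2 * real n + 1"
  have D: "0 < D" by (simp add: D_def)
  have dense: "\<exists>w\<in>Z. N w \<le> D \<and> d z w < e" if z: "z \<in> Z" "N (A z) < r" and e: "0 < e" for z e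
  proof -
    have zz: "(\<lambda>x. z x + z0 x) \<in> Z" by (intro Z_add z z0)
    have "d (\<lambda>x. z x + z0 x) z0 = N (A z)" by (simp add: d_eq[OF zz z0(1)])
    then obtain w1 where w1: "w1 \<in> Z" "N w1 \<le> real n" "d (\<lambda>x. z x + z0 x) w1 < e / 2"
      using ball zz z(2) e by (metis half_gt_zero)
    obtain w2 where w2: "w2 \<in> Z" "N w2 \<le> real n" "d z0 w2 < e / 2"
      using ball z0 e d_self[of z0] by (metis half_gt_zero)
    have w: "(\<lambda>x. w1 x - w2 x) \<in> Z" by (intro Z_diff w1 w2)
    have "N (\<lambda>x. w1 x - w2 x) \<le> D"
      using lp_norm_triangle_diff[OF Z_Lp[OF w1(1)] Z_Lp[OF w2(1)] p] w1(2) w2(2) by (simp add: D_def)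
    moreover have "d z (\<lambda>x. w1 x - w2 x) < e"
    proof -
      have u: "(\<lambda>x. z x + z0 x - w1 x) \<in> Z" "(\<lambda>x. z0 x - w2 x) \<in> Z"
        by (intro Z_diff zz w1 w2 z0)+
      have "d z (\<lambda>x. w1 x - w2 x) = N (A (\<lambda>x. z x - (w1 x - w2 x)))" by (rule d_eq[OF z(1) w])
      also have "(\<lambda>x. z x - (w1 x - w2 x)) = (\<lambda>x. (z x + z0 x - w1 x) - (z0 x - w2 x))" by auto
      also have "N (A \<dots>) = d (\<lambda>x. z x + z0 x - w1 x) (\<lambda>x. z0 x - w2 x)" by (rule d_eq[OF u, symmetric])
      also have "\<dots> \<le> N (A (\<lambda>x. z x + z0 x - w1 x)) + N (A (\<lambda>x. z0 x - w2 x))"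
        unfolding d_def by (intro lp_norm_triangle_diff A_Lp u p)
      also have "\<dots> < e"
        using w1(3) w2(3) d_eq[OF zz w1(1)] d_eq[OF z0(1) w2(1)] by simp
      finally show ?thesis .
    qed
    ultimately show ?thesis using w by blast
  qed
  \<comment> \<open>Homogeneity turns the density statement into one at scale 2^(-k).\<close>
  have scaled: "\<exists>w\<in>Z. N w \<le> D * (1/2) ^ k \<and> d z w < e"
    if z: "z \<in> Z" "N (A z) < r * (1/2) ^ k" and e: "0 < e" for z e k
  proof -
    let ?s = "complex_of_real (2 ^ k)" and ?t = "complex_of_real ((1/2) ^ k)"
    have sn: "norm ?s = 2 ^ k" "norm ?t = (1/2) ^ k" by (simp_all only: norm_of_real abs_of_nonneg zero_le_power zero_le_divide_1_iff zero_le_numeral)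
    have sz: "(\<lambda>x. ?s * z x) \<in> Z" by (intro Z_scale z)
    have "N (A (\<lambda>x. ?s * z x)) < r" using z(2) by (simp only: N_A_scale[OF z(1)] sn) (simp add: power_divide field_simps)
    then obtain w where w: "w \<in> Z" "N w \<le> D" "d (\<lambda>x. ?s * z x) w < e * 2 ^ k"
      using dense[OF sz, of "e * 2 ^ k"] e by auto
    have tw: "(\<lambda>x. ?t * w x) \<in> Z" by (intro Z_scale w)
    have "N (\<lambda>x. ?t * w x) \<le> D * (1/2) ^ k"
      using lp_norm_scale[of p m ?t w] p w(2) sn(2) by (simp add: mult.commute)
    moreover have "d z (\<lambda>x. ?t * w x) < e"
    proof -
      have "d z (\<lambda>x. ?t * w x) = N (A (\<lambda>x. z x - ?t * w x))" by (rule d_eq[OF z(1) tw])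
      also have "(\<lambda>x. z x - ?t * w x) = (\<lambda>x. ?t * (?s * z x - w x))"
        by (auto simp: algebra_simps power_divide)
      also have "N (A \<dots>) = (1/2) ^ k * d (\<lambda>x. ?s * z x) w"
        using N_A_scale[OF Z_diff[OF sz w(1)], of ?t] d_eq[OF sz w(1)] sn(2) by simp
      also have "\<dots> < (1/2) ^ k * (e * 2 ^ k)" using w(3) by (intro mult_strict_left_mono) auto
      also have "\<dots> = e" by (simp add: power_divide)
      finally show ?thesis .
    qed
    ultimately show ?thesis using tw by blast
  qed
  \<comment> \<open>Successive approximation: S k matches z up to r / 2^k in the range, and the
    corrections have norm at most D / 2^k, so S converges in norm as well. The clause for k = 0
    starts the sequence at the zero function, which bounds the limit by 2 D.\<close>
  have small: "N z \<le> 2 * D" if z: "z \<in> Z" "N (A z) < r" for z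
  proof -
    have "\<exists>S. \<forall>k. (S k \<in> Z \<and> d z (S k) < r * (1/2) ^ k \<and> (k = 0 \<longrightarrow> S k = (\<lambda>x. 0))) \<and>
        N (\<lambda>x. S (Suc k) x - S k x) \<le> D * (1/2) ^ k"
    proof (rule dependent_nat_choice)
      have "d z (\<lambda>x. 0) < r" using z d_eq[OF z(1) Z_zero] by simp
      then show "\<exists>S. S \<in> Z \<and> d z S < r * (1/2) ^ 0 \<and> ((0::nat) = 0 \<longrightarrow> S = (\<lambda>x. 0))"
        using Z_zero by (intro exI[of _ "\<lambda>x. 0"]) simp
      fix S k assume S: "S \<in> Z \<and> d z S < r * (1/2) ^ k \<and> (k = 0 \<longrightarrow> S = (\<lambda>x. 0))"
      have zS: "(\<lambda>x. z x - S x) \<in> Z" using S z by (intro Z_diff) auto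
      have "N (A (\<lambda>x. z x - S x)) < r * (1/2) ^ k" using S d_eq[OF z(1), of S] by simp
      then obtain w where w: "w \<in> Z" "N w \<le> D * (1/2) ^ k" "d (\<lambda>x. z x - S x) w < r * (1/2) ^ Suc k"
        using scaled[OF zS, of k "r * (1/2) ^ Suc k"] z0(2) by auto
      have Sw: "(\<lambda>x. S x + w x) \<in> Z" using S w by (intro Z_add) auto
      have "d z (\<lambda>x. S x + w x) = d (\<lambda>x. z x - S x) w"
        using d_eq[OF z(1) Sw] d_eq[OF zS w(1)] by (simp add: algebra_simps)
      then show "\<exists>S'. (S' \<in> Z \<and> d z S' < r * (1/2) ^ Suc k \<and> (Suc k = 0 \<longrightarrow> S' = (\<lambda>x. 0))) \<and>
          N (\<lambda>x. S' x - S x) \<le> D * (1/2) ^ k"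
        using w Sw by (intro exI[of _ "\<lambda>x. S x + w x"]) simp
    qed
    then obtain S where S: "\<forall>k. (S k \<in> Z \<and> d z (S k) < r * (1/2) ^ k \<and> (k = 0 \<longrightarrow> S k = (\<lambda>x. 0))) \<and>
        N (\<lambda>x. S (Suc k) x - S k x) \<le> D * (1/2) ^ k" by blast
    have SZ: "S k \<in> Z" for k using S by blast
    have S0: "S 0 = (\<lambda>x. 0)" using S by blast
    have Sd: "d z (S k) \<le> r * (1/2) ^ k" for k using S less_imp_le by blast
    have "\<exists>f\<in>Lp m p. \<forall>k. N (\<lambda>x. S k x - f x) \<le> 2 * D * (1/2) ^ k"
      by (rule Lp_complete_geometric[OF Z_Lp[OF SZ] p D]) (use S in blast)
    then obtain f where f: "f \<in> Lp m p" "\<forall>k. N (\<lambda>x. S k x - f x) \<le> 2 * D * (1/2) ^ k" by blast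
    have lim: "(\<lambda>k. N (\<lambda>x. S k x - f x)) \<longlonglongrightarrow> 0"
      by (rule Lim_null_comparison[OF _ geometric_null[of "2 * D"]]) (use f(2) in auto)
    have fZ: "f \<in> Z" by (rule Z_closed[OF SZ f(1) lim])
    have "N (\<lambda>x. S 0 x - f x) \<le> 2 * D * (1/2) ^ 0" using f(2) by blast
    then have Nf: "N f \<le> 2 * D"
      using S0 lp_norm_minus_commute[of m p "\<lambda>x. 0" f] by simp
    have "(\<lambda>k. r * (1/2) ^ k + C * N (\<lambda>x. S k x - f x)) \<longlonglongrightarrow> 0 + C * 0"
      by (intro tendsto_add geometric_null tendsto_mult tendsto_const lim)
    moreover have "d z f \<le> r * (1/2) ^ k + C * N (\<lambda>x. S k x - f x)" for k
      using d_triangle[OF z(1) SZ[of k] fZ] Sd[of k] d_eq[OF SZ[of k] fZ] A_bound[OF Z_diff[OF SZ[of k] fZ]]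
      by linarith
    ultimately have "d z f \<le> 0" using LIMSEQ_le_const[of _ "0 + C * 0" "d z f"] by auto
    then have "d z f = 0" using d_nonneg[of z f] by linarith
    then have "N (A (\<lambda>x. z x - f x)) = 0" using d_eq[OF z(1) fZ] by simp
    then have "AE x in m. A (\<lambda>x. z x - f x) x = 0"
      using lp_norm_eq_0_iff[OF A_Lp[OF Z_diff[OF z(1) fZ]]] p by simp
    then have "AE x in m. z x - f x = 0" using A_inj[OF Z_diff[OF z(1) fZ]] by simp
    then have "N z = N f"
      using Z_Lp[OF z(1)] f(1) by (intro lp_norm_cong_AE) (auto intro: Lp_measurable)
    then show ?thesis using Nf by simp
  qed
  have "N z \<le> (4 * D / r) * N (A z)" if z: "z \<in> Z" for z
  proof (cases "N (A z) = 0")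
    case True
    then have "AE x in m. A z x = 0" using lp_norm_eq_0_iff[OF A_Lp[OF z]] p by simp
    then have "AE x in m. z x = 0" by (rule A_inj[OF z])
    then have "N z = 0" using lp_norm_eq_0_iff[OF Z_Lp[OF z]] p by simp
    then show ?thesis using D z0 by simp
  next
    case False
    then have pos: "0 < N (A z)" using lp_norm_nonneg[of m p "A z"] by (simp add: order.strict_iff_order)
    \<comment> \<open>Scales the image of z to norm r / 2, where \<open>small\<close>
      applies.\<close>
    define t where "t = r / (2 * N (A z))"
    have t: "0 < t" using pos z0 by (simp add: t_def)
    have "N (A (\<lambda>x. complex_of_real t * z x)) = t * N (A z)"
      using N_A_scale[OF z, of "complex_of_real t"] t by (simp only: norm_of_real abs_of_pos)
    also have "\<dots> = r / 2" using pos by (simp add: t_def)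
    finally have "N (A (\<lambda>x. complex_of_real t * z x)) = r / 2" .
    then have "N (\<lambda>x. complex_of_real t * z x) \<le> 2 * D" using z0 by (intro small Z_scale z) auto
    then have "t * N z \<le> 2 * D" using lp_norm_scale[of p m "complex_of_real t" z] p t by simp
    then show ?thesis using pos z0 by (simp add: t_def field_simps)
  qed
  moreover have "0 \<le> 4 * D / r" using D z0 by simp
  ultimately show ?thesis by blast
qed

end

section \<open>Linear algebra of finitely many functions\<close>

text \<open>S is a maximal independent set of columns of the matrix L with rows in B: a row
  combination that vanishes on S vanishes on D, and all values on S can be prescribed. Applied to
  the Fourier coefficients of functions spanning the kernel, vanishing on S will define a closed
  complement of the kernel.\<close>

lemma interpolation_set:
  fixes L :: "'b \<Rightarrow> 'c \<Rightarrow> complex"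
  assumes "finite B"
  shows "\<exists>S. finite S \<and> S \<subseteq> D \<and>
    (\<forall>c. (\<forall>s\<in>S. (\<Sum>b\<in>B. c b * L b s) = 0) \<longrightarrow> (\<forall>t\<in>D. (\<Sum>b\<in>B. c b * L b t) = 0)) \<and>
    (\<forall>h. \<exists>c. \<forall>s\<in>S. h s = (\<Sum>b\<in>B. c b * L b s))"
  using assms
proof (induction B)
  case empty
  show ?case by (intro exI[of _ "{}"]) simp
next
  case (insert b B)
  obtain S where S: "finite S" "S \<subseteq> D"
    "\<forall>c. (\<forall>s\<in>S. (\<Sum>b\<in>B. c b * L b s) = 0) \<longrightarrow> (\<forall>t\<in>D. (\<Sum>b\<in>B. c b * L b t) = 0)"
    "\<forall>h. \<exists>c. \<forall>s\<in>S. h s = (\<Sum>b\<in>B. c b * L b s)"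
    using insert.IH by blast
  define E where "E c t = (\<Sum>b\<in>insert b B. c b * L b t)" for c t
  have E_B: "E c t = (\<Sum>b\<in>B. c b * L b t)" if "c b = 0" for c t
    using insert that by (simp add: E_def)
  have E_lin: "E (\<lambda>x. u * c x + v * c' x) t = u * E c t + v * E c' t" for u v c c' t
    by (simp add: E_def distrib_right sum.distrib sum_distrib_left mult.assoc)
  have ext: "\<exists>c. c b = 0 \<and> (\<forall>s\<in>S. h s = E c s)" for h
  proof -
    obtain c where c: "\<forall>s\<in>S. h s = (\<Sum>b\<in>B. c b * L b s)" using S(4) by blast
    have "E (c(b := 0)) s = (\<Sum>b\<in>B. c b * L b s)" for s
      using insert(2) by (subst E_B) (auto intro!: sum.cong)
    then show ?thesis using c by (intro exI[of _ "c(b := 0)"]) simp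
  qed
  show ?case
  \<comment> \<open>The new row either leaves the rank unchanged or contributes one column t, where
    some combination e that vanishes on S does not vanish.\<close>
  proof (cases "\<exists>e t. t \<in> D \<and> (\<forall>s\<in>S. E e s = 0) \<and> E e t \<noteq> 0")
    case False
    show ?thesis
      unfolding E_def[symmetric]
    proof (intro exI[of _ S] conjI S(1,2) allI impI ballI)
      fix c t assume "\<forall>s\<in>S. E c s = 0" "t \<in> D"
      then show "E c t = 0" using False by blast
    next
      fix h show "\<exists>c. \<forall>s\<in>S. h s = E c s" using ext by blast
    qed
  next
    case True
    then obtain e t where et: "t \<in> D" "\<forall>s\<in>S. E e s = 0" "E e t \<noteq> 0" by blast
    have eb: "e b \<noteq> 0"
    proof
      assume "e b = 0"
      then have "\<forall>s\<in>S. (\<Sum>b\<in>B. e b * L b s) = 0" using et(2) E_B[where c = e] by simp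
      then have "(\<Sum>b\<in>B. e b * L b t) = 0" using S(3) et(1) by blast
      then show False using et(3) E_B[where c = e, OF \<open>e b = 0\<close>] by simp
    qed
    show ?thesis
      unfolding E_def[symmetric]
    proof (intro exI[of _ "insert t S"] conjI allI impI ballI)
      show "finite (insert t S)" "insert t S \<subseteq> D" using S et by auto
      fix c u assume c: "\<forall>s\<in>insert t S. E c s = 0" and u: "u \<in> D"
      \<comment> \<open>Subtracting a multiple of e removes the row b and leads back to the
        induction hypothesis.\<close>
      define c' where "c' x = 1 * c x + (- (c b / e b)) * e x" for x
      have c'b: "c' b = 0" using eb by (simp add: c'_def)
      have Ec': "E c' s = E c s - c b / e b * E e s" for s
        unfolding c'_def E_lin by simp
      have "\<forall>s\<in>S. (\<Sum>b\<in>B. c' b * L b s) = 0"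
        using c et(2) unfolding E_B[where c = c', OF c'b, symmetric] Ec' by simp
      then have z: "E c' s = 0" if "s \<in> D" for s
        using S(3) that unfolding E_B[where c = c', OF c'b] by blast
      have "c b = 0" using z[OF et(1)] c et(3) eb unfolding Ec' by simp
      then show "E c u = 0" using z[OF u] unfolding Ec' by simp
    next
      fix h
      obtain c where c: "\<forall>s\<in>S. h s = E c s" using ext by blast
      define c' where "c' x = 1 * c x + ((h t - E c t) / E e t) * e x" for x
      have "E c' s = E c s + (h t - E c t) / E e t * E e s" for s
        unfolding c'_def E_lin by simp
      then have "\<forall>s\<in>insert t S. h s = E c' s" using c et by simp
      then show "\<exists>c. \<forall>s\<in>insert t S. h s = E c s" by blast
    qed
  qed
qed

text \<open>There are more unknowns than equations; Gaussian elimination solves the equation b for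
  an unknown s0 with nonzero coefficient.\<close>

lemma homogeneous_system:
  fixes c :: "'s \<Rightarrow> 'b \<Rightarrow> complex"
  assumes "finite B" "finite S" "card B < card S"
  shows "\<exists>a. (\<exists>s\<in>S. a s \<noteq> 0) \<and> (\<forall>b\<in>B. (\<Sum>s\<in>S. a s * c s b) = 0)"
  using assms
proof (induction B arbitrary: S c)
  case empty
  then have "S \<noteq> {}" by auto
  then show ?case by (intro exI[of _ "\<lambda>_. 1"]) auto
next
  case (insert b B)
  show ?case
  proof (cases "\<forall>s\<in>S. c s b = 0")
    case True
    have "\<exists>a. (\<exists>s\<in>S. a s \<noteq> 0) \<and> (\<forall>b\<in>B. (\<Sum>s\<in>S. a s * c s b) = 0)"
      by (rule insert.IH) (use insert in auto)
    then obtain a where "\<exists>s\<in>S. a s \<noteq> 0" "\<forall>b\<in>B. (\<Sum>s\<in>S. a s * c s b) = 0" by blast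
    then show ?thesis using True by (intro exI[of _ a]) auto
  next
    case False
    then obtain s0 where s0: "s0 \<in> S" "c s0 b \<noteq> 0" by blast
    define c' where "c' s b' = c s b' - (c s b / c s0 b) * c s0 b'" for s b'
    have "\<exists>a. (\<exists>s\<in>S - {s0}. a s \<noteq> 0) \<and> (\<forall>b'\<in>B. (\<Sum>s\<in>S - {s0}. a s * c' s b') = 0)"
      by (rule insert.IH) (use insert s0 in auto)
    then obtain a where a: "\<exists>s\<in>S - {s0}. a s \<noteq> 0" "\<forall>b'\<in>B. (\<Sum>s\<in>S - {s0}. a s * c' s b') = 0"
      by blast
    define k where "k = - (\<Sum>s\<in>S - {s0}. a s * c s b) / c s0 b"
    have split: "(\<Sum>s\<in>S. (a(s0 := k)) s * c s b') = k * c s0 b' + (\<Sum>s\<in>S - {s0}. a s * c s b')" for b'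
      using insert.prems s0 by (subst sum.remove[of S s0]) (auto intro!: sum.cong)
    have "(\<Sum>s\<in>S. (a(s0 := k)) s * c s b) = 0" unfolding split using s0(2) by (simp add: k_def)
    moreover have "(\<Sum>s\<in>S. (a(s0 := k)) s * c s b') = 0" if b': "b' \<in> B" for b'
    proof -
      have "(\<Sum>s\<in>S - {s0}. a s * c' s b') =
          (\<Sum>s\<in>S - {s0}. a s * c s b') - (\<Sum>s\<in>S - {s0}. a s * c s b) / c s0 b * c s0 b'"
        by (simp add: c'_def right_diff_distrib sum_subtractf sum_distrib_right sum_divide_distrib mult.assoc)
      then show ?thesis unfolding split using a(2) b' by (simp add: k_def)
    qed
    ultimately show ?thesis using a(1) by (intro exI[of _ "a(s0 := k)"]) auto
  qed
qed

text \<open>Here an identity matrix factors through B. Among more than \<open>card B\<close> rows of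
  the left factor there is a linear relation, but there is none among rows of the identity. This
  converts finite dimension into finiteness of a set of characters.\<close>

lemma identity_not_finite_rank:
  fixes c :: "'s \<Rightarrow> 'b \<Rightarrow> complex" and L :: "'b \<Rightarrow> 's \<Rightarrow> complex"
  assumes B: "finite B" and eq: "\<And>s t. s \<in> S \<Longrightarrow> t \<in> S \<Longrightarrow>
    (\<Sum>b\<in>B. c s b * L b t) = (if s = t then 1 else 0)"
  shows "finite S"
proof (rule ccontr)
  assume "infinite S"
  then obtain U where U: "finite U" "card U = Suc (card B)" "U \<subseteq> S"
    using infinite_arbitrarily_large by metis
  obtain a where a: "\<exists>s\<in>U. a s \<noteq> 0" "\<forall>b\<in>B. (\<Sum>s\<in>U. a s * c s b) = 0"
    using homogeneous_system[OF B U(1), of c] U(2) by auto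
  have "a t = 0" if t: "t \<in> U" for t
  proof -
    have "a t = (\<Sum>s\<in>U. if s = t then a t else 0)" using U t by simp
    also have "\<dots> = (\<Sum>s\<in>U. a s * (if s = t then 1 else 0))" by (intro sum.cong) auto
    also have "\<dots> = (\<Sum>s\<in>U. a s * (\<Sum>b\<in>B. c s b * L b t))"
    proof (rule sum.cong[OF refl])
      fix s assume "s \<in> U"
      then have "(\<Sum>b\<in>B. c s b * L b t) = (if s = t then 1 else 0)" using U(3) t by (intro eq) auto
      then show "a s * (if s = t then 1 else 0) = a s * (\<Sum>b\<in>B. c s b * L b t)" by simp
    qed
    also have "\<dots> = (\<Sum>s\<in>U. \<Sum>b\<in>B. (a s * c s b) * L b t)"
      by (simp add: sum_distrib_left mult.assoc)
    also have "\<dots> = (\<Sum>b\<in>B. (\<Sum>s\<in>U. a s * c s b) * L b t)"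
      by (subst sum.swap) (simp add: sum_distrib_right)
    also have "\<dots> = 0" using a(2) by simp
    finally show ?thesis .
  qed
  then show False using a(1) by blast
qed

section \<open>The Riesz projection on \<open>L\<^sup>p\<close>\<close>

context ordered_dual
begin

lemma Hp_unique:
  assumes f: "f \<in> Hp m T p" and g: "g \<in> Hp m T p" and p: "1 < p"
    and eq: "\<And>\<gamma>. \<gamma> \<in> T \<Longrightarrow> fourier m f \<gamma> = fourier m g \<gamma>"
  shows "AE x in m. f x = g x"
proof (rule fourier_unique[OF Hp_Lp[OF f] Hp_Lp[OF g] p])
  fix \<gamma> :: "'a \<Rightarrow> complex" assume \<gamma>: "\<gamma> \<in> characters"
  show "fourier m f \<gamma> = fourier m g \<gamma>"
    using eq Hp_fourier[OF f \<gamma>] Hp_fourier[OF g \<gamma>] by (cases "\<gamma> \<in> T") auto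
qed

lemma tpoly_sequence:
  assumes f: "f \<in> Lp m p" and p: "1 < p"
  shows "\<exists>F. (\<forall>n. F n \<in> tpoly characters) \<and> (\<lambda>n. lp_norm m p (\<lambda>x. F n x - f x)) \<longlonglongrightarrow> 0"
proof -
  have "\<forall>n. \<exists>q. q \<in> tpoly characters \<and> lp_norm m p (\<lambda>x. f x - q x) < inverse (real (Suc n))"
  proof
    fix n
    show "\<exists>q. q \<in> tpoly characters \<and> lp_norm m p (\<lambda>x. f x - q x) < inverse (real (Suc n))"
      using tpoly_dense_Lp[OF f, of "inverse (real (Suc n))"] p by auto
  qed
  from choice[OF this] obtain F where F: "\<And>n. F n \<in> tpoly characters"
    "\<And>n. lp_norm m p (\<lambda>x. f x - F n x) < inverse (real (Suc n))" by auto
  have "(\<lambda>n. lp_norm m p (\<lambda>x. F n x - f x)) \<longlonglongrightarrow> 0"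
  proof (rule Lim_null_comparison[OF _ LIMSEQ_inverse_real_of_nat], intro always_eventually allI)
    fix n
    show "norm (lp_norm m p (\<lambda>x. F n x - f x)) \<le> inverse (real (Suc n))"
      using F(2)[of n] lp_norm_minus_commute[of m p f "F n"] by simp
  qed
  then show ?thesis using F(1) by blast
qed

lemma riesz_extension:
  assumes p: "1 < p"
  shows "\<exists>C\<ge>0. \<forall>f\<in>Lp m p. \<exists>g. g \<in> Hp m T p \<and> (\<forall>\<gamma>\<in>T. fourier m g \<gamma> = fourier m f \<gamma>) \<and>
    lp_norm m p g \<le> C * lp_norm m p f"
proof -
  have p1: "1 \<le> p" using p by simp
  obtain K where K: "0 \<le> K" "\<forall>f g. riesz_pair f g \<longrightarrow> lp_norm m p g \<le> K * lp_norm m p f"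
    using riesz_bound[OF p] by blast
  have "\<exists>g. g \<in> Hp m T p \<and> (\<forall>\<gamma>\<in>T. fourier m g \<gamma> = fourier m f \<gamma>) \<and> lp_norm m p g \<le> K * lp_norm m p f"
    if f: "f \<in> Lp m p" for f
  proof -
    obtain F where F: "\<And>n. F n \<in> tpoly characters" "(\<lambda>n. lp_norm m p (\<lambda>x. F n x - f x)) \<longlonglongrightarrow> 0"
      using tpoly_sequence[OF f p] by blast
    have "\<forall>n. \<exists>g. riesz_pair (F n) g" using riesz_pair_exists[OF F(1)] by blast
    from choice[OF this] obtain G where G: "\<And>n. riesz_pair (F n) (G n)" by blast
    have FL: "F n \<in> Lp m p" for n using tpoly_Lp[OF F(1)] p by simp
    have GT: "G n \<in> tpoly T" for n using G[of n] by (simp add: riesz_pair_def)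
    have GH: "G n \<in> Hp m T p" for n using tpoly_Hp[OF GT T_sub] p by simp
    have GL: "G n \<in> Lp m p" for n using Hp_Lp[OF GH] .
    have diff: "lp_norm m p (\<lambda>x. G k x - G n x) \<le> K * lp_norm m p (\<lambda>x. F k x - F n x)" for k n
      using K(2) riesz_pair_lincomb[OF G[of k] G[of n], of 1 "-1"] by fastforce
    have "\<exists>N. \<forall>k\<ge>N. \<forall>n\<ge>N. lp_norm m p (\<lambda>x. G k x - G n x) < e" if e: "0 < e" for e
    proof -
      have K1: "0 < 2 * (K + 1)" using K by simp
      have "0 < e / (2 * (K + 1))" using e K1 by simp
      from LIMSEQ_D[OF F(2) this] obtain N
        where N: "\<forall>n\<ge>N. lp_norm m p (\<lambda>x. F n x - f x) < e / (2 * (K + 1))" by auto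
      have "lp_norm m p (\<lambda>x. G k x - G n x) < e" if kn: "k \<ge> N" "n \<ge> N" for k n
      proof -
        have "lp_norm m p (\<lambda>x. F k x - F n x) \<le> lp_norm m p (\<lambda>x. F k x - f x) + lp_norm m p (\<lambda>x. f x - F n x)"
          by (rule lp_norm_triangle3[OF FL f FL p1])
        also have "\<dots> < e / (2 * (K + 1)) + e / (2 * (K + 1))"
          using N kn lp_norm_minus_commute[of m p f "F n"] by (intro add_strict_mono) auto
        also have "\<dots> = e / (K + 1)"
        proof -
          have "e / (2 * (K + 1)) = (e / (K + 1)) / 2" by simp
          then show ?thesis by (simp only: field_sum_of_halves)
        qed
        finally have l: "lp_norm m p (\<lambda>x. F k x - F n x) < e / (K + 1)" .
        have "K * lp_norm m p (\<lambda>x. F k x - F n x) \<le> (K + 1) * lp_norm m p (\<lambda>x. F k x - F n x)"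
          by (intro mult_right_mono) auto
        also have "\<dots> < (K + 1) * (e / (K + 1))" using l K by (intro mult_strict_left_mono) auto
        also have "\<dots> = e" using K by simp
        finally show ?thesis using diff[of k n] by linarith
      qed
      then show ?thesis by blast
    qed
    from Lp_complete[OF GL p1 this] obtain g
      where g: "g \<in> Lp m p" "(\<lambda>n. lp_norm m p (\<lambda>x. G n x - g x)) \<longlonglongrightarrow> 0" by blast
    have "g \<in> Hp m T p" by (rule Hp_closed[OF GH g(1) p g(2)])
    moreover have "fourier m g \<gamma> = fourier m f \<gamma>" if \<gamma>: "\<gamma> \<in> T" for \<gamma>
    proof -
      have "(\<lambda>n. fourier m (G n) \<gamma>) \<longlonglongrightarrow> fourier m g \<gamma>"
        by (rule fourier_tendsto[OF GL g(1) p T_char[OF \<gamma>] g(2)])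
      moreover have "fourier m (G n) \<gamma> = fourier m (F n) \<gamma>" for n
        using G[of n] \<gamma> by (simp add: riesz_pair_def)
      moreover have "(\<lambda>n. fourier m (F n) \<gamma>) \<longlonglongrightarrow> fourier m f \<gamma>"
        by (rule fourier_tendsto[OF FL f p T_char[OF \<gamma>] F(2)])
      ultimately show ?thesis using LIMSEQ_unique by simp
    qed
    moreover have "lp_norm m p g \<le> K * lp_norm m p f"
    proof (rule LIMSEQ_le)
      show "(\<lambda>n. lp_norm m p (G n)) \<longlonglongrightarrow> lp_norm m p g" by (rule lp_norm_tendsto[OF GL g(1) p1 g(2)])
      show "(\<lambda>n. K * lp_norm m p (F n)) \<longlonglongrightarrow> K * lp_norm m p f"
        by (intro tendsto_mult tendsto_const lp_norm_tendsto[OF FL f p1 F(2)])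
      show "\<exists>N. \<forall>n\<ge>N. lp_norm m p (G n) \<le> K * lp_norm m p (F n)" using K(2) G by blast
    qed
    ultimately show ?thesis by blast
  qed
  then show ?thesis using K(1) by blast
qed

text \<open>The values of P are chosen independently for each f. Linearity and the formula on
  polynomials have to hold only almost everywhere, and so they follow because coefficients over T
  determine an element of the Hardy space up to a null function.\<close>

theorem extends_riesz_exists:
  assumes p: "1 < p"
  shows "\<exists>P. extends_riesz m T p P"
proof -
  obtain C where C: "0 \<le> C" "\<forall>f\<in>Lp m p. \<exists>g. g \<in> Hp m T p \<and> (\<forall>\<gamma>\<in>T. fourier m g \<gamma> = fourier m f \<gamma>) \<and>
    lp_norm m p g \<le> C * lp_norm m p f"
    using riesz_extension[OF p] by blast
  from bchoice[OF C(2)] obtain P where P: "\<forall>f\<in>Lp m p. P f \<in> Hp m T p \<and>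
    (\<forall>\<gamma>\<in>T. fourier m (P f) \<gamma> = fourier m f \<gamma>) \<and> lp_norm m p (P f) \<le> C * lp_norm m p f" by blast
  have lin: "AE x in m. P (\<lambda>x. a * f x + b * g x) x = a * P f x + b * P g x"
    if f: "f \<in> Lp m p" and g: "g \<in> Lp m p" for f g a b
  proof (rule Hp_unique[OF _ _ p])
    have fg: "(\<lambda>x. a * f x + b * g x) \<in> Lp m p" using p by (intro Lp_lincomb f g) auto
    show "P (\<lambda>x. a * f x + b * g x) \<in> Hp m T p" using P fg by blast
    show "(\<lambda>x. a * P f x + b * P g x) \<in> Hp m T p" using P f g p by (intro Hp_lincomb) auto
    fix \<gamma> assume \<gamma>: "\<gamma> \<in> T"
    have "fourier m (\<lambda>x. a * P f x + b * P g x) \<gamma> = a * fourier m (P f) \<gamma> + b * fourier m (P g) \<gamma>"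
      using P f g by (intro fourier_lincomb[OF _ _ T_char[OF \<gamma>] p] Hp_Lp) auto
    also have "\<dots> = a * fourier m f \<gamma> + b * fourier m g \<gamma>" using P f g \<gamma> by simp
    also have "\<dots> = fourier m (\<lambda>x. a * f x + b * g x) \<gamma>"
      by (rule fourier_lincomb[OF f g T_char[OF \<gamma>] p, symmetric])
    also have "\<dots> = fourier m (P (\<lambda>x. a * f x + b * g x)) \<gamma>" using P fg \<gamma> by simp
    finally show "fourier m (P (\<lambda>x. a * f x + b * g x)) \<gamma> = fourier m (\<lambda>x. a * P f x + b * P g x) \<gamma>" ..
  qed
  have poly: "AE x in m. P (lin_comb M c) x = lin_comb (M \<inter> T) c x"
    if M: "finite M" "M \<subseteq> characters" for M c
  proof (rule Hp_unique[OF _ _ p])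
    have L: "lin_comb M c \<in> Lp m p" using tpoly_Lp[OF tpolyI[OF M]] p by simp
    show "P (lin_comb M c) \<in> Hp m T p" using P L by blast
    have pr: "riesz_pair (lin_comb M c) (lin_comb (M \<inter> T) c)" by (rule riesz_pair_lin_comb[OF M])
    then show "lin_comb (M \<inter> T) c \<in> Hp m T p"
      using tpoly_Hp[OF _ T_sub] p by (simp add: riesz_pair_def)
    fix \<gamma> assume "\<gamma> \<in> T"
    then show "fourier m (P (lin_comb M c)) \<gamma> = fourier m (lin_comb (M \<inter> T) c) \<gamma>"
      using P L pr by (simp add: riesz_pair_def)
  qed
  have "extends_riesz m T p P"
    unfolding extends_riesz_def bounded_operator_def
  proof (intro conjI)
    show "\<forall>f\<in>Lp m p. P f \<in> Hp m T p" using P by blast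
    show "\<forall>f\<in>Lp m p. \<forall>g\<in>Lp m p. \<forall>a b. AE x in m. P (\<lambda>x. a * f x + b * g x) x = a * P f x + b * P g x"
      by (intro ballI allI lin)
    show "\<exists>C. \<forall>f\<in>Lp m p. lp_norm m p (P f) \<le> C * lp_norm m p f" using P by blast
    show "\<forall>M c. finite M \<and> M \<subseteq> characters \<longrightarrow> (AE x in m. P (lin_comb M c) x = lin_comb (M \<inter> T) c x)"
      by (intro allI impI poly) auto
  qed
  then show ?thesis by blast
qed

end

section \<open>The Riesz projection as an operator, and its Fourier coefficients\<close>

locale hardy = ordered_dual m T
  for m :: "'a::{topological_ab_group_add, t2_space} measure" and T +
  fixes p :: real
  assumes p: "1 < p"
begin

abbreviation "L \<equiv> Lp m p"
abbreviation "H \<equiv> Hp m T p"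
abbreviation "N \<equiv> lp_norm m p"
abbreviation "P \<equiv> riesz_projection m T p"

lemma p01 [simp]: "0 < p" "1 \<le> p"
  using p by simp_all

lemma P_ext: "extends_riesz m T p P"
  unfolding riesz_projection_def by (rule someI_ex[OF extends_riesz_exists[OF p]])

lemma P_H: "f \<in> L \<Longrightarrow> P f \<in> H"
  using P_ext by (simp add: extends_riesz_def bounded_operator_def)

lemma P_bound: "\<exists>C\<ge>0. \<forall>f\<in>L. N (P f) \<le> C * N f"
proof -
  obtain C where C: "\<forall>f\<in>L. N (P f) \<le> C * N f"
    using P_ext unfolding extends_riesz_def bounded_operator_def by blast
  have "N (P f) \<le> \<bar>C\<bar> * N f" if "f \<in> L" for f
  proof -
    have "C * N f \<le> \<bar>C\<bar> * N f" by (intro mult_right_mono) auto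
    then show ?thesis using C that by fastforce
  qed
  then show ?thesis by (intro exI[of _ "\<bar>C\<bar>"]) auto
qed

text \<open>The projection is prescribed only on polynomials; density and boundedness carry the
  coefficients over to all of \<open>L\<close>. Afterwards it enters only through this fact, its
  range and its bound.\<close>

lemma P_fourier:
  assumes f: "f \<in> L" and \<gamma>: "\<gamma> \<in> T"
  shows "fourier m (P f) \<gamma> = fourier m f \<gamma>"
proof -
  obtain F where F: "\<And>n. F n \<in> tpoly characters" "(\<lambda>n. N (\<lambda>x. F n x - f x)) \<longlonglongrightarrow> 0"
    using tpoly_sequence[OF f p] by blast
  obtain C where C: "0 \<le> C" "\<forall>f\<in>L. N (P f) \<le> C * N f" using P_bound by blast
  have FL: "F n \<in> L" for n using tpoly_Lp[OF F(1)] by simp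
  have PL: "P (F n) \<in> L" "P f \<in> L" for n using Hp_Lp[OF P_H] FL f by auto
  have eq: "fourier m (P (F n)) \<gamma> = fourier m (F n) \<gamma>" for n
  proof -
    obtain M c where M: "finite M" "M \<subseteq> characters" "F n = lin_comb M c"
      using F(1)[of n] by (auto simp: tpoly_def)
    have pr: "riesz_pair (F n) (lin_comb (M \<inter> T) c)" unfolding M(3) by (rule riesz_pair_lin_comb[OF M(1,2)])
    have "AE x in m. P (F n) x = lin_comb (M \<inter> T) c x"
      using P_ext M(1,2) unfolding M(3) by (simp add: extends_riesz_def)
    moreover have "cts (lin_comb (M \<inter> T) c)"
      using pr tpoly_continuous[OF _ T_sub] by (simp add: riesz_pair_def)
    ultimately have "fourier m (P (F n)) \<gamma> = fourier m (lin_comb (M \<inter> T) c) \<gamma>"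
      using PL(1) charactersD(1)[OF T_char[OF \<gamma>]]
      by (intro fourier_cong_AE) (auto intro: measurable_continuous Lp_measurable)
    then show ?thesis using pr \<gamma> by (simp add: riesz_pair_def)
  qed
  have "(\<lambda>n. N (\<lambda>x. P (F n) x - P f x)) \<longlonglongrightarrow> 0"
  proof (rule Lim_null_comparison[of _ "\<lambda>n. C * N (\<lambda>x. F n x - f x)"])
    show "(\<lambda>n. C * N (\<lambda>x. F n x - f x)) \<longlonglongrightarrow> 0" using tendsto_mult_right_zero[OF F(2)] .
    show "\<forall>\<^sub>F n in sequentially. norm (N (\<lambda>x. P (F n) x - P f x)) \<le> C * N (\<lambda>x. F n x - f x)"
    proof (intro always_eventually allI)
      fix n
      let ?d = "\<lambda>x. 1 * F n x + (-1) * f x"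
      have dL: "?d \<in> L" by (intro Lp_lincomb FL f p01)
      have "AE x in m. P ?d x = 1 * P (F n) x + (-1) * P f x"
        using P_ext FL[of n] f unfolding extends_riesz_def bounded_operator_def by blast
      then have "N (P ?d) = N (\<lambda>x. 1 * P (F n) x + (-1) * P f x)"
        using Lp_measurable[OF Hp_Lp[OF P_H[OF dL]]] Lp_measurable[OF PL(1)[of n]] Lp_measurable[OF PL(2)]
        by (intro lp_norm_cong_AE) auto
      then show "norm (N (\<lambda>x. P (F n) x - P f x)) \<le> C * N (\<lambda>x. F n x - f x)"
        using C(2) dL by fastforce
    qed
  qed
  then have "(\<lambda>n. fourier m (P (F n)) \<gamma>) \<longlonglongrightarrow> fourier m (P f) \<gamma>"
    by (rule fourier_tendsto[OF PL p T_char[OF \<gamma>]])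
  moreover have "(\<lambda>n. fourier m (F n) \<gamma>) \<longlonglongrightarrow> fourier m f \<gamma>"
    by (rule fourier_tendsto[OF FL f p T_char[OF \<gamma>] F(2)])
  ultimately show ?thesis unfolding eq using LIMSEQ_unique by blast
qed

lemma Linf_mult:
  assumes \<psi>: "\<psi> \<in> Linf m" and f: "f \<in> L"
  shows "(\<lambda>x. \<psi> x * f x) \<in> L"
proof -
  obtain C where C: "AE x in m. norm (\<psi> x) \<le> C" and \<psi>m: "\<psi> \<in> borel_measurable m"
    using \<psi> by (auto simp: Linf_def)
  have "AE x in m. norm (\<psi> x) \<le> \<bar>C\<bar>" using C by eventually_elim simp
  then show ?thesis by (rule Lp_mult_bounded(1)[OF f \<psi>m]) auto
qed

lemma Linf_diff_const:
  assumes "\<phi> \<in> Linf m"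
  shows "(\<lambda>x. \<phi> x - z) \<in> Linf m"
proof -
  obtain C where C: "AE x in m. norm (\<phi> x) \<le> C" and m: "\<phi> \<in> borel_measurable m"
    using assms by (auto simp: Linf_def)
  have "AE x in m. norm (\<phi> x - z) \<le> C + norm z"
    using C by eventually_elim (metis norm_triangle_ineq4 add_right_mono order_trans)
  then show ?thesis using m by (auto simp: Linf_def)
qed

lemma fourier_mult_lin_comb:
  assumes B: "finite B" "\<And>b. b \<in> B \<Longrightarrow> (\<lambda>x. \<psi> x * b x) \<in> L" and \<gamma>: "\<gamma> \<in> characters"
  shows "fourier m (\<lambda>x. \<psi> x * lin_comb B c x) \<gamma> = (\<Sum>b\<in>B. c b * fourier m (\<lambda>x. \<psi> x * b x) \<gamma>)"
proof -
  have "(\<lambda>x. \<psi> x * lin_comb B c x) = (\<lambda>x. \<Sum>b\<in>B. c b * (\<psi> x * b x))"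
    by (auto simp: lin_comb_def sum_distrib_left mult.left_commute)
  then have "fourier m (\<lambda>x. \<psi> x * lin_comb B c x) \<gamma> = (\<Sum>b\<in>B. fourier m (\<lambda>x. c b * (\<psi> x * b x)) \<gamma>)"
    using fourier_sum[of B "\<lambda>b x. c b * (\<psi> x * b x)", OF Lp_scale[OF B(2)] \<gamma> p] by simp
  then show ?thesis unfolding fourier_scale .
qed

lemma fourier_lin_comb_Lp:
  assumes B: "finite B" "B \<subseteq> L" and \<gamma>: "\<gamma> \<in> characters"
  shows "fourier m (lin_comb B c) \<gamma> = (\<Sum>b\<in>B. c b * fourier m b \<gamma>)"
  using fourier_mult_lin_comb[of B "\<lambda>_. 1" \<gamma> c] B \<gamma> by auto

lemma lin_comb_H:
  assumes "finite B" "B \<subseteq> H"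
  shows "lin_comb B c \<in> H"
  unfolding lin_comb_def using assms by (intro Hp_sum Hp_scale p) auto

section \<open>Toeplitz operators with Fredholm property are bounded below\<close>

lemma toeplitz_shift_H:
  assumes \<phi>: "\<phi> \<in> Linf m" and f: "f \<in> H"
  shows "(\<lambda>x. toeplitz m T p \<phi> f x - z * f x) \<in> H"
  unfolding toeplitz_def using Hp_lincomb[OF P_H[OF Linf_mult[OF \<phi> Hp_Lp[OF f]]] f p, of 1 "- z"] by simp

lemma toeplitz_shift_fourier:
  assumes \<phi>: "\<phi> \<in> Linf m" and f: "f \<in> H" and \<gamma>: "\<gamma> \<in> T"
  shows "fourier m (\<lambda>x. toeplitz m T p \<phi> f x - z * f x) \<gamma> = fourier m (\<lambda>x. (\<phi> x - z) * f x) \<gamma>"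
proof -
  note fL = Hp_Lp[OF f] and \<phi>f = Linf_mult[OF \<phi> Hp_Lp[OF f]]
  note 1 = fourier_lincomb[OF Hp_Lp[OF P_H[OF \<phi>f]] fL T_char[OF \<gamma>] p, of 1 "- z"]
  note 2 = fourier_lincomb[OF \<phi>f fL T_char[OF \<gamma>] p, of 1 "- z"]
  show ?thesis using 1 2 P_fourier[OF \<phi>f \<gamma>] by (simp add: toeplitz_def left_diff_distrib)
qed

text \<open>Removes the projection: equations for the operator become equations over T for the plain
  product with the symbol.\<close>

lemma toeplitz_shift_AE_iff:
  assumes \<phi>: "\<phi> \<in> Linf m" and f: "f \<in> H" and g: "g \<in> H"
  shows "(AE x in m. toeplitz m T p \<phi> f x - z * f x = g x) \<longleftrightarrow>
    (\<forall>\<gamma>\<in>T. fourier m (\<lambda>x. (\<phi> x - z) * f x) \<gamma> = fourier m g \<gamma>)"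
proof
  assume ae: "AE x in m. toeplitz m T p \<phi> f x - z * f x = g x"
  show "\<forall>\<gamma>\<in>T. fourier m (\<lambda>x. (\<phi> x - z) * f x) \<gamma> = fourier m g \<gamma>"
  proof
    fix \<gamma> assume \<gamma>: "\<gamma> \<in> T"
    have "fourier m (\<lambda>x. toeplitz m T p \<phi> f x - z * f x) \<gamma> = fourier m g \<gamma>"
      using Lp_measurable[OF Hp_Lp[OF toeplitz_shift_H[OF \<phi> f]]] Lp_measurable[OF Hp_Lp[OF g]]
        measurable_continuous[OF charactersD(1)[OF T_char[OF \<gamma>]]] ae
      by (intro fourier_cong_AE) auto
    then show "fourier m (\<lambda>x. (\<phi> x - z) * f x) \<gamma> = fourier m g \<gamma>"
      using toeplitz_shift_fourier[OF \<phi> f \<gamma>] by simp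
  qed
next
  assume eq: "\<forall>\<gamma>\<in>T. fourier m (\<lambda>x. (\<phi> x - z) * f x) \<gamma> = fourier m g \<gamma>"
  show "AE x in m. toeplitz m T p \<phi> f x - z * f x = g x"
    using eq toeplitz_shift_fourier[OF \<phi> f]
    by (intro Hp_unique[OF toeplitz_shift_H[OF \<phi> f] g p]) auto
qed

lemma toeplitz_shift_norm:
  assumes \<phi>: "\<phi> \<in> Linf m" and f: "f \<in> H"
  shows "N (\<lambda>x. toeplitz m T p \<phi> f x - z * f x) = N (P (\<lambda>x. (\<phi> x - z) * f x))"
proof (rule lp_norm_cong_AE)
  have \<psi>f: "(\<lambda>x. (\<phi> x - z) * f x) \<in> L" by (rule Linf_mult[OF Linf_diff_const[OF \<phi>] Hp_Lp[OF f]])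
  show "AE x in m. toeplitz m T p \<phi> f x - z * f x = P (\<lambda>x. (\<phi> x - z) * f x) x"
    unfolding toeplitz_shift_AE_iff[OF \<phi> f P_H[OF \<psi>f]] using P_fourier[OF \<psi>f] by simp
  show "(\<lambda>x. toeplitz m T p \<phi> f x - z * f x) \<in> borel_measurable m"
    "P (\<lambda>x. (\<phi> x - z) * f x) \<in> borel_measurable m"
    using toeplitz_shift_H[OF \<phi> f] P_H[OF \<psi>f] by (auto intro: Lp_measurable Hp_Lp)
qed

section \<open>Powers and shifts inside the positive cone\<close>

lemma T_power:
  assumes "\<theta> \<in> T"
  shows "(\<lambda>x. \<theta> x ^ n) \<in> T"
proof (induction n)
  case (Suc n)
  then show ?case using T_mult[OF assms Suc] by (simp add: char_mult_def)
qed simp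

text \<open>A coincidence of powers gives \<theta> \<theta>^k = 1 with both factors in T, which
  forces \<theta> = 1.\<close>

lemma T_power_inj:
  assumes \<theta>: "\<theta> \<in> T" "\<theta> \<noteq> (\<lambda>_. 1)"
  shows "inj (\<lambda>n x. \<theta> x ^ n)"
proof -
  have ne: "(\<lambda>x. \<theta> x ^ i) \<noteq> (\<lambda>x. \<theta> x ^ j)" if ij: "i < j" for i j
  proof
    assume eq: "(\<lambda>x. \<theta> x ^ i) = (\<lambda>x. \<theta> x ^ j)"
    obtain k where k: "j = i + Suc k" using ij less_iff_Suc_add by auto
    have "\<theta> x * \<theta> x ^ k = 1" for x
    proof -
      have "\<theta> x ^ i * (\<theta> x * \<theta> x ^ k) = \<theta> x ^ i * 1"
        using fun_cong[OF eq, of x] by (simp add: k power_add)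
      then show ?thesis using charactersD(9)[OF T_char[OF \<theta>(1)], of x] by simp
    qed
    then have "char_mult \<theta> (\<lambda>x. \<theta> x ^ k) = (\<lambda>_. 1)" by (simp add: char_mult_def)
    then show False using T_mult_eq_one(1)[OF \<theta>(1) T_power[OF \<theta>(1)]] \<theta>(2) by blast
  qed
  show ?thesis
  proof (rule injI)
    fix i j assume "(\<lambda>x. \<theta> x ^ i) = (\<lambda>x. \<theta> x ^ j)"
    then show "i = j" using ne[of i j] ne[of j i] by (metis linorder_neqE_nat)
  qed
qed

text \<open>Linearity of the order lets a product of inverses push all of M into T. Multiplying
  further by powers of a nontrivial \<theta> in T keeps it there, and as these powers are distinct,
  only finitely many exponents meet S. A nontrivial group has such a \<theta> because characters
  separate points.\<close>

lemma shift_into_cone: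
  assumes nontrivial: "\<exists>x::'a. x \<noteq> 0" and M: "finite M" "M \<subseteq> characters" and S: "finite S"
  shows "\<exists>\<kappa>\<in>T. \<forall>\<mu>\<in>M. char_mult \<kappa> \<mu> \<in> T - S"
proof -
  have "\<exists>\<kappa>\<in>T. \<forall>\<mu>\<in>M. char_mult \<kappa> \<mu> \<in> T"
    using M
  proof (induction M)
    case empty
    then show ?case using T_one by blast
  next
    case (insert \<mu> M)
    then obtain \<kappa> where \<kappa>: "\<kappa> \<in> T" "\<forall>\<mu>\<in>M. char_mult \<kappa> \<mu> \<in> T" by auto
    obtain \<xi> where \<xi>: "\<xi> \<in> T" "char_mult \<xi> \<mu> \<in> T"
    proof (cases "\<mu> \<in> T")
      case True
      then show thesis using that[of "\<lambda>_. 1"] by simp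
    next
      case False
      then show thesis using that[of "char_inv \<mu>"] T_total[of \<mu>] insert.prems by simp
    qed
    have "char_mult (char_mult \<kappa> \<xi>) \<nu> \<in> T" if \<nu>: "\<nu> \<in> insert \<mu> M" for \<nu>
    proof (cases "\<nu> = \<mu>")
      case True
      then show ?thesis using T_mult[OF \<kappa>(1) \<xi>(2)] by (simp add: char_mult_assoc)
    next
      case False
      then have "char_mult \<xi> (char_mult \<kappa> \<nu>) \<in> T" using \<kappa>(2) \<nu> by (intro T_mult[OF \<xi>(1)]) auto
      then show ?thesis by (metis char_mult_assoc char_mult_commute)
    qed
    then show ?case using T_mult[OF \<kappa>(1) \<xi>(1)] by blast
  qed
  then obtain \<kappa> where \<kappa>: "\<kappa> \<in> T" "\<forall>\<mu>\<in>M. char_mult \<kappa> \<mu> \<in> T" by blast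
  obtain x :: 'a where x: "x \<noteq> 0" using nontrivial by blast
  obtain \<gamma> where \<gamma>: "\<gamma> \<in> characters" "\<gamma> x \<noteq> \<gamma> 0" using characters_separate[OF x] by blast
  then have \<gamma>1: "\<gamma> \<noteq> (\<lambda>_. 1)" by auto
  obtain \<theta> where \<theta>: "\<theta> \<in> T" "\<theta> \<noteq> (\<lambda>_. 1)"
  proof (cases "\<gamma> \<in> T")
    case True
    then show thesis using that \<gamma>1 by blast
  next
    case False
    have "char_inv \<gamma> \<noteq> (\<lambda>_. 1)" using \<gamma>1 char_inv_inv[of \<gamma>] char_inv_one by metis
    then show thesis using that T_total[OF \<gamma>(1) False] by blast
  qed
  define c where "c n = char_mult \<kappa> (\<lambda>x. \<theta> x ^ n)" for n
  have injc: "inj (\<lambda>n. char_mult (c n) \<mu>)" if \<mu>: "\<mu> \<in> characters" for \<mu>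
  proof -
    have "(\<lambda>n. char_mult (c n) \<mu>) = char_mult (char_mult \<kappa> \<mu>) \<circ> (\<lambda>n x. \<theta> x ^ n)"
      by (auto simp: c_def char_mult_def fun_eq_iff)
    moreover have "inj \<dots>"
      by (intro inj_compose inj_char_mult characters_mult \<mu> T_char[OF \<kappa>(1)] T_power_inj[OF \<theta>])
    ultimately show ?thesis by simp
  qed
  have "finite (\<Union>\<mu>\<in>M. (\<lambda>n. char_mult (c n) \<mu>) -` S)"
    using M S injc by (intro finite_UN_I finite_vimageI) auto
  then obtain n where n: "n \<notin> (\<Union>\<mu>\<in>M. (\<lambda>n. char_mult (c n) \<mu>) -` S)"
    using ex_new_if_finite[OF infinite_UNIV_nat] by blast
  have "char_mult (c n) \<mu> \<in> T - S" if \<mu>: "\<mu> \<in> M" for \<mu>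
  proof -
    have "char_mult (\<lambda>x. \<theta> x ^ n) (char_mult \<kappa> \<mu>) \<in> T"
      using T_mult[OF T_power[OF \<theta>(1)]] \<kappa>(2) \<mu> by blast
    moreover have "char_mult (\<lambda>x. \<theta> x ^ n) (char_mult \<kappa> \<mu>) = char_mult (c n) \<mu>"
      by (auto simp: c_def char_mult_def)
    ultimately show ?thesis using n \<mu> by auto
  qed
  moreover have "c n \<in> T" unfolding c_def by (intro T_mult T_power \<kappa> \<theta>)
  ultimately show ?thesis by blast
qed

text \<open>Multiplication by a large character moves any polynomial into the finite-codimensional
  subspace on which the Fredholm operator is bounded below, without changing the norms.\<close>

lemma fredholm_bounded_below_tpoly:
  assumes nontrivial: "\<exists>x::'a. x \<noteq> 0" and \<phi>: "\<phi> \<in> Linf m"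
    and fr: "fredholm m p H (\<lambda>f x. toeplitz m T p \<phi> f x - z * f x)"
  shows "\<exists>K\<ge>0. \<forall>q\<in>tpoly characters. N q \<le> K * N (\<lambda>x. (\<phi> x - z) * q x)"
proof -
  define A where "A f x = toeplitz m T p \<phi> f x - z * f x" for f x
  have fr: "fredholm m p H A" using fr unfolding A_def[abs_def] .
  have AH: "A f \<in> H" if "f \<in> H" for f
    using toeplitz_shift_H[OF \<phi> that] unfolding A_def[abs_def] .
  have A_iff: "(AE x in m. A f x = g x) \<longleftrightarrow> (\<forall>\<gamma>\<in>T. fourier m (\<lambda>x. (\<phi> x - z) * f x) \<gamma> = fourier m g \<gamma>)"
    if "f \<in> H" "g \<in> H" for f g
    using toeplitz_shift_AE_iff[OF \<phi> that] unfolding A_def[abs_def] .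
  have \<psi>L: "(\<lambda>x. (\<phi> x - z) * f x) \<in> L" if "f \<in> L" for f
    by (rule Linf_mult[OF Linf_diff_const[OF \<phi>] that])
  obtain C where C: "\<forall>f\<in>H. N (A f) \<le> C * N f"
    using fr unfolding fredholm_def bounded_operator_def by blast
  have Alin: "AE x in m. A (\<lambda>x. a * f x + b * g x) x = a * A f x + b * A g x" if "f \<in> H" "g \<in> H" for f g a b
    using fr that unfolding fredholm_def bounded_operator_def by blast
  obtain B where B: "finite B" "B \<subseteq> op_kernel m H A"
    "\<forall>f\<in>op_kernel m H A. \<exists>c. AE x in m. f x = lin_comb B c x"
    using fr unfolding fredholm_def by blast
  have Aclosed: "\<exists>f\<in>H. AE x in m. A f x = g x"
    if "\<And>n. F n \<in> H" "g \<in> H" "(\<lambda>n. N (\<lambda>x. A (F n) x - g x)) \<longlonglongrightarrow> 0" for F g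
  proof -
    have "range F \<subseteq> H" using that(1) by blast
    then show ?thesis using fr that(2,3) unfolding fredholm_def by blast
  qed
  have BH: "B \<subseteq> H" and BL: "B \<subseteq> L" using B(2) Hp_Lp by (auto simp: op_kernel_def)
  have Bker: "fourier m (\<lambda>x. (\<phi> x - z) * b x) \<gamma> = 0" if "b \<in> B" "\<gamma> \<in> T" for b \<gamma>
  proof -
    have "b \<in> H" "AE x in m. A b x = 0" using B(2) that by (auto simp: op_kernel_def)
    then show ?thesis using A_iff[of b "\<lambda>x. 0"] that by (simp add: fourier_def)
  qed
  \<comment> \<open>Finitely many coefficients that determine every element of the kernel and can be
    prescribed on it. So \<open>Z\<close> below is a complement of the kernel in \<open>H\<close>,
    on which A is injective and has its full range.\<close>
  obtain S where S: "finite S" "S \<subseteq> characters"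
    "\<forall>c. (\<forall>s\<in>S. (\<Sum>b\<in>B. c b * fourier m b s) = 0) \<longrightarrow> (\<forall>t\<in>characters. (\<Sum>b\<in>B. c b * fourier m b t) = 0)"
    "\<forall>h. \<exists>c. \<forall>s\<in>S. h s = (\<Sum>b\<in>B. c b * fourier m b s)"
    using interpolation_set[OF B(1), of characters "fourier m"] by blast
  define Z where "Z = {f \<in> H. \<forall>s\<in>S. fourier m f s = 0}"
  have ZH: "f \<in> H" if "f \<in> Z" for f using that by (simp add: Z_def)
  have ZL: "f \<in> L" if "f \<in> Z" for f using Hp_Lp[OF ZH[OF that]] .
  have "inverse_mapping m p Z A C"
  proof
    show "1 \<le> p" by simp
    show "f \<in> L" if "f \<in> Z" for f by (rule ZL[OF that])
    show "(\<lambda>x. a * f x + b * g x) \<in> Z" if "f \<in> Z" "g \<in> Z" for f g a b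
      using that Hp_lincomb[OF ZH ZH p, of f g a b] fourier_lincomb[OF ZL ZL _ p, of f g _ a b] S(2)
      by (auto simp: Z_def)
    show "(\<lambda>x. 0) \<in> Z" by (simp add: Z_def fourier_def)
    show "f \<in> Z" if F: "\<And>n. F n \<in> Z" and f: "f \<in> L" and lim: "(\<lambda>n. N (\<lambda>x. F n x - f x)) \<longlonglongrightarrow> 0" for F f
    proof -
      have "f \<in> H" by (rule Hp_closed[OF ZH[OF F] f p lim])
      moreover have "fourier m f s = 0" if s: "s \<in> S" for s
      proof -
        have sc: "s \<in> characters" using S(2) s by blast
        have "(\<lambda>n. fourier m (F n) s) \<longlonglongrightarrow> fourier m f s"
          by (rule fourier_tendsto[OF ZL[OF F] f p sc lim])
        moreover have "fourier m (F n) s = 0" for n using F[of n] s by (simp add: Z_def)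
        ultimately show ?thesis by (simp add: LIMSEQ_const_iff)
      qed
      ultimately show ?thesis by (simp add: Z_def)
    qed
    show "A f \<in> L" if "f \<in> Z" for f by (rule Hp_Lp[OF AH[OF ZH[OF that]]])
    show "AE x in m. A (\<lambda>x. a * f x + b * g x) x = a * A f x + b * A g x" if "f \<in> Z" "g \<in> Z" for f g a b
      by (rule Alin[OF ZH[OF that(1)] ZH[OF that(2)]])
    show "N (A f) \<le> C * N f" if "f \<in> Z" for f using C ZH[OF that] by blast
    show "AE x in m. f x = 0" if f: "f \<in> Z" "AE x in m. A f x = 0" for f
    proof -
      have "f \<in> op_kernel m H A" using f ZH by (simp add: op_kernel_def)
      then obtain c where c: "AE x in m. f x = lin_comb B c x" using B(3) by blast
      have lc: "lin_comb B c \<in> L" by (rule Hp_Lp[OF lin_comb_H[OF B(1) BH]])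
      have eq: "fourier m f \<gamma> = (\<Sum>b\<in>B. c b * fourier m b \<gamma>)" if \<gamma>: "\<gamma> \<in> characters" for \<gamma>
        using fourier_cong_AE[OF c Lp_measurable[OF ZL[OF f(1)]] Lp_measurable[OF lc]
            measurable_continuous[OF charactersD(1)[OF \<gamma>]]] fourier_lin_comb_Lp[OF B(1) BL \<gamma>] by simp
      have "\<forall>s\<in>S. (\<Sum>b\<in>B. c b * fourier m b s) = 0"
      proof
        fix s assume s: "s \<in> S"
        then have "fourier m f s = 0" using f(1) by (simp add: Z_def)
        then show "(\<Sum>b\<in>B. c b * fourier m b s) = 0" using eq[of s] S(2) s by auto
      qed
      then have "\<forall>t\<in>characters. (\<Sum>b\<in>B. c b * fourier m b t) = 0" using S(3) by blast
      then show ?thesis using eq by (intro fourier_unique_zero[OF ZL[OF f(1)] p]) simp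
    qed
    show "\<exists>f\<in>Z. AE x in m. A f x = g x"
      if F: "\<And>n. F n \<in> Z" and g: "g \<in> L" and lim: "(\<lambda>n. N (\<lambda>x. A (F n) x - g x)) \<longlonglongrightarrow> 0" for F g
    proof -
      have gH: "g \<in> H" by (rule Hp_closed[OF AH[OF ZH[OF F]] g p lim])
      obtain f where f: "f \<in> H" "AE x in m. A f x = g x" using Aclosed[OF ZH[OF F] gH lim] by blast
      \<comment> \<open>Subtracting a kernel element with the same coefficients on S moves f into
        \<open>Z\<close> without changing its image.\<close>
      obtain c where c: "\<forall>s\<in>S. fourier m f s = (\<Sum>b\<in>B. c b * fourier m b s)" using S(4) by blast
      let ?l = "lin_comb B c"
      have lH: "?l \<in> H" by (rule lin_comb_H[OF B(1) BH])
      let ?w = "\<lambda>x. 1 * f x + (-1) * ?l x"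
      have wH: "?w \<in> H" by (rule Hp_lincomb[OF f(1) lH p])
      have wS: "fourier m ?w s = 0" if s: "s \<in> S" for s
      proof -
        have sc: "s \<in> characters" using S(2) s by blast
        show ?thesis
          using fourier_lincomb[OF Hp_Lp[OF f(1)] Hp_Lp[OF lH] sc p, of 1 "-1"]
            fourier_lin_comb_Lp[OF B(1) BL sc, of c] c s by simp
      qed
      have "?w \<in> Z" unfolding Z_def using wH wS by blast
      moreover have "AE x in m. A ?w x = g x"
      proof -
        have "fourier m (\<lambda>x. (\<phi> x - z) * ?l x) \<gamma> = 0" if \<gamma>: "\<gamma> \<in> T" for \<gamma>
          using fourier_mult_lin_comb[OF B(1), of "\<lambda>x. \<phi> x - z" \<gamma> c] \<psi>L BL T_char[OF \<gamma>] Bker \<gamma> by auto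
        then have "AE x in m. A ?l x = 0"
          using A_iff[OF lH, of "\<lambda>x. 0"] by (simp add: fourier_def)
        then show ?thesis using f(2) Alin[OF f(1) lH, of 1 "-1"] by eventually_elim simp
      qed
      ultimately show ?thesis by blast
    qed
  qed
  then obtain K where K: "0 \<le> K" "\<forall>f\<in>Z. N f \<le> K * N (A f)"
    using inverse_mapping.bounded_inverse by blast
  obtain D where D: "0 \<le> D" "\<forall>f\<in>L. N (P f) \<le> D * N f" using P_bound by blast
  have "N q \<le> K * D * N (\<lambda>x. (\<phi> x - z) * q x)" if q: "q \<in> tpoly characters" for q
  proof -
    obtain M c where M: "finite M" "M \<subseteq> characters" "q = lin_comb M c"
      using q by (auto simp: tpoly_def)
    obtain \<kappa> where \<kappa>: "\<kappa> \<in> T" "\<forall>\<mu>\<in>M. char_mult \<kappa> \<mu> \<in> T - S"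
      using shift_into_cone[OF nontrivial M(1,2) S(1)] by blast
    have \<kappa>c: "\<kappa> \<in> characters" by (rule T_char[OF \<kappa>(1)])
    have qL: "q \<in> L" using tpoly_Lp[OF q] by simp
    let ?f = "\<lambda>x. \<kappa> x * q x"
    have fL: "?f \<in> L" by (rule Lp_character_mult(1)[OF qL \<kappa>c p01(1)])
    have four: "fourier m ?f \<gamma> = 0" if \<gamma>: "\<gamma> \<in> characters" "\<gamma> \<notin> T - S" for \<gamma>
    proof -
      have "char_mult \<gamma> (char_inv \<kappa>) \<notin> M"
      proof
        assume "char_mult \<gamma> (char_inv \<kappa>) \<in> M"
        then have "char_mult \<kappa> (char_mult \<gamma> (char_inv \<kappa>)) \<in> T - S" using \<kappa>(2) by blast
        moreover have "char_mult \<kappa> (char_mult \<gamma> (char_inv \<kappa>)) = \<gamma>"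
          using \<kappa>c by (simp add: char_mult_commute[of \<gamma>])
        ultimately show False using \<gamma>(2) by simp
      qed
      then show ?thesis
        using fourier_char_mult[OF \<gamma>(1) \<kappa>c, of q] M
          fourier_lin_comb[OF M(1,2) characters_mult[OF \<gamma>(1) characters_inv[OF \<kappa>c]], of c] by simp
    qed
    have "?f \<in> Z" unfolding Z_def Hp_def using fL four S(2) by auto
    then have "N ?f \<le> K * N (A ?f)" "?f \<in> H" using K(2) ZH by blast+
    moreover have "N (A ?f) \<le> D * N (\<lambda>x. (\<phi> x - z) * ?f x)"
      using toeplitz_shift_norm[OF \<phi> \<open>?f \<in> H\<close>, of z] D(2) \<psi>L[OF fL] unfolding A_def[abs_def] by auto
    moreover have "N (\<lambda>x. (\<phi> x - z) * ?f x) = N (\<lambda>x. (\<phi> x - z) * q x)"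
      by (simp add: lp_norm_def norm_mult charactersD(2)[OF \<kappa>c])
    ultimately have "N ?f \<le> K * (D * N (\<lambda>x. (\<phi> x - z) * q x))"
      using mult_left_mono[OF _ K(1)] by fastforce
    moreover have "N ?f = N q" by (rule Lp_character_mult(2)[OF qL \<kappa>c p01(1)])
    ultimately show ?thesis by (simp add: mult.assoc)
  qed
  moreover have "0 \<le> K * D" using K D by simp
  ultimately show ?thesis by blast
qed

text \<open>By density the lower bound for polynomials extends to all of \<open>L\<close>. The
  indicator of the set where \<phi> is within e of z violates it once K e < 1.\<close>

theorem essential_range_subset:
  assumes nontrivial: "\<exists>x::'a. x \<noteq> 0" and \<phi>: "\<phi> \<in> Linf m"
  shows "essential_range m \<phi> \<subseteq> essential_spectrum m p H (toeplitz m T p \<phi>)"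
proof
  fix z assume z: "z \<in> essential_range m \<phi>"
  show "z \<in> essential_spectrum m p H (toeplitz m T p \<phi>)"
    unfolding essential_spectrum_def
  proof (intro CollectI notI)
    assume fr: "fredholm m p H (\<lambda>f x. toeplitz m T p \<phi> f x - z * f x)"
    obtain K where K: "0 \<le> K" "\<forall>q\<in>tpoly characters. N q \<le> K * N (\<lambda>x. (\<phi> x - z) * q x)"
      using fredholm_bounded_below_tpoly[OF nontrivial \<phi> fr] by blast
    define \<psi> where "\<psi> x = \<phi> x - z" for x
    have \<psi>: "\<psi> \<in> Linf m" unfolding \<psi>_def by (rule Linf_diff_const[OF \<phi>])
    obtain C0 where C0: "AE x in m. norm (\<psi> x) \<le> C0" and \<psi>m [measurable]: "\<psi> \<in> borel_measurable m"
      using \<psi> by (auto simp: Linf_def)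
    define C where "C = \<bar>C0\<bar>"
    have C: "AE x in m. norm (\<psi> x) \<le> C" "0 \<le> C"
      using C0 by (auto simp: C_def elim: eventually_mono)
    have all: "N f \<le> K * N (\<lambda>x. \<psi> x * f x)" if f: "f \<in> L" for f
    proof -
      obtain F where F: "\<And>n. F n \<in> tpoly characters" "(\<lambda>n. N (\<lambda>x. F n x - f x)) \<longlonglongrightarrow> 0"
        using tpoly_sequence[OF f p] by blast
      have FL: "F n \<in> L" for n using tpoly_Lp[OF F(1)] by simp
      have "(\<lambda>n. N (\<lambda>x. \<psi> x * F n x - \<psi> x * f x)) \<longlonglongrightarrow> 0"
      proof (rule Lim_null_comparison[of _ "\<lambda>n. C * N (\<lambda>x. F n x - f x)"])
        show "(\<lambda>n. C * N (\<lambda>x. F n x - f x)) \<longlonglongrightarrow> 0" using tendsto_mult_right_zero[OF F(2)] .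
        show "\<forall>\<^sub>F n in sequentially. norm (N (\<lambda>x. \<psi> x * F n x - \<psi> x * f x)) \<le> C * N (\<lambda>x. F n x - f x)"
          using Lp_mult_bounded(2)[OF Lp_diff[OF FL f p01(2)] \<psi>m C p01(1)]
          by (intro always_eventually allI) (simp add: right_diff_distrib)
      qed
      then have "(\<lambda>n. K * N (\<lambda>x. \<psi> x * F n x)) \<longlonglongrightarrow> K * N (\<lambda>x. \<psi> x * f x)"
        by (intro tendsto_mult tendsto_const lp_norm_tendsto Linf_mult \<psi> FL f p01)
      moreover have "(\<lambda>n. N (F n)) \<longlonglongrightarrow> N f" by (rule lp_norm_tendsto[OF FL f p01(2) F(2)])
      moreover have "N (F n) \<le> K * N (\<lambda>x. \<psi> x * F n x)" for n
        using K(2) F(1)[of n] by (simp add: \<psi>_def)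
      ultimately show ?thesis by (meson LIMSEQ_le)
    qed
    define e where "e = 1 / (2 * (K + 1))"
    have e: "0 < e" "K * e < 1" using K(1) by (auto simp: e_def field_simps)
    define E where "E = {x \<in> space m. dist (\<phi> x) z < e}"
    have Epos: "0 < emeasure m E" using z e(1) by (simp add: essential_range_def E_def)
    have Eeq: "E = {x \<in> space m. norm (\<psi> x) < e}" by (simp add: E_def \<psi>_def dist_norm)
    have Em: "E \<in> sets m" unfolding Eeq by measurable
    let ?i = "\<lambda>x. indicator E x :: complex"
    have iL: "?i \<in> L" by (rule Lp_indicator[OF Em p01(1)])
    have im: "(\<lambda>x. \<psi> x * ?i x) \<in> borel_measurable m" using Lp_measurable[OF Linf_mult[OF \<psi> iL]] .
    have "N (\<lambda>x. \<psi> x * ?i x) \<le> e * N ?i"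
    proof (rule Lp_bounded(2)[OF iL im])
      show "AE x in m. norm (\<psi> x * ?i x) \<le> e * norm (?i x)"
        by (rule AE_I2) (auto simp: Eeq indicator_def norm_mult)
    qed (use e in auto)
    then have "K * N (\<lambda>x. \<psi> x * ?i x) \<le> K * (e * N ?i)" using K(1) by (intro mult_left_mono)
    then have "N ?i \<le> (K * e) * N ?i" using all[OF iL] by simp
    then have "(1 - K * e) * N ?i \<le> 0" by (simp add: left_diff_distrib)
    then have "N ?i \<le> 0" using e(2) by (simp add: mult_le_0_iff)
    then have "N ?i = 0" using lp_norm_nonneg[of m p ?i] by linarith
    then have "AE x in m. ?i x = 0" using lp_norm_eq_0_iff[OF iL] by simp
    then have "AE x in m. x \<notin> E" by eventually_elim (auto simp: indicator_def split: if_splits)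
    then have "emeasure m E = 0"
      using AE_iff_measurable[of E m "\<lambda>x. x \<notin> E"] Em by auto
    then show False using Epos by simp
  qed
qed

end

section \<open>The theorem of Bohr and van Kampen\<close>

context compact_group_haar
begin

text \<open>The functions \<open>x \<mapsto> \<phi> (x + a) / \<phi> x\<close> have continuous logarithms for small \<open>a\<close>, hence, by
  connectedness, for all \<open>a\<close>. The exponential of the mean of such a logarithm is the character.\<close>

definition quotient_log :: "('a \<Rightarrow> complex) \<Rightarrow> 'a \<Rightarrow> ('a \<Rightarrow> complex) \<Rightarrow> bool" where
  "quotient_log \<phi> a w \<longleftrightarrow> cts w \<and> (\<forall>x. \<phi> (x + a) = \<phi> x * exp (w x))"

text \<open>The values lie in the discrete set of integer multiples of 2 pi i.\<close>

lemma exp_one_constant: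
  assumes connected: "connected (UNIV :: 'a set)" and f: "cts f" and e: "\<And>x. exp (f x) = 1"
  shows "f x = f y"
proof -
  have "f constant_on UNIV"
  proof (rule continuous_discrete_range_constant[OF connected f])
    fix x :: 'a
    show "\<exists>e>0. \<forall>y. y \<in> UNIV \<and> f y \<noteq> f x \<longrightarrow> e \<le> norm (f y - f x)"
    proof (intro exI[of _ "2 * pi"] conjI allI impI)
      fix y assume ne: "y \<in> UNIV \<and> f y \<noteq> f x"
      obtain k n :: int where k: "Re (f x) = 0" "Im (f x) = of_int (2 * k) * pi"
        and n: "Re (f y) = 0" "Im (f y) = of_int (2 * n) * pi"
        using e[of x] e[of y] unfolding exp_eq_1 by blast
      have "n \<noteq> k" using ne k n by (auto simp: complex_eq_iff)
      then have "1 \<le> \<bar>real_of_int (n - k)\<bar>" by linarith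
      then have "2 * pi * 1 \<le> 2 * pi * \<bar>real_of_int (n - k)\<bar>" by (intro mult_left_mono) auto
      also have "\<dots> = \<bar>Im (f y - f x)\<bar>"
      proof -
        have "Im (f y - f x) = 2 * pi * real_of_int (n - k)" using k n by (simp add: algebra_simps)
        then show ?thesis by (simp add: abs_mult)
      qed
      also have "\<dots> \<le> norm (f y - f x)" by (rule abs_Im_le_cmod)
      finally show "2 * pi \<le> norm (f y - f x)" by simp
    qed simp
  qed
  then show ?thesis by (auto simp: constant_on_def)
qed

text \<open>Two logarithms differ by a constant multiple of 2 pi i. Hence neither the exponential of
  the mean nor the mean-free part depends on the choice, and these two will yield the character and
  the exponent g.\<close>

lemma quotient_log_unique:
  assumes connected: "connected (UNIV :: 'a set)" and \<phi>: "\<And>x. \<phi> x \<noteq> 0"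
    and w: "quotient_log \<phi> a w" and w': "quotient_log \<phi> a w'"
  shows "w x - w' x = (LINT x|m. w x) - (LINT x|m. w' x)" "exp (LINT x|m. w x) = exp (LINT x|m. w' x)"
proof -
  have c: "cts w" "cts w'" using w w' by (auto simp: quotient_log_def)
  have e: "exp (w x - w' x) = 1" for x
  proof -
    have "\<phi> x * exp (w x) = \<phi> x * exp (w' x)" using w w' unfolding quotient_log_def by metis
    then show ?thesis using \<phi>[of x] by (simp add: exp_diff)
  qed
  have const: "w x - w' x = w 0 - w' 0" for x
    by (rule exp_one_constant[OF connected _ e]) (intro continuous_intros c)
  have "(LINT x|m. w x) - (LINT x|m. w' x) = (LINT x|m. w x - w' x)"
    using integrable_continuous[OF c(1)] integrable_continuous[OF c(2)] by simp
  also have "(\<lambda>x. w x - w' x) = (\<lambda>x. w 0 - w' 0)" by (rule ext, rule const)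
  also have "(LINT x|m. w 0 - w' 0) = w 0 - w' 0" by simp
  finally have mean: "(LINT x|m. w x) - (LINT x|m. w' x) = w 0 - w' 0" .
  then show "w x - w' x = (LINT x|m. w x) - (LINT x|m. w' x)" using const by simp
  have "exp ((LINT x|m. w x) - (LINT x|m. w' x)) = 1" unfolding mean by (rule e)
  then show "exp (LINT x|m. w x) = exp (LINT x|m. w' x)" by (simp add: exp_diff)
qed

text \<open>Translation by a + b in two stages; the shifted argument of v is what makes the
  logarithms a cocycle.\<close>

lemma quotient_log_add:
  assumes w: "quotient_log \<phi> a w" and v: "quotient_log \<phi> b v"
  shows "quotient_log \<phi> (a + b) (\<lambda>x. w x + v (x + a))"
  unfolding quotient_log_def
proof (intro conjI allI)
  have c: "cts w" "cts v" using w v by (auto simp: quotient_log_def)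
  have "cts (\<lambda>x. v (x + a))" by (intro continuous_on_compose_UNIV[OF c(2)] continuous_intros)
  then show "cts (\<lambda>x. w x + v (x + a))" using c by (intro continuous_intros)
  fix x
  have "\<phi> (x + (a + b)) = \<phi> (x + a) * exp (v (x + a))"
    using v by (simp add: quotient_log_def add.assoc[symmetric])
  also have "\<phi> (x + a) = \<phi> x * exp (w x)" using w by (simp add: quotient_log_def)
  finally show "\<phi> (x + (a + b)) = \<phi> x * exp (w x + v (x + a))" by (simp add: exp_add)
qed

lemma quotient_log_uminus:
  assumes w: "quotient_log \<phi> a w"
  shows "quotient_log \<phi> (- a) (\<lambda>x. - w (x - a))"
  unfolding quotient_log_def
proof (intro conjI allI)
  have c: "cts w" using w by (auto simp: quotient_log_def)
  show "cts (\<lambda>x. - w (x - a))"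
    by (intro continuous_on_minus continuous_on_compose_UNIV[OF c] continuous_intros)
  fix x
  have "\<phi> (x - a + a) = \<phi> (x - a) * exp (w (x - a))" using w by (simp only: quotient_log_def)
  then show "\<phi> (x + - a) = \<phi> x * exp (- w (x - a))" by (simp add: exp_minus field_simps)
qed

lemma quotient_log_small:
  assumes \<phi>: "cts \<phi>" "\<And>x. \<phi> x \<noteq> 0" and e: "0 < e"
  shows "\<exists>U. open U \<and> 0 \<in> U \<and> (\<forall>a\<in>U. \<exists>w. quotient_log \<phi> a w \<and> (\<forall>x. norm (w x) < e))"
proof -
  \<comment> \<open>Within 1/2 of 1 the principal branch is continuous and
    \<open>norm (Ln (1 + z)) \<le> 2 * norm z\<close>; the second entry turns this into the bound
    e.\<close>
  define \<epsilon> where "\<epsilon> = min (1/2) (e/2)"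
  have \<epsilon>: "0 < \<epsilon>" "\<epsilon> \<le> 1/2" "\<epsilon> \<le> e/2" using e by (auto simp: \<epsilon>_def)
  have F: "continuous_on UNIV (\<lambda>(a, x). \<phi> (x + a) / \<phi> x)"
    unfolding case_prod_unfold using \<phi>(2)
    by (intro continuous_on_divide continuous_on_compose_UNIV[OF \<phi>(1)] continuous_intros) auto
  obtain U where U: "open U" "0 \<in> U" "\<forall>a\<in>U. \<forall>x. dist (\<phi> (x + a) / \<phi> x) (\<phi> (x + 0) / \<phi> x) < \<epsilon>"
    using uniform_in_parameter[OF F \<epsilon>(1), of 0] by blast
  have "\<exists>w. quotient_log \<phi> a w \<and> (\<forall>x. norm (w x) < e)" if a: "a \<in> U" for a
  proof (intro exI[of _ "\<lambda>x. Ln (\<phi> (x + a) / \<phi> x)"] conjI allI)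
    have near: "norm (\<phi> (x + a) / \<phi> x - 1) < \<epsilon>" for x
    proof -
      have "dist (\<phi> (x + a) / \<phi> x) (\<phi> (x + 0) / \<phi> x) < \<epsilon>" using U(3) a by blast
      moreover have "\<phi> (x + 0) / \<phi> x = 1" using \<phi>(2)[of x] by simp
      ultimately show ?thesis by (simp only: dist_norm)
    qed
    have nonpos: "\<phi> (x + a) / \<phi> x \<notin> \<real>\<^sub>\<le>\<^sub>0" for x
    proof
      assume "\<phi> (x + a) / \<phi> x \<in> \<real>\<^sub>\<le>\<^sub>0"
      then have "Re (\<phi> (x + a) / \<phi> x) \<le> 0" by (simp add: complex_nonpos_Reals_iff)
      then show False
        using abs_Re_le_cmod[of "\<phi> (x + a) / \<phi> x - 1"] near[of x] \<epsilon>(2) by simp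
    qed
    have c: "cts (\<lambda>x. \<phi> (x + a) / \<phi> x)"
      using continuous_section(1)[OF F, of a] .
    show "quotient_log \<phi> a (\<lambda>x. Ln (\<phi> (x + a) / \<phi> x))"
      unfolding quotient_log_def using nonpos \<phi>(2) by (auto intro!: continuous_on_Ln' c)
    fix x
    have "norm (Ln (1 + (\<phi> (x + a) / \<phi> x - 1))) \<le> 2 * norm (\<phi> (x + a) / \<phi> x - 1)"
      using near[of x] \<epsilon>(2) by (intro norm_Ln_le) auto
    then show "norm (Ln (\<phi> (x + a) / \<phi> x)) < e" using near[of x] \<epsilon>(3) by simp
  qed
  then show ?thesis using U by blast
qed

text \<open>The translations with a logarithm form an open subgroup. Its cosets are open too, so it
  is closed and, by connectedness, everything.\<close>

lemma quotient_log_exists: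
  assumes connected: "connected (UNIV :: 'a set)" and \<phi>: "cts \<phi>" "\<And>x. \<phi> x \<noteq> 0"
  shows "\<exists>w. quotient_log \<phi> a w"
proof -
  define D where "D = {a. \<exists>w. quotient_log \<phi> a w}"
  obtain U where U: "open U" "0 \<in> U" "\<forall>a\<in>U. \<exists>w. quotient_log \<phi> a w \<and> (\<forall>x. norm (w x) < 1)"
    using quotient_log_small[OF \<phi> zero_less_one] by blast
  then have UD: "U \<subseteq> D" unfolding D_def by blast
  have add: "a + b \<in> D" if "a \<in> D" "b \<in> D" for a b
    using that quotient_log_add unfolding D_def by blast
  have minus: "- a \<in> D" if "a \<in> D" for a
    using that quotient_log_uminus unfolding D_def by blast
  have nbh: "open ((\<lambda>y. y - b) -` U)" "b \<in> (\<lambda>y. y - b) -` U" for b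
    using U by (auto intro!: open_vimage continuous_intros)
  have "open D"
  proof (subst open_subopen, rule ballI)
    fix b assume b: "b \<in> D"
    have "(\<lambda>y. y - b) -` U \<subseteq> D"
    proof
      fix y assume "y \<in> (\<lambda>y. y - b) -` U"
      then have "b + (y - b) \<in> D" using UD b by (intro add) auto
      then show "y \<in> D" by simp
    qed
    then show "\<exists>V. open V \<and> b \<in> V \<and> V \<subseteq> D" using nbh by blast
  qed
  moreover have "open (- D)"
  proof (subst open_subopen, rule ballI)
    fix b assume b: "b \<in> - D"
    have "(\<lambda>y. y - b) -` U \<subseteq> - D"
    proof
      fix y assume y: "y \<in> (\<lambda>y. y - b) -` U"
      show "y \<in> - D"
      proof
        assume "y \<in> D"
        moreover have "y - b \<in> D" using y UD by auto
        ultimately have "y + - (y - b) \<in> D" by (intro add minus)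
        then show False using b by simp
      qed
    qed
    then show "\<exists>V. open V \<and> b \<in> V \<and> V \<subseteq> - D" using nbh by blast
  qed
  moreover have "D \<noteq> {}" using U UD by blast
  ultimately have "D = UNIV"
    using connectedD[OF connected, of D "- D"] by auto
  then show ?thesis by (auto simp: D_def)
qed

text \<open>The logarithms \<open>u a\<close> are chosen with no coherence in a. By uniqueness
  \<open>\<gamma>\<close> and \<open>v\<close> satisfy exact product and cocycle rules nonetheless,
  which reduce continuity to small translations, where small logarithms exist. The quotient relation
  at the base point 0 then expresses \<phi> through \<open>\<gamma>\<close> and
  \<open>v\<close>.\<close>

theorem bohr_van_kampen:
  assumes connected: "connected (UNIV :: 'a set)" and \<phi>: "cts \<phi>" "\<And>x. \<phi> x \<noteq> 0"
  shows "\<exists>\<gamma>\<in>characters. \<exists>g. cts g \<and> \<phi> = (\<lambda>x. \<gamma> x * exp (g x))"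
proof -
  have "\<forall>a. \<exists>w. quotient_log \<phi> a w" using quotient_log_exists[OF connected \<phi>] by blast
  from choice[OF this] obtain u where u: "\<And>a. quotient_log \<phi> a (u a)" by blast
  have uc: "cts (u a)" for a using u by (simp add: quotient_log_def)
  define I where "I a = (LINT x|m. u a x)" for a
  define \<gamma> where "\<gamma> a = exp (I a)" for a
  define v where "v a x = u a x - I a" for a x
  have \<gamma>_eq: "exp (LINT x|m. w x) = \<gamma> a" if "quotient_log \<phi> a w" for a w
    unfolding \<gamma>_def I_def by (rule quotient_log_unique(2)[OF connected \<phi>(2) that u])
  have v_eq: "w x - (LINT x|m. w x) = v a x" if "quotient_log \<phi> a w" for a w x
    using quotient_log_unique(1)[OF connected \<phi>(2) that u[of a], of x] by (simp add: v_def I_def algebra_simps)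
  have mean_add: "(LINT x|m. u a x + u b (x + a)) = I a + I b" for a b
  proof -
    have c: "cts (\<lambda>x. u b (x + a))" by (intro continuous_on_compose_UNIV[OF uc] continuous_intros)
    have "(LINT x|m. u b (x + a)) = I b"
      using integral_translation[OF measurable_continuous[OF uc[of b]], of a] by (simp add: I_def add.commute)
    then show ?thesis using integrable_continuous[OF uc[of a]] integrable_continuous[OF c] by (simp add: I_def)
  qed
  have mult: "\<gamma> (a + b) = \<gamma> a * \<gamma> b" for a b
    using \<gamma>_eq[OF quotient_log_add[OF u[of a] u[of b]]] by (simp add: mean_add \<gamma>_def exp_add)
  have v_add: "v (a + b) x = v a x + v b (x + a)" for a b x
    using v_eq[OF quotient_log_add[OF u[of a] u[of b]], of x] by (simp add: mean_add v_def algebra_simps)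
  have small: "\<exists>U. open U \<and> 0 \<in> U \<and> (\<forall>a\<in>U. norm (\<gamma> a - 1) < e \<and> (\<forall>x. norm (v a x) < e))" if e: "0 < e" for e
  proof -
    have "isCont (exp :: complex \<Rightarrow> complex) 0" by simp
    then have "\<exists>d>0. \<forall>z::complex. dist z 0 < d \<longrightarrow> dist (exp z) (exp 0) < e"
      using e unfolding continuous_at_eps_delta by blast
    then obtain d where d: "0 < d" "\<forall>z::complex. norm z < d \<longrightarrow> norm (exp z - 1) < e"
      by (auto simp: dist_norm)
    \<comment> \<open>The first entry makes the exponential of the mean close to 1; v is a logarithm
      minus its mean and therefore bounded by 2 \<epsilon>.\<close>
    define \<epsilon> where "\<epsilon> = min (d / 2) (e / 3)"
    have \<epsilon>: "0 < \<epsilon>" "\<epsilon> < d" "\<epsilon> + \<epsilon> < e" using d(1) e by (auto simp: \<epsilon>_def min_def field_simps)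
    obtain U where U: "open U" "0 \<in> U" "\<forall>a\<in>U. \<exists>w. quotient_log \<phi> a w \<and> (\<forall>x. norm (w x) < \<epsilon>)"
      using quotient_log_small[OF \<phi> \<epsilon>(1)] by blast
    have "norm (\<gamma> a - 1) < e \<and> (\<forall>x. norm (v a x) < e)" if a: "a \<in> U" for a
    proof -
      obtain w where w: "quotient_log \<phi> a w" "\<forall>x. norm (w x) < \<epsilon>" using U(3) a by blast
      have wc: "cts w" using w(1) by (simp add: quotient_log_def)
      have M: "norm (LINT x|m. w x) \<le> \<epsilon>"
        using norm_integral_diff_le[OF integrable_continuous[OF wc], of "\<lambda>x. 0" \<epsilon>] w(2) by (simp add: less_imp_le)
      have "norm (exp (LINT x|m. w x) - 1) < e" using d(2) M \<epsilon>(2) by auto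
      moreover have "norm (v a x) < e" for x
        using norm_triangle_ineq4[of "w x" "LINT x|m. w x"] M spec[OF w(2), of x] \<epsilon>(3)
        unfolding v_eq[OF w(1)] by linarith
      ultimately show ?thesis using \<gamma>_eq[OF w(1)] by simp
    qed
    then show ?thesis using U by blast
  qed
  have cont: "cts f" if f: "\<And>e b. 0 < e \<Longrightarrow> \<exists>U. open U \<and> 0 \<in> U \<and> (\<forall>a\<in>U. norm (f (b + a) - f b) < e)" for f
  proof -
    have "(f \<longlongrightarrow> f b) (at b)" for b
    proof (rule tendstoI)
      fix e :: real assume e: "0 < e"
      obtain U where U: "open U" "0 \<in> U" "\<forall>a\<in>U. norm (f (b + a) - f b) < e" using f[OF e] by blast
      have "open ((\<lambda>y. y - b) -` U)" "b \<in> (\<lambda>y. y - b) -` U"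
        using U by (auto intro!: open_vimage continuous_intros)
      moreover have "dist (f y) (f b) < e" if "y \<in> (\<lambda>y. y - b) -` U" for y
      proof -
        have "norm (f (b + (y - b)) - f b) < e" using U(3) that by blast
        then show ?thesis by (simp add: dist_norm)
      qed
      ultimately show "\<forall>\<^sub>F y in at b. dist (f y) (f b) < e" unfolding eventually_at_topological by blast
    qed
    then show ?thesis by (simp add: continuous_on_def)
  qed
  have \<gamma>0: "\<gamma> x \<noteq> 0" for x by (simp add: \<gamma>_def)
  have \<gamma>c: "cts \<gamma>"
  proof (rule cont)
    fix e :: real and b assume e: "0 < e"
    have "0 < e / norm (\<gamma> b)" using e \<gamma>0 by simp
    from small[OF this] obtain U where U: "open U" "0 \<in> U" "\<forall>a\<in>U. norm (\<gamma> a - 1) < e / norm (\<gamma> b)" by blast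
    have "norm (\<gamma> (b + a) - \<gamma> b) < e" if "a \<in> U" for a
    proof -
      have "\<gamma> (b + a) - \<gamma> b = \<gamma> b * (\<gamma> a - 1)" unfolding mult by (simp add: algebra_simps)
      then have "norm (\<gamma> (b + a) - \<gamma> b) = norm (\<gamma> b) * norm (\<gamma> a - 1)" by (simp add: norm_mult)
      also have "\<dots> < norm (\<gamma> b) * (e / norm (\<gamma> b))"
        using U(3) that \<gamma>0 by (intro mult_strict_left_mono) auto
      finally show ?thesis using \<gamma>0[of b] by simp
    qed
    then show "\<exists>U. open U \<and> 0 \<in> U \<and> (\<forall>a\<in>U. norm (\<gamma> (b + a) - \<gamma> b) < e)" using U by blast
  qed
  obtain B where B: "0 < B" "\<And>x. norm (\<gamma> x) \<le> B" using continuous_norm_bound[OF \<gamma>c] by blast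
  have one: "\<gamma> 0 = 1" using mult[of 0 0] \<gamma>0[of 0] by simp
  \<comment> \<open>A value of modulus above 1 would have unbounded powers, which are again values
    of the bounded function \<open>\<gamma>\<close>; applied to -a as well, this gives modulus
    1.\<close>
  have le1: "norm (\<gamma> a) \<le> 1" for a
  proof (rule ccontr)
    assume "\<not> norm (\<gamma> a) \<le> 1"
    then obtain n where n: "B < norm (\<gamma> a) ^ n" using real_arch_pow[of "norm (\<gamma> a)" B] by auto
    have "\<gamma> ((((+) a) ^^ n) 0) = \<gamma> a ^ n" by (induction n) (auto simp: one mult)
    then show False using B(2)[of "(((+) a) ^^ n) 0"] n by (simp add: norm_power)
  qed
  have "norm (\<gamma> a) = 1" for a
  proof (rule antisym[OF le1])
    have "norm (\<gamma> a) * norm (\<gamma> (- a)) = 1"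
      using mult[of a "- a"] one by (simp add: norm_mult[symmetric])
    moreover have "norm (\<gamma> a) * norm (\<gamma> (- a)) \<le> norm (\<gamma> a) * 1"
      using le1 by (intro mult_left_mono) auto
    ultimately show "1 \<le> norm (\<gamma> a)" by simp
  qed
  then have \<gamma>: "\<gamma> \<in> characters" using \<gamma>c mult by (auto simp: characters_def)
  have vc: "cts (\<lambda>a. v a 0)"
  proof (rule cont)
    fix e :: real and b assume e: "0 < e"
    obtain U where U: "open U" "0 \<in> U" "\<forall>a\<in>U. \<forall>x. norm (v a x) < e" using small[OF e] by blast
    then show "\<exists>U. open U \<and> 0 \<in> U \<and> (\<forall>a\<in>U. norm (v (b + a) 0 - v b 0) < e)"
      unfolding v_add by (intro exI[of _ U]) simp
  qed
  have "\<phi> x = \<gamma> x * exp (v x 0 + Ln (\<phi> 0))" for x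
  proof -
    have "\<phi> (0 + x) = \<phi> 0 * exp (u x 0)" using u[of x] by (simp only: quotient_log_def)
    also have "u x 0 = I x + v x 0" by (simp add: v_def)
    finally show ?thesis using \<phi>(2)[of 0] by (simp add: exp_add \<gamma>_def mult.commute mult.left_commute)
  qed
  then have "\<phi> = (\<lambda>x. \<gamma> x * exp (v x 0 + Ln (\<phi> 0)))" by (rule ext)
  moreover have "cts (\<lambda>x. v x 0 + Ln (\<phi> 0))" by (intro continuous_intros vc)
  ultimately have "cts (\<lambda>x. v x 0 + Ln (\<phi> 0)) \<and> \<phi> = (\<lambda>x. \<gamma> x * exp (v x 0 + Ln (\<phi> 0)))" by (rule conjI[rotated])
  then show ?thesis using \<gamma> by (intro bexI[of _ \<gamma>]) (rule exI[of _ "\<lambda>x. v x 0 + Ln (\<phi> 0)"])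
qed

lemma Linf_continuous:
  assumes "cts f"
  shows "f \<in> Linf m"
proof -
  obtain B where "\<And>x. norm (f x) \<le> B" using continuous_norm_bound[OF assms] by metis
  then have "AE x in m. norm (f x) \<le> B" by simp
  then show ?thesis using measurable_continuous[OF assms] unfolding Linf_def by blast
qed

end

lemma XiI:
  assumes "\<gamma> \<in> characters" "\<gamma>1 \<in> T" "\<gamma>2 \<in> T" "\<gamma> = char_mult \<gamma>1 (char_inv \<gamma>2)"
    "finite (T - char_mult \<gamma>1 ` T)" "finite (T - char_mult \<gamma>2 ` T)"
  shows "\<gamma> \<in> Xi T"
  unfolding Xi_def using assms by blast

section \<open>Symbols with Fredholm Toeplitz operators\<close>

context hardy
begin

lemma continuous_mult_L: "cts \<psi> \<Longrightarrow> f \<in> L \<Longrightarrow> (\<lambda>x. \<psi> x * f x) \<in> L"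
  by (rule Linf_mult[OF Linf_continuous])

text \<open>K is a set of frequencies missing from f and stable under division by the frequencies of
  the exponent, so all terms of the exponential series inherit the gap. With K = characters - T this
  serves analytic factors on \<open>H\<close>, with K = T antianalytic ones on
  \<open>nul\<close>.\<close>

lemma fourier_exp_mult_zero:
  assumes M: "finite M" "M \<subseteq> characters" and K: "K \<subseteq> characters"
    and closed: "\<And>\<gamma> \<mu>. \<gamma> \<in> K \<Longrightarrow> \<mu> \<in> M \<Longrightarrow> char_mult \<gamma> (char_inv \<mu>) \<in> K"
    and f: "f \<in> L" "\<And>\<gamma>. \<gamma> \<in> K \<Longrightarrow> fourier m f \<gamma> = 0" and \<gamma>: "\<gamma> \<in> K"
  shows "fourier m (\<lambda>x. exp (lin_comb M c x) * f x) \<gamma> = 0"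
proof -
  let ?q = "lin_comb M c"
  have qc: "cts ?q" by (rule tpoly_continuous[OF tpolyI[OF M] subset_refl])
  have pw: "(\<lambda>x. ?q x ^ n * f x) \<in> L \<and> (\<forall>\<gamma>\<in>K. fourier m (\<lambda>x. ?q x ^ n * f x) \<gamma> = 0)" for n
  proof (induction n)
    case 0
    then show ?case using f by simp
  next
    case (Suc n)
    let ?h = "\<lambda>x. ?q x ^ n * f x"
    have hL: "?h \<in> L" using Suc by blast
    have eq: "(\<lambda>x. ?q x ^ Suc n * f x) = (\<lambda>x. ?h x * ?q x)" by (auto simp: mult_ac)
    have "(\<lambda>x. ?q x ^ Suc n * f x) \<in> L"
      by (rule continuous_mult_L[OF _ f(1)]) (intro continuous_intros qc)
    moreover have "fourier m (\<lambda>x. ?h x * ?q x) \<gamma> = 0" if \<gamma>: "\<gamma> \<in> K" for \<gamma>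
    proof -
      have \<gamma>c: "\<gamma> \<in> characters" using \<gamma> K by blast
      have L: "(\<lambda>x. ?h x * \<mu> x) \<in> L" if "\<mu> \<in> M" for \<mu>
        using Lp_character_mult(1)[OF hL _ p01(1), of \<mu>] that M(2) by (auto simp: mult.commute)
      have "fourier m (\<lambda>x. ?h x * ?q x) \<gamma> = (\<Sum>\<mu>\<in>M. c \<mu> * fourier m (\<lambda>x. ?h x * \<mu> x) \<gamma>)"
        by (rule fourier_mult_lin_comb[OF M(1) L \<gamma>c])
      also have "\<dots> = 0"
      proof (rule sum.neutral, rule ballI)
        fix \<mu> assume \<mu>: "\<mu> \<in> M"
        have \<mu>c: "\<mu> \<in> characters" using \<mu> M(2) by blast
        have "fourier m (\<lambda>x. \<mu> x * ?h x) \<gamma> = fourier m ?h (char_mult \<gamma> (char_inv \<mu>))"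
          by (rule fourier_char_mult[OF \<gamma>c \<mu>c])
        also have "\<dots> = 0" using Suc closed[OF \<gamma> \<mu>] by blast
        finally show "c \<mu> * fourier m (\<lambda>x. ?h x * \<mu> x) \<gamma> = 0" by (simp add: mult.commute)
      qed
      finally show ?thesis .
    qed
    ultimately show ?case unfolding eq by blast
  qed
  obtain B where B: "0 < B" "\<And>x. norm (?q x) \<le> B" using continuous_norm_bound[OF qc] by blast
  have \<gamma>c: "\<gamma> \<in> characters" using \<gamma> K by blast
  let ?F = "\<lambda>x. f x * cnj (\<gamma> x)"
  let ?t = "\<lambda>n x. (?q x ^ n /\<^sub>R fact n) * ?F x"
  have Fi: "integrable m ?F" by (rule Lp_fourier_integrable(1)[OF f(1) \<gamma>c p])
  have t_eq: "?t n x = (1 / fact n) * ((?q x ^ n * f x) * cnj (\<gamma> x))" for n x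
    by (simp add: scaleR_conv_of_real field_simps)
  have ti: "integrable m (?t n)" for n
    unfolding t_eq using Lp_fourier_integrable(1)[OF conjunct1[OF pw] \<gamma>c p] by (rule integrable_mult_right)
  have t0: "(LINT x|m. ?t n x) = 0" for n
    unfolding t_eq using pw[of n] \<gamma> by (simp add: fourier_def)
  have tn: "norm (?t n x) \<le> (B ^ n /\<^sub>R fact n) * norm (?F x)" for n x
  proof -
    have "norm (?t n x) = (norm (?q x) ^ n /\<^sub>R fact n) * norm (?F x)"
      by (simp add: norm_mult norm_power)
    also have "\<dots> \<le> (B ^ n /\<^sub>R fact n) * norm (?F x)"
      by (intro mult_right_mono scaleR_left_mono power_mono B) auto
    finally show ?thesis .
  qed
  have sB: "summable (\<lambda>n. (B ^ n /\<^sub>R fact n) * k)" for k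
    by (rule summable_mult2) (rule summable_exp_generic)
  have pt: "(\<lambda>n. ?t n x) sums (exp (?q x) * ?F x)" for x
    by (rule sums_mult2[OF exp_converges])
  have s1: "AE x in m. summable (\<lambda>n. norm (?t n x))"
  proof (rule AE_I2)
    fix x
    show "summable (\<lambda>n. norm (?t n x))"
      by (rule summable_comparison_test[OF _ sB[of "norm (?F x)"]]) (use tn in auto)
  qed
  have s2: "summable (\<lambda>n. LINT x|m. norm (?t n x))"
  proof (rule summable_comparison_test[OF _ sB[of "LINT x|m. norm (?F x)"]], intro exI allI impI)
    fix n :: nat
    have "(LINT x|m. norm (?t n x)) \<le> (LINT x|m. (B ^ n /\<^sub>R fact n) * norm (?F x))"
      by (rule integral_mono[OF integrable_norm[OF ti] _ tn])
        (intro integrable_mult_right integrable_norm Fi)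
    then show "norm (LINT x|m. norm (?t n x)) \<le> (B ^ n /\<^sub>R fact n) * (LINT x|m. norm (?F x))"
      by simp
  qed
  have "(\<lambda>n. LINT x|m. ?t n x) sums (LINT x|m. (\<Sum>n. ?t n x))" by (rule sums_integral[OF ti s1 s2])
  then have "(LINT x|m. (\<Sum>n. ?t n x)) = 0" unfolding t0 by (simp add: sums_iff)
  moreover have "(\<Sum>n. ?t n x) = exp (?q x) * ?F x" for x using pt[of x] by (simp add: sums_iff)
  ultimately show ?thesis by (simp add: fourier_def mult.assoc)
qed

text \<open>The kernel of the projection: p-integrable functions without frequencies in T. Equality
  of coefficients over T is congruence modulo \<open>nul\<close>.\<close>

definition nul :: "('a \<Rightarrow> complex) \<Rightarrow> bool" where
  "nul f \<longleftrightarrow> f \<in> L \<and> (\<forall>\<gamma>\<in>T. fourier m f \<gamma> = 0)"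

lemma nul_diff_iff:
  assumes "f \<in> L" "g \<in> L"
  shows "nul (\<lambda>x. f x - g x) \<longleftrightarrow> (\<forall>\<gamma>\<in>T. fourier m f \<gamma> = fourier m g \<gamma>)"
  using assms fourier_diff[OF assms T_char p] Lp_diff[OF assms p01(2)] by (auto simp: nul_def)

lemma nul_add: "nul f \<Longrightarrow> nul g \<Longrightarrow> nul (\<lambda>x. f x + g x)"
  using fourier_lincomb[of f p g _ 1 1] T_char p by (auto simp: nul_def intro!: Lp_add)

lemma H_exp_mult:
  assumes M: "finite M" "M \<subseteq> T" and f: "f \<in> H"
  shows "(\<lambda>x. exp (lin_comb M c x) * f x) \<in> H"
proof -
  have Mc: "M \<subseteq> characters" using M(2) T_sub by blast
  have qc: "cts (lin_comb M c)" by (rule tpoly_continuous[OF tpolyI[OF M(1) Mc] subset_refl])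
  have "(\<lambda>x. exp (lin_comb M c x) * f x) \<in> L"
    by (rule continuous_mult_L[OF _ Hp_Lp[OF f]]) (intro continuous_intros qc)
  moreover have "fourier m (\<lambda>x. exp (lin_comb M c x) * f x) \<gamma> = 0" if \<gamma>: "\<gamma> \<in> characters - T" for \<gamma>
  proof (rule fourier_exp_mult_zero[OF M(1) Mc, of "characters - T"])
    fix \<xi> \<mu> assume \<xi>: "\<xi> \<in> characters - T" and \<mu>: "\<mu> \<in> M"
    have \<mu>T: "\<mu> \<in> T" using \<mu> M(2) by blast
    have "char_mult \<xi> (char_inv \<mu>) \<notin> T"
    proof
      assume "char_mult \<xi> (char_inv \<mu>) \<in> T"
      then have "char_mult \<mu> (char_mult \<xi> (char_inv \<mu>)) \<in> T" by (rule T_mult[OF \<mu>T])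
      moreover have "char_mult \<mu> (char_mult \<xi> (char_inv \<mu>)) = \<xi>"
        using T_char[OF \<mu>T] by (simp add: char_mult_commute[of \<xi>])
      ultimately show False using \<xi> by simp
    qed
    then show "char_mult \<xi> (char_inv \<mu>) \<in> characters - T"
      using \<xi> T_char[OF \<mu>T] by (auto intro: characters_mult characters_inv)
  qed (use f \<gamma> Hp_Lp Hp_fourier in auto)
  ultimately show ?thesis by (simp add: Hp_def)
qed

lemma nul_exp_mult:
  assumes M: "finite M" "M \<subseteq> characters - T" and f: "nul f"
  shows "nul (\<lambda>x. exp (lin_comb M c x) * f x)"
proof -
  have Mc: "M \<subseteq> characters" using M(2) by blast
  have fL: "f \<in> L" using f by (simp add: nul_def)
  have qc: "cts (lin_comb M c)" by (rule tpoly_continuous[OF tpolyI[OF M(1) Mc] subset_refl])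
  have "(\<lambda>x. exp (lin_comb M c x) * f x) \<in> L"
    by (rule continuous_mult_L[OF _ fL]) (intro continuous_intros qc)
  moreover have "fourier m (\<lambda>x. exp (lin_comb M c x) * f x) \<gamma> = 0" if \<gamma>: "\<gamma> \<in> T" for \<gamma>
  proof (rule fourier_exp_mult_zero[OF M(1) Mc T_sub _ fL _ \<gamma>])
    fix \<xi> \<mu> assume "\<xi> \<in> T" "\<mu> \<in> M"
    then show "char_mult \<xi> (char_inv \<mu>) \<in> T" using M(2) by (intro T_mult T_total) auto
  qed (use f in \<open>auto simp: nul_def\<close>)
  ultimately show ?thesis by (simp add: nul_def)
qed

lemma nul_inverse_mult:
  assumes \<gamma>: "\<gamma> \<in> T" and f: "nul f"
  shows "nul (\<lambda>x. char_inv \<gamma> x * f x)"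
proof -
  have \<gamma>c: "\<gamma> \<in> characters" by (rule T_char[OF \<gamma>])
  have "(\<lambda>x. char_inv \<gamma> x * f x) \<in> L"
    using f by (intro Lp_character_mult(1) characters_inv \<gamma>c) (auto simp: nul_def)
  moreover have "fourier m (\<lambda>x. char_inv \<gamma> x * f x) \<xi> = 0" if \<xi>: "\<xi> \<in> T" for \<xi>
    using fourier_char_mult[OF T_char[OF \<xi>] characters_inv[OF \<gamma>c], of f] f T_mult[OF \<xi> \<gamma>] by (simp add: nul_def)
  ultimately show ?thesis by (simp add: nul_def)
qed

lemma P_contraction:
  assumes "\<And>f. f \<in> L \<Longrightarrow> N (P f) \<le> C * N f" and f: "f \<in> L" and g: "g \<in> L"
  shows "N (\<lambda>x. P f x - P g x) \<le> C * N (\<lambda>x. f x - g x)"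
proof -
  have d: "(\<lambda>x. f x - g x) \<in> L" by (rule Lp_diff[OF f g p01(2)])
  have "AE x in m. P f x - P g x = P (\<lambda>x. f x - g x) x"
  proof (rule Hp_unique[OF Hp_diff[OF P_H[OF f] P_H[OF g] p] P_H[OF d] p])
    fix \<gamma> assume \<gamma>: "\<gamma> \<in> T"
    show "fourier m (\<lambda>x. P f x - P g x) \<gamma> = fourier m (P (\<lambda>x. f x - g x)) \<gamma>"
      using fourier_diff[OF Hp_Lp[OF P_H[OF f]] Hp_Lp[OF P_H[OF g]] T_char[OF \<gamma>] p]
        fourier_diff[OF f g T_char[OF \<gamma>] p] P_fourier[OF f \<gamma>] P_fourier[OF g \<gamma>] P_fourier[OF d \<gamma>] by simp
  qed
  then have "N (\<lambda>x. P f x - P g x) = N (P (\<lambda>x. f x - g x))"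
    using Lp_measurable[OF Hp_Lp[OF P_H[OF f]]] Lp_measurable[OF Hp_Lp[OF P_H[OF g]]]
      Lp_measurable[OF Hp_Lp[OF P_H[OF d]]]
    by (intro lp_norm_cong_AE) auto
  then show ?thesis using assms(1)[OF d] by simp
qed

text \<open>Neumann series: sending f to P(\<delta> f) has norm at most C \<eta> \<le> 1/2, so the
  Toeplitz operator with symbol 1 + \<delta> is bijective up to null functions.\<close>

lemma toeplitz_near_one:
  assumes C: "\<And>f. f \<in> L \<Longrightarrow> N (P f) \<le> C * N f" "0 \<le> C"
    and \<delta>: "cts \<delta>" "\<And>x. norm (\<delta> x) \<le> \<eta>" and \<eta>: "0 \<le> \<eta>" "C * \<eta> \<le> 1 / 2"
  shows "g \<in> H \<Longrightarrow> \<exists>y\<in>H. \<forall>\<gamma>\<in>T. fourier m (\<lambda>x. (1 + \<delta> x) * y x) \<gamma> = fourier m g \<gamma>"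
    and "y \<in> H \<Longrightarrow> nul (\<lambda>x. (1 + \<delta> x) * y x) \<Longrightarrow> AE x in m. y x = 0"
proof -
  have \<delta>L: "(\<lambda>x. \<delta> x * f x) \<in> L" if "f \<in> L" for f by (rule continuous_mult_L[OF \<delta>(1) that])
  have \<delta>N: "N (\<lambda>x. \<delta> x * f x) \<le> \<eta> * N f" if "f \<in> L" for f
    using \<delta>(2) \<eta>(1) by (intro Lp_mult_bounded(2)[OF that measurable_continuous[OF \<delta>(1)]]) auto
  have split: "fourier m (\<lambda>x. (1 + \<delta> x) * f x) \<gamma> = fourier m f \<gamma> + fourier m (\<lambda>x. \<delta> x * f x) \<gamma>"
    if "f \<in> L" "\<gamma> \<in> characters" for f \<gamma>
    using fourier_lincomb[OF that(1) \<delta>L[OF that(1)] that(2) p, of 1 1] by (simp add: distrib_right)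
  have half: "C * N (\<lambda>x. \<delta> x * f x) \<le> (1 / 2) * N f" if "f \<in> L" for f
  proof -
    have "C * N (\<lambda>x. \<delta> x * f x) \<le> C * (\<eta> * N f)" using C(2) by (intro mult_left_mono \<delta>N that)
    also have "\<dots> \<le> (1 / 2) * N f"
      using mult_right_mono[OF \<eta>(2) lp_norm_nonneg[of m p f]] by (simp add: mult.assoc)
    finally show ?thesis .
  qed
  show "\<exists>y\<in>H. \<forall>\<gamma>\<in>T. fourier m (\<lambda>x. (1 + \<delta> x) * y x) \<gamma> = fourier m g \<gamma>" if g: "g \<in> H"
  proof -
    define F where "F n = ((\<lambda>f x. g x - P (\<lambda>x. \<delta> x * f x) x) ^^ n) g" for n
    have F0: "F 0 = g" and FS: "F (Suc n) = (\<lambda>x. g x - P (\<lambda>x. \<delta> x * F n x) x)" for n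
      by (auto simp: F_def)
    have FH: "F n \<in> H" for n
    proof (induction n)
      case 0
      show ?case unfolding F0 by (rule g)
    next
      case (Suc n)
      show ?case unfolding FS by (rule Hp_diff[OF g P_H[OF \<delta>L[OF Hp_Lp[OF Suc]]] p])
    qed
    have FL: "F n \<in> L" for n by (rule Hp_Lp[OF FH])
    define D where "D = N (\<lambda>x. F 1 x - F 0 x) + 1"
    have D: "0 < D" unfolding D_def by (intro add_nonneg_pos) auto
    have fast: "N (\<lambda>x. F (Suc n) x - F n x) \<le> D * (1/2) ^ n" for n
    proof (induction n)
      case 0
      then show ?case by (simp add: D_def)
    next
      case (Suc n)
      have "N (\<lambda>x. F (Suc (Suc n)) x - F (Suc n) x) = N (\<lambda>x. P (\<lambda>x. \<delta> x * F n x) x - P (\<lambda>x. \<delta> x * F (Suc n) x) x)"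
        unfolding FS[of "Suc n"] FS[of n] by simp
      also have "\<dots> \<le> C * N (\<lambda>x. \<delta> x * F n x - \<delta> x * F (Suc n) x)"
        by (intro P_contraction C \<delta>L FL)
      also have "(\<lambda>x. \<delta> x * F n x - \<delta> x * F (Suc n) x) = (\<lambda>x. \<delta> x * (F n x - F (Suc n) x))"
        by (auto simp: right_diff_distrib)
      also have "C * N \<dots> \<le> (1 / 2) * N (\<lambda>x. F n x - F (Suc n) x)"
        by (intro half Lp_diff FL p01)
      also have "\<dots> \<le> (1 / 2) * (D * (1/2) ^ n)"
        using Suc lp_norm_minus_commute[of m p "F n" "F (Suc n)"] by simp
      finally show ?case by simp
    qed
    obtain y where y: "y \<in> L" "\<forall>n. N (\<lambda>x. F n x - y x) \<le> 2 * D * (1/2) ^ n"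
      using Lp_complete_geometric[OF FL p01(2) D fast] by blast
    have lim: "(\<lambda>n. N (\<lambda>x. F n x - y x)) \<longlonglongrightarrow> 0"
      by (rule Lim_null_comparison[OF _ geometric_null[of "2 * D"]]) (use y(2) in auto)
    have yH: "y \<in> H" by (rule Hp_closed[OF FH y(1) p lim])
    have lim\<delta>: "(\<lambda>n. N (\<lambda>x. \<delta> x * F n x - \<delta> x * y x)) \<longlonglongrightarrow> 0"
    proof (rule Lim_null_comparison[of _ "\<lambda>n. \<eta> * N (\<lambda>x. F n x - y x)"])
      show "(\<lambda>n. \<eta> * N (\<lambda>x. F n x - y x)) \<longlonglongrightarrow> 0" using tendsto_mult_right_zero[OF lim] .
      show "\<forall>\<^sub>F n in sequentially. norm (N (\<lambda>x. \<delta> x * F n x - \<delta> x * y x)) \<le> \<eta> * N (\<lambda>x. F n x - y x)"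
        using \<delta>N[OF Lp_diff[OF FL y(1) p01(2)]]
        by (intro always_eventually allI) (simp add: right_diff_distrib)
    qed
    have "fourier m (\<lambda>x. (1 + \<delta> x) * y x) \<gamma> = fourier m g \<gamma>" if \<gamma>: "\<gamma> \<in> T" for \<gamma>
    proof -
      note \<gamma>c = T_char[OF \<gamma>]
      have "fourier m (F (Suc n)) \<gamma> = fourier m g \<gamma> - fourier m (\<lambda>x. \<delta> x * F n x) \<gamma>" for n
        unfolding FS using fourier_diff[OF Hp_Lp[OF g] Hp_Lp[OF P_H[OF \<delta>L[OF FL]]] \<gamma>c p] P_fourier[OF \<delta>L[OF FL] \<gamma>]
        by simp
      moreover have "(\<lambda>n. fourier m (F (Suc n)) \<gamma>) \<longlonglongrightarrow> fourier m y \<gamma>"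
        by (rule LIMSEQ_Suc[OF fourier_tendsto[OF FL y(1) p \<gamma>c lim]])
      moreover have "(\<lambda>n. fourier m g \<gamma> - fourier m (\<lambda>x. \<delta> x * F n x) \<gamma>) \<longlonglongrightarrow>
          fourier m g \<gamma> - fourier m (\<lambda>x. \<delta> x * y x) \<gamma>"
        by (intro tendsto_diff tendsto_const fourier_tendsto[OF \<delta>L[OF FL] \<delta>L[OF y(1)] p \<gamma>c lim\<delta>])
      ultimately have "fourier m y \<gamma> = fourier m g \<gamma> - fourier m (\<lambda>x. \<delta> x * y x) \<gamma>"
        using LIMSEQ_unique by simp
      then show ?thesis unfolding split[OF y(1) \<gamma>c] by simp
    qed
    then show ?thesis using yH by blast
  qed
  show "AE x in m. y x = 0" if y: "y \<in> H" and n: "nul (\<lambda>x. (1 + \<delta> x) * y x)"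
  proof -
    have yL: "y \<in> L" by (rule Hp_Lp[OF y])
    let ?d = "\<lambda>x. (-1) * (\<delta> x * y x)"
    have dL: "?d \<in> L" by (intro Lp_scale \<delta>L yL)
    have "AE x in m. y x = P ?d x"
    proof (rule Hp_unique[OF y P_H[OF dL] p])
      fix \<gamma> assume \<gamma>: "\<gamma> \<in> T"
      have "fourier m y \<gamma> + fourier m (\<lambda>x. \<delta> x * y x) \<gamma> = 0"
        using n \<gamma> split[OF yL T_char[OF \<gamma>]] by (simp add: nul_def)
      then show "fourier m y \<gamma> = fourier m (P ?d) \<gamma>"
        unfolding P_fourier[OF dL \<gamma>] fourier_scale by (simp add: add_eq_0_iff2)
    qed
    then have "N y = N (P ?d)"
      using Lp_measurable[OF yL] Lp_measurable[OF Hp_Lp[OF P_H[OF dL]]] by (intro lp_norm_cong_AE) auto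
    also have "\<dots> \<le> C * N ?d" by (rule C(1)[OF dL])
    also have "\<dots> = C * N (\<lambda>x. \<delta> x * y x)" by (simp add: lp_norm_def)
    also have "\<dots> \<le> (1 / 2) * N y" by (rule half[OF yL])
    finally have "N y = 0" using lp_norm_nonneg[of m p y] by linarith
    then show ?thesis using lp_norm_eq_0_iff[OF yL] by simp
  qed
qed

lemma exp_mult_cancel: "exp (lin_comb M (\<lambda>b. - c b) x) * (exp (lin_comb M c x) * y) = y"
proof -
  have "lin_comb M (\<lambda>b. - c b) x = - lin_comb M c x" by (simp add: lin_comb_def sum_negf)
  then show ?thesis by (simp add: exp_minus)
qed

text \<open>Wiener--Hopf factorization up to a small factor: \<open>\<phi> = \<gamma> exp q\<^sub>- (1 + \<delta>) exp q\<^sub>+\<close>, where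
  multiplication by \<open>exp q\<^sub>-\<close> preserves the annihilator \<open>nul\<close> and multiplication by \<open>exp q\<^sub>+\<close>
  preserves \<open>H\<close>. Only the factor \<open>\<gamma>\<close> can then obstruct the Fredholm property.\<close>

lemma fredholm_character_Xi:
  assumes \<gamma>: "\<gamma> \<in> characters" and g: "cts g"
    and fr: "fredholm m p H (\<lambda>f x. toeplitz m T p (\<lambda>x. \<gamma> x * exp (g x)) f x - 0 * f x)"
  shows "\<gamma> \<in> Xi T"
proof -
  define \<phi> where "\<phi> x = \<gamma> x * exp (g x)" for x
  have \<phi>c: "cts \<phi>" unfolding \<phi>_def by (intro continuous_intros charactersD(1)[OF \<gamma>] g)
  have \<phi>I: "\<phi> \<in> Linf m" by (rule Linf_continuous[OF \<phi>c])
  define A where "A f x = toeplitz m T p \<phi> f x - 0 * f x" for f x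
  have fr: "fredholm m p H A" using fr unfolding A_def[abs_def] \<phi>_def[abs_def] .
  have A_iff: "(AE x in m. A f x = h x) \<longleftrightarrow> (\<forall>\<gamma>\<in>T. fourier m (\<lambda>x. \<phi> x * f x) \<gamma> = fourier m h \<gamma>)"
    if "f \<in> H" "h \<in> H" for f h
    using toeplitz_shift_AE_iff[OF \<phi>I that, of 0] unfolding A_def[abs_def] by simp
  obtain C where C: "0 \<le> C" "\<forall>f\<in>L. N (P f) \<le> C * N f" using P_bound by blast
  \<comment> \<open>Chosen so that \<open>toeplitz_near_one\<close> applies to \<delta>; C + 1
    covers the case C = 0. The e obtained next is the accuracy of q for which exp (g - q) is within
    \<eta> of 1.\<close>
  define \<eta> where "\<eta> = 1 / (2 * (C + 1))"
  have \<eta>: "0 < \<eta>" "C * \<eta> \<le> 1 / 2" using C(1) by (auto simp: \<eta>_def field_simps)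
  have "isCont (exp :: complex \<Rightarrow> complex) 0" by simp
  then have "\<exists>d>0. \<forall>z::complex. dist z 0 < d \<longrightarrow> dist (exp z) (exp 0) < \<eta>"
    using \<eta>(1) unfolding continuous_at_eps_delta by blast
  then obtain e where e: "0 < e" "\<forall>z::complex. norm z < e \<longrightarrow> norm (exp z - 1) < \<eta>"
    by (auto simp: dist_norm)
  obtain q where q: "q \<in> tpoly characters" "\<forall>x. norm (g x - q x) < e" using tpoly_dense[OF g e(1)] by blast
  obtain M c where M: "finite M" "M \<subseteq> characters" "q = lin_comb M c" using q(1) by (auto simp: tpoly_def)
  have qc: "cts q" by (rule tpoly_continuous[OF q(1) subset_refl])
  define \<delta> where "\<delta> x = exp (g x - q x) - 1" for x
  have \<delta>c: "cts \<delta>" unfolding \<delta>_def by (intro continuous_intros g qc)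
  have \<delta>b: "norm (\<delta> x) \<le> \<eta>" for x using e(2) q(2) unfolding \<delta>_def by (meson less_imp_le)
  have PC: "N (P f) \<le> C * N f" if "f \<in> L" for f
    using C(2) that by blast
  have near1: "\<exists>y\<in>H. \<forall>\<xi>\<in>T. fourier m (\<lambda>x. (1 + \<delta> x) * y x) \<xi> = fourier m h \<xi>" if "h \<in> H" for h
    by (rule toeplitz_near_one(1)[OF _ C(1) \<delta>c \<delta>b less_imp_le[OF \<eta>(1)] \<eta>(2) that]) (rule PC)
  have near2: "AE x in m. y x = 0" if "y \<in> H" "nul (\<lambda>x. (1 + \<delta> x) * y x)" for y
    by (rule toeplitz_near_one(2)[OF _ C(1) \<delta>c \<delta>b less_imp_le[OF \<eta>(1)] \<eta>(2) that]) (rule PC)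
  \<comment> \<open>The trivial character, hence the constant term of q, goes to the analytic
    part.\<close>
  define Mp where "Mp = M \<inter> T"
  define Mm where "Mm = M - T"
  have Mp: "finite Mp" "Mp \<subseteq> T" "Mp \<subseteq> characters" and Mm: "finite Mm" "Mm \<subseteq> characters - T" "Mm \<subseteq> characters"
    using M T_sub by (auto simp: Mp_def Mm_def)
  define ep where "ep x = exp (lin_comb Mp c x)" for x
  define em where "em x = exp (lin_comb Mm c x)" for x
  define em' where "em' x = exp (lin_comb Mm (\<lambda>b. - c b) x)" for x
  define ep' where "ep' x = exp (lin_comb Mp (\<lambda>b. - c b) x)" for x
  have cts_lc: "cts (lin_comb Mp b)" "cts (lin_comb Mm b)" for b
    by (intro tpoly_continuous[OF tpolyI[OF Mp(1,3)] subset_refl] tpoly_continuous[OF tpolyI[OF Mm(1,3)] subset_refl])+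
  have cts_e: "cts ep" "cts em" "cts em'" "cts ep'"
    unfolding ep_def em_def em'_def ep'_def by (intro continuous_intros cts_lc)+
  have ep_ep': "ep x * (ep' x * y) = y" for x y
    using exp_mult_cancel[of Mp "\<lambda>b. - c b" x y] by (simp add: ep_def ep'_def)
  have em'_em: "em' x * (em x * y) = y" for x y
    using exp_mult_cancel[of Mm c x y] by (simp add: em_def em'_def)
  have em_em': "em x * (em' x * y) = y" for x y
    using exp_mult_cancel[of Mm "\<lambda>b. - c b" x y] by (simp add: em_def em'_def)
  have \<phi>_eq: "\<phi> x = \<gamma> x * (em x * ((1 + \<delta> x) * ep x))" for x
  proof -
    have "q x = lin_comb Mp c x + lin_comb Mm c x"
      unfolding M(3) lin_comb_def Mp_def Mm_def
      using sum.Int_Diff[OF M(1), of "\<lambda>b. c b * b x" T] by simp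
    then have "exp (g x) = exp (lin_comb Mm c x) * (exp (g x - q x) * exp (lin_comb Mp c x))"
      by (simp add: exp_add[symmetric])
    then show ?thesis by (simp add: \<phi>_def em_def ep_def \<delta>_def)
  qed
  have nul_em: "nul (\<lambda>x. em x * f x)" and nul_em': "nul (\<lambda>x. em' x * f x)" if "nul f" for f
    unfolding em_def em'_def using nul_exp_mult[OF Mm(1,2) that] by auto
  have H_ep: "(\<lambda>x. ep x * f x) \<in> H" and H_ep': "(\<lambda>x. ep' x * f x) \<in> H" if "f \<in> H" for f
    unfolding ep_def ep'_def using H_exp_mult[OF Mp(1,2) that] by auto
  have c1\<delta>: "cts (\<lambda>x. 1 + \<delta> x)" by (intro continuous_intros \<delta>c)
  show ?thesis
  proof (cases "\<gamma> \<in> T")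
    case True
    \<comment> \<open>Case of the cokernel. Since \<phi> f = E (\<gamma> ep f), where the Toeplitz
      operator of the factor E below is invertible, the range of A corresponds to \<gamma>
      \<open>H\<close>, and S consists of the frequencies in T that are missing there.\<close>
    define S where "S = T - char_mult \<gamma> ` T"
    obtain B where B: "finite B" "B \<subseteq> H" "\<forall>h\<in>H. \<exists>f\<in>H. \<exists>c. AE x in m. h x = A f x + lin_comb B c x"
      using fr unfolding fredholm_def by blast
    let ?E = "\<lambda>x. em x * (1 + \<delta> x)"
    have Ec: "cts ?E" by (intro continuous_intros cts_e c1\<delta>)
    have E_inj: "AE x in m. w x = 0" if w: "w \<in> H" "nul (\<lambda>x. ?E x * w x)" for w
    proof (rule near2[OF w(1)])
      show "nul (\<lambda>x. (1 + \<delta> x) * w x)" using nul_em'[OF w(2)] by (simp add: em'_em mult.assoc)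
    qed
    \<comment> \<open>Divide the right-hand side by em, project, and solve with the symbol 1 +
      \<delta>; the error committed by projecting lies in \<open>nul\<close> and stays there when
      multiplied by em.\<close>
    have E_surj: "\<exists>y. y \<in> H \<and> (\<forall>\<xi>\<in>T. fourier m (\<lambda>x. ?E x * y x) \<xi> = fourier m h \<xi>)" if h: "h \<in> H" for h
    proof -
      have hL: "h \<in> L" by (rule Hp_Lp[OF h])
      have eL: "(\<lambda>x. em' x * h x) \<in> L" by (rule continuous_mult_L[OF cts_e(3) hL])
      obtain y where y: "y \<in> H" "\<forall>\<xi>\<in>T. fourier m (\<lambda>x. (1 + \<delta> x) * y x) \<xi> = fourier m (P (\<lambda>x. em' x * h x)) \<xi>"
        using near1[OF P_H[OF eL]] by blast
      have yL: "(\<lambda>x. (1 + \<delta> x) * y x) \<in> L" by (rule continuous_mult_L[OF c1\<delta> Hp_Lp[OF y(1)]])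
      have "nul (\<lambda>x. (1 + \<delta> x) * y x - em' x * h x)"
        unfolding nul_diff_iff[OF yL eL] using y(2) P_fourier[OF eL] by simp
      from nul_em[OF this] have "nul (\<lambda>x. ?E x * y x - h x)"
        by (simp add: right_diff_distrib em_em' mult.assoc)
      then have "\<forall>\<xi>\<in>T. fourier m (\<lambda>x. ?E x * y x) \<xi> = fourier m h \<xi>"
        using nul_diff_iff[OF continuous_mult_L[OF Ec Hp_Lp[OF y(1)]] hL] by simp
      then show ?thesis using y(1) by blast
    qed
    have "\<forall>b\<in>B. \<exists>y. y \<in> H \<and> (\<forall>\<xi>\<in>T. fourier m (\<lambda>x. ?E x * y x) \<xi> = fourier m b \<xi>)"
      using E_surj B(2) by blast
    \<comment> \<open>\<open>Y b\<close> is a preimage of the cokernel vector b under the Toeplitz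
      operator of E.\<close>
    from bchoice[OF this] obtain Y where Y: "\<And>b. b \<in> B \<Longrightarrow> Y b \<in> H"
      "\<And>b \<xi>. b \<in> B \<Longrightarrow> \<xi> \<in> T \<Longrightarrow> fourier m (\<lambda>x. ?E x * Y b x) \<xi> = fourier m b \<xi>" by blast
    have "\<exists>k. \<forall>t\<in>S. (\<Sum>b\<in>B. k b * fourier m (Y b) t) = (if s = t then 1 else 0)" if s: "s \<in> S" for s
    proof -
      have sT: "s \<in> T" using s by (simp add: S_def)
      have sH: "s \<in> H" by (rule tpoly_Hp[OF tpoly_base[OF sT] T_sub p01(1)])
      have EsL: "(\<lambda>x. ?E x * s x) \<in> L" by (rule continuous_mult_L[OF Ec Hp_Lp[OF sH]])
      obtain f k where f: "f \<in> H" and fk: "AE x in m. P (\<lambda>x. ?E x * s x) x = A f x + lin_comb B k x"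
        using B(3) P_H[OF EsL] by blast
      let ?l = "lin_comb B k"
      have lH: "?l \<in> H" by (rule lin_comb_H[OF B(1,2)])
      let ?z = "\<lambda>x. \<gamma> x * (ep x * f x)"
      let ?y = "\<lambda>x. \<Sum>b\<in>B. k b * Y b x"
      have eH: "(\<lambda>x. ep x * f x) \<in> H" by (rule H_ep[OF f])
      have zero: "fourier m ?z t = 0" if t: "t \<in> characters" "t \<notin> char_mult \<gamma> ` T" for t
      proof -
        have "char_mult t (char_inv \<gamma>) \<notin> T"
        proof
          assume "char_mult t (char_inv \<gamma>) \<in> T"
          then have "char_mult \<gamma> (char_mult t (char_inv \<gamma>)) \<in> char_mult \<gamma> ` T" by blast
          then show False using t(2) \<gamma> by (simp add: char_mult_commute[of t])
        qed
        then show ?thesis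
          unfolding fourier_char_mult[OF t(1) \<gamma>]
          using t(1) \<gamma> by (intro Hp_fourier[OF eH]) (auto intro: characters_mult characters_inv)
      qed
      have zL: "?z \<in> L" by (rule Lp_character_mult(1)[OF Hp_Lp[OF eH] \<gamma> p01(1)])
      have zH: "?z \<in> H"
        unfolding Hp_def using zL zero T_mult[OF True] by blast
      have yH: "?y \<in> H" using Y(1) by (intro Hp_sum Hp_scale p) auto
      have four_y: "fourier m ?y t = (\<Sum>b\<in>B. k b * fourier m (Y b) t)" if t: "t \<in> characters" for t
        using fourier_sum[of B "\<lambda>b x. k b * Y b x", OF Lp_scale[OF Hp_Lp[OF Y(1)]] t p]
        by (simp add: fourier_scale)
      \<comment> \<open>Under the Toeplitz operator of E, s and the bracketed sum have the same
        image, so w vanishes almost everywhere and s = \<gamma> ep f + \<Sum> k b Y b. The first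
        summand has no coefficient on S, which leaves a row of the identity matrix.\<close>
      let ?w = "\<lambda>x. s x - (?z x + ?y x)"
      have wH: "?w \<in> H" by (intro Hp_diff Hp_add sH zH yH p)
      have EzL: "(\<lambda>x. ?E x * ?z x) \<in> L" and EyL: "(\<lambda>x. ?E x * ?y x) \<in> L"
        by (rule continuous_mult_L[OF Ec zL], rule continuous_mult_L[OF Ec Hp_Lp[OF yH]])
      have \<phi>f: "(\<lambda>x. ?E x * ?z x) = (\<lambda>x. \<phi> x * f x)"
        by (auto simp: \<phi>_eq mult_ac)
      have EsumL: "(\<lambda>x. ?E x * ?z x + ?E x * ?y x) \<in> L" by (rule Lp_add[OF EzL EyL p01(2)])
      have "nul (\<lambda>x. ?E x * s x - (?E x * ?z x + ?E x * ?y x))"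
        unfolding nul_diff_iff[OF EsL EsumL]
      proof
        fix \<xi> assume \<xi>: "\<xi> \<in> T"
        note \<xi>c = T_char[OF \<xi>]
        have Af: "A f \<in> H" using toeplitz_shift_H[OF \<phi>I f, of 0] unfolding A_def[abs_def] .
        have AfL: "A f \<in> L" by (rule Hp_Lp[OF Af])
        have sumL: "(\<lambda>x. A f x + ?l x) \<in> L" by (rule Lp_add[OF AfL Hp_Lp[OF lH] p01(2)])
        have "fourier m (\<lambda>x. ?E x * s x) \<xi> = fourier m (P (\<lambda>x. ?E x * s x)) \<xi>"
          by (rule P_fourier[OF EsL \<xi>, symmetric])
        also have "\<dots> = fourier m (\<lambda>x. A f x + ?l x) \<xi>"
          by (rule fourier_cong_AE[OF fk Lp_measurable[OF Hp_Lp[OF P_H[OF EsL]]] Lp_measurable[OF sumL]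
              measurable_continuous[OF charactersD(1)[OF \<xi>c]]])
        also have "\<dots> = fourier m (A f) \<xi> + fourier m ?l \<xi>"
          using fourier_lincomb[OF AfL Hp_Lp[OF lH] \<xi>c p, of 1 1] by simp
        also have "fourier m (A f) \<xi> = fourier m (\<lambda>x. \<phi> x * f x) \<xi>"
          using A_iff[OF f Af] \<xi> by simp
        also have "fourier m ?l \<xi> = (\<Sum>b\<in>B. k b * fourier m b \<xi>)"
          using B(2) Hp_Lp by (intro fourier_lin_comb_Lp B(1) \<xi>c) auto
        also have "\<dots> = (\<Sum>b\<in>B. k b * fourier m (\<lambda>x. ?E x * Y b x) \<xi>)"
          using Y(2) \<xi> by (intro sum.cong) auto
        also have "\<dots> = fourier m (\<lambda>x. \<Sum>b\<in>B. k b * (?E x * Y b x)) \<xi>"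
        proof -
          have "fourier m (\<lambda>x. \<Sum>b\<in>B. k b * (?E x * Y b x)) \<xi> = (\<Sum>b\<in>B. fourier m (\<lambda>x. k b * (?E x * Y b x)) \<xi>)"
            by (rule fourier_sum[OF Lp_scale[OF continuous_mult_L[OF Ec Hp_Lp[OF Y(1)]]] \<xi>c p])
          then show ?thesis unfolding fourier_scale ..
        qed
        also have "(\<lambda>x. \<Sum>b\<in>B. k b * (?E x * Y b x)) = (\<lambda>x. ?E x * ?y x)"
          by (auto simp: sum_distrib_left mult_ac)
        also have "fourier m (\<lambda>x. \<phi> x * f x) \<xi> + fourier m (\<lambda>x. ?E x * ?y x) \<xi> =
            fourier m (\<lambda>x. ?E x * ?z x + ?E x * ?y x) \<xi>"
          using fourier_lincomb[OF EzL EyL \<xi>c p, of 1 1] unfolding \<phi>f by simp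
        finally show "fourier m (\<lambda>x. ?E x * s x) \<xi> = fourier m (\<lambda>x. ?E x * ?z x + ?E x * ?y x) \<xi>" .
      qed
      then have "nul (\<lambda>x. ?E x * ?w x)" by (simp only: right_diff_distrib distrib_left)
      then have w0: "AE x in m. ?w x = 0" by (rule E_inj[OF wH])
      have "(\<Sum>b\<in>B. k b * fourier m (Y b) t) = (if s = t then 1 else 0)" if t: "t \<in> S" for t
      proof -
        have tc: "t \<in> characters" using t T_char by (simp add: S_def)
        have "fourier m ?w t = fourier m (\<lambda>x. 0) t"
          by (rule fourier_cong_AE[OF w0 Lp_measurable[OF Hp_Lp[OF wH]] _
              measurable_continuous[OF charactersD(1)[OF tc]]]) simp
        moreover have "fourier m ?w t = fourier m s t - fourier m (\<lambda>x. ?z x + ?y x) t"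
          by (rule fourier_diff[OF Hp_Lp[OF sH] Lp_add[OF zL Hp_Lp[OF yH] p01(2)] tc p])
        moreover have "fourier m (\<lambda>x. ?z x + ?y x) t = fourier m ?z t + fourier m ?y t"
          using fourier_lincomb[OF zL Hp_Lp[OF yH] tc p, of 1 1] by simp
        moreover have "fourier m ?z t = 0" using t by (intro zero tc) (simp add: S_def)
        ultimately show ?thesis
          using fourier_character[OF T_char[OF sT] tc] four_y[OF tc] by (simp add: fourier_def)
      qed
      then show ?thesis by blast
    qed
    then have "\<forall>s\<in>S. \<exists>k. \<forall>t\<in>S. (\<Sum>b\<in>B. k b * fourier m (Y b) t) = (if s = t then 1 else 0)" by blast
    from bchoice[OF this] obtain k where k: "\<forall>s\<in>S. \<forall>t\<in>S. (\<Sum>b\<in>B. k s b * fourier m (Y b) t) = (if s = t then 1 else 0)"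
      by blast
    have "finite S"
      by (rule identity_not_finite_rank[OF B(1), of S k "\<lambda>b t. fourier m (Y b) t"]) (use k in blast)
    \<comment> \<open>In the definition of \<open>Xi\<close> the trivial character serves as the
      other factor; its set of missing frequencies is empty.\<close>
    moreover have "T - char_mult (\<lambda>_. 1) ` T = {}" by (auto simp: image_def)
    ultimately show ?thesis
      by (intro XiI[OF \<gamma> True T_one]) (simp_all add: S_def)
  next
    case False
    define \<kappa> where "\<kappa> = char_inv \<gamma>"
    have \<kappa>T: "\<kappa> \<in> T" unfolding \<kappa>_def by (rule T_total[OF \<gamma> False])
    have \<gamma>\<kappa>: "\<gamma> = char_inv \<kappa>" by (simp add: \<kappa>_def)
    \<comment> \<open>Case of the kernel. A character s in S has \<gamma> s outside T, so the
      Toeplitz operator of \<gamma> annihilates it; each such s is turned into an element of the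
      kernel of A.\<close>
    define S where "S = T - char_mult \<kappa> ` T"
    obtain B where B: "finite B" "B \<subseteq> op_kernel m H A"
      "\<forall>f\<in>op_kernel m H A. \<exists>c. AE x in m. f x = lin_comb B c x"
      using fr unfolding fredholm_def by blast
    have BL: "B \<subseteq> L" using B(2) Hp_Lp by (auto simp: op_kernel_def)
    let ?W = "\<lambda>x. (1 + \<delta> x) * ep x"
    have Wc: "cts ?W" by (intro continuous_intros c1\<delta> cts_e)
    have "\<exists>k. \<forall>t\<in>S. (\<Sum>b\<in>B. k b * fourier m (\<lambda>x. ?W x * b x) t) = (if s = t then 1 else 0)" if s: "s \<in> S" for s
    proof -
      have sT: "s \<in> T" using s by (simp add: S_def)
      have sH: "s \<in> H" by (rule tpoly_Hp[OF tpoly_base[OF sT] T_sub p01(1)])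
      have sL: "s \<in> L" by (rule Hp_Lp[OF sH])
      obtain y where y: "y \<in> H" "\<forall>\<xi>\<in>T. fourier m (\<lambda>x. (1 + \<delta> x) * y x) \<xi> = fourier m s \<xi>"
        using near1[OF sH] by blast
      have yL: "(\<lambda>x. (1 + \<delta> x) * y x) \<in> L" by (rule continuous_mult_L[OF c1\<delta> Hp_Lp[OF y(1)]])
      \<comment> \<open>Then \<phi> f = em \<gamma> (1 + \<delta>) y, and (1 + \<delta>) y differs
        from s by an element of \<open>nul\<close>; multiplication by \<gamma>, the inverse of a
        positive character, and by em preserves \<open>nul\<close>.\<close>
      define f where "f x = ep' x * y x" for x
      have fH: "f \<in> H" unfolding f_def by (rule H_ep'[OF y(1)])
      have "nul (\<lambda>x. (1 + \<delta> x) * y x - s x)" unfolding nul_diff_iff[OF yL sL] by (rule y(2))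
      from nul_inverse_mult[OF \<kappa>T this] have n1: "nul (\<lambda>x. \<gamma> x * ((1 + \<delta> x) * y x - s x))"
        unfolding \<gamma>\<kappa> .
      have n2: "nul (\<lambda>x. \<gamma> x * s x)"
        unfolding nul_def
      proof (intro conjI ballI)
        show "(\<lambda>x. \<gamma> x * s x) \<in> L" by (rule Lp_character_mult(1)[OF sL \<gamma> p01(1)])
        fix \<xi> assume \<xi>: "\<xi> \<in> T"
        have "char_mult \<xi> (char_inv \<gamma>) = char_mult \<kappa> \<xi>" by (simp add: \<kappa>_def char_mult_commute)
        moreover have "s \<noteq> char_mult \<kappa> \<xi>" using s \<xi> by (auto simp: S_def)
        ultimately show "fourier m (\<lambda>x. \<gamma> x * s x) \<xi> = 0"
          using fourier_char_mult[OF T_char[OF \<xi>] \<gamma>, of s]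
            fourier_character[OF T_char[OF sT] T_char[OF T_mult[OF \<kappa>T \<xi>]]] by simp
      qed
      have "nul (\<lambda>x. em x * (\<gamma> x * ((1 + \<delta> x) * y x - s x) + \<gamma> x * s x))"
        by (rule nul_em[OF nul_add[OF n1 n2]])
      moreover have "em x * (\<gamma> x * ((1 + \<delta> x) * y x - s x) + \<gamma> x * s x) = \<phi> x * f x" for x
      proof -
        have "\<phi> x * f x = em x * (\<gamma> x * ((1 + \<delta> x) * (ep x * (ep' x * y x))))"
          unfolding \<phi>_eq f_def by (simp add: mult_ac)
        then show ?thesis unfolding ep_ep' by (simp add: algebra_simps)
      qed
      ultimately have "nul (\<lambda>x. \<phi> x * f x)" by simp
      then have "AE x in m. A f x = 0"
        using A_iff[OF fH Hp_zero] by (simp add: nul_def fourier_def)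
      then have "f \<in> op_kernel m H A" using fH by (simp add: op_kernel_def)
      then obtain k where k: "AE x in m. f x = lin_comb B k x" using B(3) by blast
      \<comment> \<open>Multiplication by W recovers (1 + \<delta>) y from f, and the coefficients
        of that function over T are those of s.\<close>
      have "(\<Sum>b\<in>B. k b * fourier m (\<lambda>x. ?W x * b x) t) = (if s = t then 1 else 0)" if t: "t \<in> S" for t
      proof -
        have tT: "t \<in> T" using t by (simp add: S_def)
        note tc = T_char[OF tT]
        have lL: "lin_comb B k \<in> L" unfolding lin_comb_def using BL by (intro Lp_sum Lp_scale) auto
        have "(\<Sum>b\<in>B. k b * fourier m (\<lambda>x. ?W x * b x) t) = fourier m (\<lambda>x. ?W x * lin_comb B k x) t"
          using BL by (intro fourier_mult_lin_comb[symmetric] B(1) tc continuous_mult_L[OF Wc]) auto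
        also have "\<dots> = fourier m (\<lambda>x. ?W x * f x) t"
        proof (rule fourier_cong_AE)
          show "AE x in m. ?W x * lin_comb B k x = ?W x * f x" using k by eventually_elim simp
          show "(\<lambda>x. ?W x * lin_comb B k x) \<in> borel_measurable m" "(\<lambda>x. ?W x * f x) \<in> borel_measurable m"
            using continuous_mult_L[OF Wc lL] continuous_mult_L[OF Wc Hp_Lp[OF fH]] by (auto intro: Lp_measurable)
        qed (rule measurable_continuous[OF charactersD(1)[OF tc]])
        also have "(\<lambda>x. ?W x * f x) = (\<lambda>x. (1 + \<delta> x) * y x)"
          unfolding f_def by (simp add: mult.assoc ep_ep')
        also have "fourier m \<dots> t = fourier m s t" using y(2) tT by blast
        also have "\<dots> = (if s = t then 1 else 0)" by (rule fourier_character[OF T_char[OF sT] tc])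
        finally show ?thesis .
      qed
      then show ?thesis by blast
    qed
    then have "\<forall>s\<in>S. \<exists>k. \<forall>t\<in>S. (\<Sum>b\<in>B. k b * fourier m (\<lambda>x. ?W x * b x) t) = (if s = t then 1 else 0)" by blast
    from bchoice[OF this] obtain k where
      k: "\<forall>s\<in>S. \<forall>t\<in>S. (\<Sum>b\<in>B. k s b * fourier m (\<lambda>x. ?W x * b x) t) = (if s = t then 1 else 0)"
      by blast
    have "finite S"
      by (rule identity_not_finite_rank[OF B(1), of S k "\<lambda>b t. fourier m (\<lambda>x. ?W x * b x) t"]) (use k in blast)
    moreover have "T - char_mult (\<lambda>_. 1) ` T = {}" by (auto simp: image_def)
    ultimately show ?thesis
      by (intro XiI[OF \<gamma> T_one \<kappa>T]) (simp_all add: S_def \<gamma>\<kappa>)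
  qed
qed

end

theorem corollary7:
  fixes m :: "'a::{topological_ab_group_add, t2_space} measure"
    and T :: "('a \<Rightarrow> complex) set"
    and p :: real
  assumes nontrivial: "\<exists>x::'a. x \<noteq> 0"
    and compact: "compact (UNIV :: 'a set)"
    and connected: "connected (UNIV :: 'a set)"
    and haar: "normalized_haar m"
    and cone: "positive_cone T"
    and linear: "linearly_ordered T"
    and p: "1 < p"
  shows "(\<forall>\<phi>\<in>Linf m.
            essential_range m \<phi> \<subseteq> essential_spectrum m p (Hp m T p) (toeplitz m T p \<phi>)) \<and>
         (\<not> isomorphic_to_circle TYPE('a) \<longrightarrow>
            (\<forall>\<phi>\<in>C_invertible - Phi T.
               essential_range m \<phi> \<subset> essential_spectrum m p (Hp m T p) (toeplitz m T p \<phi>)))"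
proof -
  interpret hardy m T p
    by unfold_locales (rule compact haar cone linear p)+
  have sub: "essential_range m \<phi> \<subseteq> essential_spectrum m p (Hp m T p) (toeplitz m T p \<phi>)" if "\<phi> \<in> Linf m" for \<phi>
    by (rule essential_range_subset[OF nontrivial that])
  have "essential_range m \<phi> \<subset> essential_spectrum m p (Hp m T p) (toeplitz m T p \<phi>)"
    if \<phi>: "\<phi> \<in> C_invertible - Phi T" for \<phi>
  proof -
    obtain \<psi> where c: "cts \<phi>" "cts \<psi>" and \<phi>\<psi>: "\<And>x. \<phi> x * \<psi> x = 1"
      using \<phi> by (auto simp: C_invertible_def)
    have nz: "\<phi> x \<noteq> 0" for x using \<phi>\<psi>[of x] by auto
    obtain \<gamma> g where \<gamma>: "\<gamma> \<in> characters" and g: "cts g" and eq: "\<phi> = (\<lambda>x. \<gamma> x * exp (g x))"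
      using bohr_van_kampen[OF connected c(1) nz] by blast
    have "0 \<in> essential_spectrum m p (Hp m T p) (toeplitz m T p \<phi>)"
      unfolding essential_spectrum_def
    proof (intro CollectI notI)
      assume "fredholm m p (Hp m T p) (\<lambda>f x. toeplitz m T p \<phi> f x - 0 * f x)"
      then have "\<gamma> \<in> Xi T" unfolding eq by (rule fredholm_character_Xi[OF \<gamma> g])
      then have "\<phi> \<in> Phi T" unfolding eq Phi_def using g by blast
      then show False using \<phi> by blast
    qed
    moreover have "0 \<notin> essential_range m \<phi>"
    proof
      assume "0 \<in> essential_range m \<phi>"
      \<comment> \<open>A bound B for the inverse \<psi> keeps the modulus of \<phi> at least 1 /
        B.\<close>
      moreover obtain B where B: "0 < B" "\<And>x. norm (\<psi> x) \<le> B" using continuous_norm_bound[OF c(2)] by blast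
      ultimately have "emeasure m {x \<in> space m. dist (\<phi> x) 0 < 1 / B} > 0"
        unfolding essential_range_def by simp
      moreover have "{x \<in> space m. dist (\<phi> x) 0 < 1 / B} = {}"
      proof -
        have "1 \<le> norm (\<phi> x) * B" for x
        proof -
          have "norm (\<phi> x) * norm (\<psi> x) = 1" using \<phi>\<psi>[of x] by (metis norm_mult norm_one)
          moreover have "norm (\<phi> x) * norm (\<psi> x) \<le> norm (\<phi> x) * B" using B(2) by (intro mult_left_mono) auto
          ultimately show ?thesis by simp
        qed
        then show ?thesis using B(1) by (auto simp: less_divide_eq not_less)
      qed
      ultimately show False by simp
    qed
    ultimately show ?thesis using sub[OF Linf_continuous[OF c(1)]] by blast
  qed
  then show ?thesis using sub by blast
qed

end
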